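(* Let $\beta\in\mathfrak g(O)$ satisfy the following two conditions: (1) $G_\beta$ is a commutative smooth $O$-group scheme; (2) the Schur multiplier $[c_{\beta,\rho}]\in H^2(G_\beta(\mathbb F),\mathbb C^\times)$ is trivial for all characters $\rho\in\mathfrak g_\beta(\mathbb F)^\wedge$. Then $\theta\mapsto\sigma_{\beta,\theta}$ is a bijection of the set $$\{\theta\in G_\beta(O_r)^\wedge \;:\; \theta=\psi_\beta\ \text{on}\ G_\beta(O_r)\cap K_l(O_r)\}$$ onto $\mathrm{Irr}(G(O_r,\beta)\mid\psi_\beta)$.
   Context: Let $F$ be a non-archimedean local field with integer ring $O$, maximal ideal $\mathfrak p=\varpi O$ and finite residue field $\mathbb F=O/\mathfrak p$ of odd characteristic; $O_m=O/\mathfrak p^m$ for $m>0$. Fix a continuous unitary character $\tau$ of the additive group $F$ with $\{x\in F:\tau(xO)=1\}=O$, and let $\widehat\tau$ be the character of $\mathbb F$ given by $\widehat\tau(\overline x)=\tau(\varpi^{-1}x)$. For a finite abelian group $A$, $A^\wedge$ is its group of complex characters. A bar denotes reduction modulo $\mathfrak p$. $G\subset GL_n$ is a closed smooth $O$-group subscheme with Lie algebra $\mathfrak g\subset\mathfrak{gl}_n$, whose fibres over $F$ and $\mathbb F$ are non-commutative algebraic groups; $B(X,Y)=\mathrm{tr}(XY)$ is the trace form. For $0<m<r$ put $K_m(O_r)=\ker(G(O_r)\to G(O_m))$. Standing assumptions: (I) $B:\mathfrak g(\mathbb F)\times\mathfrak g(\mathbb F)\to\mathbb F$ is non-degenerate;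 (II) for all integers $r=l+l'$ with $0<l'\le l<r$, $X\bmod\mathfrak p^{l'}\mapsto 1+\varpi^lX\bmod\mathfrak p^r$ is a group isomorphism $\mathfrak g(O_{l'})\to K_l(O_r)$; (III) if $r=2l-1\ge3$ is odd, $X\mapsto 1+\varpi^{l-1}X+2^{-1}\varpi^{2l-2}X^2\bmod\mathfrak p^r$ maps $\mathfrak g(O)$ into $K_{l-1}(O_r)$. Fix an integer $r\ge2$ and write $r=l+l'$ with $l'=l$ if $r=2l$, $l'=l-1$ if $r=2l-1$. For $\beta\in\mathfrak g(O)$, $\psi_\beta$ is the character of the abelian group $K_l(O_r)$ with $\psi_\beta(1+\varpi^lX\bmod\mathfrak p^r)=\tau(\varpi^{-l'}B(X,\beta))$, $X\in\mathfrak g(O)$. Its stabilizer in $G(O_r)$ is $G(O_r,\beta)=\{g\bmod\mathfrak p^r:\mathrm{Ad}(g)\beta\equiv\beta\pmod{\mathfrak p^{l'}}\}$. $\mathrm{Irr}(G(O_r,\beta)\mid\psi_\beta)$ is the set of isomorphism classes of irreducible complex representations of $G(O_r,\beta)$ whose restriction to $K_l(O_r)$ contains $\psi_\beta$. $G_\beta$ and $\mathfrak g_\beta$ are the centralizers of $\beta$ in $G$ and in $\mathfrak g$. Definition of $c_{\beta,\rho}$. Assume $\mathfrak g_\beta(\mathbb F)\subsetneq\mathfrak g(\mathbb F)$ (automatic when $G_\beta$ is smooth commutative) and let $\rho\in\mathfrak g_\beta(\mathbb F)^\wedge$. $\mathbb V_\beta=\mathfrak g(\mathbb F)/\mathfrak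 g_\beta(\mathbb F)$ carries the symplectic form $\langle\dot X,\dot Y\rangle_\beta=B([X,Y],\overline\beta)$. For $g\in G_\beta(\mathbb F)$, $\sigma_g$ acts on $\mathbb V_\beta$ from the right by $\dot X\sigma_g=$ class of $\mathrm{Ad}(g)^{-1}X$. Choose an $\mathbb F$-linear section $v\mapsto[v]$ of $\mathfrak g(\mathbb F)\to\mathbb V_\beta$, put $\gamma(v,g)=\mathrm{Ad}(g)^{-1}[v]-[v\sigma_g]\in\mathfrak g_\beta(\mathbb F)$, and let $v_g\in\mathbb V_\beta$ be the unique element with $\rho(\gamma(v,g))=\widehat\tau(\langle v,v_g\rangle_\beta)$ for all $v\in\mathbb V_\beta$. On the centralizer $G_\beta(\mathbb F)^{(c)}=\{g\in G(\mathbb F):\mathrm{Ad}(g)Y=Y\ \forall Y\in\mathfrak g_\beta(\mathbb F)\}$ (equal to $G_\beta(\mathbb F)$ when $G_\beta$ is commutative and smooth), $c_{\beta,\rho}(g,h)=\widehat\tau(2^{-1}\langle v_g,v_{gh}\rangle_\beta)$ is a 2-cocycle (trivial action on $\mathbb C^\times$) whose class does not depend on the section. Definition of $\sigma_{\beta,\theta}$. When $G_\beta$ is smooth, $G(O_r,\beta)=G_\beta(O_r)\cdot K_{l'}(O_r)$. If $r=2l$: $\sigma_{\beta,\theta}(gh)=\theta(g)\psi_\beta(h)$ for $g\in G_\beta(O_r)$, $h\in K_l(O_r)$. If $r=2l-1\ge3$: let $Z(O_r,\beta)\subset K_{l-1}(O_r)$ be the subgroup of the elements $1+\varpi^{l-1}X\bmod\mathfrak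 p^r$ with $\overline X\in\mathfrak g_\beta(\mathbb F)$. For $\rho\in\mathfrak g_\beta(\mathbb F)^\wedge$ let $\psi_{\beta,\rho}$ be the character $1+\varpi^{l-1}X\mapsto\tau(\varpi^{-l}B(X,\beta)-(2\varpi)^{-1}B(X^2,\beta))\rho(\overline X)$ of $Z(O_r,\beta)$, and $\pi_{\beta,\rho}$ (on the space $V_{\beta,\rho}$) the unique irreducible representation of $K_{l-1}(O_r)$ whose restriction to $Z(O_r,\beta)$ contains $\psi_{\beta,\rho}$. Fix for each $\rho$ a group homomorphism $U_{\beta,\rho}:G_\beta(O_r)\to GL_{\mathbb C}(V_{\beta,\rho})$ (it exists under conditions (1), (2) of the claim) such that $\pi_{\beta,\rho}(g^{-1}xg)=U_{\beta,\rho}(g)^{-1}\pi_{\beta,\rho}(x)U_{\beta,\rho}(g)$ for $g\in G_\beta(O_r)$, $x\in K_{l-1}(O_r)$, and $U_{\beta,\rho}=1$ on $G_\beta(O_r)\cap K_{l-1}(O_r)$. For $\theta$ as in the claim there is a unique $\rho$ with $\theta=\psi_{\beta,\rho}$ on $G_\beta(O_r)\cap K_{l-1}(O_r)$, and $\sigma_{\beta,\theta}(gh)=\theta(g)\,U_{\beta,\rho}(g)\,\pi_{\beta,\rho}(h)$ for $g\in G_\beta(O_r)$, $h\in K_{l-1}(O_r)$. *)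

theory Defs
  imports Complex_Main "HOL-Algebra.QuotRing" "HOL-Library.Poly_Mapping"
    "Jordan_Normal_Form.VS_Connect"
begin

section \<open>Non-archimedean local fields\<close>

text \<open>
  The field is a type \<open>'f\<close> with a normalised discrete valuation \<open>v\<close>; the value \<open>v 0\<close> is
  irrelevant. \<open>ppow v m\<close> is the fractional ideal \<open>\<pp>\<^sup>m\<close>, so \<open>ppow v 0\<close> is the integer ring.
\<close>

definition ppow :: "('f::field \<Rightarrow> int) \<Rightarrow> nat \<Rightarrow> 'f set" where
  "ppow v m = {x. x = 0 \<or> int m \<le> v x}"

definition int_ring :: "('f::field \<Rightarrow> int) \<Rightarrow> 'f ring" where
  "int_ring v = class_ring\<lparr>carrier := ppow v 0\<rparr>"

definition Omod :: "('f::field \<Rightarrow> int) \<Rightarrow> nat \<Rightarrow> 'f set ring" where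
  "Omod v m = int_ring v Quot ppow v m"

definition omod :: "('f::field \<Rightarrow> int) \<Rightarrow> nat \<Rightarrow> 'f \<Rightarrow> 'f set" where
  "omod v m x = ppow v m +>\<^bsub>int_ring v\<^esub> x"

text \<open>The residue field is \<open>Omod v 1\<close>.\<close>

locale nonarch_local_field =
  fixes v :: "'f::field \<Rightarrow> int"
  assumes val_mult: "x \<noteq> 0 \<Longrightarrow> y \<noteq> 0 \<Longrightarrow> v (x * y) = v x + v y"
    and val_add: "x \<noteq> 0 \<Longrightarrow> y \<noteq> 0 \<Longrightarrow> x + y \<noteq> 0 \<Longrightarrow> min (v x) (v y) \<le> v (x + y)"
    and val_normalised: "\<exists>x. x \<noteq> 0 \<and> v x = 1"
    and complete:
      "\<And>s :: nat \<Rightarrow> 'f. (\<And>m. \<exists>N. \<forall>i\<ge>N. \<forall>j\<ge>N. s i - s j \<in> ppow v m) \<Longrightarrow>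
        \<exists>x. \<forall>m. \<exists>N. \<forall>i\<ge>N. s i - x \<in> ppow v m"
    and finite_residue_field: "finite (carrier (Omod v 1))"

definition odd_residue_char :: "('f::field \<Rightarrow> int) \<Rightarrow> bool" where
  "odd_residue_char v \<longleftrightarrow>
    (\<exists>p::nat. prime p \<and> odd p \<and> omod v 1 (of_nat p) = \<zero>\<^bsub>Omod v 1\<^esub>)"

definition cont_unitary_char :: "('f::field \<Rightarrow> int) \<Rightarrow> ('f \<Rightarrow> complex) \<Rightarrow> bool" where
  "cont_unitary_char v \<tau> \<longleftrightarrow>
    (\<forall>x y. \<tau> (x + y) = \<tau> x * \<tau> y) \<and> (\<forall>x. cmod (\<tau> x) = 1) \<and>
    (\<forall>x. \<forall>e>0. \<exists>m. \<forall>y. y - x \<in> ppow v m \<longrightarrow> cmod (\<tau> y - \<tau> x) < e)"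

definition hat_tau :: "'f::field \<Rightarrow> ('f \<Rightarrow> complex) \<Rightarrow> 'f set \<Rightarrow> complex" where
  "hat_tau \<pi>F \<tau> x = \<tau> (inverse \<pi>F * (SOME a. a \<in> x))"

section \<open>Matrices over a ring\<close>

text \<open>
  An \<open>n \<times> n\<close> matrix is a function on \<open>'n \<times> 'n\<close> in curried form, with \<open>CARD('n) = n\<close>.
\<close>

type_synonym ('n, 'r) sqmat = "'n \<Rightarrow> 'n \<Rightarrow> 'r"

definition mmult :: "('r, 'm) ring_scheme \<Rightarrow> ('n::finite, 'r) sqmat \<Rightarrow> ('n, 'r) sqmat \<Rightarrow> ('n, 'r) sqmat"
  where "mmult R A B = (\<lambda>i j. \<Oplus>\<^bsub>R\<^esub>k\<in>UNIV. A i k \<otimes>\<^bsub>R\<^esub> B k j)"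

definition mone :: "('r, 'm) ring_scheme \<Rightarrow> ('n::finite, 'r) sqmat" where
  "mone R = (\<lambda>i j. if i = j then \<one>\<^bsub>R\<^esub> else \<zero>\<^bsub>R\<^esub>)"

definition mzero :: "('r, 'm) ring_scheme \<Rightarrow> ('n::finite, 'r) sqmat" where
  "mzero R = (\<lambda>i j. \<zero>\<^bsub>R\<^esub>)"

definition madd :: "('r, 'm) ring_scheme \<Rightarrow> ('n::finite, 'r) sqmat \<Rightarrow> ('n, 'r) sqmat \<Rightarrow> ('n, 'r) sqmat"
  where "madd R A B = (\<lambda>i j. A i j \<oplus>\<^bsub>R\<^esub> B i j)"

definition mminus :: "('r, 'm) ring_scheme \<Rightarrow> ('n::finite, 'r) sqmat \<Rightarrow> ('n, 'r) sqmat \<Rightarrow> ('n, 'r) sqmat"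
  where "mminus R A B = (\<lambda>i j. A i j \<ominus>\<^bsub>R\<^esub> B i j)"

definition msmult :: "('r, 'm) ring_scheme \<Rightarrow> 'r \<Rightarrow> ('n::finite, 'r) sqmat \<Rightarrow> ('n, 'r) sqmat" where
  "msmult R a A = (\<lambda>i j. a \<otimes>\<^bsub>R\<^esub> A i j)"

definition mtrace :: "('r, 'm) ring_scheme \<Rightarrow> ('n::finite, 'r) sqmat \<Rightarrow> 'r" where
  "mtrace R A = (\<Oplus>\<^bsub>R\<^esub>i\<in>UNIV. A i i)"

definition bracket :: "('r, 'm) ring_scheme \<Rightarrow> ('n::finite, 'r) sqmat \<Rightarrow> ('n, 'r) sqmat \<Rightarrow> ('n, 'r) sqmat"
  where "bracket R A B = mminus R (mmult R A B) (mmult R B A)"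

definition tform :: "('r, 'm) ring_scheme \<Rightarrow> ('n::finite, 'r) sqmat \<Rightarrow> ('n, 'r) sqmat \<Rightarrow> 'r" where
  "tform R X Y = mtrace R (mmult R X Y)"

definition mat_monoid :: "('r, 'm) ring_scheme \<Rightarrow> ('n::finite, 'r) sqmat monoid" where
  "mat_monoid R = \<lparr>carrier = {A. \<forall>i j. A i j \<in> carrier R}, mult = mmult R, one = mone R\<rparr>"

abbreviation GLn :: "('r, 'm) ring_scheme \<Rightarrow> ('n::finite, 'r) sqmat monoid" where
  "GLn R \<equiv> units_of (mat_monoid R)"

definition Ad :: "('r, 'm) ring_scheme \<Rightarrow> ('n::finite, 'r) sqmat \<Rightarrow> ('n, 'r) sqmat \<Rightarrow> ('n, 'r) sqmat"
  where "Ad R g X = mmult R (mmult R g X) (inv\<^bsub>mat_monoid R\<^esub> g)"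

definition mmap :: "('r \<Rightarrow> 's) \<Rightarrow> ('n, 'r) sqmat \<Rightarrow> ('n, 's) sqmat" where
  "mmap f A = (\<lambda>i j. f (A i j))"

text \<open>An arbitrary entrywise lift of a matrix over a quotient ring.\<close>

definition mlift :: "('n, 'r set) sqmat \<Rightarrow> ('n, 'r) sqmat" where
  "mlift A = (\<lambda>i j. SOME a. a \<in> A i j)"

definition one_plus :: "'f::field \<Rightarrow> ('n, 'f) sqmat \<Rightarrow> ('n, 'f) sqmat" where
  "one_plus c X = (\<lambda>i j. (if i = j then 1 else 0) + c * X i j)"

section \<open>Closed subschemes of the general linear group\<close>

text \<open>
  A closed \<open>O\<close>-subscheme of \<open>GL\<^sub>n\<close> is given by a set \<open>E\<close> of polynomials in the \<open>n\<^sup>2\<close> matrix entries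
  with coefficients in \<open>O\<close>; every ideal of \<open>O[x\<^sub>i\<^sub>j, det\<^sup>-\<^sup>1]\<close> is generated by such polynomials. Schemes
  are handled through their functors of points: \<open>points E R \<phi>\<close> is the set of \<open>R\<close>-valued points,
  where the \<open>O\<close>-algebra structure of \<open>R\<close> is the ring homomorphism \<open>\<phi>\<close> from \<open>O\<close> to \<open>R\<close>.
\<close>

type_synonym ('n, 'f) mpoly = "('n \<times> 'n \<Rightarrow>\<^sub>0 nat) \<Rightarrow>\<^sub>0 'f"

definition poly_eval ::
  "('r, 'm) ring_scheme \<Rightarrow> ('f::zero \<Rightarrow> 'r) \<Rightarrow> ('n::finite, 'f) mpoly \<Rightarrow> ('n, 'r) sqmat \<Rightarrow> 'r" where
  "poly_eval R \<phi> p A =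
    (\<Oplus>\<^bsub>R\<^esub>m\<in>Poly_Mapping.keys p. \<phi> (Poly_Mapping.lookup p m) \<otimes>\<^bsub>R\<^esub>
      (\<Otimes>\<^bsub>R\<^esub>ij\<in>Poly_Mapping.keys m. A (fst ij) (snd ij) [^]\<^bsub>R\<^esub> Poly_Mapping.lookup m ij))"

definition points ::
  "('n::finite, 'f::zero) mpoly set \<Rightarrow> ('r, 'm) ring_scheme \<Rightarrow> ('f \<Rightarrow> 'r) \<Rightarrow> ('n, 'r) sqmat set" where
  "points E R \<phi> = {A \<in> Units (mat_monoid R). \<forall>p\<in>E. poly_eval R \<phi> p A = \<zero>\<^bsub>R\<^esub>}"

definition O_algebra :: "('f::field \<Rightarrow> int) \<Rightarrow> 'r ring \<Rightarrow> ('f \<Rightarrow> 'r) \<Rightarrow> bool" where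
  "O_algebra v R \<phi> \<longleftrightarrow> cring R \<and> \<phi> \<in> Ring.ring_hom (int_ring v) R"

text \<open>
  Conditions on all \<open>O\<close>-algebras are stated for the algebras whose elements are of type \<open>'f set\<close>.
  This is no restriction. The group axioms, commutativity and the infinitesimal lifting property
  for closed subschemes of \<open>GL\<^sub>n\<close> can all be tested at universal points, which live over finitely
  generated \<open>O\<close>-algebras. Over a local field \<open>F\<close> these have at most the cardinality of \<open>F\<close>, so
  that each is isomorphic to an algebra of the kind considered.

  The centralizer \<open>G\<^sub>\<beta>\<close> is the subfunctor \<open>cent_points E \<beta>\<close> of \<open>points E\<close>. It too is a closed
  subscheme of \<open>GL\<^sub>n\<close>. The predicates below therefore take a functor of points \<open>X\<close> as argument.
\<close>

type_synonym ('n, 'f) point_functor = "'f set ring \<Rightarrow> ('f \<Rightarrow> 'f set) \<Rightarrow> ('n, 'f set) sqmat set"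

definition cent_points ::
  "('n::finite, 'f::zero) mpoly set \<Rightarrow> ('n, 'f) sqmat \<Rightarrow> ('r, 'm) ring_scheme \<Rightarrow> ('f \<Rightarrow> 'r) \<Rightarrow>
    ('n, 'r) sqmat set" where
  "cent_points E \<beta> R \<phi> = {g \<in> points E R \<phi>. Ad R g (mmap \<phi> \<beta>) = mmap \<phi> \<beta>}"

definition closed_subgroup_scheme :: "('f::field \<Rightarrow> int) \<Rightarrow> ('n::finite, 'f) mpoly set \<Rightarrow> bool" where
  "closed_subgroup_scheme v E \<longleftrightarrow>
    (\<forall>p\<in>E. \<forall>m. Poly_Mapping.lookup p m \<in> ppow v 0) \<and>
    (\<forall>(R :: 'f set ring) \<phi>. O_algebra v R \<phi> \<longrightarrow> subgroup (points E R \<phi>) (GLn R))"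

text \<open>
  Smoothness is the infinitesimal lifting property; finite presentation is automatic since \<open>O\<close> is
  noetherian.
\<close>

definition smooth_functor :: "('f::field \<Rightarrow> int) \<Rightarrow> ('n::finite, 'f) point_functor \<Rightarrow> bool" where
  "smooth_functor v X \<longleftrightarrow>
    (\<forall>R \<phi> R' q. O_algebra v R \<phi> \<and> cring R' \<and> q \<in> Ring.ring_hom R R' \<and> q ` carrier R = carrier R' \<and>
        (\<forall>x\<in>a_kernel R R' q. \<forall>y\<in>a_kernel R R' q. x \<otimes>\<^bsub>R\<^esub> y = \<zero>\<^bsub>R\<^esub>) \<longrightarrow>
      (\<forall>A\<in>X R' (q \<circ> \<phi>). \<exists>B\<in>X R \<phi>. mmap q B = A))"

definition commutative_functor :: "('f::field \<Rightarrow> int) \<Rightarrow> ('n::finite, 'f) point_functor \<Rightarrow> bool" where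
  "commutative_functor v X \<longleftrightarrow>
    (\<forall>R \<phi>. O_algebra v R \<phi> \<longrightarrow> (\<forall>A\<in>X R \<phi>. \<forall>B\<in>X R \<phi>. mmult R A B = mmult R B A))"

text \<open>The fibre over \<open>k\<close>, where \<open>\<iota>\<close> is the homomorphism from \<open>O\<close> to \<open>k\<close>, is not commutative.\<close>

definition noncommutative_fibre ::
  "('n::finite, 'f::zero) point_functor \<Rightarrow> 'k ring \<Rightarrow> ('f \<Rightarrow> 'k) \<Rightarrow> bool" where
  "noncommutative_fibre X k \<iota> \<longleftrightarrow>
    (\<exists>(R :: 'f set ring) \<phi>. cring R \<and> \<phi> \<in> Ring.ring_hom k R \<and>
      (\<exists>A\<in>X R (\<phi> \<circ> \<iota>). \<exists>B\<in>X R (\<phi> \<circ> \<iota>). mmult R A B \<noteq> mmult R B A))"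

text \<open>
  The Lie algebra is the kernel of \<open>G(R[\<epsilon>]) \<rightarrow> G(R)\<close>: it consists of the \<open>X\<close> with
  \<open>1 + \<epsilon>X \<in> G(R[\<epsilon>])\<close>, where \<open>a + \<epsilon>b\<close> is the pair \<open>(a, b)\<close>.
\<close>

definition dual_numbers :: "('r, 'm) ring_scheme \<Rightarrow> ('r \<times> 'r) ring" where
  "dual_numbers R = \<lparr>carrier = carrier R \<times> carrier R,
    mult = (\<lambda>(a, b) (c, d). (a \<otimes>\<^bsub>R\<^esub> c, a \<otimes>\<^bsub>R\<^esub> d \<oplus>\<^bsub>R\<^esub> b \<otimes>\<^bsub>R\<^esub> c)),
    one = (\<one>\<^bsub>R\<^esub>, \<zero>\<^bsub>R\<^esub>), zero = (\<zero>\<^bsub>R\<^esub>, \<zero>\<^bsub>R\<^esub>),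
    add = (\<lambda>(a, b) (c, d). (a \<oplus>\<^bsub>R\<^esub> c, b \<oplus>\<^bsub>R\<^esub> d))\<rparr>"

definition lie_points ::
  "('n::finite, 'f::zero) mpoly set \<Rightarrow> ('r, 'm) ring_scheme \<Rightarrow> ('f \<Rightarrow> 'r) \<Rightarrow> ('n, 'r) sqmat set" where
  "lie_points E R \<phi> = {X. (\<forall>i j. X i j \<in> carrier R) \<and>
    (\<lambda>i j. (mone R i j, X i j)) \<in> points E (dual_numbers R) (\<lambda>a. (\<phi> a, \<zero>\<^bsub>R\<^esub>))}"

definition lie_cent_points ::
  "('n::finite, 'f::zero) mpoly set \<Rightarrow> ('n, 'f) sqmat \<Rightarrow> ('r, 'm) ring_scheme \<Rightarrow> ('f \<Rightarrow> 'r) \<Rightarrow>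
    ('n, 'r) sqmat set" where
  "lie_cent_points E \<beta> R \<phi> = {X \<in> lie_points E R \<phi>. bracket R X (mmap \<phi> \<beta>) = mzero R}"

abbreviation lie_int ::
  "('f::field \<Rightarrow> int) \<Rightarrow> ('n::finite, 'f) mpoly set \<Rightarrow> ('n, 'f) sqmat set" where
  "lie_int v E \<equiv> lie_points E (int_ring v) id"

definition lie_group ::
  "('f::field \<Rightarrow> int) \<Rightarrow> ('n::finite, 'f) mpoly set \<Rightarrow> nat \<Rightarrow> ('n, 'f set) sqmat monoid" where
  "lie_group v E m =
    \<lparr>carrier = lie_points E (Omod v m) (omod v m), mult = madd (Omod v m), one = mzero (Omod v m)\<rparr>"

definition lie_cent_res ::
  "('f::field \<Rightarrow> int) \<Rightarrow> ('n::finite, 'f) mpoly set \<Rightarrow> ('n, 'f) sqmat \<Rightarrow> ('n, 'f set) sqmat monoid" where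
  "lie_cent_res v E \<beta> = (lie_group v E 1)\<lparr>carrier := lie_cent_points E \<beta> (Omod v 1) (omod v 1)\<rparr>"

definition G_group ::
  "('f::field \<Rightarrow> int) \<Rightarrow> ('n::finite, 'f) mpoly set \<Rightarrow> nat \<Rightarrow> ('n, 'f set) sqmat monoid" where
  "G_group v E r = (GLn (Omod v r))\<lparr>carrier := points E (Omod v r) (omod v r)\<rparr>"

definition cent_group ::
  "('f::field \<Rightarrow> int) \<Rightarrow> ('n::finite, 'f) mpoly set \<Rightarrow> ('n, 'f) sqmat \<Rightarrow> nat \<Rightarrow>
    ('n, 'f set) sqmat monoid" where
  "cent_group v E \<beta> r = (G_group v E r)\<lparr>carrier := cent_points E \<beta> (Omod v r) (omod v r)\<rparr>"

text \<open>The reduction from \<open>O\<^sub>r\<close> to \<open>O\<^sub>m\<close>, for \<open>m \<le> r\<close>.\<close>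

definition mred :: "('f::field \<Rightarrow> int) \<Rightarrow> nat \<Rightarrow> ('n, 'f set) sqmat \<Rightarrow> ('n, 'f set) sqmat" where
  "mred v m A = mmap (omod v m) (mlift A)"

definition K_group ::
  "('f::field \<Rightarrow> int) \<Rightarrow> ('n::finite, 'f) mpoly set \<Rightarrow> nat \<Rightarrow> nat \<Rightarrow> ('n, 'f set) sqmat monoid" where
  "K_group v E m r = (G_group v E r)\<lparr>carrier :=
    {A \<in> carrier (G_group v E r). mred v m A = mone (Omod v m)}\<rparr>"

section \<open>The standing assumptions on the group scheme\<close>

definition cond_I :: "('f::field \<Rightarrow> int) \<Rightarrow> ('n::finite, 'f) mpoly set \<Rightarrow> bool" where
  "cond_I v E \<longleftrightarrow>
    (\<forall>X\<in>carrier (lie_group v E 1).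
      (\<forall>Y\<in>carrier (lie_group v E 1). tform (Omod v 1) X Y = \<zero>\<^bsub>Omod v 1\<^esub>) \<longrightarrow> X = mzero (Omod v 1))"

definition cond_II :: "('f::field \<Rightarrow> int) \<Rightarrow> 'f \<Rightarrow> ('n::finite, 'f) mpoly set \<Rightarrow> bool" where
  "cond_II v \<pi>F E \<longleftrightarrow>
    (\<forall>l l'. 0 < l' \<and> l' \<le> l \<longrightarrow>
      (\<lambda>X. mmap (omod v (l + l')) (one_plus (\<pi>F ^ l) (mlift X)))
        \<in> iso (lie_group v E l') (K_group v E l (l + l')))"

definition cond_III :: "('f::field \<Rightarrow> int) \<Rightarrow> 'f \<Rightarrow> ('n::finite, 'f) mpoly set \<Rightarrow> bool" where
  "cond_III v \<pi>F E \<longleftrightarrow>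
    (\<forall>l\<ge>2. \<forall>X\<in>lie_int v E.
      mmap (omod v (2 * l - 1))
        (\<lambda>i j. one_plus (\<pi>F ^ (l - 1)) X i j
          + inverse 2 * \<pi>F ^ (2 * l - 2) * mmult (int_ring v) X X i j)
      \<in> carrier (K_group v E (l - 1) (2 * l - 1)))"

section \<open>Characters and representations\<close>

definition complex_units :: "complex monoid" where
  "complex_units = \<lparr>carrier = - {0}, mult = (*), one = 1\<rparr>"

text \<open>Characters are made extensional so that equality of functions is equality on the group.\<close>

definition dual :: "('g, 'm) monoid_scheme \<Rightarrow> ('g \<Rightarrow> complex) set" where
  "dual A = hom A complex_units \<inter> extensional (carrier A)"

text \<open>
  A finite-dimensional complex representation is, up to isomorphism, a matrix representation on
  \<open>\<complex>\<^sup>d\<close>. Only the values on the group matter.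
\<close>

definition rep :: "('g, 'm) monoid_scheme \<Rightarrow> nat \<Rightarrow> ('g \<Rightarrow> complex mat) \<Rightarrow> bool" where
  "rep H d \<sigma> \<longleftrightarrow> (\<forall>x\<in>carrier H. \<sigma> x \<in> carrier_mat d d) \<and>
    \<sigma> \<one>\<^bsub>H\<^esub> = 1\<^sub>m d \<and> (\<forall>x\<in>carrier H. \<forall>y\<in>carrier H. \<sigma> (x \<otimes>\<^bsub>H\<^esub> y) = \<sigma> x * \<sigma> y)"

definition irrep :: "('g, 'm) monoid_scheme \<Rightarrow> nat \<Rightarrow> ('g \<Rightarrow> complex mat) \<Rightarrow> bool" where
  "irrep H d \<sigma> \<longleftrightarrow> rep H d \<sigma> \<and> 0 < d \<and>
    (\<forall>W. subspace class_ring W (module_vec TYPE(complex) d) \<and>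
        (\<forall>x\<in>carrier H. \<forall>w\<in>W. \<sigma> x *\<^sub>v w \<in> W) \<longrightarrow>
      W = {0\<^sub>v d} \<or> W = carrier_vec d)"

definition contains_char ::
  "nat \<Rightarrow> ('g \<Rightarrow> complex mat) \<Rightarrow> ('g, 'm) monoid_scheme \<Rightarrow> ('g \<Rightarrow> complex) \<Rightarrow> bool" where
  "contains_char d \<sigma> N \<psi> \<longleftrightarrow>
    (\<exists>w\<in>carrier_vec d. w \<noteq> 0\<^sub>v d \<and> (\<forall>x\<in>carrier N. \<sigma> x *\<^sub>v w = \<psi> x \<cdot>\<^sub>v w))"

definition iso_class ::
  "('g, 'm) monoid_scheme \<Rightarrow> ('g \<Rightarrow> complex mat) \<Rightarrow> ('g \<Rightarrow> complex mat) set" where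
  "iso_class H \<sigma> = {\<sigma>'. \<exists>d. rep H d \<sigma> \<and> rep H d \<sigma>' \<and>
    (\<exists>P\<in>carrier_mat d d. invertible_mat P \<and> (\<forall>x\<in>carrier H. P * \<sigma> x = \<sigma>' x * P))}"

definition Irr_over ::
  "('g, 'm) monoid_scheme \<Rightarrow> ('g, 'm) monoid_scheme \<Rightarrow> ('g \<Rightarrow> complex) \<Rightarrow>
    ('g \<Rightarrow> complex mat) set set" where
  "Irr_over H N \<psi> = {iso_class H \<sigma> |\<sigma> d. irrep H d \<sigma> \<and> contains_char d \<sigma> N \<psi>}"

section \<open>The characters attached to \<open>\<beta>\<close>\<close>

definition lup :: "nat \<Rightarrow> nat" where "lup r = (r + 1) div 2"

definition ldn :: "nat \<Rightarrow> nat" where "ldn r = r div 2"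

definition psi ::
  "('f::field \<Rightarrow> int) \<Rightarrow> 'f \<Rightarrow> ('f \<Rightarrow> complex) \<Rightarrow> ('n::finite, 'f) mpoly set \<Rightarrow> nat \<Rightarrow>
    ('n, 'f) sqmat \<Rightarrow> ('n, 'f set) sqmat \<Rightarrow> complex" where
  "psi v \<pi>F \<tau> E r \<beta> A =
    (let X = (SOME X. X \<in> lie_int v E \<and> A = mmap (omod v r) (one_plus (\<pi>F ^ lup r) X))
     in \<tau> (inverse (\<pi>F ^ ldn r) * tform (int_ring v) X \<beta>))"

definition stab_group ::
  "('f::field \<Rightarrow> int) \<Rightarrow> ('n::finite, 'f) mpoly set \<Rightarrow> nat \<Rightarrow> ('n, 'f) sqmat \<Rightarrow>
    ('n, 'f set) sqmat monoid" where
  "stab_group v E r \<beta> = (G_group v E r)\<lparr>carrier := {A \<in> carrier (G_group v E r).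
    Ad (Omod v (ldn r)) (mred v (ldn r) A) (mmap (omod v (ldn r)) \<beta>) = mmap (omod v (ldn r)) \<beta>}\<rparr>"

section \<open>The cocycle over the residue field\<close>

definition Vspace ::
  "('f::field \<Rightarrow> int) \<Rightarrow> ('n::finite, 'f) mpoly set \<Rightarrow> ('n, 'f) sqmat \<Rightarrow>
    ('n, 'f set) sqmat set monoid" where
  "Vspace v E \<beta> = lie_group v E 1 Mod carrier (lie_cent_res v E \<beta>)"

definition Vclass ::
  "('f::field \<Rightarrow> int) \<Rightarrow> ('n::finite, 'f) mpoly set \<Rightarrow> ('n, 'f) sqmat \<Rightarrow>
    ('n, 'f set) sqmat \<Rightarrow> ('n, 'f set) sqmat set" where
  "Vclass v E \<beta> X = carrier (lie_cent_res v E \<beta>) #>\<^bsub>lie_group v E 1\<^esub> X"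

definition sympl_form ::
  "('f::field \<Rightarrow> int) \<Rightarrow> ('n::finite, 'f) sqmat \<Rightarrow>
    ('n, 'f set) sqmat set \<Rightarrow> ('n, 'f set) sqmat set \<Rightarrow> 'f set" where
  "sympl_form v \<beta> u w =
    tform (Omod v 1) (bracket (Omod v 1) (SOME X. X \<in> u) (SOME Y. Y \<in> w)) (mmap (omod v 1) \<beta>)"

definition linear_section ::
  "('f::field \<Rightarrow> int) \<Rightarrow> ('n::finite, 'f) mpoly set \<Rightarrow> ('n, 'f) sqmat \<Rightarrow>
    (('n, 'f set) sqmat set \<Rightarrow> ('n, 'f set) sqmat) \<Rightarrow> bool" where
  "linear_section v E \<beta> s \<longleftrightarrow>
    (\<forall>u\<in>carrier (Vspace v E \<beta>). s u \<in> carrier (lie_group v E 1) \<and> Vclass v E \<beta> (s u) = u) \<and>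
    (\<forall>u\<in>carrier (Vspace v E \<beta>). \<forall>w\<in>carrier (Vspace v E \<beta>).
      s (u \<otimes>\<^bsub>Vspace v E \<beta>\<^esub> w) = madd (Omod v 1) (s u) (s w)) \<and>
    (\<forall>a\<in>carrier (Omod v 1). \<forall>X\<in>carrier (lie_group v E 1).
      s (Vclass v E \<beta> (msmult (Omod v 1) a X)) = msmult (Omod v 1) a (s (Vclass v E \<beta> X)))"

definition Vact ::
  "('f::field \<Rightarrow> int) \<Rightarrow> ('n::finite, 'f) mpoly set \<Rightarrow> ('n, 'f) sqmat \<Rightarrow>
    ('n, 'f set) sqmat set \<Rightarrow> ('n, 'f set) sqmat \<Rightarrow> ('n, 'f set) sqmat set" where
  "Vact v E \<beta> u g =
    Vclass v E \<beta> (Ad (Omod v 1) (inv\<^bsub>G_group v E 1\<^esub> g) (SOME X. X \<in> u))"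

definition gam ::
  "('f::field \<Rightarrow> int) \<Rightarrow> ('n::finite, 'f) mpoly set \<Rightarrow> ('n, 'f) sqmat \<Rightarrow>
    (('n, 'f set) sqmat set \<Rightarrow> ('n, 'f set) sqmat) \<Rightarrow>
    ('n, 'f set) sqmat set \<Rightarrow> ('n, 'f set) sqmat \<Rightarrow> ('n, 'f set) sqmat" where
  "gam v E \<beta> s u g =
    mminus (Omod v 1) (Ad (Omod v 1) (inv\<^bsub>G_group v E 1\<^esub> g) (s u)) (s (Vact v E \<beta> u g))"

definition v_elem ::
  "('f::field \<Rightarrow> int) \<Rightarrow> 'f \<Rightarrow> ('f \<Rightarrow> complex) \<Rightarrow> ('n::finite, 'f) mpoly set \<Rightarrow> ('n, 'f) sqmat \<Rightarrow>
    (('n, 'f set) sqmat set \<Rightarrow> ('n, 'f set) sqmat) \<Rightarrow> (('n, 'f set) sqmat \<Rightarrow> complex) \<Rightarrow>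
    ('n, 'f set) sqmat \<Rightarrow> ('n, 'f set) sqmat set" where
  "v_elem v \<pi>F \<tau> E \<beta> s \<rho> g =
    (THE w. w \<in> carrier (Vspace v E \<beta>) \<and>
      (\<forall>u\<in>carrier (Vspace v E \<beta>). \<rho> (gam v E \<beta> s u g) = hat_tau \<pi>F \<tau> (sympl_form v \<beta> u w)))"

definition cocycle ::
  "('f::field \<Rightarrow> int) \<Rightarrow> 'f \<Rightarrow> ('f \<Rightarrow> complex) \<Rightarrow> ('n::finite, 'f) mpoly set \<Rightarrow> ('n, 'f) sqmat \<Rightarrow>
    (('n, 'f set) sqmat set \<Rightarrow> ('n, 'f set) sqmat) \<Rightarrow> (('n, 'f set) sqmat \<Rightarrow> complex) \<Rightarrow>
    ('n, 'f set) sqmat \<Rightarrow> ('n, 'f set) sqmat \<Rightarrow> complex" where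
  "cocycle v \<pi>F \<tau> E \<beta> s \<rho> g h =
    hat_tau \<pi>F \<tau> (omod v 1 (inverse 2) \<otimes>\<^bsub>Omod v 1\<^esub>
      sympl_form v \<beta> (v_elem v \<pi>F \<tau> E \<beta> s \<rho> g)
        (v_elem v \<pi>F \<tau> E \<beta> s \<rho> (g \<otimes>\<^bsub>cent_group v E \<beta> 1\<^esub> h)))"

text \<open>Trivial action on the coefficients \<open>\<complex>\<^sup>\<times>\<close>: the class is trivial iff \<open>c\<close> is a 2-coboundary.\<close>

definition trivial_H2_class :: "('g, 'm) monoid_scheme \<Rightarrow> ('g \<Rightarrow> 'g \<Rightarrow> complex) \<Rightarrow> bool" where
  "trivial_H2_class H c \<longleftrightarrow>
    (\<exists>f. (\<forall>g\<in>carrier H. f g \<noteq> 0) \<and>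
      (\<forall>g\<in>carrier H. \<forall>h\<in>carrier H. c g h = f h * inverse (f (g \<otimes>\<^bsub>H\<^esub> h)) * f g))"

section \<open>The representations \<open>\<sigma>\<^sub>\<beta>\<^sub>,\<^sub>\<theta>\<close>\<close>

definition Z_group ::
  "('f::field \<Rightarrow> int) \<Rightarrow> 'f \<Rightarrow> ('n::finite, 'f) mpoly set \<Rightarrow> nat \<Rightarrow> ('n, 'f) sqmat \<Rightarrow>
    ('n, 'f set) sqmat monoid" where
  "Z_group v \<pi>F E r \<beta> = (G_group v E r)\<lparr>carrier := {A \<in> carrier (K_group v E (lup r - 1) r).
    \<exists>X. (\<forall>i j. X i j \<in> carrier (int_ring v)) \<and>
      A = mmap (omod v r) (one_plus (\<pi>F ^ (lup r - 1)) X) \<and>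
      mmap (omod v 1) X \<in> carrier (lie_cent_res v E \<beta>)}\<rparr>"

text \<open>The matrix \<open>X\<close> is integral, but need not lie in the Lie algebra; only its residue does.\<close>

definition psi_rho ::
  "('f::field \<Rightarrow> int) \<Rightarrow> 'f \<Rightarrow> ('f \<Rightarrow> complex) \<Rightarrow> nat \<Rightarrow> ('n::finite, 'f) sqmat \<Rightarrow>
    (('n, 'f set) sqmat \<Rightarrow> complex) \<Rightarrow> ('n, 'f set) sqmat \<Rightarrow> complex" where
  "psi_rho v \<pi>F \<tau> r \<beta> \<rho> A =
    (let X = (SOME X. (\<forall>i j. X i j \<in> carrier (int_ring v)) \<and>
                A = mmap (omod v r) (one_plus (\<pi>F ^ (lup r - 1)) X))
     in \<tau> (inverse (\<pi>F ^ lup r) * tform (int_ring v) X \<beta>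
           - inverse (2 * \<pi>F) * tform (int_ring v) (mmult (int_ring v) X X) \<beta>)
        * \<rho> (mmap (omod v 1) X))"

text \<open>
  For odd \<open>r\<close>: \<open>\<pi>\<close> is a matrix model of \<open>\<pi>\<^sub>\<beta>\<^sub>,\<^sub>\<rho>\<close>, and \<open>U\<close> is a homomorphism \<open>U\<^sub>\<beta>\<^sub>,\<^sub>\<rho>\<close> on the same
  space, so that \<open>U(g)\<^sup>-\<^sup>1 = U(g\<^sup>-\<^sup>1)\<close>.
\<close>

definition pi_U_data ::
  "('f::field \<Rightarrow> int) \<Rightarrow> 'f \<Rightarrow> ('f \<Rightarrow> complex) \<Rightarrow> ('n::finite, 'f) mpoly set \<Rightarrow> nat \<Rightarrow>
    ('n, 'f) sqmat \<Rightarrow> (('n, 'f set) sqmat \<Rightarrow> complex) \<Rightarrow>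
    (('n, 'f set) sqmat \<Rightarrow> complex mat) \<Rightarrow> (('n, 'f set) sqmat \<Rightarrow> complex mat) \<Rightarrow> bool" where
  "pi_U_data v \<pi>F \<tau> E r \<beta> \<rho> \<pi> U \<longleftrightarrow>
    (\<exists>d. irrep (K_group v E (lup r - 1) r) d \<pi> \<and>
      contains_char d \<pi> (Z_group v \<pi>F E r \<beta>) (psi_rho v \<pi>F \<tau> r \<beta> \<rho>) \<and>
      rep (cent_group v E \<beta> r) d U \<and>
      (\<forall>g\<in>carrier (cent_group v E \<beta> r). \<forall>x\<in>carrier (K_group v E (lup r - 1) r).
        \<pi> (inv\<^bsub>G_group v E r\<^esub> g \<otimes>\<^bsub>G_group v E r\<^esub> x \<otimes>\<^bsub>G_group v E r\<^esub> g)
          = U (inv\<^bsub>G_group v E r\<^esub> g) * \<pi> x * U g) \<and>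
      (\<forall>g\<in>carrier (cent_group v E \<beta> r) \<inter> carrier (K_group v E (lup r - 1) r). U g = 1\<^sub>m d))"

definition rho_of ::
  "('f::field \<Rightarrow> int) \<Rightarrow> 'f \<Rightarrow> ('f \<Rightarrow> complex) \<Rightarrow> ('n::finite, 'f) mpoly set \<Rightarrow> nat \<Rightarrow>
    ('n, 'f) sqmat \<Rightarrow> (('n, 'f set) sqmat \<Rightarrow> complex) \<Rightarrow> ('n, 'f set) sqmat \<Rightarrow> complex" where
  "rho_of v \<pi>F \<tau> E r \<beta> \<theta> =
    (THE \<rho>. \<rho> \<in> dual (lie_cent_res v E \<beta>) \<and>
      (\<forall>g\<in>carrier (cent_group v E \<beta> r) \<inter> carrier (K_group v E (lup r - 1) r).
        \<theta> g = psi_rho v \<pi>F \<tau> r \<beta> \<rho> g))"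

definition sigma ::
  "('f::field \<Rightarrow> int) \<Rightarrow> 'f \<Rightarrow> ('f \<Rightarrow> complex) \<Rightarrow> ('n::finite, 'f) mpoly set \<Rightarrow> nat \<Rightarrow>
    ('n, 'f) sqmat \<Rightarrow>
    ((('n, 'f set) sqmat \<Rightarrow> complex) \<Rightarrow> ('n, 'f set) sqmat \<Rightarrow> complex mat) \<Rightarrow>
    ((('n, 'f set) sqmat \<Rightarrow> complex) \<Rightarrow> ('n, 'f set) sqmat \<Rightarrow> complex mat) \<Rightarrow>
    (('n, 'f set) sqmat \<Rightarrow> complex) \<Rightarrow> ('n, 'f set) sqmat \<Rightarrow> complex mat" where
  "sigma v \<pi>F \<tau> E r \<beta> \<pi> U \<theta> A =
    (SOME M. \<exists>g\<in>carrier (cent_group v E \<beta> r). \<exists>h\<in>carrier (K_group v E (ldn r) r).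
      A = g \<otimes>\<^bsub>G_group v E r\<^esub> h \<and>
      M = (if even r then (\<theta> g * psi v \<pi>F \<tau> E r \<beta> h) \<cdot>\<^sub>m 1\<^sub>m 1
           else \<theta> g \<cdot>\<^sub>m (U (rho_of v \<pi>F \<tau> E r \<beta> \<theta>) g * \<pi> (rho_of v \<pi>F \<tau> E r \<beta> \<theta>) h)))"

definition Theta ::
  "('f::field \<Rightarrow> int) \<Rightarrow> 'f \<Rightarrow> ('f \<Rightarrow> complex) \<Rightarrow> ('n::finite, 'f) mpoly set \<Rightarrow> nat \<Rightarrow>
    ('n, 'f) sqmat \<Rightarrow> (('n, 'f set) sqmat \<Rightarrow> complex) set" where
  "Theta v \<pi>F \<tau> E r \<beta> = {\<theta> \<in> dual (cent_group v E \<beta> r).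
    \<forall>g\<in>carrier (cent_group v E \<beta> r) \<inter> carrier (K_group v E (lup r) r). \<theta> g = psi v \<pi>F \<tau> E r \<beta> g}"

end

theory Submission
  imports Defs "Jordan_Normal_Form.Spectral_Radius" "Jordan_Normal_Form.Schur_Decomposition"
begin

hide_const (open) Multiset.mult

text \<open>
  Write \<open>H\<close> for the stabilizer of \<open>\<psi>\<^sub>\<beta>\<close>. Smoothness of \<open>G\<^sub>\<beta>\<close> gives \<open>H = C K\<close> with \<open>C = G\<^sub>\<beta>(O\<^sub>r)\<close>
  commutative and \<open>K = K\<^sub>k(O\<^sub>r)\<close> normal, \<open>k = r div 2\<close>, and, for odd \<open>r\<close>, \<open>Z(O\<^sub>r, \<beta>) = (C \<inter> K) K\<^sub>l(O\<^sub>r)\<close>.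
  An irreducible representation of \<open>H\<close> above \<open>\<psi>\<^sub>\<beta>\<close> restricts to \<open>Z(O\<^sub>r, \<beta>)\<close> by a multiple of one
  \<open>\<psi>\<^sub>\<beta>\<^sub>,\<^sub>\<rho>\<close>, and the commutator pairing makes \<open>\<pi>\<^sub>\<beta>\<^sub>,\<^sub>\<rho>\<close> the only irreducible representation of \<open>K\<close> above it.
  The commuting operators of \<open>C\<close> on the space of \<open>K\<close>-intertwiners have a common eigenvector; its
  eigenvalues, corrected by \<open>U\<close>, form \<open>\<theta>\<close>. For even \<open>r\<close> the same argument applies with \<open>Z = K\<close> and
  one-dimensional \<open>\<pi>\<close>.

  The representation \<open>U\<close> is built from the Heisenberg representation \<open>W\<close> of \<open>V\<^sub>\<beta>\<close>. The operators
  implementing the isometries \<open>\<sigma>\<^sub>g\<close> commute with the involution induced by \<open>v \<mapsto> v\<^sup>-\<^sup>1\<close>, whose trace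
  is \<open>1\<close>; dividing by the determinant ratio on its eigenspaces removes the projective
  ambiguity and gives \<open>\<omega>\<close>. Then \<open>g \<mapsto> W(v\<^sub>g) \<omega>(g)\<close> is projective with cocycle \<open>c\<^sub>\<beta>\<^sub>,\<^sub>\<rho>\<close>, which is a coboundary
  by hypothesis.
\<close>


section \<open>Irreducible families of matrices\<close>

text \<open>For odd \<open>r\<close> the group K is not abelian: the product of 1 +
  \<open>\<pi>F ^ k\<close> X and 1 + \<open>\<pi>F ^ k\<close> Y has the parameter X + Y +
  \<open>\<pi>F ^ k\<close> XY, and the linear exponent B(X, \<beta>) / \<open>\<pi>F ^ l\<close>
  sees the term XY. The quadratic correction in \<open>psi_rho\<close> removes the symmetric part of
  this term and leaves half of B([X, Y], \<beta>). That half, available in odd residue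
  characteristic, is itself an alternating bicharacter preserved by the isometries \<sigma>_g, so it
  can serve as the multiplier of the Heisenberg representation. Schur's lemma attaches to each g in
  C an operator that is unique only up to a scalar. The obstruction to a coherent choice has two
  sources. One is the action of \<sigma>_g on the Heisenberg representation, and it vanishes for
  every group of isometries. The other is that a linear section of the projection onto V_\<beta>
  need not be compatible with Ad(g): the defect, read through \<rho>, is a translation by v_g, and
  c_{\<beta>,\<rho>} measures how these translations compose.\<close>

lemma subspace_module_vec_iff:
  "VectorSpace.subspace class_ring W (module_vec TYPE('a::field) d) \<longleftrightarrow>
    W \<subseteq> carrier_vec d \<and> 0\<^sub>v d \<in> W \<and> (\<forall>v\<in>W. \<forall>w\<in>W. v + w \<in> W) \<and> (\<forall>c. \<forall>v\<in>W. c \<cdot>\<^sub>v v \<in> W)"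
  unfolding VectorSpace.subspace_def submodule_def
  apply (simp add: module_vec_simps vec_module vec_vs Ball_def)
  apply (rule iffI)
   apply blast
  apply blast
  done

text \<open>The index set is arbitrary and need carry no group, so that Schur's lemma applies alike
  to representations, to projective representations and to families of commuting operators.\<close>

definition irr :: "nat \<Rightarrow> 'i set \<Rightarrow> ('i \<Rightarrow> complex mat) \<Rightarrow> bool" where
  "irr d S \<sigma> \<longleftrightarrow> 0 < d \<and> (\<forall>x\<in>S. \<sigma> x \<in> carrier_mat d d) \<and>
    (\<forall>W. VectorSpace.subspace class_ring W (module_vec TYPE(complex) d) \<and> (\<forall>x\<in>S. \<forall>w\<in>W. \<sigma> x *\<^sub>v w \<in> W) \<longrightarrow>
      W = {0\<^sub>v d} \<or> W = carrier_vec d)"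

lemma irrep_iff: "irrep H d \<sigma> \<longleftrightarrow> rep H d \<sigma> \<and> irr d (carrier H) \<sigma>"
  by (auto simp: irrep_def irr_def rep_def)

lemma irr_carrier: "irr d S \<sigma> \<Longrightarrow> x \<in> S \<Longrightarrow> \<sigma> x \<in> carrier_mat d d"
  by (auto simp: irr_def)

lemma irrD:
  assumes "irr d S \<sigma>" "W \<subseteq> carrier_vec d" "0\<^sub>v d \<in> W" "\<And>v w. v \<in> W \<Longrightarrow> w \<in> W \<Longrightarrow> v + w \<in> W"
    "\<And>c v. v \<in> W \<Longrightarrow> c \<cdot>\<^sub>v v \<in> W" "\<And>x w. x \<in> S \<Longrightarrow> w \<in> W \<Longrightarrow> \<sigma> x *\<^sub>v w \<in> W"
  shows "W = {0\<^sub>v d} \<or> W = carrier_vec d"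
proof -
  have "VectorSpace.subspace class_ring W (module_vec TYPE(complex) d)"
    unfolding subspace_module_vec_iff using assms(2-5) by auto
  moreover have "\<forall>x\<in>S. \<forall>w\<in>W. \<sigma> x *\<^sub>v w \<in> W" using assms(6) by auto
  ultimately show ?thesis using assms(1) unfolding irr_def by auto
qed

lemma irr_mono:
  assumes "irr d S \<sigma>" "S \<subseteq> S'" "\<And>x. x \<in> S' \<Longrightarrow> \<sigma> x \<in> carrier_mat d d"
  shows "irr d S' \<sigma>"
proof -
  have *: "\<forall>x\<in>S. \<forall>w\<in>W. \<sigma> x *\<^sub>v w \<in> W" if "\<forall>x\<in>S'. \<forall>w\<in>W. \<sigma> x *\<^sub>v w \<in> W" for W
    using that assms(2) by auto
  show ?thesis using assms(1,3) * unfolding irr_def by metis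
qed

lemma irr_cong:
  assumes "irr d S \<sigma>" "\<And>x. x \<in> S \<Longrightarrow> \<sigma>' x = \<sigma> x"
  shows "irr d S \<sigma>'"
proof -
  have *: "(\<forall>x\<in>S. \<forall>w\<in>W. \<sigma>' x *\<^sub>v w \<in> W) = (\<forall>x\<in>S. \<forall>w\<in>W. \<sigma> x *\<^sub>v w \<in> W)" for W
    using assms(2) by simp
  show ?thesis using assms unfolding irr_def * by simp
qed

section \<open>Rank arguments for rectangular matrices, and Schur's lemma\<close>

lemma mat_mult_unit_vec:
  fixes P :: "'a::semiring_1 mat"
  assumes "P \<in> carrier_mat m n" "j < n"
  shows "P *\<^sub>v unit_vec n j = col P j"
  by (rule eq_vecI) (use assms in auto)

lemma det_zero_row:
  fixes A :: "'a::comm_ring_1 mat"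
  assumes "A \<in> carrier_mat n n" "i < n" "\<And>j. j < n \<Longrightarrow> A $$ (i,j) = 0"
  shows "det A = 0"
  using laplace_expansion_row[OF assms(1,2)] assms(3) by simp

text \<open>Padding with zero rows gives a square matrix of determinant zero; a kernel vector of
  that matrix is killed by the original rows.\<close>

lemma wide_matrix_kernel:
  fixes P :: "'a::field mat"
  assumes P: "P \<in> carrier_mat m n" and mn: "m < n"
  obtains w where "w \<in> carrier_vec n" "w \<noteq> 0\<^sub>v n" "P *\<^sub>v w = 0\<^sub>v m"
proof -
  define Q where "Q = mat n n (\<lambda>(i,j). if i < m then P $$ (i,j) else 0)"
  have Q: "Q \<in> carrier_mat n n" by (simp add: Q_def)
  have "det Q = 0" by (rule det_zero_row[OF Q mn]) (use mn in \<open>auto simp: Q_def\<close>)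
  then obtain w where w: "w \<in> carrier_vec n" "w \<noteq> 0\<^sub>v n" "Q *\<^sub>v w = 0\<^sub>v n"
    using det_0_iff_vec_prod_zero_field[OF Q] by auto
  have "P *\<^sub>v w = 0\<^sub>v m"
  proof (rule eq_vecI)
    fix i assume "i < dim_vec (0\<^sub>v m :: 'a vec)"
    hence i: "i < m" by simp
    have "row Q i = row P i" by (rule eq_vecI) (use P i mn in \<open>auto simp: Q_def\<close>)
    moreover have "(Q *\<^sub>v w) $ i = 0" using w(3) i mn by simp
    ultimately show "(P *\<^sub>v w) $ i = 0\<^sub>v m $ i" using i mn P Q by auto
  qed (use P in auto)
  with w that show ?thesis by blast
qed

text \<open>The transpose is wide, so some nonzero \<open>u\<close> is orthogonal to the whole
  image; the unit vector at a nonzero coordinate of \<open>u\<close> is then missed.\<close>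

lemma tall_matrix_not_onto:
  fixes P :: "'a::field mat"
  assumes P: "P \<in> carrier_mat m n" and mn: "n < m"
  obtains v where "v \<in> carrier_vec m" "\<And>w. w \<in> carrier_vec n \<Longrightarrow> P *\<^sub>v w \<noteq> v"
proof -
  obtain u where u: "u \<in> carrier_vec m" "u \<noteq> 0\<^sub>v m" "P\<^sup>T *\<^sub>v u = 0\<^sub>v n"
    using wide_matrix_kernel[of "P\<^sup>T" n m] P mn by auto
  have "\<exists>i<m. u $ i \<noteq> 0" using u(1,2) by (metis carrier_vecD eq_vecI index_zero_vec(1,2))
  then obtain i where i: "i < m" "u $ i \<noteq> 0" by auto
  have z: "u \<bullet> (P *\<^sub>v w) = 0" if w: "w \<in> carrier_vec n" for w
  proof -
    have "u \<bullet> (P *\<^sub>v w) = (P\<^sup>T *\<^sub>v u) \<bullet> w" using transpose_vec_mult_scalar[OF P w u(1)] by simp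
    also have "\<dots> = 0" using u(3) w by simp
    finally show ?thesis .
  qed
  have "u \<bullet> unit_vec m i \<noteq> 0" using i u by simp
  hence "P *\<^sub>v w \<noteq> unit_vec m i" if "w \<in> carrier_vec n" for w using z[OF that] by force
  then show ?thesis using that[of "unit_vec m i"] by simp
qed

lemma square_injective_inverse:
  fixes P :: "'a::field mat"
  assumes P: "P \<in> carrier_mat n n" and inj: "\<And>w. w \<in> carrier_vec n \<Longrightarrow> P *\<^sub>v w = 0\<^sub>v n \<Longrightarrow> w = 0\<^sub>v n"
  obtains Q where "Q \<in> carrier_mat n n" "P * Q = 1\<^sub>m n" "Q * P = 1\<^sub>m n"
proof -
  have "det P \<noteq> 0" using det_0_iff_vec_prod_zero_field[OF P] inj by blast
  from det_non_zero_imp_unit[OF P this, of "()"] show ?thesis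
    using that by (auto simp: Units_def ring_mat_def)
qed

text \<open>The kernel and the image of \<open>P\<close> are invariant subspaces; as
  \<open>P\<close> is nonzero, the kernel is trivial and the image is everything. The lemmas on wide
  and tall matrices then exclude unequal dimensions.\<close>

lemma schur_zero_or_iso:
  assumes 1: "irr d1 S \<sigma>1" and 2: "irr d2 S \<sigma>2" and P: "P \<in> carrier_mat d1 d2"
    and comm: "\<And>x. x \<in> S \<Longrightarrow> \<sigma>1 x * P = P * \<sigma>2 x" and nz: "P \<noteq> 0\<^sub>m d1 d2"
  shows "d1 = d2" "\<exists>Q. Q \<in> carrier_mat d2 d2 \<and> P * Q = 1\<^sub>m d2 \<and> Q * P = 1\<^sub>m d2"
proof -
  note c1 = irr_carrier[OF 1] and c2 = irr_carrier[OF 2]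
  have actP: "\<sigma>1 x *\<^sub>v (P *\<^sub>v w) = P *\<^sub>v (\<sigma>2 x *\<^sub>v w)" if "x \<in> S" "w \<in> carrier_vec d2" for x w
    using comm[OF that(1)] c1[OF that(1)] c2[OF that(1)] P that(2)
    by (metis assoc_mult_mat_vec)
  let ?K = "{w \<in> carrier_vec d2. P *\<^sub>v w = 0\<^sub>v d1}"
  let ?I = "(\<lambda>w. P *\<^sub>v w) ` carrier_vec d2"
  have nzv: "\<exists>w\<in>carrier_vec d2. P *\<^sub>v w \<noteq> 0\<^sub>v d1"
  proof (rule ccontr)
    assume a: "\<not> ?thesis"
    have "P = 0\<^sub>m d1 d2"
    proof (rule eq_matI)
      fix i j assume ij: "i < dim_row (0\<^sub>m d1 d2 :: complex mat)" "j < dim_col (0\<^sub>m d1 d2 :: complex mat)"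
      have "P *\<^sub>v unit_vec d2 j = col P j" using mat_mult_unit_vec[OF P] ij by simp
      hence "col P j = 0\<^sub>v d1" using a by auto
      thus "P $$ (i,j) = 0\<^sub>m d1 d2 $$ (i,j)" using ij P by (metis carrier_matD index_col index_zero_mat index_zero_vec(1))
    qed (use P in auto)
    with nz show False by simp
  qed
  have "?K = {0\<^sub>v d2} \<or> ?K = carrier_vec d2"
  proof (rule irrD[OF 2])
    show "0\<^sub>v d2 \<in> ?K" using P by (auto simp: mult_mat_vec_def intro!: eq_vecI)
    show "v + w \<in> ?K" if "v \<in> ?K" "w \<in> ?K" for v w
      using that P by (auto simp: mult_add_distrib_mat_vec)
    show "c \<cdot>\<^sub>v v \<in> ?K" if "v \<in> ?K" for c v using that P by (auto simp: mult_mat_vec)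
    show "\<sigma>2 x *\<^sub>v w \<in> ?K" if "x \<in> S" "w \<in> ?K" for x w
    proof -
      have "P *\<^sub>v (\<sigma>2 x *\<^sub>v w) = \<sigma>1 x *\<^sub>v 0\<^sub>v d1" using actP[OF that(1), of w] that(2) by simp
      also have "\<dots> = 0\<^sub>v d1" using c1[OF that(1)] by (auto simp: mult_mat_vec_def intro!: eq_vecI)
      finally show ?thesis using c2[OF that(1)] that(2) by auto
    qed
  qed auto
  with nzv have K: "?K = {0\<^sub>v d2}" by auto
  have "?I = {0\<^sub>v d1} \<or> ?I = carrier_vec d1"
  proof (rule irrD[OF 1])
    show "?I \<subseteq> carrier_vec d1" using P by auto
    have "P *\<^sub>v 0\<^sub>v d2 = 0\<^sub>v d1" using P by (auto simp: mult_mat_vec_def intro!: eq_vecI)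
    thus "0\<^sub>v d1 \<in> ?I" by (metis imageI zero_carrier_vec)
    show "v + w \<in> ?I" if vw: "v \<in> ?I" "w \<in> ?I" for v w
    proof -
      obtain v' w' where "v' \<in> carrier_vec d2" "w' \<in> carrier_vec d2" "v = P *\<^sub>v v'" "w = P *\<^sub>v w'" using vw by auto
      hence "v + w = P *\<^sub>v (v' + w')" "v' + w' \<in> carrier_vec d2" using P by (auto simp: mult_add_distrib_mat_vec)
      thus ?thesis by blast
    qed
    show "c \<cdot>\<^sub>v v \<in> ?I" if v: "v \<in> ?I" for c v
    proof -
      obtain v' where "v' \<in> carrier_vec d2" "v = P *\<^sub>v v'" using v by auto
      hence "c \<cdot>\<^sub>v v = P *\<^sub>v (c \<cdot>\<^sub>v v')" "c \<cdot>\<^sub>v v' \<in> carrier_vec d2" using P by (auto simp: mult_mat_vec)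
      thus ?thesis by blast
    qed
    show "\<sigma>1 x *\<^sub>v w \<in> ?I" if xw: "x \<in> S" "w \<in> ?I" for x w
    proof -
      obtain w' where w': "w' \<in> carrier_vec d2" "w = P *\<^sub>v w'" using xw by auto
      hence "\<sigma>1 x *\<^sub>v w = P *\<^sub>v (\<sigma>2 x *\<^sub>v w')" using actP xw by auto
      moreover have "\<sigma>2 x *\<^sub>v w' \<in> carrier_vec d2" using c2[OF xw(1)] w' by auto
      ultimately show ?thesis by blast
    qed
  qed
  with nzv have I: "?I = carrier_vec d1" by blast
  show d: "d1 = d2"
  proof (rule ccontr)
    assume "d1 \<noteq> d2"
    then consider "d1 < d2" | "d2 < d1" by linarith
    thus False
    proof cases
      case 1
      obtain w where "w \<in> carrier_vec d2" "w \<noteq> 0\<^sub>v d2" "P *\<^sub>v w = 0\<^sub>v d1" using wide_matrix_kernel[OF P 1] by blast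
      with K show False by blast
    next
      case 2
      obtain w where w: "w \<in> carrier_vec d1" "\<And>u. u \<in> carrier_vec d2 \<Longrightarrow> P *\<^sub>v u \<noteq> w" using tall_matrix_not_onto[OF P 2] by blast
      have "w \<in> ?I" using I w(1) by simp
      thus False using w(2) by auto
    qed
  qed
  have P': "P \<in> carrier_mat d2 d2" using P d by simp
  show "\<exists>Q. Q \<in> carrier_mat d2 d2 \<and> P * Q = 1\<^sub>m d2 \<and> Q * P = 1\<^sub>m d2"
  proof (rule square_injective_inverse[OF P'])
    show "w = 0\<^sub>v d2" if "w \<in> carrier_vec d2" "P *\<^sub>v w = 0\<^sub>v d2" for w
      using K d that by auto
  qed blast
qed

text \<open>Over the complex numbers \<open>P\<close> has an eigenvalue \<open>c\<close>; the
  difference of \<open>P\<close> and \<open>c\<close> still commutes with the family but has a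
  kernel, so it cannot be invertible and must vanish.\<close>

lemma schur_scalar:
  assumes S: "irr d S \<sigma>" and P: "P \<in> carrier_mat d d" and comm: "\<And>x. x \<in> S \<Longrightarrow> \<sigma> x * P = P * \<sigma> x"
  obtains c where "P = c \<cdot>\<^sub>m 1\<^sub>m d"
proof -
  have d: "0 < d" using S by (simp add: irr_def)
  obtain c where "c \<in> spectrum P" using spectrum_non_empty[OF P d] by auto
  then obtain v where v: "v \<in> carrier_vec d" "v \<noteq> 0\<^sub>v d" "P *\<^sub>v v = c \<cdot>\<^sub>v v"
    using P by (auto simp: spectrum_def eigenvalue_def eigenvector_def)
  define Q where "Q = P - c \<cdot>\<^sub>m 1\<^sub>m d"
  have Q: "Q \<in> carrier_mat d d" using P unfolding Q_def by (intro minus_carrier_mat) simp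
  have Qv: "Q *\<^sub>v v = 0\<^sub>v d"
    unfolding Q_def using P v by (auto simp: minus_mult_distrib_mat_vec intro!: eq_vecI)
  have cQ: "\<sigma> x * Q = Q * \<sigma> x" if x: "x \<in> S" for x
    using irr_carrier[OF S x] P comm[OF x] unfolding Q_def
    by (simp add: mult_minus_distrib_mat minus_mult_distrib_mat mult_smult_distrib[of _ d d _ d] mult_smult_assoc_mat[of _ d d _ d])
  have "Q = 0\<^sub>m d d"
  proof (rule ccontr)
    assume "Q \<noteq> 0\<^sub>m d d"
    then obtain R where R: "R \<in> carrier_mat d d" "R * Q = 1\<^sub>m d"
      using schur_zero_or_iso[OF S S Q cQ] by auto
    have "v = R *\<^sub>v (Q *\<^sub>v v)" using R Q v by (metis assoc_mult_mat_vec one_mult_mat_vec)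
    also have "\<dots> = 0\<^sub>v d" using R Qv by (auto simp: mult_mat_vec_def intro!: eq_vecI)
    finally show False using v by simp
  qed
  hence "P = c \<cdot>\<^sub>m 1\<^sub>m d"
    unfolding Q_def using P by (auto simp: mat_eq_iff)
  thus ?thesis using that by blast
qed

text \<open>An invariant subspace is handled as the image of such a matrix, whose columns form a
  basis; the restriction of an operator to the subspace is then again a square matrix.\<close>

definition minj :: "complex mat \<Rightarrow> bool" where
  "minj Q \<longleftrightarrow> (\<forall>w\<in>carrier_vec (dim_col Q). Q *\<^sub>v w = 0\<^sub>v (dim_row Q) \<longrightarrow> w = 0\<^sub>v (dim_col Q))"

text \<open>Columns are adjoined one at a time, each a vector of \<open>W\<close> outside the span
  of the earlier ones. Injectivity bounds their number by \<open>d\<close>, so a matrix with the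
  largest possible number of columns has image all of \<open>W\<close>.\<close>

lemma subspace_column_basis:
  assumes W: "VectorSpace.subspace class_ring W (module_vec TYPE(complex) d)" and n0: "W \<noteq> {0\<^sub>v d}" and nt: "W \<noteq> carrier_vec d"
  obtains j Q where "0 < j" "j < d" "Q \<in> carrier_mat d j" "minj Q" "(\<lambda>w. Q *\<^sub>v w) ` carrier_vec j = W"
proof -
  have Ws: "W \<subseteq> carrier_vec d" "0\<^sub>v d \<in> W" "\<And>v w. v \<in> W \<Longrightarrow> w \<in> W \<Longrightarrow> v + w \<in> W" "\<And>c v. v \<in> W \<Longrightarrow> c \<cdot>\<^sub>v v \<in> W"
    using W unfolding subspace_module_vec_iff by blast+
  define good where "good j Q \<longleftrightarrow> Q \<in> carrier_mat d j \<and> minj Q \<and> (\<lambda>w. Q *\<^sub>v w) ` carrier_vec j \<subseteq> W" for j Q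
  have le: "j \<le> d" if "good j Q" for j Q
  proof (rule ccontr)
    assume "\<not> j \<le> d"
    hence jd: "d < j" and Qc: "Q \<in> carrier_mat d j" using that by (auto simp: good_def)
    obtain w where "w \<in> carrier_vec j" "w \<noteq> 0\<^sub>v j" "Q *\<^sub>v w = 0\<^sub>v d"
      by (rule wide_matrix_kernel[OF Qc jd])
    thus False using that by (auto simp: good_def minj_def)
  qed
  have ext: "\<exists>Q'. good (Suc j) Q'" if g: "good j Q" and w: "w \<in> W" "w \<notin> (\<lambda>w. Q *\<^sub>v w) ` carrier_vec j" for j Q w
  proof -
    have Q: "Q \<in> carrier_mat d j" "minj Q" and QW: "\<And>u. u \<in> carrier_vec j \<Longrightarrow> Q *\<^sub>v u \<in> W" using g by (auto simp: good_def)
    have wd: "w \<in> carrier_vec d" using w Ws by auto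
    define Q' where "Q' = mat d (Suc j) (\<lambda>(i,c). if c < j then Q $$ (i,c) else w $ i)"
    have Q': "Q' \<in> carrier_mat d (Suc j)" by (simp add: Q'_def)
    have eq: "Q' *\<^sub>v u = Q *\<^sub>v (vec j (\<lambda>i. u $ i)) + u $ j \<cdot>\<^sub>v w" if u: "u \<in> carrier_vec (Suc j)" for u
    proof (rule eq_vecI)
      fix i assume "i < dim_vec (Q *\<^sub>v (vec j (\<lambda>i. u $ i)) + u $ j \<cdot>\<^sub>v w)"
      hence i: "i < d" using wd by simp
      have "(Q' *\<^sub>v u) $ i = (\<Sum>c<Suc j. Q' $$ (i,c) * u $ c)"
        using i Q' u by (auto simp: scalar_prod_def lessThan_atLeast0 intro!: sum.cong)
      also have "\<dots> = (\<Sum>c<j. Q $$ (i,c) * u $ c) + w $ i * u $ j" using i by (simp add: Q'_def)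
      also have "(\<Sum>c<j. Q $$ (i,c) * u $ c) = (Q *\<^sub>v (vec j (\<lambda>i. u $ i))) $ i"
        using i Q by (auto simp: scalar_prod_def lessThan_atLeast0 intro!: sum.cong)
      finally show "(Q' *\<^sub>v u) $ i = (Q *\<^sub>v (vec j (\<lambda>i. u $ i)) + u $ j \<cdot>\<^sub>v w) $ i" using i wd Q by (simp add: mult.commute)
    qed (use Q' wd in auto)
    have "minj Q'"
      unfolding minj_def
    proof (intro ballI impI)
      fix u assume u: "u \<in> carrier_vec (dim_col Q')" "Q' *\<^sub>v u = 0\<^sub>v (dim_row Q')"
      hence uc: "u \<in> carrier_vec (Suc j)" and "Q' *\<^sub>v u = 0\<^sub>v d" using Q' by auto
      hence z: "Q *\<^sub>v (vec j (\<lambda>i. u $ i)) + u $ j \<cdot>\<^sub>v w = 0\<^sub>v d" using eq by simp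
      have uj: "u $ j = 0"
      proof (rule ccontr)
        assume nz: "u $ j \<noteq> 0"
        have "w = Q *\<^sub>v ((- 1 / u $ j) \<cdot>\<^sub>v vec j (\<lambda>i. u $ i))"
        proof (rule eq_vecI)
          fix i assume "i < dim_vec (Q *\<^sub>v ((- 1 / u $ j) \<cdot>\<^sub>v vec j (\<lambda>i. u $ i)))"
          hence i: "i < d" using Q by simp
          have "(Q *\<^sub>v vec j (\<lambda>i. u $ i)) $ i + u $ j * w $ i = 0"
            using arg_cong[OF z, of "\<lambda>v. v $ i"] i wd Q by simp
          hence "u $ j * w $ i = - (Q *\<^sub>v vec j (\<lambda>i. u $ i)) $ i" by (metis add_eq_0_iff)
          hence "w $ i = - (Q *\<^sub>v vec j (\<lambda>i. u $ i)) $ i / u $ j" using nz by (metis nonzero_mult_div_cancel_left)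
          moreover have "(Q *\<^sub>v ((- 1 / u $ j) \<cdot>\<^sub>v vec j (\<lambda>i. u $ i))) $ i = (- 1 / u $ j) * (Q *\<^sub>v vec j (\<lambda>i. u $ i)) $ i"
            using mult_mat_vec[OF Q(1), of "vec j (\<lambda>i. u $ i)" "- 1 / u $ j"] i Q(1) by simp
          ultimately show "w $ i = (Q *\<^sub>v ((- 1 / u $ j) \<cdot>\<^sub>v vec j (\<lambda>i. u $ i))) $ i"
            by simp
        qed (use wd Q in auto)
        moreover have "(- 1 / u $ j) \<cdot>\<^sub>v vec j (\<lambda>i. u $ i) \<in> carrier_vec j" by simp
        ultimately show False using w by blast
      qed
      have "Q *\<^sub>v (vec j (\<lambda>i. u $ i)) = 0\<^sub>v d"
        using z uj wd Q by (auto simp: vec_eq_iff)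
      hence "vec j (\<lambda>i. u $ i) = 0\<^sub>v j" using Q by (auto simp: minj_def)
      hence "u $ i = 0" if "i < j" for i using that by (metis index_vec index_zero_vec(1))
      hence "u = 0\<^sub>v (Suc j)" using uj uc by (auto intro!: eq_vecI simp: less_Suc_eq)
      thus "u = 0\<^sub>v (dim_col Q')" using Q' by simp
    qed
    moreover have "(\<lambda>w. Q' *\<^sub>v w) ` carrier_vec (Suc j) \<subseteq> W"
      using eq QW Ws(3,4) w(1) by auto
    ultimately show ?thesis using Q' unfolding good_def by blast
  qed
  have g0: "good 0 (0\<^sub>m d 0)" unfolding good_def minj_def using Ws(2)
    by (auto simp: mult_mat_vec_def scalar_prod_def vec_eq_iff zero_vec_def)
  define j where "j = Max {j. \<exists>Q. good j Q}"
  have fin: "finite {j. \<exists>Q. good j Q}" by (rule finite_subset[of _ "{..d}"]) (use le in auto)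
  have "j \<in> {j. \<exists>Q. good j Q}" unfolding j_def by (rule Max_in[OF fin]) (use g0 in auto)
  then obtain Q where Q: "good j Q" by auto
  have onto: "(\<lambda>w. Q *\<^sub>v w) ` carrier_vec j = W"
  proof (rule ccontr)
    assume "\<not> ?thesis"
    then obtain w where "w \<in> W" "w \<notin> (\<lambda>w. Q *\<^sub>v w) ` carrier_vec j" using Q by (auto simp: good_def)
    then obtain Q' where "good (Suc j) Q'" using ext[OF Q] by blast
    hence "Suc j \<le> j" unfolding j_def using Max_ge[OF fin, of "Suc j"] j_def by auto
    thus False by simp
  qed
  have "0 < j"
  proof (rule ccontr)
    assume "\<not> 0 < j"
    hence "\<And>w. w \<in> carrier_vec j \<Longrightarrow> Q *\<^sub>v w = 0\<^sub>v d" using Q by (auto simp: good_def mult_mat_vec_def scalar_prod_def vec_eq_iff)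
    hence "W \<subseteq> {0\<^sub>v d}" using onto by auto
    with Ws(2) n0 show False by blast
  qed
  moreover have "j < d"
  proof (rule ccontr)
    assume "\<not> j < d"
    hence jd: "j = d" using le[OF Q] by simp
    hence Qc: "Q \<in> carrier_mat d d" using Q by (auto simp: good_def)
    obtain R where R: "R \<in> carrier_mat d d" "Q * R = 1\<^sub>m d" "R * Q = 1\<^sub>m d"
      by (rule square_injective_inverse[OF Qc]) (use Q Qc jd in \<open>auto simp: good_def minj_def\<close>)
    have "carrier_vec d \<subseteq> W"
    proof
      fix v :: "complex vec" assume v: "v \<in> carrier_vec d"
      have "v = Q *\<^sub>v (R *\<^sub>v v)" using assoc_mult_mat_vec[of Q d d R d v] R Qc v by simp
      thus "v \<in> W" using onto jd R v by auto
    qed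
    thus False using Ws(1) nt by blast
  qed
  ultimately show ?thesis using that[of j Q] Q onto by (auto simp: good_def)
qed

lemma minj_mult:
  assumes "P \<in> carrier_mat a b" "Q \<in> carrier_mat b c" "minj P" "minj Q"
  shows "minj (P * Q)"
  unfolding minj_def
proof (intro ballI impI)
  fix w assume "w \<in> carrier_vec (dim_col (P * Q))" "P * Q *\<^sub>v w = 0\<^sub>v (dim_row (P * Q))"
  hence w: "w \<in> carrier_vec c" "P *\<^sub>v (Q *\<^sub>v w) = 0\<^sub>v a" using assms(1,2) by (auto simp: assoc_mult_mat_vec[of P a b Q c])
  have "Q *\<^sub>v w = 0\<^sub>v b" using assms(1,2,3) w by (auto simp: minj_def)
  thus "w = 0\<^sub>v (dim_col (P * Q))" using assms(2,4) w by (auto simp: minj_def)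
qed

lemma minj_cancel:
  assumes Q: "Q \<in> carrier_mat n k" "minj Q" and A: "A \<in> carrier_mat k m" and B: "B \<in> carrier_mat k m" and eq: "Q * A = Q * B"
  shows "A = B"
proof (rule mat_col_eqI)
  fix j assume "j < dim_col B"
  hence j: "j < m" using B by simp
  have "Q *\<^sub>v (col A j - col B j) = Q *\<^sub>v col A j - Q *\<^sub>v col B j"
    by (rule mult_minus_distrib_mat_vec[OF Q(1)]) (use A B in auto)
  also have "Q *\<^sub>v col A j = Q *\<^sub>v col B j" using col_mult2[OF Q(1) A j] col_mult2[OF Q(1) B j] eq by simp
  finally have "Q *\<^sub>v (col A j - col B j) = 0\<^sub>v n" using Q(1) by auto
  moreover have "col A j - col B j \<in> carrier_vec k" by (rule carrier_vecI) (use B in simp)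
  ultimately have z: "col A j - col B j = 0\<^sub>v k" using Q by (auto simp: minj_def)
  show "col A j = col B j"
  proof (rule eq_vecI)
    fix i assume "i < dim_vec (col B j)"
    hence i: "i < k" using B by simp
    have "(col A j - col B j) $ i = 0" using z i by simp
    thus "col A j $ i = col B j $ i" using i A B by simp
  qed (use A B in simp)
qed (use A B in auto)

text \<open>The \<open>c\<close>-th column of \<open>t\<close> holds coordinates, with respect to
  the columns of \<open>Q\<close>, of the image under \<open>s\<close> of the \<open>c\<close>-th
  column of \<open>Q\<close>.\<close>

lemma intertwiner_of_invariant_image:
  assumes Q: "Q \<in> carrier_mat d j" and s: "s \<in> carrier_mat d d"
    and inv: "\<And>w. w \<in> carrier_vec j \<Longrightarrow> s *\<^sub>v (Q *\<^sub>v w) \<in> (\<lambda>w. Q *\<^sub>v w) ` carrier_vec j"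
  obtains t :: "complex mat" where "t \<in> carrier_mat j j" "s * Q = Q * t"
proof -
  have "\<exists>u\<in>carrier_vec j. s *\<^sub>v (Q *\<^sub>v unit_vec j c) = Q *\<^sub>v u" for c using inv[of "unit_vec j c"] by auto
  then obtain u where u: "\<And>c. u c \<in> carrier_vec j" "\<And>c. s *\<^sub>v (Q *\<^sub>v unit_vec j c) = Q *\<^sub>v u c" by metis
  define t where "t = mat j j (\<lambda>(i,c). u c $ i)"
  have t: "t \<in> carrier_mat j j" by (simp add: t_def)
  have ct: "col t c = u c" if "c < j" for c using u(1)[of c] that by (auto simp: t_def)
  have "s * Q = Q * t"
  proof (rule mat_col_eqI)
    fix c assume "c < dim_col (Q * t)"
    hence c: "c < j" using t by simp
    have "col (s * Q) c = s *\<^sub>v col Q c" by (rule col_mult2[OF s Q c])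
    also have "col Q c = Q *\<^sub>v unit_vec j c" using mat_mult_unit_vec[OF Q c] by simp
    also have "s *\<^sub>v \<dots> = col (Q * t) c" using u(2)[of c] ct[OF c] col_mult2[OF Q t c] mat_mult_unit_vec[OF Q c] by simp
    finally show "col (s * Q) c = col (Q * t) c" .
  qed (use s Q t in auto)
  with t that show ?thesis by blast
qed

text \<open>Among all injective \<open>Q\<close> with invariant image, one with the least positive
  number of columns is taken; a proper nonzero invariant subspace of the restricted family would
  yield a smaller one.\<close>

lemma irreducible_subfamily:
  assumes d: "0 < d" and c: "\<And>x. x \<in> S \<Longrightarrow> \<sigma> x \<in> carrier_mat d d"
  obtains k Q \<sigma>' where "0 < k" "Q \<in> carrier_mat d k" "minj Q" "\<And>x. x \<in> S \<Longrightarrow> \<sigma> x * Q = Q * \<sigma>' x" "irr k S \<sigma>'"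
proof -
  define good where "good k Q \<sigma>' \<longleftrightarrow> 0 < k \<and> Q \<in> carrier_mat d k \<and> minj Q \<and>
      (\<forall>x\<in>S. \<sigma>' x \<in> carrier_mat k k \<and> \<sigma> x * Q = Q * \<sigma>' x)" for k Q \<sigma>'
  have "good d (1\<^sub>m d) \<sigma>" using d c by (auto simp: good_def minj_def right_mult_one_mat[OF c] left_mult_one_mat[OF c])
  hence ex: "\<exists>k Q \<sigma>'. good k Q \<sigma>'" by blast
  define k where "k = (LEAST k. \<exists>Q \<sigma>'. good k Q \<sigma>')"
  have "\<exists>Q \<sigma>'. good k Q \<sigma>'" unfolding k_def by (rule LeastI_ex[OF ex])
  then obtain Q \<sigma>' where g: "good k Q \<sigma>'" by blast
  have min: "\<not> good j R \<rho>" if "j < k" for j R \<rho> using that not_less_Least unfolding k_def by blast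
  have gk: "0 < k" "Q \<in> carrier_mat d k" "minj Q" "\<And>x. x \<in> S \<Longrightarrow> \<sigma>' x \<in> carrier_mat k k" "\<And>x. x \<in> S \<Longrightarrow> \<sigma> x * Q = Q * \<sigma>' x"
    using g by (auto simp: good_def)
  have "irr k S \<sigma>'"
    unfolding irr_def
  proof (intro conjI ballI allI impI; (elim conjE)?)
    fix W assume W: "VectorSpace.subspace class_ring W (module_vec TYPE(complex) k)" "\<forall>x\<in>S. \<forall>w\<in>W. \<sigma>' x *\<^sub>v w \<in> W"
    show "W = {0\<^sub>v k} \<or> W = carrier_vec k"
    proof (rule ccontr)
      assume "\<not> ?thesis"
      hence W': "W \<noteq> {0\<^sub>v k}" "W \<noteq> carrier_vec k" by auto
      obtain j R where R: "0 < j" "j < k" "R \<in> carrier_mat k j" "minj R" "(\<lambda>w. R *\<^sub>v w) ` carrier_vec j = W"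
        by (rule subspace_column_basis[OF W(1) W'])
      have "\<exists>t. t \<in> carrier_mat j j \<and> \<sigma>' x * R = R * t" if x: "x \<in> S" for x
      proof (rule intertwiner_of_invariant_image[OF R(3) gk(4)[OF x]])
        show "\<sigma>' x *\<^sub>v (R *\<^sub>v w) \<in> (\<lambda>w. R *\<^sub>v w) ` carrier_vec j" if "w \<in> carrier_vec j" for w
          unfolding R(5) using W(2) x R(5) that by auto
      qed blast
      then obtain \<rho> where \<rho>: "\<And>x. x \<in> S \<Longrightarrow> \<rho> x \<in> carrier_mat j j" "\<And>x. x \<in> S \<Longrightarrow> \<sigma>' x * R = R * \<rho> x" by metis
      have "\<sigma> x * (Q * R) = Q * R * \<rho> x" if x: "x \<in> S" for x
      proof -
        have "\<sigma> x * (Q * R) = (\<sigma> x * Q) * R" using c[OF x] gk(2) R(3) by simp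
        also have "\<dots> = Q * (\<sigma>' x * R)" using assoc_mult_mat[OF gk(2) gk(4)[OF x] R(3)] gk(5)[OF x] by simp
        also have "\<dots> = Q * R * \<rho> x" using \<rho>[OF x] gk(2) R(3) by simp
        finally show ?thesis .
      qed
      hence "good j (Q * R) \<rho>" unfolding good_def using \<rho> R gk minj_mult[OF gk(2) R(3) gk(3) R(4)] by auto
      thus False using min[OF R(2)] by simp
    qed
  qed (use gk in auto)
  with gk that show ?thesis by blast
qed

text \<open>An irreducible subfamily of the restriction to \<open>W\<close> consists of commuting
  operators, hence of scalars by \<open>schur_scalar\<close>; every nonzero vector of its space is
  then a common eigenvector.\<close>

lemma common_eigenvector:
  assumes W: "VectorSpace.subspace class_ring W (module_vec TYPE(complex) d)" and n0: "W \<noteq> {0\<^sub>v d}"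
    and c: "\<And>x. x \<in> S \<Longrightarrow> \<sigma> x \<in> carrier_mat d d"
    and inv: "\<And>x w. x \<in> S \<Longrightarrow> w \<in> W \<Longrightarrow> \<sigma> x *\<^sub>v w \<in> W"
    and comm: "\<And>x y. x \<in> S \<Longrightarrow> y \<in> S \<Longrightarrow> \<sigma> x * \<sigma> y = \<sigma> y * \<sigma> x"
  obtains w where "w \<in> W" "w \<noteq> 0\<^sub>v d" "\<And>x. x \<in> S \<Longrightarrow> \<exists>c. \<sigma> x *\<^sub>v w = c \<cdot>\<^sub>v w"
proof -
  have "\<exists>j Q. 0 < j \<and> Q \<in> carrier_mat d j \<and> minj Q \<and> (\<lambda>w. Q *\<^sub>v w) ` carrier_vec j = W"
  proof (cases "W = carrier_vec d")
    case True
    have "0 < d"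
    proof (rule ccontr)
      assume "\<not> 0 < d"
      hence "carrier_vec d = {0\<^sub>v d :: complex vec}" by auto
      thus False using True n0 by simp
    qed
    moreover have "(\<lambda>w. 1\<^sub>m d *\<^sub>v w) ` carrier_vec d = W" using True by force
    ultimately show ?thesis by (intro exI[of _ d] exI[of _ "1\<^sub>m d"]) (auto simp: minj_def)
  next
    case False
    obtain j Q where "0 < j" "j < d" "Q \<in> carrier_mat d j" "minj Q" "(\<lambda>w. Q *\<^sub>v w) ` carrier_vec j = W"
      by (rule subspace_column_basis[OF W n0 False])
    thus ?thesis by blast
  qed
  then obtain j Q where Q: "0 < j" "Q \<in> carrier_mat d j" "minj Q" "(\<lambda>w. Q *\<^sub>v w) ` carrier_vec j = W" by blast
  have "\<exists>t. t \<in> carrier_mat j j \<and> \<sigma> x * Q = Q * t" if x: "x \<in> S" for x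
  proof (rule intertwiner_of_invariant_image[OF Q(2) c[OF x]])
    show "\<sigma> x *\<^sub>v (Q *\<^sub>v w) \<in> (\<lambda>w. Q *\<^sub>v w) ` carrier_vec j" if "w \<in> carrier_vec j" for w
      unfolding Q(4) by (rule inv[OF x]) (use Q(4) that in auto)
  qed blast
  then obtain \<tau> where \<tau>: "\<And>x. x \<in> S \<Longrightarrow> \<tau> x \<in> carrier_mat j j" "\<And>x. x \<in> S \<Longrightarrow> \<sigma> x * Q = Q * \<tau> x" by metis
  obtain k R \<rho> where R: "0 < k" "R \<in> carrier_mat j k" "minj R" "\<And>x. x \<in> S \<Longrightarrow> \<tau> x * R = R * \<rho> x" and irr: "irr k S \<rho>"
    by (rule irreducible_subfamily[OF Q(1) \<tau>(1)]) blast+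
  define P where "P = Q * R"
  have P: "P \<in> carrier_mat d k" using Q R by (simp add: P_def)
  have Pi: "minj P" unfolding P_def by (rule minj_mult[OF Q(2) R(2) Q(3) R(3)])
  note \<rho>c = irr_carrier[OF irr]
  have \<sigma>P: "\<sigma> x * P = P * \<rho> x" if x: "x \<in> S" for x
  proof -
    have "\<sigma> x * P = \<sigma> x * Q * R" unfolding P_def by (rule assoc_mult_mat[OF c[OF x] Q(2) R(2), symmetric])
    also have "\<dots> = Q * (\<tau> x * R)" unfolding \<tau>(2)[OF x] by (rule assoc_mult_mat[OF Q(2) \<tau>(1)[OF x] R(2)])
    also have "\<dots> = P * \<rho> x" unfolding R(4)[OF x] P_def by (rule assoc_mult_mat[OF Q(2) R(2) \<rho>c[OF x], symmetric])
    finally show ?thesis .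
  qed
  have PP: "P * (\<rho> x * \<rho> y) = \<sigma> x * \<sigma> y * P" if x: "x \<in> S" and y: "y \<in> S" for x y
  proof -
    have "P * (\<rho> x * \<rho> y) = P * \<rho> x * \<rho> y" by (rule assoc_mult_mat[OF P \<rho>c[OF x] \<rho>c[OF y], symmetric])
    also have "\<dots> = \<sigma> x * (P * \<rho> y)" unfolding \<sigma>P[OF x, symmetric] by (rule assoc_mult_mat[OF c[OF x] P \<rho>c[OF y]])
    also have "\<dots> = \<sigma> x * \<sigma> y * P" unfolding \<sigma>P[OF y, symmetric] by (rule assoc_mult_mat[OF c[OF x] c[OF y] P, symmetric])
    finally show ?thesis .
  qed
  \<comment> \<open>Commutation is known for \<open>\<sigma>\<close>; it is transferred to
    \<open>\<rho>\<close> by cancelling the injective matrix \<open>P\<close>.\<close>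
  have scal: "\<exists>b. \<rho> x = b \<cdot>\<^sub>m 1\<^sub>m k" if x: "x \<in> S" for x
  proof (rule schur_scalar[OF irr \<rho>c[OF x]])
    fix y assume y: "y \<in> S"
    show "\<rho> y * \<rho> x = \<rho> x * \<rho> y"
      by (rule minj_cancel[OF P Pi mult_carrier_mat[OF \<rho>c[OF y] \<rho>c[OF x]] mult_carrier_mat[OF \<rho>c[OF x] \<rho>c[OF y]]])
        (simp add: PP x y comm[OF x y])
  qed blast
  let ?e = "unit_vec k 0 :: complex vec"
  have e: "?e \<in> carrier_vec k" "?e \<noteq> 0\<^sub>v k" using R(1) by auto
  show ?thesis
  proof (rule that[of "P *\<^sub>v ?e"])
    have "P *\<^sub>v ?e = Q *\<^sub>v (R *\<^sub>v ?e)" unfolding P_def by (rule assoc_mult_mat_vec[OF Q(2) R(2) e(1)])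
    moreover have "R *\<^sub>v ?e \<in> carrier_vec j" using R(2) e(1) by auto
    ultimately show "P *\<^sub>v ?e \<in> W" using Q(4) by auto
    show "P *\<^sub>v ?e \<noteq> 0\<^sub>v d" using Pi P e by (auto simp: minj_def)
    fix x assume x: "x \<in> S"
    obtain b where b: "\<rho> x = b \<cdot>\<^sub>m 1\<^sub>m k" using scal[OF x] by blast
    have "\<sigma> x *\<^sub>v (P *\<^sub>v ?e) = \<sigma> x * P *\<^sub>v ?e" by (rule assoc_mult_mat_vec[OF c[OF x] P e(1), symmetric])
    also have "\<dots> = P * \<rho> x *\<^sub>v ?e" unfolding \<sigma>P[OF x] ..
    also have "P * \<rho> x = b \<cdot>\<^sub>m P" unfolding b using mult_smult_distrib[OF P, of "1\<^sub>m k" k b] P by simp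
    also have "(b \<cdot>\<^sub>m P) *\<^sub>v ?e = b \<cdot>\<^sub>v (P *\<^sub>v ?e)" by (rule eq_vecI) (use P e in \<open>auto simp: scalar_prod_def sum_distrib_left ac_simps\<close>)
    finally show "\<exists>c. \<sigma> x *\<^sub>v (P *\<^sub>v ?e) = c \<cdot>\<^sub>v (P *\<^sub>v ?e)" by blast
  qed
qed

section \<open>Traces and averages\<close>

definition mtr :: "complex mat \<Rightarrow> complex" where
  "mtr A = (\<Sum>i<dim_row A. A $$ (i,i))"

text \<open>Both dimensions are parameters because the matrix type contains all sizes, so that even
  an empty sum has a definite shape.\<close>

definition msum :: "nat \<Rightarrow> nat \<Rightarrow> ('i \<Rightarrow> complex mat) \<Rightarrow> 'i set \<Rightarrow> complex mat" where
  "msum n m F X = mat n m (\<lambda>(i,j). \<Sum>x\<in>X. F x $$ (i,j))"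

lemma msum_carrier [simp]: "msum n m F X \<in> carrier_mat n m"
  by (simp add: msum_def)

lemma msum_dim [simp]: "dim_row (msum n m F X) = n" "dim_col (msum n m F X) = m"
  by (simp_all add: msum_def)

lemma msum_cong: "(\<And>x. x \<in> X \<Longrightarrow> F x = G x) \<Longrightarrow> msum n m F X = msum n m G X"
  by (auto simp: msum_def intro!: eq_matI sum.cong)

lemma msum_reindex: "bij_betw h X Y \<Longrightarrow> msum n m F Y = msum n m (\<lambda>x. F (h x)) X"
  by (auto simp: msum_def sum.reindex_bij_betw[symmetric] intro!: eq_matI)

lemma index_mult_mat_sum:
  assumes "A \<in> carrier_mat n m" "B \<in> carrier_mat m l" "i < n" "j < l"
  shows "(A * B) $$ (i,j) = (\<Sum>k<m. A $$ (i,k) * B $$ (k,j))"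
  using assms by (auto simp: scalar_prod_def lessThan_atLeast0 intro!: sum.cong)

lemma mult_msum:
  assumes A: "A \<in> carrier_mat l n" and F: "\<And>x. x \<in> X \<Longrightarrow> F x \<in> carrier_mat n m"
  shows "A * msum n m F X = msum l m (\<lambda>x. A * F x) X"
proof (rule eq_matI)
  fix i j assume "i < dim_row (msum l m (\<lambda>x. A * F x) X)" "j < dim_col (msum l m (\<lambda>x. A * F x) X)"
  hence ij: "i < l" "j < m" by auto
  have "(A * msum n m F X) $$ (i,j) = (\<Sum>k<n. A $$ (i,k) * (\<Sum>x\<in>X. F x $$ (k,j)))"
    unfolding index_mult_mat_sum[OF A msum_carrier ij] using ij by (auto simp: msum_def)
  also have "\<dots> = (\<Sum>k<n. \<Sum>x\<in>X. A $$ (i,k) * F x $$ (k,j))" by (simp add: sum_distrib_left)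
  also have "\<dots> = (\<Sum>x\<in>X. \<Sum>k<n. A $$ (i,k) * F x $$ (k,j))" by (rule sum.swap)
  also have "\<dots> = (\<Sum>x\<in>X. (A * F x) $$ (i,j))"
    by (rule sum.cong[OF refl]) (use index_mult_mat_sum[OF A F ij] in simp)
  finally show "(A * msum n m F X) $$ (i,j) = msum l m (\<lambda>x. A * F x) X $$ (i,j)" using ij by (simp add: msum_def)
qed (use A in auto)

lemma msum_mult:
  assumes A: "A \<in> carrier_mat m l" and F: "\<And>x. x \<in> X \<Longrightarrow> F x \<in> carrier_mat n m"
  shows "msum n m F X * A = msum n l (\<lambda>x. F x * A) X"
proof (rule eq_matI)
  fix i j assume "i < dim_row (msum n l (\<lambda>x. F x * A) X)" "j < dim_col (msum n l (\<lambda>x. F x * A) X)"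
  hence ij: "i < n" "j < l" by auto
  have "(msum n m F X * A) $$ (i,j) = (\<Sum>k<m. (\<Sum>x\<in>X. F x $$ (i,k)) * A $$ (k,j))"
    unfolding index_mult_mat_sum[OF msum_carrier A ij] using ij by (auto simp: msum_def)
  also have "\<dots> = (\<Sum>k<m. \<Sum>x\<in>X. F x $$ (i,k) * A $$ (k,j))" by (simp add: sum_distrib_right)
  also have "\<dots> = (\<Sum>x\<in>X. \<Sum>k<m. F x $$ (i,k) * A $$ (k,j))" by (rule sum.swap)
  also have "\<dots> = (\<Sum>x\<in>X. (F x * A) $$ (i,j))"
    by (rule sum.cong[OF refl]) (use index_mult_mat_sum[OF F A ij] in simp)
  finally show "(msum n m F X * A) $$ (i,j) = msum n l (\<lambda>x. F x * A) X $$ (i,j)" using ij by (simp add: msum_def)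
qed (use A in auto)

lemma mtr_eq: "A \<in> carrier_mat n n \<Longrightarrow> mtr A = (\<Sum>i<n. A $$ (i,i))"
  by (auto simp: mtr_def)

lemma mtr_mult_commute:
  assumes A: "A \<in> carrier_mat n m" and B: "B \<in> carrier_mat m n"
  shows "mtr (A * B) = mtr (B * A)"
proof -
  have "mtr (A * B) = (\<Sum>i<n. \<Sum>k<m. A $$ (i,k) * B $$ (k,i))"
    unfolding mtr_def using A by (auto intro!: sum.cong simp: index_mult_mat_sum[OF A B] simp del: index_mult_mat(1))
  also have "\<dots> = (\<Sum>k<m. \<Sum>i<n. B $$ (k,i) * A $$ (i,k))"
    by (subst sum.swap) (simp add: mult.commute)
  also have "\<dots> = mtr (B * A)"
    unfolding mtr_def using B by (auto intro!: sum.cong simp: index_mult_mat_sum[OF B A] simp del: index_mult_mat(1))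
  finally show ?thesis .
qed

lemma mtr_smult: "A \<in> carrier_mat n n \<Longrightarrow> mtr (c \<cdot>\<^sub>m A) = c * mtr A"
  by (auto simp: mtr_def sum_distrib_left)

lemma mtr_one: "mtr (1\<^sub>m n) = of_nat n"
  by (simp add: mtr_def)

lemma mtr_msum: "(\<And>x. x \<in> X \<Longrightarrow> F x \<in> carrier_mat n n) \<Longrightarrow> mtr (msum n n F X) = (\<Sum>x\<in>X. mtr (F x))"
proof -
  assume a: "\<And>x. x \<in> X \<Longrightarrow> F x \<in> carrier_mat n n"
  have "mtr (msum n n F X) = (\<Sum>i<n. \<Sum>x\<in>X. F x $$ (i,i))" by (simp add: mtr_def msum_def)
  also have "\<dots> = (\<Sum>x\<in>X. \<Sum>i<n. F x $$ (i,i))" by (rule sum.swap)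
  also have "\<dots> = (\<Sum>x\<in>X. mtr (F x))" using a by (intro sum.cong) (auto simp: mtr_def)
  finally show ?thesis .
qed

lemma smult_smult_mat: "b \<cdot>\<^sub>m (c \<cdot>\<^sub>m A) = (b * c :: 'a :: semigroup_mult) \<cdot>\<^sub>m A"
  by (rule eq_matI) (auto simp: mult.assoc)

lemma one_smult_mat [simp]: "(1 :: 'a :: monoid_mult) \<cdot>\<^sub>m A = A"
  by (rule eq_matI) auto

section \<open>Character sums and averages over matrix units\<close>

definition munit :: "nat \<Rightarrow> nat \<Rightarrow> nat \<Rightarrow> nat \<Rightarrow> complex mat" where
  "munit n m i j = mat n m (\<lambda>(a,b). if a = i \<and> b = j then 1 else 0)"

lemma munit_carrier [simp]: "munit n m i j \<in> carrier_mat n m" by (simp add: munit_def)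

lemma mult_munit_mult:
  assumes A: "A \<in> carrier_mat l n" and B: "B \<in> carrier_mat m k" and ij: "i < n" "j < m" and ab: "a < l" "b < k"
  shows "(A * munit n m i j * B) $$ (a,b) = A $$ (a,i) * B $$ (j,b)"
proof -
  have 1: "(A * munit n m i j) $$ (a,c) = (if c = j then A $$ (a,i) else 0)" if c: "c < m" for c
  proof -
    have "(A * munit n m i j) $$ (a,c) = (\<Sum>k<n. A $$ (a,k) * munit n m i j $$ (k,c))"
      by (rule index_mult_mat_sum[OF A munit_carrier ab(1) c])
    also have "\<dots> = (\<Sum>k<n. if k = i then (if c = j then A $$ (a,i) else 0) else 0)"
      by (rule sum.cong) (use c in \<open>auto simp: munit_def\<close>)
    finally show ?thesis using ij by simp
  qed
  have "(A * munit n m i j * B) $$ (a,b) = (\<Sum>c<m. (A * munit n m i j) $$ (a,c) * B $$ (c,b))"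
    by (rule index_mult_mat_sum[OF _ B ab]) (use A in auto)
  also have "\<dots> = (\<Sum>c<m. if c = j then A $$ (a,i) * B $$ (j,b) else 0)"
    by (rule sum.cong) (auto simp: 1)
  finally show ?thesis using ij by simp
qed

lemma mtr_munit: "i < n \<Longrightarrow> j < n \<Longrightarrow> mtr (munit n n i j) = (if i = j then 1 else 0)"
  by (auto simp: mtr_def munit_def if_distrib cong: if_cong)

text \<open>With E_ij the matrix units, the (i, j) entry of F E_ij G is F_ii G_jj. A sum of products
  of traces is thus read off from averaged operators, which links characters to
  intertwiners.\<close>

lemma sum_mtr_mult:
  assumes F: "\<And>x. x \<in> X \<Longrightarrow> F x \<in> carrier_mat d1 d1" and G: "\<And>x. x \<in> X \<Longrightarrow> G x \<in> carrier_mat d2 d2"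
  shows "(\<Sum>x\<in>X. mtr (F x) * mtr (G x)) =
    (\<Sum>i<d1. \<Sum>j<d2. msum d1 d2 (\<lambda>x. F x * munit d1 d2 i j * G x) X $$ (i,j))"
proof -
  have "(\<Sum>x\<in>X. mtr (F x) * mtr (G x)) = (\<Sum>x\<in>X. \<Sum>i<d1. \<Sum>j<d2. F x $$ (i,i) * G x $$ (j,j))"
    by (rule sum.cong[OF refl]) (simp only: mtr_eq[OF F] mtr_eq[OF G] sum_product)
  also have "\<dots> = (\<Sum>i<d1. \<Sum>x\<in>X. \<Sum>j<d2. F x $$ (i,i) * G x $$ (j,j))" by (rule sum.swap)
  also have "\<dots> = (\<Sum>i<d1. \<Sum>j<d2. \<Sum>x\<in>X. F x $$ (i,i) * G x $$ (j,j))"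
    by (rule sum.cong[OF refl]) (rule sum.swap)
  also have "\<dots> = (\<Sum>i<d1. \<Sum>j<d2. msum d1 d2 (\<lambda>x. F x * munit d1 d2 i j * G x) X $$ (i,j))"
    by (intro sum.cong refl) (auto simp: msum_def mult_munit_mult[OF F G] intro!: sum.cong simp del: index_mult_mat(1))
  finally show ?thesis .
qed

text \<open>If every average vanished, those of the matrix units would, and with them the character
  sum by \<open>sum_mtr_mult\<close>. This is the source of all nonzero intertwiners below.\<close>

lemma nonzero_average:
  assumes F: "\<And>x. x \<in> X \<Longrightarrow> F x \<in> carrier_mat d1 d1" and G: "\<And>x. x \<in> X \<Longrightarrow> G x \<in> carrier_mat d2 d2"
    and nz: "(\<Sum>x\<in>X. mtr (F x) * mtr (G x)) \<noteq> 0"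
  obtains A where "A \<in> carrier_mat d1 d2" "msum d1 d2 (\<lambda>x. F x * A * G x) X \<noteq> 0\<^sub>m d1 d2"
proof (rule ccontr)
  assume "\<not> thesis"
  hence z: "\<And>A. A \<in> carrier_mat d1 d2 \<Longrightarrow> msum d1 d2 (\<lambda>x. F x * A * G x) X = 0\<^sub>m d1 d2" using that by auto
  have "(\<Sum>i<d1. \<Sum>j<d2. msum d1 d2 (\<lambda>x. F x * munit d1 d2 i j * G x) X $$ (i,j)) = 0"
    by (simp add: z)
  moreover have "(\<Sum>x\<in>X. mtr (F x) * mtr (G x)) =
      (\<Sum>i<d1. \<Sum>j<d2. msum d1 d2 (\<lambda>x. F x * munit d1 d2 i j * G x) X $$ (i,j))"
    by (rule sum_mtr_mult) (use F G in auto)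
  ultimately show False using nz by simp
qed

text \<open>Each averaged operator commutes with an irreducible family, so it is the scalar
  \<open>card X * mtr A / d\<close>, and only diagonal matrix units contribute. The inverses
  \<open>G x\<close> and the commutation \<open>comm\<close> are separate data, so that projective
  representations are covered.\<close>

lemma schur_orthogonality:
  assumes S: "irr d S \<sigma>"
    and F: "\<And>x. x \<in> X \<Longrightarrow> F x \<in> carrier_mat d d" and G: "\<And>x. x \<in> X \<Longrightarrow> G x \<in> carrier_mat d d"
    and GF: "\<And>x. x \<in> X \<Longrightarrow> G x * F x = 1\<^sub>m d"
    and comm: "\<And>A y. A \<in> carrier_mat d d \<Longrightarrow> y \<in> S \<Longrightarrow>
      \<sigma> y * msum d d (\<lambda>x. F x * A * G x) X = msum d d (\<lambda>x. F x * A * G x) X * \<sigma> y"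
  shows "(\<Sum>x\<in>X. mtr (F x) * mtr (G x)) = of_nat (card X)"
proof -
  have d: "0 < d" using S by (simp add: irr_def)
  have diag: "msum d d (\<lambda>x. F x * A * G x) X = (of_nat (card X) * mtr A / of_nat d) \<cdot>\<^sub>m 1\<^sub>m d"
    if A: "A \<in> carrier_mat d d" for A
  proof -
    obtain c where c: "msum d d (\<lambda>x. F x * A * G x) X = c \<cdot>\<^sub>m 1\<^sub>m d"
      by (rule schur_scalar[OF S _ comm[OF A]]) auto
    have "mtr (F x * A * G x) = mtr A" if x: "x \<in> X" for x
    proof -
      have "mtr (F x * A * G x) = mtr (F x * (A * G x))" using assoc_mult_mat[OF F[OF x] A G[OF x]] by simp
      also have "\<dots> = mtr (A * G x * F x)" by (rule mtr_mult_commute[of _ d d]) (use F[OF x] A G[OF x] in auto)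
      also have "A * G x * F x = A * (G x * F x)" by (rule assoc_mult_mat[OF A G[OF x] F[OF x]])
      finally show ?thesis using GF[OF x] A by simp
    qed
    hence "(\<Sum>x\<in>X. mtr (F x * A * G x)) = of_nat (card X) * mtr A" by simp
    moreover have "mtr (msum d d (\<lambda>x. F x * A * G x) X) = (\<Sum>x\<in>X. mtr (F x * A * G x))"
      by (rule mtr_msum) (use F G A in \<open>meson mult_carrier_mat\<close>)
    moreover have "mtr (c \<cdot>\<^sub>m 1\<^sub>m d) = c * of_nat d" using mtr_smult[of "1\<^sub>m d" d c] by (simp add: mtr_one)
    ultimately have "c * of_nat d = of_nat (card X) * mtr A" using c by simp
    hence "c = of_nat (card X) * mtr A / of_nat d" using d by (simp add: field_simps)
    thus ?thesis using c by simp
  qed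
  have "(\<Sum>i<d. \<Sum>j<d. msum d d (\<lambda>x. F x * munit d d i j * G x) X $$ (i,j)) =
      (\<Sum>i<d. \<Sum>j<d. if j = i then of_nat (card X) / of_nat d else 0)"
    by (intro sum.cong refl) (auto simp: diag mtr_munit)
  also have "\<dots> = of_nat (card X)" using d by simp
  finally have "of_nat (card X) = (\<Sum>i<d. \<Sum>j<d. msum d d (\<lambda>x. F x * munit d d i j * G x) X $$ (i,j))" by simp
  also have "(\<Sum>i<d. \<Sum>j<d. msum d d (\<lambda>x. F x * munit d d i j * G x) X $$ (i,j)) = (\<Sum>x\<in>X. mtr (F x) * mtr (G x))"
    by (rule sum_mtr_mult[symmetric]) (use F G in auto)
  finally show ?thesis by simp
qed

lemma upper_triangular_square_diag:
  assumes B: "B \<in> carrier_mat d d" and ut: "upper_triangular B" and i: "i < d"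
  shows "(B * B) $$ (i,i) = B $$ (i,i) * B $$ (i,i)"
proof -
  have "(B * B) $$ (i,i) = (\<Sum>k<d. B $$ (i,k) * B $$ (k,i))" by (rule index_mult_mat_sum[OF B B i i])
  also have "\<dots> = (\<Sum>k<d. if k = i then B $$ (i,i) * B $$ (i,i) else 0)"
  proof (rule sum.cong[OF refl])
    fix k assume k: "k \<in> {..<d}"
    consider "k = i" | "k < i" | "i < k" by linarith
    thus "B $$ (i,k) * B $$ (k,i) = (if k = i then B $$ (i,i) * B $$ (i,i) else 0)"
      by cases (use ut B i k in \<open>auto simp: upper_triangular_def\<close>)
  qed
  finally show ?thesis using i by simp
qed

text \<open>A non-zero scalar \<open>c\<close> has determinant \<open>c\<^sup>p\<close> on the \<open>+1\<close> eigenspace of \<open>J\<close> and \<open>c\<^sup>q\<close> on the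
  \<open>-1\<close> eigenspace, where \<open>p - q = tr J = 1\<close>. The quotient of the two determinants is
  therefore a character of the centralizer of \<open>J\<close> that restricts to the identity on scalars.\<close>

lemma involution_determinants:
  fixes J :: "complex mat"
  assumes J: "J \<in> carrier_mat d d" and JJ: "J * J = 1\<^sub>m d" and tr: "mtr J = 1" and c: "c \<noteq> 0"
  shows "det (((c + 1) / 2) \<cdot>\<^sub>m 1\<^sub>m d + ((c - 1) / 2) \<cdot>\<^sub>m J) =
      c * det (((c + 1) / 2) \<cdot>\<^sub>m 1\<^sub>m d + ((1 - c) / 2) \<cdot>\<^sub>m J)"
    and "det (((c + 1) / 2) \<cdot>\<^sub>m 1\<^sub>m d + ((1 - c) / 2) \<cdot>\<^sub>m J) \<noteq> 0"
proof -
  \<comment> \<open>A triangular form is enough: determinants of combinations of 1 and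
    \<open>J\<close> depend only on the diagonal entries of \<open>B\<close>, and these square to 1
    because \<open>B * B\<close> is the identity.\<close>
  obtain es where "char_poly J = (\<Prod> e \<leftarrow> es. [:- e, 1:])" using char_poly_factorized[OF J] by auto
  then obtain B where B: "B \<in> carrier_mat d d" "upper_triangular B" "similar_mat J B"
    using schur_decomposition_exists[OF J] by blast
  then obtain P Q where PQ: "P \<in> carrier_mat d d" "Q \<in> carrier_mat d d" "P * Q = 1\<^sub>m d" "Q * P = 1\<^sub>m d" "J = P * B * Q"
    using J unfolding similar_mat_def similar_mat_wit_def Let_def by auto
  have tr_conj: "mtr (P * X * Q) = mtr X" if "X \<in> carrier_mat d d" for X
  proof -
    have "mtr (P * X * Q) = mtr (Q * (P * X))" by (rule mtr_mult_commute[of _ d d]) (use PQ that in auto)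
    also have "Q * (P * X) = X" using assoc_mult_mat[of Q d d P d X d] PQ that by simp
    finally show ?thesis .
  qed
  have detc: "det (P * X * Q) = det X" if X: "X \<in> carrier_mat d d" for X
  proof -
    have "det (P * X * Q) = det P * det X * det Q" using PQ X by (simp add: det_mult[of _ d])
    moreover have "det P * det Q = 1" using det_mult[OF PQ(1,2)] PQ(3) by simp
    ultimately show ?thesis by (simp add: ac_simps)
  qed
  have aff: "a \<cdot>\<^sub>m 1\<^sub>m d + b \<cdot>\<^sub>m J = P * (a \<cdot>\<^sub>m 1\<^sub>m d + b \<cdot>\<^sub>m B) * Q" for a b
  proof -
    have "P * (a \<cdot>\<^sub>m 1\<^sub>m d + b \<cdot>\<^sub>m B) * Q = (a \<cdot>\<^sub>m P + b \<cdot>\<^sub>m (P * B)) * Q"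
      using PQ(1) B(1) mult_add_distrib_mat[of P d d "a \<cdot>\<^sub>m 1\<^sub>m d" d "b \<cdot>\<^sub>m B"] mult_smult_distrib[of P d d "1\<^sub>m d" d a] mult_smult_distrib[of P d d B d b] by simp
    also have "\<dots> = a \<cdot>\<^sub>m (P * Q) + b \<cdot>\<^sub>m (P * B * Q)"
      using PQ(1,2) B(1) by (simp add: add_mult_distrib_mat[of _ d d _ Q d] mult_smult_assoc_mat[of _ d d Q d])
    finally show ?thesis using PQ(3,5) by simp
  qed
  have BB: "B * B = 1\<^sub>m d"
  proof -
    have QJP: "B = Q * J * P"
    proof -
      have "Q * J * P = Q * (P * B * Q) * P" using PQ by simp
      also have "\<dots> = (Q * P) * B * (Q * P)" using PQ(1,2) B(1) by (simp add: assoc_mult_mat[of _ d d _ d _ d])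
      finally show ?thesis using PQ B by simp
    qed
    have "B * B = (Q * J * P) * (Q * J * P)" using QJP by simp
    also have "\<dots> = Q * J * (P * Q) * (J * P)" using PQ(1,2) J by (simp add: assoc_mult_mat[of _ d d _ d _ d])
    also have "\<dots> = Q * (J * J) * P" using PQ(1,2,3) J by (simp add: assoc_mult_mat[of _ d d _ d _ d])
    also have "\<dots> = 1\<^sub>m d" using PQ(1,2,4) JJ by simp
    finally show ?thesis .
  qed
  have sq: "B $$ (i,i) = 1 \<or> B $$ (i,i) = -1" if i: "i < d" for i
  proof -
    have "B $$ (i,i) * B $$ (i,i) = 1" using upper_triangular_square_diag[OF B(1,2) i] BB i by simp
    thus ?thesis by (metis power2_eq_1_iff power2_eq_square)
  qed
  have detf: "det (a \<cdot>\<^sub>m 1\<^sub>m d + b \<cdot>\<^sub>m J) = (\<Prod>i<d. a + b * B $$ (i,i))" for a b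
  proof -
    have M: "a \<cdot>\<^sub>m 1\<^sub>m d + b \<cdot>\<^sub>m B \<in> carrier_mat d d" using B by simp
    have "upper_triangular (a \<cdot>\<^sub>m 1\<^sub>m d + b \<cdot>\<^sub>m B)"
      using B(1,2) by (auto simp: upper_triangular_def)
    hence "det (a \<cdot>\<^sub>m 1\<^sub>m d + b \<cdot>\<^sub>m B) = prod_list (diag_mat (a \<cdot>\<^sub>m 1\<^sub>m d + b \<cdot>\<^sub>m B))"
      by (rule det_upper_triangular[OF _ M])
    also have "\<dots> = (\<Prod>i<d. (a \<cdot>\<^sub>m 1\<^sub>m d + b \<cdot>\<^sub>m B) $$ (i,i))"
      using M by (simp add: diag_mat_def prod.list_conv_set_nth lessThan_atLeast0 carrier_matD[OF M] del: index_add_mat index_smult_mat)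
    also have "\<dots> = (\<Prod>i<d. a + b * B $$ (i,i))" using B(1) by (intro prod.cong) auto
    finally show ?thesis unfolding aff detc[OF M] .
  qed
  let ?p = "{i\<in>{..<d}. B $$ (i,i) = 1}" and ?q = "{i\<in>{..<d}. \<not> B $$ (i,i) = 1}"
  have "mtr B = 1" using tr tr_conj[OF B(1)] PQ(5) by simp
  also have "mtr B = (\<Sum>i<d. if B $$ (i,i) = 1 then 1 else - 1)" unfolding mtr_def using B(1) sq by (intro sum.cong) auto
  also have "\<dots> = of_nat (card ?p) - of_nat (card ?q)"
    by (subst sum.If_cases) (simp_all add: Int_def Collect_conj_eq[symmetric] Compl_eq)
  finally have "(of_nat (card ?p) :: complex) = of_nat (card ?q + 1)" by (simp add: algebra_simps)
  hence pq: "card ?p = card ?q + 1" by (simp only: of_nat_eq_iff)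
  have "det (((c + 1) / 2) \<cdot>\<^sub>m 1\<^sub>m d + ((c - 1) / 2) \<cdot>\<^sub>m J) = (\<Prod>i<d. if B $$ (i,i) = 1 then c else 1)"
    unfolding detf by (intro prod.cong refl) (use sq in \<open>auto simp: field_simps dest!: sq\<close>)
  also have "\<dots> = c ^ card ?p" by (subst prod.If_cases) (simp_all add: Int_def)
  finally have 1: "det (((c + 1) / 2) \<cdot>\<^sub>m 1\<^sub>m d + ((c - 1) / 2) \<cdot>\<^sub>m J) = c ^ card ?p" .
  have "det (((c + 1) / 2) \<cdot>\<^sub>m 1\<^sub>m d + ((1 - c) / 2) \<cdot>\<^sub>m J) = (\<Prod>i<d. if B $$ (i,i) = 1 then 1 else c)"
    unfolding detf by (intro prod.cong refl) (use sq in \<open>auto simp: field_simps dest!: sq\<close>)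
  also have "\<dots> = c ^ card ?q" by (subst prod.If_cases) (simp_all add: Int_def Compl_eq)
  finally have 2: "det (((c + 1) / 2) \<cdot>\<^sub>m 1\<^sub>m d + ((1 - c) / 2) \<cdot>\<^sub>m J) = c ^ card ?q" .
  show "det (((c + 1) / 2) \<cdot>\<^sub>m 1\<^sub>m d + ((c - 1) / 2) \<cdot>\<^sub>m J) =
      c * det (((c + 1) / 2) \<cdot>\<^sub>m 1\<^sub>m d + ((1 - c) / 2) \<cdot>\<^sub>m J)"
    unfolding 1 2 pq by simp
  show "det (((c + 1) / 2) \<cdot>\<^sub>m 1\<^sub>m d + ((1 - c) / 2) \<cdot>\<^sub>m J) \<noteq> 0" unfolding 2 using c by simp
qed

text \<open>With \<open>p\<close> and \<open>q\<close> the projections onto the eigenspaces of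
  \<open>J\<close>, the operator \<open>T * p + q\<close> is \<open>T\<close> on the one eigenspace
  and the identity on the other, so \<open>D1\<close> and \<open>D2\<close> are the two restricted
  determinants. The relations between \<open>p\<close> and \<open>q\<close> make both multiplicative
  on the centralizer.\<close>

lemma involution_character:
  fixes J :: "complex mat"
  assumes J: "J \<in> carrier_mat d d" and JJ: "J * J = 1\<^sub>m d" and tr: "mtr J = 1"
  obtains \<chi> :: "complex mat \<Rightarrow> complex"
  where "\<And>S T. S \<in> carrier_mat d d \<Longrightarrow> T \<in> carrier_mat d d \<Longrightarrow> S * J = J * S \<Longrightarrow> T * J = J * T \<Longrightarrow> \<chi> (S * T) = \<chi> S * \<chi> T"
    and "\<And>c. c \<noteq> 0 \<Longrightarrow> \<chi> (c \<cdot>\<^sub>m 1\<^sub>m d) = c"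
proof -
  define p where "p = (1/2) \<cdot>\<^sub>m (1\<^sub>m d + J)"
  define q where "q = (1/2) \<cdot>\<^sub>m (1\<^sub>m d - J)"
  have pc: "p \<in> carrier_mat d d" and qc: "q \<in> carrier_mat d d" using J by (auto simp: p_def q_def intro!: minus_carrier_mat)
  note ac = assoc_mult_mat[of _ d d _ d _ d]
  have JJx: "(J * J) $$ (i,j) = (1\<^sub>m d :: complex mat) $$ (i,j)" for i j using JJ by simp
  note ds = mult_add_distrib_mat[of _ d d _ d] add_mult_distrib_mat[of _ d d _ _ d]
    mult_minus_distrib_mat[of _ d d _ d] minus_mult_distrib_mat[of _ d d _ _ d]
    mult_smult_distrib[of _ d d _ d] mult_smult_assoc_mat[of _ d d _ d]
  have mm: "1\<^sub>m d - J \<in> carrier_mat d d" using J by (intro minus_carrier_mat) auto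
  have pp: "p * p = p" and qq: "q * q = q" and pq: "p * q = 0\<^sub>m d d" and qp: "q * p = 0\<^sub>m d d"
  proof -
    have 1: "(1\<^sub>m d + J) * (1\<^sub>m d + J) = 2 \<cdot>\<^sub>m (1\<^sub>m d + J)" "(1\<^sub>m d + J) * (1\<^sub>m d - J) = 0\<^sub>m d d"
      "(1\<^sub>m d - J) * (1\<^sub>m d + J) = 0\<^sub>m d d" "(1\<^sub>m d - J) * (1\<^sub>m d - J) = 2 \<cdot>\<^sub>m (1\<^sub>m d - J)"
      using J mm by (auto simp: ds JJ simp del: index_mult_mat(1) intro!: eq_matI)
    show "p * p = p" "q * q = q" "p * q = 0\<^sub>m d d" "q * p = 0\<^sub>m d d"
      unfolding p_def q_def using J mm by (simp_all add: ds(5,6) 1 smult_smult_mat)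
  qed
  have comm: "S * p = p * S" "S * q = q * S" if "S \<in> carrier_mat d d" "S * J = J * S" for S
    unfolding p_def q_def using J mm that by (simp_all add: ds)
  have mult: "(S * a + b) * (T * a + b) = S * T * a + b"
    if ST: "S \<in> carrier_mat d d" "T \<in> carrier_mat d d" and a: "a \<in> carrier_mat d d" "b \<in> carrier_mat d d"
      and ab: "a * a = a" "b * b = b" "a * b = 0\<^sub>m d d" "b * a = 0\<^sub>m d d" and Ta: "T * a = a * T" "T * b = b * T" for S T a b
  proof -
    have "(S * a + b) * (T * a + b) = S * a * (T * a) + b * (T * a) + (S * a * b + b * b)"
      using ST a by (simp add: ds)
    also have "S * a * (T * a) = S * (a * T) * a" using ST a by (simp add: ac)
    also have "S * (a * T) * a = S * (T * a) * a" using Ta(1) by simp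
    also have "S * (T * a) * a = S * T * (a * a)" using ST a by (simp add: ac)
    also have "b * (T * a) = b * T * a" using ST a by (simp add: ac)
    also have "b * T * a = T * b * a" using Ta(2) by simp
    also have "T * b * a = T * (b * a)" using ST a by (simp add: ac)
    also have "S * a * b = S * (a * b)" using ST a by (simp add: ac)
    finally show ?thesis using ST a ab by simp
  qed
  define D1 where "D1 T = det (T * p + q)" for T
  define D2 where "D2 T = det (T * q + p)" for T
  have D1m: "D1 (S * T) = D1 S * D1 T" and D2m: "D2 (S * T) = D2 S * D2 T"
    if "S \<in> carrier_mat d d" "T \<in> carrier_mat d d" "T * J = J * T" for S T
  proof -
    have "det ((S * p + q) * (T * p + q)) = det (S * p + q) * det (T * p + q)"
      by (rule det_mult) (use that pc qc in auto)
    thus "D1 (S * T) = D1 S * D1 T" unfolding D1_def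
      using mult[OF that(1,2) pc qc pp qq pq qp] comm[OF that(2,3)] by simp
    have "det ((S * q + p) * (T * q + p)) = det (S * q + p) * det (T * q + p)"
      by (rule det_mult) (use that pc qc in auto)
    thus "D2 (S * T) = D2 S * D2 T" unfolding D2_def
      using mult[OF that(1,2) qc pc qq pp qp pq] comm[OF that(2,3)] by simp
  qed
  have s1: "(c \<cdot>\<^sub>m 1\<^sub>m d) * p + q = ((c + 1) / 2) \<cdot>\<^sub>m 1\<^sub>m d + ((c - 1) / 2) \<cdot>\<^sub>m J"
    and s2: "(c \<cdot>\<^sub>m 1\<^sub>m d) * q + p = ((c + 1) / 2) \<cdot>\<^sub>m 1\<^sub>m d + ((1 - c) / 2) \<cdot>\<^sub>m J" for c
  proof -
    have "(c \<cdot>\<^sub>m 1\<^sub>m d) * p = c \<cdot>\<^sub>m p" "(c \<cdot>\<^sub>m 1\<^sub>m d) * q = c \<cdot>\<^sub>m q" using pc qc by (simp_all add: ds)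
    thus "(c \<cdot>\<^sub>m 1\<^sub>m d) * p + q = ((c + 1) / 2) \<cdot>\<^sub>m 1\<^sub>m d + ((c - 1) / 2) \<cdot>\<^sub>m J"
      "(c \<cdot>\<^sub>m 1\<^sub>m d) * q + p = ((c + 1) / 2) \<cdot>\<^sub>m 1\<^sub>m d + ((1 - c) / 2) \<cdot>\<^sub>m J"
      using J by (auto simp: p_def q_def field_simps intro!: eq_matI)
  qed
  show ?thesis
  \<comment> \<open>On singular operators \<open>D2\<close> can vanish; division by zero then gives
    0, and the quotient is still multiplicative.\<close>
  proof (rule that[of "\<lambda>T. D1 T / D2 T"])
    show "D1 (S * T) / D2 (S * T) = D1 S / D2 S * (D1 T / D2 T)"
      if "S \<in> carrier_mat d d" "T \<in> carrier_mat d d" "S * J = J * S" "T * J = J * T" for S T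
      using D1m[OF that(1,2,4)] D2m[OF that(1,2,4)] by simp
    show "D1 (c \<cdot>\<^sub>m 1\<^sub>m d) / D2 (c \<cdot>\<^sub>m 1\<^sub>m d) = c" if c: "c \<noteq> 0" for c
      unfolding D1_def D2_def s1 s2 using involution_determinants[OF J JJ tr c] by simp
  qed
qed

section \<open>The Heisenberg representation and the Weil representation\<close>

text \<open>The multiplier \<open>a\<close> is half of the symplectic pairing: operators commute up
  to the square of \<open>a\<close> (see \<open>W_conj\<close>), so nondegeneracy is asked of that
  square. Fixing an alternating multiplier, and not just some cocycle in its class, lets
  automorphisms act without a correcting factor: precomposition with one that preserves
  \<open>a\<close> keeps the multiplier.\<close>

locale heisenberg = comm_group V for V :: "('v, 'm) monoid_scheme" (structure) +
  fixes a :: "'v \<Rightarrow> 'v \<Rightarrow> complex"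
  assumes fin: "finite (carrier V)"
    and a_mult_left: "\<And>x y z. x \<in> carrier V \<Longrightarrow> y \<in> carrier V \<Longrightarrow> z \<in> carrier V \<Longrightarrow> a (x \<otimes> y) z = a x z * a y z"
    and a_mult_right: "\<And>x y z. x \<in> carrier V \<Longrightarrow> y \<in> carrier V \<Longrightarrow> z \<in> carrier V \<Longrightarrow> a x (y \<otimes> z) = a x y * a x z"
    and a_alt: "\<And>x. x \<in> carrier V \<Longrightarrow> a x x = 1"
    and a_nondeg: "\<And>x. x \<in> carrier V \<Longrightarrow> (\<And>y. y \<in> carrier V \<Longrightarrow> a x y ^ 2 = 1) \<Longrightarrow> x = \<one>"
begin

lemma a_skew: "x \<in> carrier V \<Longrightarrow> y \<in> carrier V \<Longrightarrow> a x y * a y x = 1"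
proof -
  assume x: "x \<in> carrier V" and y: "y \<in> carrier V"
  have "1 = a (x \<otimes> y) (x \<otimes> y)" using a_alt[of "x \<otimes> y"] x y by simp
  also have "\<dots> = a x x * a x y * (a y x * a y y)" using x y by (simp only: a_mult_left a_mult_right m_closed) (simp add: ac_simps)
  finally show "a x y * a y x = 1" using x y by (simp add: a_alt)
qed

lemma a_nz: "x \<in> carrier V \<Longrightarrow> y \<in> carrier V \<Longrightarrow> a x y \<noteq> 0"
  using a_skew by fastforce

lemma a_one_left [simp]: "y \<in> carrier V \<Longrightarrow> a \<one> y = 1"
  using a_mult_left[of \<one> \<one> y] a_nz[of \<one> y] by simp

lemma a_one_right [simp]: "y \<in> carrier V \<Longrightarrow> a y \<one> = 1"
  using a_mult_right[of y \<one> \<one>] a_nz[of y \<one>] by simp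

lemma a_inv_left: "x \<in> carrier V \<Longrightarrow> y \<in> carrier V \<Longrightarrow> a (inv x) y = a y x"
proof -
  assume x: "x \<in> carrier V" and y: "y \<in> carrier V"
  have "a (inv x) y * a x y = 1" using a_mult_left[of "inv x" x y] x y by simp
  thus ?thesis using a_skew[OF x y] a_nz[OF x y] by (metis mult.commute mult_cancel_right)
qed

lemma a_inv_right: "x \<in> carrier V \<Longrightarrow> y \<in> carrier V \<Longrightarrow> a x (inv y) = a y x"
proof -
  assume x: "x \<in> carrier V" and y: "y \<in> carrier V"
  have "a x (inv y) * a x y = 1" using a_mult_right[of x "inv y" y] x y by simp
  thus ?thesis using a_skew[OF x y] a_nz[OF x y] by (metis mult.commute mult_cancel_right)
qed

lemma sum_a: "w \<in> carrier V \<Longrightarrow> (\<Sum>u\<in>carrier V. a u w) = (if w = \<one> then of_nat (card (carrier V)) else 0)"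
proof (cases "w = \<one>")
  assume w: "w \<in> carrier V" and nw: "w \<noteq> \<one>"
  obtain y where y: "y \<in> carrier V" "a w y ^ 2 \<noteq> 1" using a_nondeg[OF w] nw by blast
  have ne: "a y w \<noteq> 1" using y a_skew[OF w y(1)] by auto
  have "(\<Sum>u\<in>carrier V. a u w) = (\<Sum>u\<in>carrier V. a (y \<otimes> u) w)"
    by (rule sum.reindex_bij_witness[of _ "\<lambda>u. y \<otimes> u" "\<lambda>u. inv y \<otimes> u"]) (use y in \<open>auto simp: m_assoc[symmetric]\<close>)
  also have "\<dots> = a y w * (\<Sum>u\<in>carrier V. a u w)" using y w by (simp add: a_mult_left sum_distrib_left)
  finally have "(\<Sum>u\<in>carrier V. a u w) = 0" using ne by (metis mult_cancel_right1)
  thus ?thesis using nw by simp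
qed simp

text \<open>Every character of a finite abelian group with a perfect pairing comes from the pairing:
  otherwise it would be orthogonal to all the characters \<open>u \<mapsto> a u w\<close>, whose sum is
  supported at the identity.\<close>

lemma character_from_pairing:
  assumes \<chi>: "\<And>x y. x \<in> carrier V \<Longrightarrow> y \<in> carrier V \<Longrightarrow> \<chi> (x \<otimes> y) = \<chi> x * \<chi> y" and nz: "\<chi> \<one> \<noteq> (0 :: complex)"
  obtains w where "w \<in> carrier V" "\<And>u. u \<in> carrier V \<Longrightarrow> \<chi> u = a u w"
proof (rule ccontr)
  assume "\<not> thesis"
  hence no: "\<exists>u\<in>carrier V. \<chi> u \<noteq> a u w" if "w \<in> carrier V" for w using that \<open>\<And>w. \<lbrakk>w \<in> carrier V; \<And>u. u \<in> carrier V \<Longrightarrow> \<chi> u = a u w\<rbrakk> \<Longrightarrow> thesis\<close> by blast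
  have \<chi>1: "\<chi> \<one> = 1" using \<chi>[of \<one> \<one>] nz by simp
  have z: "(\<Sum>v\<in>carrier V. \<chi> v * a w v) = 0" if w: "w \<in> carrier V" for w
  proof -
    obtain u where u: "u \<in> carrier V" "\<chi> u \<noteq> a u w" using no[OF w] by blast
    have ne: "\<chi> u * a w u \<noteq> 1"
    proof
      assume "\<chi> u * a w u = 1"
      hence "\<chi> u * (a w u * a u w) = a u w" by (simp add: mult.assoc[symmetric])
      thus False using u a_skew[OF w u(1)] by simp
    qed
    have "(\<Sum>v\<in>carrier V. \<chi> v * a w v) = (\<Sum>v\<in>carrier V. \<chi> (u \<otimes> v) * a w (u \<otimes> v))"
      by (rule sum.reindex_bij_witness[of _ "\<lambda>v. u \<otimes> v" "\<lambda>v. inv u \<otimes> v"]) (use u in \<open>auto simp: m_assoc[symmetric]\<close>)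
    also have "\<dots> = \<chi> u * a w u * (\<Sum>v\<in>carrier V. \<chi> v * a w v)"
      using u w by (simp add: \<chi> a_mult_right sum_distrib_left ac_simps)
    finally show ?thesis using ne by (metis mult_cancel_right1)
  qed
  have "0 = (\<Sum>w\<in>carrier V. \<Sum>v\<in>carrier V. \<chi> v * a w v)" using z by simp
  also have "\<dots> = (\<Sum>v\<in>carrier V. \<chi> v * (\<Sum>w\<in>carrier V. a w v))"
    by (subst sum.swap) (simp add: sum_distrib_left)
  also have "\<dots> = (\<Sum>v\<in>carrier V. if v = \<one> then \<chi> v * of_nat (card (carrier V)) else 0)"
    by (rule sum.cong[OF refl]) (simp add: sum_a)
  also have "\<dots> = of_nat (card (carrier V))" using fin \<chi>1 by simp
  finally show False using fin by (metis card_gt_0_iff empty_iff less_numeral_extra(3) of_nat_eq_0_iff one_closed)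
qed

definition proj :: "nat \<Rightarrow> ('v \<Rightarrow> complex mat) \<Rightarrow> bool" where
  "proj d W \<longleftrightarrow> (\<forall>x\<in>carrier V. W x \<in> carrier_mat d d) \<and> W \<one> = 1\<^sub>m d \<and>
    (\<forall>x\<in>carrier V. \<forall>y\<in>carrier V. W x * W y = a x y \<cdot>\<^sub>m W (x \<otimes> y))"

text \<open>The regular representation twisted by the multiplier: \<open>L v\<close> sends the basis
  vector of x to \<open>a v x\<close> times that of \<open>v \<otimes> x\<close>. The bijection
  \<open>e\<close> numbers the group so that this becomes a matrix.\<close>

lemma twisted_regular:
  obtains N L where "0 < N" "proj N L"
proof -
  obtain e n where e: "bij_betw e {..<n::nat} (carrier V)"
    using fin by (metis finite_imp_nat_seg_image_inj_on bij_betw_def lessThan_def)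
  have ec: "e i \<in> carrier V" if "i < n" for i using e that by (auto simp: bij_betw_def)
  have einj: "e i = e j \<longleftrightarrow> i = j" if "i < n" "j < n" for i j using e that by (auto simp: bij_betw_def inj_on_def)
  have n: "0 < n" using e one_closed by (cases n) (auto simp: bij_betw_def)
  define L where "L v = mat n n (\<lambda>(i,j). if e i = v \<otimes> e j then a v (e j) else 0)" for v
  have "proj n L"
    unfolding proj_def
  proof (intro conjI ballI)
    show "L \<one> = 1\<^sub>m n" by (rule eq_matI) (auto simp: L_def ec einj)
    fix x y assume x: "x \<in> carrier V" and y: "y \<in> carrier V"
    show "L x \<in> carrier_mat n n" by (simp add: L_def)
    show "L x * L y = a x y \<cdot>\<^sub>m L (x \<otimes> y)"
    proof (rule eq_matI)
      fix i j assume "i < dim_row (a x y \<cdot>\<^sub>m L (x \<otimes> y))" "j < dim_col (a x y \<cdot>\<^sub>m L (x \<otimes> y))"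
      hence ij: "i < n" "j < n" by (auto simp: L_def)
      obtain k where k: "k < n" "e k = y \<otimes> e j" using e y ec[OF ij(2)] by (metis (no_types, lifting) bij_betw_def image_iff lessThan_iff m_closed)
      have "(L x * L y) $$ (i,j) = (\<Sum>c<n. L x $$ (i,c) * L y $$ (c,j))"
        by (rule index_mult_mat_sum[of _ n n]) (use ij in \<open>auto simp: L_def\<close>)
      also have "\<dots> = (\<Sum>c<n. if c = k then L x $$ (i,k) * a y (e j) else 0)"
      proof (rule sum.cong[OF refl])
        fix c assume c: "c \<in> {..<n}"
        have "e c = y \<otimes> e j \<longleftrightarrow> c = k" using einj[of c k] k c by auto
        thus "L x $$ (i,c) * L y $$ (c,j) = (if c = k then L x $$ (i,k) * a y (e j) else 0)"
          using ij k c by (auto simp: L_def)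
      qed
      also have "\<dots> = L x $$ (i,k) * a y (e j)" using k by simp
      also have "\<dots> = (a x y \<cdot>\<^sub>m L (x \<otimes> y)) $$ (i,j)"
        using ij k x y ec[OF ij(2)] by (auto simp: L_def a_mult_left a_mult_right m_assoc)
      finally show "(L x * L y) $$ (i,j) = (a x y \<cdot>\<^sub>m L (x \<otimes> y)) $$ (i,j)" .
    qed (auto simp: L_def)
  qed
  with n that show ?thesis by blast
qed

text \<open>An irreducible piece of the twisted regular representation serves; its multiplication
  rule is obtained by cancelling the injective embedding \<open>Q\<close>.\<close>

lemma heisenberg_rep_exists:
  obtains d W where "proj d W" "irr d (carrier V) W"
proof -
  obtain N L where N: "0 < N" and L: "proj N L" by (rule twisted_regular)
  have Lc: "\<And>x. x \<in> carrier V \<Longrightarrow> L x \<in> carrier_mat N N" using L by (simp add: proj_def)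
  obtain k Q W where k: "0 < k" and Q: "Q \<in> carrier_mat N k" "minj Q" and LQ: "\<And>x. x \<in> carrier V \<Longrightarrow> L x * Q = Q * W x"
    and W: "irr k (carrier V) W" by (rule irreducible_subfamily[OF N Lc]) blast+
  note Wc = irr_carrier[OF W]
  have "proj k W"
    unfolding proj_def
  proof (intro conjI ballI)
    show "W \<one> = 1\<^sub>m k"
      by (rule minj_cancel[OF Q, of _ k]) (use Wc[of \<one>] LQ[of \<one>] L Q in \<open>auto simp: proj_def\<close>)
    fix x y assume x: "x \<in> carrier V" and y: "y \<in> carrier V"
    show "W x \<in> carrier_mat k k" by (rule Wc[OF x])
    have "Q * (W x * W y) = Q * W x * W y" using Q(1) Wc[OF x] Wc[OF y] by simp
    also have "\<dots> = L x * Q * W y" using LQ[OF x] by simp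
    also have "\<dots> = L x * (Q * W y)" by (rule assoc_mult_mat[OF Lc[OF x] Q(1) Wc[OF y]])
    also have "\<dots> = L x * (L y * Q)" using LQ[OF y] by simp
    also have "\<dots> = L x * L y * Q" by (rule assoc_mult_mat[OF Lc[OF x] Lc[OF y] Q(1), symmetric])
    also have "L x * L y = a x y \<cdot>\<^sub>m L (x \<otimes> y)" using L x y by (simp add: proj_def)
    also have "a x y \<cdot>\<^sub>m L (x \<otimes> y) * Q = a x y \<cdot>\<^sub>m (Q * W (x \<otimes> y))"
      using mult_smult_assoc_mat[OF Lc Q(1), of "x \<otimes> y" "a x y"] LQ[of "x \<otimes> y"] x y by simp
    also have "\<dots> = Q * (a x y \<cdot>\<^sub>m W (x \<otimes> y))" using mult_smult_distrib[OF Q(1) Wc, of "x \<otimes> y"] x y by simp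
    finally show "W x * W y = a x y \<cdot>\<^sub>m W (x \<otimes> y)"
      by (rule minj_cancel[OF Q, of _ k, rotated 2]) (use mult_carrier_mat[OF Wc[OF x] Wc[OF y]] Wc x y in auto)
  qed
  with W that show ?thesis by blast
qed

end

section \<open>Traces, the dimension and the parity operator of an irreducible Heisenberg
  representation\<close>

locale heisenberg_rep = heisenberg +
  fixes d :: nat and W :: "'a \<Rightarrow> complex mat"
  assumes W_proj: "proj d W" and W_irr: "irr d (carrier V) W"
begin

lemma W_carrier [simp]: "x \<in> carrier V \<Longrightarrow> W x \<in> carrier_mat d d" using W_proj by (simp add: proj_def)
lemma W_one [simp]: "W \<one> = 1\<^sub>m d" using W_proj by (simp add: proj_def)
lemma W_mult: "x \<in> carrier V \<Longrightarrow> y \<in> carrier V \<Longrightarrow> W x * W y = a x y \<cdot>\<^sub>m W (x \<otimes> y)" using W_proj by (simp add: proj_def)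
lemma d_pos: "0 < d" using W_irr by (simp add: irr_def)

lemma W_inv: "x \<in> carrier V \<Longrightarrow> W (inv x) * W x = 1\<^sub>m d" "x \<in> carrier V \<Longrightarrow> W x * W (inv x) = 1\<^sub>m d"
  by (simp_all add: W_mult a_inv_left a_inv_right a_alt)

lemma W_conj: "x \<in> carrier V \<Longrightarrow> y \<in> carrier V \<Longrightarrow> W x * W y * W (inv x) = (a x y)^2 \<cdot>\<^sub>m W y"
proof -
  assume x: "x \<in> carrier V" and y: "y \<in> carrier V"
  have e: "x \<otimes> y \<otimes> inv x = y" using x y by (metis inv_closed m_assoc m_comm r_inv r_one)
  have "W x * W y * W (inv x) = a x y \<cdot>\<^sub>m (W (x \<otimes> y) * W (inv x))"
    using x y by (simp add: W_mult[OF x y] mult_smult_assoc_mat[of _ d d _ d])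
  also have "\<dots> = (a x y * a (x \<otimes> y) (inv x)) \<cdot>\<^sub>m W y" using x y e by (simp add: W_mult smult_smult_mat)
  also have "a (x \<otimes> y) (inv x) = a x y" using x y by (simp add: a_inv_right a_mult_right a_alt)
  finally show ?thesis by (simp add: power2_eq_square)
qed

text \<open>Conjugation by \<open>W y\<close> preserves the trace of \<open>W x\<close> but
  multiplies the operator by the square of \<open>a y x\<close>; nondegeneracy provides a
  \<open>y\<close> for which this factor is not 1.\<close>

lemma W_trace: "x \<in> carrier V \<Longrightarrow> mtr (W x) = (if x = \<one> then of_nat d else 0)"
proof (cases "x = \<one>")
  assume x: "x \<in> carrier V" and nx: "x \<noteq> \<one>"
  obtain y where y: "y \<in> carrier V" "a x y ^ 2 \<noteq> 1" using a_nondeg[OF x] nx by blast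
  have ne: "a y x ^ 2 \<noteq> 1"
  proof
    assume 1: "a y x ^ 2 = 1"
    have "a x y ^ 2 * a y x ^ 2 = 1" using a_skew[OF x y(1)] by (simp add: power_mult_distrib[symmetric])
    thus False using 1 y(2) by simp
  qed
  have "mtr (W y * W x * W (inv y)) = mtr (W (inv y) * (W y * W x))"
    by (rule mtr_mult_commute[of _ d d]) (use mult_carrier_mat[OF W_carrier[OF y(1)] W_carrier[OF x]] y in auto)
  also have "W (inv y) * (W y * W x) = W (inv y) * W y * W x"
    by (rule assoc_mult_mat[symmetric, of _ d d _ d _ d]) (use x y in auto)
  also have "\<dots> = W x" using x W_inv(1)[OF y(1)] left_mult_one_mat[OF W_carrier[OF x]] by simp
  finally have "(a y x)^2 * mtr (W x) = mtr (W x)"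
    unfolding W_conj[OF y(1) x] using mtr_smult[of "W x" d] x by simp
  thus ?thesis using ne nx by auto
qed (simp add: mtr_one)

text \<open>The parity operator, which satisfies \<open>J * W u = W (inv u) * J\<close>. Written as
  a sum over the whole group, it commutes with every operator that permutes the \<open>W v\<close>
  by conjugation, and only the summand at the identity has nonzero trace. The factor 1/d makes its
  square 1, since d^2 is the order of the group.\<close>

definition J :: "complex mat" where
  "J = msum d d (\<lambda>v. (1 / of_nat d) \<cdot>\<^sub>m W v) (carrier V)"

lemma J_carrier [simp]: "J \<in> carrier_mat d d" by (simp add: J_def)

text \<open>Replacing \<open>x\<close> by \<open>inv u \<otimes> x\<close> produces the multiplier
  \<open>a u x\<close> on the left, which is just what \<open>W' (inv x) * W' u\<close> absorbs on
  the right. The second representation may differ from \<open>W\<close>: it is also used with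
  \<open>W\<close> composed with an automorphism.\<close>

lemma average_intertwines:
  assumes W': "proj d' W'" and A: "A \<in> carrier_mat d d'" and u: "u \<in> carrier V"
  shows "W u * msum d d' (\<lambda>x. W x * A * W' (inv x)) (carrier V) = msum d d' (\<lambda>x. W x * A * W' (inv x)) (carrier V) * W' u"
proof -
  have W'c: "\<And>x. x \<in> carrier V \<Longrightarrow> W' x \<in> carrier_mat d' d'"
    and W'm: "\<And>x y. x \<in> carrier V \<Longrightarrow> y \<in> carrier V \<Longrightarrow> W' x * W' y = a x y \<cdot>\<^sub>m W' (x \<otimes> y)" using W' by (auto simp: proj_def)
  have c: "W x * A * W' (inv x) \<in> carrier_mat d d'" if "x \<in> carrier V" for x
    using that A W'c[of "inv x"] by (meson W_carrier inv_closed mult_carrier_mat)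
  have bij: "bij_betw (\<lambda>x. inv u \<otimes> x) (carrier V) (carrier V)"
    by (rule bij_betw_byWitness[of _ "\<lambda>x. u \<otimes> x"]) (use u in \<open>auto simp: m_assoc[symmetric]\<close>)
  have "W u * msum d d' (\<lambda>x. W x * A * W' (inv x)) (carrier V) = msum d d' (\<lambda>x. W u * (W x * A * W' (inv x))) (carrier V)"
    by (rule mult_msum) (use u c in auto)
  also have "\<dots> = msum d d' (\<lambda>x. W u * (W (inv u \<otimes> x) * A * W' (inv (inv u \<otimes> x)))) (carrier V)"
    by (rule msum_reindex[OF bij])
  also have "\<dots> = msum d d' (\<lambda>x. W x * A * W' (inv x) * W' u) (carrier V)"
  proof (rule msum_cong)
    fix x assume x: "x \<in> carrier V"
    have e: "u \<otimes> (inv u \<otimes> x) = x" using u x by (simp add: m_assoc[symmetric])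
    have e2: "inv (inv u \<otimes> x) = inv x \<otimes> u" using u x by (simp add: inv_mult_group)
    have c1: "W u \<in> carrier_mat d d" "W (inv u \<otimes> x) \<in> carrier_mat d d" "W x \<in> carrier_mat d d"
      "W' (inv x) \<in> carrier_mat d' d'" "W' u \<in> carrier_mat d' d'" "W' (inv x \<otimes> u) \<in> carrier_mat d' d'"
      using u x W'c by simp_all
    have c2: "W (inv u \<otimes> x) * A \<in> carrier_mat d d'" "W x * A \<in> carrier_mat d d'" using c1 A by simp_all
    have "W u * (W (inv u \<otimes> x) * A * W' (inv (inv u \<otimes> x))) = W u * W (inv u \<otimes> x) * A * W' (inv x \<otimes> u)"
      unfolding e2 assoc_mult_mat[OF c1(1) c2(1) c1(6), symmetric] assoc_mult_mat[OF c1(1) c1(2) A, symmetric] ..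
    also have "W u * W (inv u \<otimes> x) = a u x \<cdot>\<^sub>m W x"
      using u x e by (simp add: W_mult a_mult_right a_inv_right a_alt)
    also have "a u x \<cdot>\<^sub>m W x * A * W' (inv x \<otimes> u) = W x * A * (a u x \<cdot>\<^sub>m W' (inv x \<otimes> u))"
      unfolding mult_smult_assoc_mat[OF c1(3) A] mult_smult_assoc_mat[OF c2(2) c1(6)] mult_smult_distrib[OF c2(2) c1(6)] ..
    also have "a u x \<cdot>\<^sub>m W' (inv x \<otimes> u) = W' (inv x) * W' u" using u x by (simp add: W'm a_inv_left)
    also have "W x * A * (W' (inv x) * W' u) = W x * A * W' (inv x) * W' u"
      by (rule assoc_mult_mat[OF c2(2) c1(4,5), symmetric])
    finally show "W u * (W (inv u \<otimes> x) * A * W' (inv (inv u \<otimes> x))) = W x * A * W' (inv x) * W' u" .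
  qed
  also have "\<dots> = msum d d' (\<lambda>x. W x * A * W' (inv x)) (carrier V) * W' u"
    by (rule msum_mult[symmetric]) (use u c W'c in auto)
  finally show ?thesis .
qed

text \<open>In the orthogonality relation for \<open>W\<close> all traces off the identity vanish,
  and the one remaining term is d^2.\<close>

lemma d_square: "d * d = card (carrier V)"
proof -
  have "(\<Sum>x\<in>carrier V. mtr (W x) * mtr (W (inv x))) = of_nat (card (carrier V))"
    by (rule schur_orthogonality[OF W_irr]) (simp_all add: W_inv average_intertwines[OF W_proj])
  moreover have "(\<Sum>x\<in>carrier V. mtr (W x) * mtr (W (inv x))) = (\<Sum>x\<in>carrier V. if x = \<one> then of_nat d * of_nat d else 0)"
    by (rule sum.cong[OF refl]) (simp add: W_trace)
  ultimately have "(of_nat d * of_nat d :: complex) = of_nat (card (carrier V))" using fin by simp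
  thus ?thesis by (metis of_nat_eq_iff of_nat_mult)
qed

lemma J_trace: "mtr J = 1"
proof -
  have "mtr J = (\<Sum>v\<in>carrier V. mtr ((1 / of_nat d) \<cdot>\<^sub>m W v))" unfolding J_def by (rule mtr_msum) auto
  also have "\<dots> = (\<Sum>v\<in>carrier V. if v = \<one> then 1 else 0)"
    by (rule sum.cong[OF refl]) (use d_pos in \<open>auto simp: mtr_smult[OF W_carrier] W_trace\<close>)
  finally show ?thesis using fin by simp
qed

text \<open>Once the coefficient of each \<open>W v\<close> is collected, it is the sum of
  \<open>a v u\<close> over u divided by d^2, which is 1 at the identity and 0 elsewhere.\<close>

lemma J_square: "J * J = 1\<^sub>m d"
proof -
  have "J * J = msum d d (\<lambda>u. J * ((1 / of_nat d) \<cdot>\<^sub>m W u)) (carrier V)"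
    by (subst (2) J_def) (rule mult_msum, auto)
  also have "\<dots> = msum d d (\<lambda>u. msum d d (\<lambda>v. (1 / of_nat (d * d) * a v u) \<cdot>\<^sub>m W v) (carrier V)) (carrier V)"
  proof (rule msum_cong)
    fix u assume u: "u \<in> carrier V"
    have bij: "bij_betw (\<lambda>x. x \<otimes> inv u) (carrier V) (carrier V)"
      by (rule bij_betw_byWitness[of _ "\<lambda>x. x \<otimes> u"]) (use u in \<open>auto simp: m_assoc\<close>)
    have "J * ((1 / of_nat d) \<cdot>\<^sub>m W u) = msum d d (\<lambda>v. (1 / of_nat d) \<cdot>\<^sub>m W v * ((1 / of_nat d) \<cdot>\<^sub>m W u)) (carrier V)"
      unfolding J_def by (rule msum_mult) (use u in auto)
    also have "\<dots> = msum d d (\<lambda>v. (1 / of_nat d) \<cdot>\<^sub>m W (v \<otimes> inv u) * ((1 / of_nat d) \<cdot>\<^sub>m W u)) (carrier V)"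
      by (rule msum_reindex[OF bij])
    also have "\<dots> = msum d d (\<lambda>v. (1 / of_nat (d * d) * a v u) \<cdot>\<^sub>m W v) (carrier V)"
    proof (rule msum_cong)
      fix v assume v: "v \<in> carrier V"
      have e: "v \<otimes> inv u \<otimes> u = v" using u v by (simp add: m_assoc)
      have "(1 / of_nat d) \<cdot>\<^sub>m W (v \<otimes> inv u) * ((1 / of_nat d) \<cdot>\<^sub>m W u) = (1 / of_nat (d * d)) \<cdot>\<^sub>m (W (v \<otimes> inv u) * W u)"
        using u v mult_smult_assoc_mat[of "W (v \<otimes> inv u)" d d "(1 / of_nat d) \<cdot>\<^sub>m W u" d "1 / of_nat d"]
          mult_smult_distrib[of "W (v \<otimes> inv u)" d d "W u" d "1 / of_nat d"] by (simp add: smult_smult_mat)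
      also have "W (v \<otimes> inv u) * W u = a v u \<cdot>\<^sub>m W v"
        using u v e by (simp add: W_mult a_mult_left a_inv_left a_alt)
      finally show "(1 / of_nat d) \<cdot>\<^sub>m W (v \<otimes> inv u) * ((1 / of_nat d) \<cdot>\<^sub>m W u) = (1 / of_nat (d * d) * a v u) \<cdot>\<^sub>m W v"
        by (simp add: smult_smult_mat)
    qed
    finally show "J * ((1 / of_nat d) \<cdot>\<^sub>m W u) = msum d d (\<lambda>v. (1 / of_nat (d * d) * a v u) \<cdot>\<^sub>m W v) (carrier V)" .
  qed
  also have "\<dots> = W \<one>"
  proof (rule eq_matI)
    fix i j assume "i < dim_row (W \<one>)" "j < dim_col (W \<one>)"
    hence ij: "i < d" "j < d" by auto
    have "msum d d (\<lambda>u. msum d d (\<lambda>v. (1 / of_nat (d * d) * a v u) \<cdot>\<^sub>m W v) (carrier V)) (carrier V) $$ (i,j) =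
       (\<Sum>u\<in>carrier V. \<Sum>v\<in>carrier V. (1 / of_nat (d * d) * a v u) * W v $$ (i,j))"
      using ij by (auto simp: msum_def intro!: sum.cong dest!: W_carrier)
    also have "\<dots> = (\<Sum>v\<in>carrier V. (1 / of_nat (d * d) * W v $$ (i,j)) * (\<Sum>u\<in>carrier V. a v u))"
      by (subst sum.swap, rule sum.cong[OF refl], subst sum_distrib_left, rule sum.cong[OF refl], simp add: ac_simps)
    also have "\<dots> = (\<Sum>v\<in>carrier V. if v = \<one> then W v $$ (i,j) else 0)"
    proof (rule sum.cong[OF refl])
      fix v assume v: "v \<in> carrier V"
      have "(\<Sum>u\<in>carrier V. a v u) = (\<Sum>u\<in>carrier V. a (inv u) v)" by (rule sum.cong) (simp_all add: a_inv_left v)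
      also have "\<dots> = (\<Sum>u\<in>carrier V. a u v)"
        by (rule sum.reindex_bij_witness[of _ "\<lambda>u. inv u" "\<lambda>u. inv u"]) auto
      also have "\<dots> = (if v = \<one> then of_nat (d * d) else 0)" using sum_a[OF v] d_square by simp
      finally show "(1 / of_nat (d * d) * W v $$ (i,j)) * (\<Sum>u\<in>carrier V. a v u) = (if v = \<one> then W v $$ (i,j) else 0)"
        using d_pos by auto
    qed
    also have "\<dots> = W \<one> $$ (i,j)" using fin by simp
    finally show "msum d d (\<lambda>u. msum d d (\<lambda>v. (1 / of_nat (d * d) * a v u) \<cdot>\<^sub>m W v) (carrier V)) (carrier V) $$ (i,j) = W \<one> $$ (i,j)" .
  qed auto
  finally show ?thesis by simp
qed

text \<open>The operators implementing a group of symplectic automorphisms are determined up to scalars and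
  commute with \<open>J\<close>; dividing by the character of \<open>involution_character\<close> makes them
  multiplicative.\<close>

lemma weil_representation:
  fixes \<Gamma> :: "('g, 'k) monoid_scheme" and act :: "'a \<Rightarrow> 'g \<Rightarrow> 'a"
  assumes \<Gamma>: "group \<Gamma>"
    and act_closed: "\<And>x g. x \<in> carrier V \<Longrightarrow> g \<in> carrier \<Gamma> \<Longrightarrow> act x g \<in> carrier V"
    and act_mult: "\<And>x y g. x \<in> carrier V \<Longrightarrow> y \<in> carrier V \<Longrightarrow> g \<in> carrier \<Gamma> \<Longrightarrow> act (x \<otimes> y) g = act x g \<otimes> act y g"
    and act_a: "\<And>x y g. x \<in> carrier V \<Longrightarrow> y \<in> carrier V \<Longrightarrow> g \<in> carrier \<Gamma> \<Longrightarrow> a (act x g) (act y g) = a x y"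
    and act_act: "\<And>x g h. x \<in> carrier V \<Longrightarrow> g \<in> carrier \<Gamma> \<Longrightarrow> h \<in> carrier \<Gamma> \<Longrightarrow> act x (g \<otimes>\<^bsub>\<Gamma>\<^esub> h) = act (act x g) h"
    and act_one: "\<And>x. x \<in> carrier V \<Longrightarrow> act x \<one>\<^bsub>\<Gamma>\<^esub> = x"
  obtains \<omega> where "rep \<Gamma> d \<omega>" "\<And>x g. x \<in> carrier V \<Longrightarrow> g \<in> carrier \<Gamma> \<Longrightarrow> W x * \<omega> g = \<omega> g * W (act x g)"
proof -
  interpret \<Gamma>: group \<Gamma> by (rule \<Gamma>)
  have act_bij: "bij_betw (\<lambda>x. act x g) (carrier V) (carrier V)" if g: "g \<in> carrier \<Gamma>" for g
  proof (rule bij_betw_byWitness[of _ "\<lambda>x. act x (inv\<^bsub>\<Gamma>\<^esub> g)"])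
    have gi: "inv\<^bsub>\<Gamma>\<^esub> g \<in> carrier \<Gamma>" using g by simp
    show "\<forall>x\<in>carrier V. act (act x g) (inv\<^bsub>\<Gamma>\<^esub> g) = x" using act_act[OF _ g gi] g act_one by simp
    show "\<forall>x\<in>carrier V. act (act x (inv\<^bsub>\<Gamma>\<^esub> g)) g = x" using act_act[OF _ gi g] g act_one by simp
  qed (use g act_closed in auto)
  have act_id: "act \<one> g = \<one>" if g: "g \<in> carrier \<Gamma>" for g
    using act_mult[of \<one> \<one> g] act_closed[of \<one> g] g by (metis l_one one_closed r_cancel_one)
  have projg: "proj d (\<lambda>x. W (act x g))" if g: "g \<in> carrier \<Gamma>" for g
    unfolding proj_def using g act_closed act_id act_mult act_a by (simp add: W_mult)
  have irrg: "irr d (carrier V) (\<lambda>x. W (act x g))" if g: "g \<in> carrier \<Gamma>" for g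
    unfolding irr_def
  proof (intro conjI ballI allI impI)
    fix U assume U: "VectorSpace.subspace class_ring U (module_vec TYPE(complex) d) \<and> (\<forall>x\<in>carrier V. \<forall>w\<in>U. W (act x g) *\<^sub>v w \<in> U)"
    have "\<forall>x\<in>carrier V. \<forall>w\<in>U. W x *\<^sub>v w \<in> U"
    proof (intro ballI)
      fix x w assume x: "x \<in> carrier V" and w: "w \<in> U"
      have "x \<in> (\<lambda>x. act x g) ` carrier V" using bij_betw_imp_surj_on[OF act_bij[OF g]] x by simp
      then obtain y where "y \<in> carrier V" "act y g = x" by auto
      thus "W x *\<^sub>v w \<in> U" using U w by auto
    qed
    thus "U = {0\<^sub>v d} \<or> U = carrier_vec d" using U W_irr unfolding irr_def by simp
  qed (use g act_closed d_pos in auto)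
  have ex: "\<exists>T. T \<in> carrier_mat d d \<and> (\<exists>R. R \<in> carrier_mat d d \<and> T * R = 1\<^sub>m d \<and> R * T = 1\<^sub>m d) \<and>
      (\<forall>x\<in>carrier V. W x * T = T * W (act x g))" if g: "g \<in> carrier \<Gamma>" for g
  proof -
    \<comment> \<open>The twisted copy has the same character as \<open>W\<close>, supported at the
      identity, so some average is a nonzero intertwiner and hence invertible.\<close>
    have "(\<Sum>x\<in>carrier V. mtr (W x) * mtr (W (act (inv x) g))) = (\<Sum>x\<in>carrier V. if x = \<one> then of_nat d * of_nat d else 0)"
      by (rule sum.cong[OF refl]) (auto simp: W_trace act_closed g act_id)
    hence nz: "(\<Sum>x\<in>carrier V. mtr (W x) * mtr (W (act (inv x) g))) \<noteq> 0" using fin d_pos by simp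
    obtain A where A: "A \<in> carrier_mat d d" "msum d d (\<lambda>x. W x * A * W (act (inv x) g)) (carrier V) \<noteq> 0\<^sub>m d d"
      by (rule nonzero_average[OF _ _ nz, of d d]) (use act_closed g in auto)
    define T where "T = msum d d (\<lambda>x. W x * A * W (act (inv x) g)) (carrier V)"
    have int: "\<And>x. x \<in> carrier V \<Longrightarrow> W x * T = T * W (act x g)"
      unfolding T_def by (rule average_intertwines[OF projg[OF g] A(1)])
    have Tc: "T \<in> carrier_mat d d" by (simp add: T_def)
    have T0: "T \<noteq> 0\<^sub>m d d" using A(2) by (simp add: T_def)
    obtain R where "R \<in> carrier_mat d d" "T * R = 1\<^sub>m d" "R * T = 1\<^sub>m d"
      using schur_zero_or_iso(2)[OF W_irr irrg[OF g] Tc int T0] by blast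
    thus ?thesis using int Tc by blast
  qed
  define good where "good g T \<longleftrightarrow> T \<in> carrier_mat d d \<and> (\<exists>R. R \<in> carrier_mat d d \<and> T * R = 1\<^sub>m d \<and> R * T = 1\<^sub>m d) \<and>
      (\<forall>x\<in>carrier V. W x * T = T * W (act x g))" for g T
  define T where "T g = (SOME T. good g T)" for g
  have T: "good g (T g)" if "g \<in> carrier \<Gamma>" for g
    unfolding T_def by (rule someI_ex) (use ex[OF that] in \<open>simp add: good_def\<close>)
  have Tc: "T g \<in> carrier_mat d d" if "g \<in> carrier \<Gamma>" for g using T[OF that] by (simp add: good_def)
  have Tint: "W x * T g = T g * W (act x g)" if "g \<in> carrier \<Gamma>" "x \<in> carrier V" for g x using T[OF that(1)] that(2) by (simp add: good_def)
  \<comment> \<open>The action permutes the summands of \<open>J\<close>.\<close>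
  have TJ: "T g * J = J * T g" if g: "g \<in> carrier \<Gamma>" for g
  proof -
    have "J * T g = msum d d (\<lambda>v. (1 / of_nat d) \<cdot>\<^sub>m W v * T g) (carrier V)"
      unfolding J_def by (rule msum_mult) (use Tc[OF g] in auto)
    also have "\<dots> = msum d d (\<lambda>v. T g * ((1 / of_nat d) \<cdot>\<^sub>m W (act v g))) (carrier V)"
    proof (rule msum_cong)
      fix v assume v: "v \<in> carrier V"
      have "(1 / of_nat d) \<cdot>\<^sub>m W v * T g = (1 / of_nat d) \<cdot>\<^sub>m (W v * T g)"
        by (rule mult_smult_assoc_mat[OF W_carrier[OF v] Tc[OF g]])
      also have "\<dots> = T g * ((1 / of_nat d) \<cdot>\<^sub>m W (act v g))"
        unfolding Tint[OF g v] by (rule mult_smult_distrib[OF Tc[OF g] W_carrier[OF act_closed[OF v g]], symmetric])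
      finally show "(1 / of_nat d) \<cdot>\<^sub>m W v * T g = T g * ((1 / of_nat d) \<cdot>\<^sub>m W (act v g))" .
    qed
    also have "\<dots> = T g * msum d d (\<lambda>v. (1 / of_nat d) \<cdot>\<^sub>m W (act v g)) (carrier V)"
      by (rule mult_msum[symmetric]) (use Tc[OF g] act_closed g in auto)
    also have "msum d d (\<lambda>v. (1 / of_nat d) \<cdot>\<^sub>m W (act v g)) (carrier V) = J"
      unfolding J_def by (rule msum_reindex[OF act_bij[OF g], symmetric])
    finally show ?thesis by simp
  qed
  obtain \<chi> where \<chi>: "\<And>S T. S \<in> carrier_mat d d \<Longrightarrow> T \<in> carrier_mat d d \<Longrightarrow> S * J = J * S \<Longrightarrow> T * J = J * T \<Longrightarrow> \<chi> (S * T) = \<chi> S * \<chi> T"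
    and \<chi>c: "\<And>c. c \<noteq> 0 \<Longrightarrow> \<chi> (c \<cdot>\<^sub>m 1\<^sub>m d) = c"
    by (rule involution_character[OF J_carrier J_square J_trace]) blast
  have \<chi>s: "\<chi> (c \<cdot>\<^sub>m T g) = c * \<chi> (T g)" if "g \<in> carrier \<Gamma>" "c \<noteq> 0" for c g
  proof -
    have "c \<cdot>\<^sub>m T g = (c \<cdot>\<^sub>m 1\<^sub>m d) * T g" using Tc[OF that(1)] mult_smult_assoc_mat[of "1\<^sub>m d" d d "T g" d c] by simp
    moreover have "(c \<cdot>\<^sub>m 1\<^sub>m d) * J = J * (c \<cdot>\<^sub>m 1\<^sub>m d)"
      using mult_smult_assoc_mat[of "1\<^sub>m d" d d J d c] mult_smult_distrib[of J d d "1\<^sub>m d" d c]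
        left_mult_one_mat[OF J_carrier] right_mult_one_mat[OF J_carrier] by simp
    ultimately show ?thesis using \<chi>[of "c \<cdot>\<^sub>m 1\<^sub>m d" "T g"] \<chi>c[OF that(2)] Tc[OF that(1)] TJ[OF that(1)] by simp
  qed
  have prod: "\<exists>c. c \<noteq> 0 \<and> T g * T h = c \<cdot>\<^sub>m T (g \<otimes>\<^bsub>\<Gamma>\<^esub> h)" if g: "g \<in> carrier \<Gamma>" and h: "h \<in> carrier \<Gamma>" for g h
  proof -
    let ?gh = "g \<otimes>\<^bsub>\<Gamma>\<^esub> h"
    have gh: "?gh \<in> carrier \<Gamma>" using g h by simp
    obtain R where R: "R \<in> carrier_mat d d" "T ?gh * R = 1\<^sub>m d" "R * T ?gh = 1\<^sub>m d" using T[OF gh] unfolding good_def by blast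
    obtain Rg where Rg: "Rg \<in> carrier_mat d d" "T g * Rg = 1\<^sub>m d" "Rg * T g = 1\<^sub>m d" using T[OF g] unfolding good_def by blast
    obtain Rh where Rh: "Rh \<in> carrier_mat d d" "T h * Rh = 1\<^sub>m d" "Rh * T h = 1\<^sub>m d" using T[OF h] unfolding good_def by blast
    note ac = assoc_mult_mat[of _ d d _ d _ d]
    note Tcc = Tc[OF g] Tc[OF h] Tc[OF gh]
    \<comment> \<open>Both \<open>T g * T h\<close> and the operator of the product group element
      carry \<open>W x\<close> to the same twisted operator, so their quotient commutes with
      \<open>W\<close> and is a scalar.\<close>
    define M where "M = T g * T h * R"
    have Mc: "M \<in> carrier_mat d d" using Tcc R by (simp add: M_def)
    have "W x * M = M * W x" if x: "x \<in> carrier V" for x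
    proof -
      have RW: "W (act x ?gh) * R = R * W x"
      proof -
        have y: "act x ?gh \<in> carrier V" using act_closed[OF x gh] .
        have "W (act x ?gh) * R = R * T ?gh * W (act x ?gh) * R" using R Tcc W_carrier[OF y] by simp
        also have "\<dots> = R * (T ?gh * W (act x ?gh)) * R" using R(1) Tcc W_carrier[OF y] by (simp add: ac)
        also have "\<dots> = R * (W x * T ?gh) * R" using Tint[OF gh x] by simp
        also have "\<dots> = R * W x * (T ?gh * R)" using R(1) Tcc W_carrier[OF x] by (simp add: ac)
        finally show ?thesis using R(1,2) W_carrier[OF x] by simp
      qed
      have xg: "act x g \<in> carrier V" using act_closed[OF x g] .
      have "W x * M = W x * T g * (T h * R)" using Tcc R(1) x by (simp add: M_def ac)
      also have "\<dots> = T g * W (act x g) * (T h * R)" using Tint[OF g x] by simp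
      also have "\<dots> = T g * (W (act x g) * T h) * R" using Tcc R(1) W_carrier[OF xg] by (simp add: ac)
      also have "W (act x g) * T h = T h * W (act x ?gh)" using Tint[OF h xg] act_act[OF x g h] by simp
      also have "T g * (T h * W (act x ?gh)) * R = T g * T h * (W (act x ?gh) * R)"
        using Tcc R(1) W_carrier[OF act_closed[OF x gh]] by (simp add: ac)
      also have "\<dots> = M * W x" unfolding RW using Tcc R(1) W_carrier[OF x] by (simp add: M_def ac)
      finally show ?thesis .
    qed
    then obtain c where c: "M = c \<cdot>\<^sub>m 1\<^sub>m d" by (rule schur_scalar[OF W_irr Mc])
    have "T g * T h = M * T ?gh" using Tcc R by (simp add: M_def ac)
    also have "\<dots> = c \<cdot>\<^sub>m T ?gh" unfolding c using mult_smult_assoc_mat[of "1\<^sub>m d" d d "T ?gh" d c] Tcc by simp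
    finally have e: "T g * T h = c \<cdot>\<^sub>m T ?gh" .
    have "c \<noteq> 0"
    proof
      assume "c = 0"
      hence "T g * T h = 0\<^sub>m d d" using e Tcc by auto
      hence "Rg * (T g * T h) * Rh = 0\<^sub>m d d" using Rg Rh by simp
      moreover have "Rg * (T g * T h) * Rh = (Rg * T g) * (T h * Rh)" using Tcc Rg(1) Rh(1) by (simp add: ac)
      ultimately have "(1\<^sub>m d :: complex mat) = 0\<^sub>m d d" using Rg Rh by simp
      hence "(1\<^sub>m d :: complex mat) $$ (0,0) = 0\<^sub>m d d $$ (0,0)" by simp
      thus False using d_pos by simp
    qed
    with e show ?thesis by blast
  qed
  have \<chi>m: "\<chi> (T g) * \<chi> (T h) = \<chi> (T g * T h)" if "g \<in> carrier \<Gamma>" "h \<in> carrier \<Gamma>" for g h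
    using \<chi>[OF Tc[OF that(1)] Tc[OF that(2)] TJ[OF that(1)] TJ[OF that(2)]] by simp
  have T1: "\<exists>c. c \<noteq> 0 \<and> T \<one>\<^bsub>\<Gamma>\<^esub> = c \<cdot>\<^sub>m 1\<^sub>m d"
  proof -
    have o: "\<one>\<^bsub>\<Gamma>\<^esub> \<in> carrier \<Gamma>" by simp
    obtain c where c: "T \<one>\<^bsub>\<Gamma>\<^esub> = c \<cdot>\<^sub>m 1\<^sub>m d"
      by (rule schur_scalar[OF W_irr Tc[OF o]]) (use Tint[OF o] act_one in auto)
    obtain R where R: "R \<in> carrier_mat d d" "T \<one>\<^bsub>\<Gamma>\<^esub> * R = 1\<^sub>m d" using T[OF o] unfolding good_def by blast
    have "c \<noteq> 0"
    proof
      assume "c = 0"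
      hence "T \<one>\<^bsub>\<Gamma>\<^esub> = 0\<^sub>m d d" using c by auto
      hence "(1\<^sub>m d :: complex mat) = 0\<^sub>m d d" using R by simp
      hence "(1\<^sub>m d :: complex mat) $$ (0,0) = 0\<^sub>m d d $$ (0,0)" by simp
      thus False using d_pos by simp
    qed
    with c show ?thesis by blast
  qed
  have \<chi>nz: "\<chi> (T g) \<noteq> 0" if g: "g \<in> carrier \<Gamma>" for g
  proof -
    obtain c where c: "c \<noteq> 0" "T \<one>\<^bsub>\<Gamma>\<^esub> = c \<cdot>\<^sub>m 1\<^sub>m d" using T1 by blast
    obtain b where b: "b \<noteq> 0" "T g * T (inv\<^bsub>\<Gamma>\<^esub> g) = b \<cdot>\<^sub>m T \<one>\<^bsub>\<Gamma>\<^esub>" using prod[of g "inv\<^bsub>\<Gamma>\<^esub> g"] g by auto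
    have "\<chi> (T g) * \<chi> (T (inv\<^bsub>\<Gamma>\<^esub> g)) = b * c"
      using \<chi>m[of g "inv\<^bsub>\<Gamma>\<^esub> g"] g b c \<chi>s[of "\<one>\<^bsub>\<Gamma>\<^esub>" b] \<chi>c[of c] by simp
    thus ?thesis using b c by auto
  qed
  define \<omega> where "\<omega> g = (1 / \<chi> (T g)) \<cdot>\<^sub>m T g" for g
  have "rep \<Gamma> d \<omega>"
    unfolding rep_def
  proof (intro conjI ballI)
    obtain c where c: "c \<noteq> 0" "T \<one>\<^bsub>\<Gamma>\<^esub> = c \<cdot>\<^sub>m 1\<^sub>m d" using T1 by blast
    show "\<omega> \<one>\<^bsub>\<Gamma>\<^esub> = 1\<^sub>m d" unfolding \<omega>_def c(2) \<chi>c[OF c(1)] using c(1) by (simp add: smult_smult_mat)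
    fix g h assume g: "g \<in> carrier \<Gamma>" and h: "h \<in> carrier \<Gamma>"
    show "\<omega> g \<in> carrier_mat d d" using Tc[OF g] by (simp add: \<omega>_def)
    let ?gh = "g \<otimes>\<^bsub>\<Gamma>\<^esub> h"
    have gh: "?gh \<in> carrier \<Gamma>" using g h by simp
    obtain b where b: "b \<noteq> 0" "T g * T h = b \<cdot>\<^sub>m T ?gh" using prod[OF g h] by blast
    have x: "\<chi> (T g) * \<chi> (T h) = b * \<chi> (T ?gh)" using \<chi>m[OF g h] b \<chi>s[OF gh b(1)] by simp
    have "\<omega> g * \<omega> h = (1 / \<chi> (T g) * (1 / \<chi> (T h))) \<cdot>\<^sub>m (T g * T h)"
      unfolding \<omega>_def using Tc[OF g] Tc[OF h] mult_smult_assoc_mat[of "T g" d d "(1 / \<chi> (T h)) \<cdot>\<^sub>m T h" d]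
        mult_smult_distrib[of "T g" d d "T h" d "1 / \<chi> (T h)"] by (simp add: smult_smult_mat)
    also have "\<dots> = (1 / (\<chi> (T g) * \<chi> (T h)) * b) \<cdot>\<^sub>m T ?gh" unfolding b(2) by (simp add: smult_smult_mat)
    also have "1 / (\<chi> (T g) * \<chi> (T h)) * b = 1 / \<chi> (T ?gh)" unfolding x using b(1) by simp
    finally show "\<omega> ?gh = \<omega> g * \<omega> h" by (simp add: \<omega>_def)
  qed
  moreover have "W x * \<omega> g = \<omega> g * W (act x g)" if x: "x \<in> carrier V" and g: "g \<in> carrier \<Gamma>" for x g
    unfolding \<omega>_def mult_smult_distrib[OF W_carrier[OF x] Tc[OF g]]
      mult_smult_assoc_mat[OF Tc[OF g] W_carrier[OF act_closed[OF x g]]] Tint[OF g x] ..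
  ultimately show ?thesis using that by blast
qed

end

section \<open>Clifford theory\<close>

lemma rep_subgroup_iff:
  "rep (G\<lparr>carrier := S\<rparr>) d \<sigma> \<longleftrightarrow> (\<forall>x\<in>S. \<sigma> x \<in> carrier_mat d d) \<and> \<sigma> \<one>\<^bsub>G\<^esub> = 1\<^sub>m d \<and>
    (\<forall>x\<in>S. \<forall>y\<in>S. \<sigma> (x \<otimes>\<^bsub>G\<^esub> y) = \<sigma> x * \<sigma> y)"
  by (simp add: rep_def)

lemma irrep_subgroup_iff: "irrep (G\<lparr>carrier := S\<rparr>) d \<sigma> \<longleftrightarrow> rep (G\<lparr>carrier := S\<rparr>) d \<sigma> \<and> irr d S \<sigma>"
  by (simp add: irrep_iff)

lemma mat_eq_vecI:
  fixes A B :: "complex mat"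
  assumes A: "A \<in> carrier_mat n m" and B: "B \<in> carrier_mat n m"
    and eq: "\<And>w. w \<in> carrier_vec m \<Longrightarrow> A *\<^sub>v w = B *\<^sub>v w"
  shows "A = B"
proof (rule mat_col_eqI)
  fix j assume "j < dim_col B"
  hence j: "j < m" using B by simp
  show "col A j = col B j" using eq[of "unit_vec m j"] mat_mult_unit_vec[OF A j] mat_mult_unit_vec[OF B j] by simp
qed (use A B in auto)

lemma mat_mult_zero_vec: "(A :: complex mat) \<in> carrier_mat n m \<Longrightarrow> A *\<^sub>v 0\<^sub>v m = 0\<^sub>v n"
  by (rule eq_vecI) auto

lemma smult_mat_mult_vec:
  fixes A :: "complex mat"
  assumes "A \<in> carrier_mat n m" "w \<in> carrier_vec m"
  shows "(b \<cdot>\<^sub>m A) *\<^sub>v w = b \<cdot>\<^sub>v (A *\<^sub>v w)"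
  by (rule eq_vecI) (use assms in \<open>auto simp: scalar_prod_def sum_distrib_left ac_simps\<close>)

lemma scalar_mat_mult:
  fixes A :: "complex mat"
  assumes "A \<in> carrier_mat n m"
  shows "(b \<cdot>\<^sub>m 1\<^sub>m n) * A = b \<cdot>\<^sub>m A" "A * (b \<cdot>\<^sub>m 1\<^sub>m m) = b \<cdot>\<^sub>m A"
  using assms mult_smult_assoc_mat[of "1\<^sub>m n" n n A m b] mult_smult_distrib[of A n m "1\<^sub>m m" m b] by simp_all

lemma smult_mat_cancel:
  fixes A :: "complex mat"
  assumes "b \<cdot>\<^sub>m A = c \<cdot>\<^sub>m A" "A \<in> carrier_mat n m" "A \<noteq> 0\<^sub>m n m"
  shows "b = c"
proof (rule ccontr)
  assume bc: "b \<noteq> c"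
  have "A = 0\<^sub>m n m"
  proof (rule eq_matI)
    fix i j assume ij: "i < dim_row (0\<^sub>m n m :: complex mat)" "j < dim_col (0\<^sub>m n m :: complex mat)"
    have "(b \<cdot>\<^sub>m A) $$ (i,j) = (c \<cdot>\<^sub>m A) $$ (i,j)" using assms(1) by simp
    thus "A $$ (i,j) = 0\<^sub>m n m $$ (i,j)" using bc ij assms(2) by simp
  qed (use assms in auto)
  with assms show False by simp
qed

lemma one_mat_nonzero: "0 < d \<Longrightarrow> (1\<^sub>m d :: complex mat) \<noteq> 0\<^sub>m d d"
  by (metis index_one_mat(1) index_zero_mat(1) zero_neq_one)

lemma subspace_eigenspaces:
  assumes "\<And>x. x \<in> N \<Longrightarrow> \<sigma> x \<in> carrier_mat d d"
  shows "VectorSpace.subspace class_ring {w \<in> carrier_vec d. \<forall>x\<in>N. \<sigma> x *\<^sub>v w = \<chi> x \<cdot>\<^sub>v w} (module_vec TYPE(complex) d)"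
  unfolding subspace_module_vec_iff
proof (intro conjI ballI allI)
  show "0\<^sub>v d \<in> {w \<in> carrier_vec d. \<forall>x\<in>N. \<sigma> x *\<^sub>v w = \<chi> x \<cdot>\<^sub>v w}"
    using mat_mult_zero_vec[OF assms] by (auto intro!: eq_vecI)
  show "v + w \<in> {w \<in> carrier_vec d. \<forall>x\<in>N. \<sigma> x *\<^sub>v w = \<chi> x \<cdot>\<^sub>v w}"
    if vw: "v \<in> {w \<in> carrier_vec d. \<forall>x\<in>N. \<sigma> x *\<^sub>v w = \<chi> x \<cdot>\<^sub>v w}" "w \<in> {w \<in> carrier_vec d. \<forall>x\<in>N. \<sigma> x *\<^sub>v w = \<chi> x \<cdot>\<^sub>v w}" for v w
  proof -
    have "\<sigma> x *\<^sub>v (v + w) = \<chi> x \<cdot>\<^sub>v (v + w)" if "x \<in> N" for x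
      using mult_add_distrib_mat_vec[OF assms[OF that], of v w] smult_add_distrib_vec[of v d w "\<chi> x"] vw that by simp
    thus ?thesis using vw by simp
  qed
  show "c \<cdot>\<^sub>v v \<in> {w \<in> carrier_vec d. \<forall>x\<in>N. \<sigma> x *\<^sub>v w = \<chi> x \<cdot>\<^sub>v w}"
    if v: "v \<in> {w \<in> carrier_vec d. \<forall>x\<in>N. \<sigma> x *\<^sub>v w = \<chi> x \<cdot>\<^sub>v w}" for c v
  proof -
    have "\<sigma> x *\<^sub>v (c \<cdot>\<^sub>v v) = \<chi> x \<cdot>\<^sub>v (c \<cdot>\<^sub>v v)" if "x \<in> N" for x
      using mult_mat_vec[OF assms[OF that], of v c] v that by (simp add: smult_smult_assoc mult.commute)
    thus ?thesis using v by simp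
  qed
qed auto

text \<open>Invariance of \<open>\<chi>\<close> under conjugation makes the common
  \<open>\<chi>\<close>-eigenspace of \<open>N\<close> stable under \<open>S\<close>; it is nonzero
  because the character occurs, hence it is everything.\<close>

lemma (in group) isotypic_scalar:
  assumes S: "subgroup S G" and \<sigma>: "irrep (G\<lparr>carrier := S\<rparr>) d \<sigma>" and N: "N \<subseteq> S"
    and inv: "\<And>h n. h \<in> S \<Longrightarrow> n \<in> N \<Longrightarrow> inv h \<otimes> n \<otimes> h \<in> N \<and> \<chi> (inv h \<otimes> n \<otimes> h) = \<chi> n"
    and cc: "contains_char d \<sigma> (G\<lparr>carrier := N\<rparr>) \<chi>"
    and n: "n \<in> N"
  shows "\<sigma> n = \<chi> n \<cdot>\<^sub>m 1\<^sub>m d"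
proof -
  have r: "rep (G\<lparr>carrier := S\<rparr>) d \<sigma>" and i: "irr d S \<sigma>" using \<sigma> by (simp_all add: irrep_subgroup_iff)
  note rr = r[unfolded rep_subgroup_iff]
  have c: "\<sigma> x \<in> carrier_mat d d" if "x \<in> S" for x using rr that by blast
  have m: "\<sigma> (x \<otimes> y) = \<sigma> x * \<sigma> y" if "x \<in> S" "y \<in> S" for x y using rr that by blast
  have SG: "x \<in> carrier G" if "x \<in> S" for x using subgroup.mem_carrier[OF S that] .
  let ?W = "{w \<in> carrier_vec d. \<forall>x\<in>N. \<sigma> x *\<^sub>v w = \<chi> x \<cdot>\<^sub>v w}"
  have sub: "VectorSpace.subspace class_ring ?W (module_vec TYPE(complex) d)"
    by (rule subspace_eigenspaces) (use c N in auto)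
  have stab: "\<sigma> h *\<^sub>v w \<in> ?W" if h: "h \<in> S" and w: "w \<in> ?W" for h w
  proof -
    have "\<sigma> x *\<^sub>v (\<sigma> h *\<^sub>v w) = \<chi> x \<cdot>\<^sub>v (\<sigma> h *\<^sub>v w)" if x: "x \<in> N" for x
    proof -
      let ?y = "inv h \<otimes> x \<otimes> h"
      have xS: "x \<in> S" using x N by blast
      have y: "?y \<in> N" "\<chi> ?y = \<chi> x" using inv[OF h x] by auto
      have yS: "?y \<in> S" using y N by blast
      have wd: "w \<in> carrier_vec d" using w by simp
      have e: "x \<otimes> h = h \<otimes> ?y" using SG[OF h] SG[OF xS] by (simp add: m_assoc[symmetric])
      have "\<sigma> x *\<^sub>v (\<sigma> h *\<^sub>v w) = \<sigma> x * \<sigma> h *\<^sub>v w" by (rule assoc_mult_mat_vec[OF c[OF xS] c[OF h] wd, symmetric])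
      also have "\<sigma> x * \<sigma> h = \<sigma> h * \<sigma> ?y" using m[OF xS h] m[OF h yS] e by simp
      also have "\<sigma> h * \<sigma> ?y *\<^sub>v w = \<sigma> h *\<^sub>v (\<sigma> ?y *\<^sub>v w)" by (rule assoc_mult_mat_vec[OF c[OF h] c[OF yS] wd])
      also have "\<sigma> ?y *\<^sub>v w = \<chi> x \<cdot>\<^sub>v w" using w y by simp
      also have "\<sigma> h *\<^sub>v (\<chi> x \<cdot>\<^sub>v w) = \<chi> x \<cdot>\<^sub>v (\<sigma> h *\<^sub>v w)" by (rule mult_mat_vec[OF c[OF h] wd])
      finally show ?thesis .
    qed
    thus ?thesis using c[OF h] w by auto
  qed
  have "?W = {0\<^sub>v d} \<or> ?W = carrier_vec d" using i sub stab unfolding irr_def by blast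
  moreover have "?W \<noteq> {0\<^sub>v d}" using cc unfolding contains_char_def by auto
  ultimately have W: "?W = carrier_vec d" by blast
  show ?thesis
  proof (rule mat_eq_vecI[of _ d d])
    fix w :: "complex vec" assume w: "w \<in> carrier_vec d"
    hence "w \<in> ?W" using W by simp
    thus "\<sigma> n *\<^sub>v w = (\<chi> n \<cdot>\<^sub>m 1\<^sub>m d) *\<^sub>v w" using n w smult_mat_mult_vec[of "1\<^sub>m d" d d w] by simp
  qed (use c n N in auto)
qed

section \<open>Isomorphism classes of matrix representations\<close>

lemma invertible_mat_obtain:
  fixes P :: "complex mat"
  assumes "invertible_mat P" "P \<in> carrier_mat d d"
  obtains Q where "Q \<in> carrier_mat d d" "P * Q = 1\<^sub>m d" "Q * P = 1\<^sub>m d"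
proof -
  obtain B where B: "P * B = 1\<^sub>m (dim_row P)" "B * P = 1\<^sub>m (dim_row B)"
    using assms(1) unfolding invertible_mat_def inverts_mat_def by blast
  have "dim_col (P * B) = d" "dim_col (B * P) = dim_row B" unfolding B using assms(2) by simp_all
  hence "B \<in> carrier_mat d d" using assms(2) by auto
  thus ?thesis using that B assms(2) by auto
qed

lemma invertible_matI:
  "P \<in> carrier_mat d d \<Longrightarrow> Q \<in> carrier_mat d d \<Longrightarrow> P * Q = 1\<^sub>m d \<Longrightarrow> Q * P = 1\<^sub>m d \<Longrightarrow> invertible_mat P"
  unfolding invertible_mat_def inverts_mat_def by (auto simp: square_mat.simps)

lemma rep_dim_unique: "rep H d \<sigma> \<Longrightarrow> rep H e \<sigma> \<Longrightarrow> d = e"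
  unfolding rep_def by (metis index_one_mat(2))

lemma iso_class_refl: "rep H d \<sigma> \<Longrightarrow> \<sigma> \<in> iso_class H \<sigma>"
  unfolding iso_class_def
proof (rule CollectI, intro exI conjI bexI ballI)
  show "invertible_mat (1\<^sub>m d :: complex mat)" by (rule invertible_matI[of _ d "1\<^sub>m d"]) auto
  show "1\<^sub>m d * \<sigma> x = \<sigma> x * 1\<^sub>m d" if "rep H d \<sigma>" "x \<in> carrier H" for x
    using that left_mult_one_mat[of "\<sigma> x" d d] right_mult_one_mat[of "\<sigma> x" d d] by (simp add: rep_def)
qed auto

lemma iso_class_subset:
  assumes \<sigma>: "rep H d \<sigma>" and \<tau>: "rep H d \<tau>" and P: "P \<in> carrier_mat d d" "Q \<in> carrier_mat d d" "P * Q = 1\<^sub>m d" "Q * P = 1\<^sub>m d"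
    and int: "\<And>x. x \<in> carrier H \<Longrightarrow> P * \<sigma> x = \<tau> x * P"
  shows "iso_class H \<tau> \<subseteq> iso_class H \<sigma>"
proof
  fix \<rho> assume "\<rho> \<in> iso_class H \<tau>"
  then obtain e R where R0: "rep H e \<tau>" "rep H e \<rho>" "R \<in> carrier_mat e e" "invertible_mat R" "\<And>x. x \<in> carrier H \<Longrightarrow> R * \<tau> x = \<rho> x * R"
    unfolding iso_class_def by blast
  have ed: "e = d" by (rule rep_dim_unique[OF R0(1) \<tau>])
  note R = R0[unfolded ed]
  obtain S where S: "S \<in> carrier_mat d d" "R * S = 1\<^sub>m d" "S * R = 1\<^sub>m d" by (rule invertible_mat_obtain[OF R(4,3)])
  note ac = assoc_mult_mat[of _ d d _ d _ d]
  have "invertible_mat (R * P)"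
  proof (rule invertible_matI[of _ d "Q * S"])
    have "R * P * (Q * S) = R * (P * Q) * S" using R(3) S(1) P(1,2) by (simp add: ac)
    thus "R * P * (Q * S) = 1\<^sub>m d" using P(3) S(2) R(3) by simp
    have "Q * S * (R * P) = Q * (S * R) * P" using R(3) S(1) P(1,2) by (simp add: ac)
    thus "Q * S * (R * P) = 1\<^sub>m d" using P(2,4) S(3) by simp
  qed (use R S P in auto)
  moreover have "R * P * \<sigma> x = \<rho> x * (R * P)" if x: "x \<in> carrier H" for x
  proof -
    have c: "\<sigma> x \<in> carrier_mat d d" "\<tau> x \<in> carrier_mat d d" "\<rho> x \<in> carrier_mat d d" using \<sigma> \<tau> R(2) x by (simp_all add: rep_def)
    have "R * P * \<sigma> x = R * (\<tau> x * P)" unfolding int[OF x, symmetric] by (rule assoc_mult_mat[OF R(3) P(1) c(1)])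
    also have "\<dots> = R * \<tau> x * P" by (rule assoc_mult_mat[OF R(3) c(2) P(1), symmetric])
    also have "\<dots> = \<rho> x * (R * P)" unfolding R(5)[OF x] by (rule assoc_mult_mat[OF c(3) R(3) P(1)])
    finally show ?thesis .
  qed
  moreover have "R * P \<in> carrier_mat d d" by (rule mult_carrier_mat[OF R(3) P(1)])
  ultimately show "\<rho> \<in> iso_class H \<sigma>" unfolding iso_class_def using \<sigma> R(2) by blast
qed

lemma iso_class_eqI:
  assumes \<sigma>: "rep H d \<sigma>" and \<tau>: "rep H d \<tau>" and P: "P \<in> carrier_mat d d" "Q \<in> carrier_mat d d" "P * Q = 1\<^sub>m d" "Q * P = 1\<^sub>m d"
    and int: "\<And>x. x \<in> carrier H \<Longrightarrow> P * \<sigma> x = \<tau> x * P"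
  shows "iso_class H \<sigma> = iso_class H \<tau>"
proof
  show "iso_class H \<tau> \<subseteq> iso_class H \<sigma>" by (rule iso_class_subset[OF assms])
  show "iso_class H \<sigma> \<subseteq> iso_class H \<tau>"
  proof (rule iso_class_subset[OF \<tau> \<sigma> P(2,1,4,3)])
    fix x assume x: "x \<in> carrier H"
    have c: "\<sigma> x \<in> carrier_mat d d" "\<tau> x \<in> carrier_mat d d" using \<sigma> \<tau> x by (simp_all add: rep_def)
    note ac = assoc_mult_mat[of _ d d _ d _ d]
    have "Q * \<tau> x = Q * (\<tau> x * P) * Q" using c P by (simp add: ac)
    also have "\<dots> = Q * P * \<sigma> x * Q" unfolding int[OF x, symmetric] using c P(1,2) by (simp add: ac)
    finally show "Q * \<tau> x = \<sigma> x * Q" using c P by simp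
  qed
qed

text \<open>Common setting for both parities of the level. \<open>Rho\<close> indexes characters of
  \<open>Z\<close> that extend \<open>\<psi>\<close>; \<open>noncentral\<close> says that
  \<open>Z\<close> is the radical of the commutator pairing on \<open>K\<close>;
  \<open>extension\<close> matches the admissible characters of \<open>C \<inter> K\<close> with
  indices. Together they let \<open>\<theta>\<close> determine \<rho>, and \<rho> determine the
  restriction to \<open>K\<close>.\<close>

locale clifford = group G for G :: "('g, 'm) monoid_scheme" (structure) +
  fixes H C K Z L :: "'g set" and Rho :: "'r set" and \<psi> :: "'g \<Rightarrow> complex" and \<psi>\<rho> :: "'r \<Rightarrow> 'g \<Rightarrow> complex"
    and \<pi> U :: "'r \<Rightarrow> 'g \<Rightarrow> complex mat"
  assumes sub: "subgroup H G" "subgroup C G" "subgroup K G" "subgroup Z G" "subgroup L G"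
    and finH: "finite H" and CH: "C \<subseteq> H" and KH: "K \<subseteq> H" and ZK: "Z \<subseteq> K" and LZ: "L \<subseteq> Z" and CKZ: "C \<inter> K \<subseteq> Z"
    and HCK: "\<And>h. h \<in> H \<Longrightarrow> \<exists>c\<in>C. \<exists>k\<in>K. h = c \<otimes> k"
    and ZCL: "\<And>z. z \<in> Z \<Longrightarrow> \<exists>c\<in>C \<inter> K. \<exists>l\<in>L. z = c \<otimes> l"
    and Ccomm: "\<And>x y. x \<in> C \<Longrightarrow> y \<in> C \<Longrightarrow> x \<otimes> y = y \<otimes> x"
    and CnormK: "\<And>g x. g \<in> C \<Longrightarrow> x \<in> K \<Longrightarrow> inv g \<otimes> x \<otimes> g \<in> K"
    and L_inv: "\<And>h l. h \<in> H \<Longrightarrow> l \<in> L \<Longrightarrow> inv h \<otimes> l \<otimes> h \<in> L \<and> \<psi> (inv h \<otimes> l \<otimes> h) = \<psi> l"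
    and Z_inv: "\<And>\<rho> h z. \<rho> \<in> Rho \<Longrightarrow> h \<in> C \<union> K \<Longrightarrow> z \<in> Z \<Longrightarrow>
      inv h \<otimes> z \<otimes> h \<in> Z \<and> \<psi>\<rho> \<rho> (inv h \<otimes> z \<otimes> h) = \<psi>\<rho> \<rho> z"
    and \<psi>\<rho>_mult: "\<And>\<rho> x y. \<rho> \<in> Rho \<Longrightarrow> x \<in> Z \<Longrightarrow> y \<in> Z \<Longrightarrow> \<psi>\<rho> \<rho> (x \<otimes> y) = \<psi>\<rho> \<rho> x * \<psi>\<rho> \<rho> y"
    and \<psi>\<rho>_one: "\<And>\<rho>. \<rho> \<in> Rho \<Longrightarrow> \<psi>\<rho> \<rho> \<one> = 1"
    and \<psi>\<rho>_L: "\<And>\<rho> x. \<rho> \<in> Rho \<Longrightarrow> x \<in> L \<Longrightarrow> \<psi>\<rho> \<rho> x = \<psi> x"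
    and noncentral: "\<And>\<rho> x. \<rho> \<in> Rho \<Longrightarrow> x \<in> K \<Longrightarrow> x \<notin> Z \<Longrightarrow>
      \<exists>y\<in>K. y \<otimes> x \<otimes> inv y \<otimes> inv x \<in> Z \<and> \<psi>\<rho> \<rho> (y \<otimes> x \<otimes> inv y \<otimes> inv x) \<noteq> 1"
    and extension: "\<And>\<theta>. (\<And>x y. x \<in> C \<inter> K \<Longrightarrow> y \<in> C \<inter> K \<Longrightarrow> \<theta> (x \<otimes> y) = \<theta> x * \<theta> y) \<Longrightarrow>
      (\<And>x. x \<in> C \<inter> L \<Longrightarrow> \<theta> x = \<psi> x) \<Longrightarrow> \<exists>!\<rho>. \<rho> \<in> Rho \<and> (\<forall>g\<in>C \<inter> K. \<theta> g = \<psi>\<rho> \<rho> g)"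
    and pi_data: "\<And>\<rho>. \<rho> \<in> Rho \<Longrightarrow> \<exists>d. irrep (G\<lparr>carrier := K\<rparr>) d (\<pi> \<rho>) \<and>
      contains_char d (\<pi> \<rho>) (G\<lparr>carrier := Z\<rparr>) (\<psi>\<rho> \<rho>) \<and> rep (G\<lparr>carrier := C\<rparr>) d (U \<rho>) \<and>
      (\<forall>g\<in>C. \<forall>x\<in>K. \<pi> \<rho> (inv g \<otimes> x \<otimes> g) = U \<rho> (inv g) * \<pi> \<rho> x * U \<rho> g) \<and>
      (\<forall>g\<in>C \<inter> K. U \<rho> g = 1\<^sub>m d)"
begin

definition rho_ext :: "('g \<Rightarrow> complex) \<Rightarrow> 'r" where
  "rho_ext \<theta> = (THE \<rho>. \<rho> \<in> Rho \<and> (\<forall>g\<in>C \<inter> K. \<theta> g = \<psi>\<rho> \<rho> g))"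

definition sig :: "('g \<Rightarrow> complex) \<Rightarrow> 'g \<Rightarrow> complex mat" where
  "sig \<theta> A = (SOME M. \<exists>g\<in>C. \<exists>h\<in>K. A = g \<otimes> h \<and> M = \<theta> g \<cdot>\<^sub>m (U (rho_ext \<theta>) g * \<pi> (rho_ext \<theta>) h))"

definition Thetas :: "('g \<Rightarrow> complex) set" where
  "Thetas = {\<theta> \<in> dual (G\<lparr>carrier := C\<rparr>). \<forall>g\<in>C \<inter> L. \<theta> g = \<psi> g}"

lemma carr: "x \<in> H \<Longrightarrow> x \<in> carrier G" "x \<in> C \<Longrightarrow> x \<in> carrier G" "x \<in> K \<Longrightarrow> x \<in> carrier G"
  "x \<in> Z \<Longrightarrow> x \<in> carrier G" "x \<in> L \<Longrightarrow> x \<in> carrier G"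
  using sub[THEN subgroup.mem_carrier] by blast+

lemma one_mem: "\<one> \<in> H" "\<one> \<in> C" "\<one> \<in> K" "\<one> \<in> Z" "\<one> \<in> L"
  using sub[THEN subgroup.one_closed] by blast+

lemma mult_mem: "x \<in> H \<Longrightarrow> y \<in> H \<Longrightarrow> x \<otimes> y \<in> H" "x \<in> C \<Longrightarrow> y \<in> C \<Longrightarrow> x \<otimes> y \<in> C"
  "x \<in> K \<Longrightarrow> y \<in> K \<Longrightarrow> x \<otimes> y \<in> K" "x \<in> Z \<Longrightarrow> y \<in> Z \<Longrightarrow> x \<otimes> y \<in> Z"
  using sub[THEN subgroup.m_closed] by blast+

lemma inv_mem: "x \<in> H \<Longrightarrow> inv x \<in> H" "x \<in> C \<Longrightarrow> inv x \<in> C" "x \<in> K \<Longrightarrow> inv x \<in> K" "x \<in> Z \<Longrightarrow> inv x \<in> Z"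
  using sub[THEN subgroup.m_inv_closed] by blast+

lemma finite_K: "finite K" "finite Z" using finH KH ZK by (meson finite_subset)+

lemma Z_inv_H:
  assumes \<rho>: "\<rho> \<in> Rho" and h: "h \<in> H" and z: "z \<in> Z"
  shows "inv h \<otimes> z \<otimes> h \<in> Z \<and> \<psi>\<rho> \<rho> (inv h \<otimes> z \<otimes> h) = \<psi>\<rho> \<rho> z"
proof -
  obtain c k where ck: "c \<in> C" "k \<in> K" "h = c \<otimes> k" using HCK[OF h] by blast
  have e: "inv h \<otimes> z \<otimes> h = inv k \<otimes> (inv c \<otimes> z \<otimes> c) \<otimes> k"
    using ck carr z by (simp add: inv_mult_group m_assoc)
  show ?thesis unfolding e using Z_inv[OF \<rho>, of c z] Z_inv[OF \<rho>, of k "inv c \<otimes> z \<otimes> c"] ck z by auto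
qed

lemma \<psi>\<rho>_nz: "\<rho> \<in> Rho \<Longrightarrow> z \<in> Z \<Longrightarrow> \<psi>\<rho> \<rho> z * \<psi>\<rho> \<rho> (inv z) = 1"
  using \<psi>\<rho>_mult[of \<rho> z "inv z"] \<psi>\<rho>_one[of \<rho>] inv_mem(4) carr(4) by simp

definition pidata :: "'r \<Rightarrow> nat \<Rightarrow> bool" where
  "pidata \<rho> d \<longleftrightarrow> \<rho> \<in> Rho \<and> irrep (G\<lparr>carrier := K\<rparr>) d (\<pi> \<rho>) \<and>
      contains_char d (\<pi> \<rho>) (G\<lparr>carrier := Z\<rparr>) (\<psi>\<rho> \<rho>) \<and> rep (G\<lparr>carrier := C\<rparr>) d (U \<rho>) \<and>
      (\<forall>g\<in>C. \<forall>x\<in>K. \<pi> \<rho> (inv g \<otimes> x \<otimes> g) = U \<rho> (inv g) * \<pi> \<rho> x * U \<rho> g) \<and>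
      (\<forall>g\<in>C \<inter> K. U \<rho> g = 1\<^sub>m d)"

text \<open>The last clause resolves the description \<open>rho_ext\<close> inside
  \<open>sig\<close>, so that the computations below can be made with a fixed \<rho>.\<close>

definition extends :: "('g \<Rightarrow> complex) \<Rightarrow> 'r \<Rightarrow> bool" where
  "extends \<theta> \<rho> \<longleftrightarrow> (\<forall>x\<in>C. \<forall>y\<in>C. \<theta> (x \<otimes> y) = \<theta> x * \<theta> y) \<and>
    (\<forall>g\<in>C \<inter> K. \<theta> g = \<psi>\<rho> \<rho> g) \<and> rho_ext \<theta> = \<rho>"

context
  fixes \<rho> d
  assumes pd: "pidata \<rho> d"
begin

lemma pidataD:
  shows rho_mem: "\<rho> \<in> Rho" and irrep_pi: "irrep (G\<lparr>carrier := K\<rparr>) d (\<pi> \<rho>)"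
    and cc_pi: "contains_char d (\<pi> \<rho>) (G\<lparr>carrier := Z\<rparr>) (\<psi>\<rho> \<rho>)"
    and rep_U: "rep (G\<lparr>carrier := C\<rparr>) d (U \<rho>)"
    and conj_U: "\<And>g x. g \<in> C \<Longrightarrow> x \<in> K \<Longrightarrow> \<pi> \<rho> (inv g \<otimes> x \<otimes> g) = U \<rho> (inv g) * \<pi> \<rho> x * U \<rho> g"
    and U_CK: "\<And>g. g \<in> C \<inter> K \<Longrightarrow> U \<rho> g = 1\<^sub>m d"
  using pd unfolding pidata_def by auto

lemma pi_facts: "irr d K (\<pi> \<rho>)" "0 < d" "x \<in> K \<Longrightarrow> \<pi> \<rho> x \<in> carrier_mat d d" "\<pi> \<rho> \<one> = 1\<^sub>m d"
  "x \<in> K \<Longrightarrow> y \<in> K \<Longrightarrow> \<pi> \<rho> (x \<otimes> y) = \<pi> \<rho> x * \<pi> \<rho> y"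
  using irrep_pi unfolding irrep_subgroup_iff rep_subgroup_iff by (auto simp: irr_def)

lemma U_facts: "x \<in> C \<Longrightarrow> U \<rho> x \<in> carrier_mat d d" "U \<rho> \<one> = 1\<^sub>m d"
  "x \<in> C \<Longrightarrow> y \<in> C \<Longrightarrow> U \<rho> (x \<otimes> y) = U \<rho> x * U \<rho> y"
  using rep_U unfolding rep_subgroup_iff by auto

lemma U_inv: "x \<in> C \<Longrightarrow> U \<rho> x * U \<rho> (inv x) = 1\<^sub>m d" "x \<in> C \<Longrightarrow> U \<rho> (inv x) * U \<rho> x = 1\<^sub>m d"
  using U_facts(3)[of x "inv x"] U_facts(3)[of "inv x" x] U_facts(2) inv_mem(2) carr(2) by simp_all

lemma pi_Z: "z \<in> Z \<Longrightarrow> \<pi> \<rho> z = \<psi>\<rho> \<rho> z \<cdot>\<^sub>m 1\<^sub>m d"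
  by (rule isotypic_scalar[OF sub(3) irrep_pi ZK _ cc_pi]) (use Z_inv[OF rho_mem] in auto)

text \<open>A commutator z = y x y^-1 x^-1 with \<open>\<psi>\<rho> \<rho>\<close> different from 1
  acts as a scalar, and \<open>\<pi> \<rho> (z \<otimes> x)\<close> is conjugate to
  \<open>\<pi> \<rho> x\<close>; so the trace equals itself times a factor other than 1.\<close>

lemma pi_trace: "x \<in> K \<Longrightarrow> x \<notin> Z \<Longrightarrow> mtr (\<pi> \<rho> x) = 0"
proof -
  assume x: "x \<in> K" "x \<notin> Z"
  obtain y where y: "y \<in> K" "y \<otimes> x \<otimes> inv y \<otimes> inv x \<in> Z" "\<psi>\<rho> \<rho> (y \<otimes> x \<otimes> inv y \<otimes> inv x) \<noteq> 1"
    using noncentral[OF rho_mem x] by blast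
  let ?z = "y \<otimes> x \<otimes> inv y \<otimes> inv x"
  have xy: "x \<in> carrier G" "y \<in> carrier G" using carr(3) x(1) y(1) by blast+
  have e': "?z \<otimes> x = y \<otimes> (x \<otimes> inv y)" using xy by (simp add: m_assoc)
  have k: "x \<otimes> inv y \<in> K" "inv y \<in> K" "?z \<in> K"
    using mult_mem(3)[OF x(1) inv_mem(3)[OF y(1)]] inv_mem(3)[OF y(1)] y(2) ZK by auto
  have "\<psi>\<rho> \<rho> ?z * mtr (\<pi> \<rho> x) = mtr (\<psi>\<rho> \<rho> ?z \<cdot>\<^sub>m \<pi> \<rho> x)" using mtr_smult[OF pi_facts(3)[OF x(1)]] by simp
  also have "\<psi>\<rho> \<rho> ?z \<cdot>\<^sub>m \<pi> \<rho> x = \<pi> \<rho> (?z \<otimes> x)"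
    unfolding pi_facts(5)[OF k(3) x(1)] pi_Z[OF y(2)] by (rule scalar_mat_mult(1)[OF pi_facts(3)[OF x(1)], symmetric])
  also have "\<dots> = \<pi> \<rho> y * \<pi> \<rho> (x \<otimes> inv y)" unfolding e' by (rule pi_facts(5)[OF y(1) k(1)])
  also have "mtr \<dots> = mtr (\<pi> \<rho> (x \<otimes> inv y) * \<pi> \<rho> y)" by (rule mtr_mult_commute[OF pi_facts(3)[OF y(1)] pi_facts(3)[OF k(1)]])
  also have "\<pi> \<rho> (x \<otimes> inv y) * \<pi> \<rho> y = \<pi> \<rho> x" using pi_facts(5)[OF k(1) y(1)] xy by (simp add: m_assoc)
  finally show ?thesis using y(3) by auto
qed

lemma UpiU:
  assumes g: "g \<in> C" and x: "x \<in> K"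
  shows "\<pi> \<rho> x * U \<rho> g = U \<rho> g * \<pi> \<rho> (inv g \<otimes> x \<otimes> g)"
proof -
  have gi: "inv g \<in> C" by (rule inv_mem(2)[OF g])
  note Uc = U_facts(1)[OF g] U_facts(1)[OF gi] pi_facts(3)[OF x]
  have "U \<rho> g * \<pi> \<rho> (inv g \<otimes> x \<otimes> g) = U \<rho> g * (U \<rho> (inv g) * (\<pi> \<rho> x * U \<rho> g))"
    unfolding conj_U[OF g x] assoc_mult_mat[OF Uc(2,3,1)] ..
  also have "\<dots> = U \<rho> g * U \<rho> (inv g) * (\<pi> \<rho> x * U \<rho> g)"
    by (rule assoc_mult_mat[OF Uc(1,2) mult_carrier_mat[OF Uc(3,1)], symmetric])
  also have "\<dots> = \<pi> \<rho> x * U \<rho> g" unfolding U_inv(1)[OF g] by (rule left_mult_one_mat[OF mult_carrier_mat[OF Uc(3,1)]])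
  finally show ?thesis by simp
qed

context
  fixes \<theta>
  assumes ed: "extends \<theta> \<rho>"
begin

lemma \<theta>_mult: "x \<in> C \<Longrightarrow> y \<in> C \<Longrightarrow> \<theta> (x \<otimes> y) = \<theta> x * \<theta> y"
  and \<theta>_\<rho>: "g \<in> C \<inter> K \<Longrightarrow> \<theta> g = \<psi>\<rho> \<rho> g"
  and \<rho>_ext: "rho_ext \<theta> = \<rho>"
  using ed unfolding extends_def by auto

text \<open>Two decompositions differ by some z in \<open>C \<inter> K\<close>. There
  \<open>U\<close> is trivial, \<open>\<pi> \<rho> z\<close> is the scalar
  \<open>\<psi>\<rho> \<rho> z\<close>, and \<open>\<theta> z\<close> is the same number, so moving
  z from one factor to the other changes nothing.\<close>

lemma sig_eq:
  assumes g: "g \<in> C" and h: "h \<in> K"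
  shows "sig \<theta> (g \<otimes> h) = \<theta> g \<cdot>\<^sub>m (U \<rho> g * \<pi> \<rho> h)"
proof -
  let ?P = "\<lambda>M. \<exists>g'\<in>C. \<exists>h'\<in>K. g \<otimes> h = g' \<otimes> h' \<and> M = \<theta> g' \<cdot>\<^sub>m (U \<rho> g' * \<pi> \<rho> h')"
  have "?P (SOME M. ?P M)" by (rule someI_ex) (use g h in blast)
  then obtain g' h' where gh': "g' \<in> C" "h' \<in> K" "g \<otimes> h = g' \<otimes> h'"
    and M: "sig \<theta> (g \<otimes> h) = \<theta> g' \<cdot>\<^sub>m (U \<rho> g' * \<pi> \<rho> h')" unfolding sig_def \<rho>_ext by blast
  define z where "z = inv g' \<otimes> g"
  have gc: "g \<in> carrier G" "h \<in> carrier G" "g' \<in> carrier G" "h' \<in> carrier G" using g h gh' carr by auto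
  have zC: "z \<in> C" using g gh' inv_mem mult_mem by (simp add: z_def)
  have zh: "z = h' \<otimes> inv h"
  proof -
    have "z \<otimes> h = h'" unfolding z_def using gh'(3) gc by (metis inv_closed inv_solve_left m_assoc m_closed)
    thus ?thesis using gc zC carr by (metis inv_solve_right)
  qed
  have zK: "z \<in> K" unfolding zh using gh' h inv_mem mult_mem by blast
  have zZ: "z \<in> Z" using zC zK CKZ by blast
  have g_eq: "g = g' \<otimes> z" unfolding z_def using gc by (simp add: m_assoc[symmetric])
  have h'_eq: "h' = z \<otimes> h" using zh gc by (simp add: m_assoc)
  have "U \<rho> g = U \<rho> g'" unfolding g_eq U_facts(3)[OF gh'(1) zC] U_CK[OF IntI[OF zC zK]]
    by (rule right_mult_one_mat[OF U_facts(1)[OF gh'(1)]])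
  moreover have "\<pi> \<rho> h' = \<psi>\<rho> \<rho> z \<cdot>\<^sub>m \<pi> \<rho> h"
    unfolding h'_eq pi_facts(5)[OF zK h] pi_Z[OF zZ] by (rule scalar_mat_mult(1)[OF pi_facts(3)[OF h]])
  moreover have "\<theta> g = \<theta> g' * \<psi>\<rho> \<rho> z" unfolding g_eq \<theta>_mult[OF gh'(1) zC] \<theta>_\<rho>[OF IntI[OF zC zK]] ..
  ultimately show ?thesis unfolding M
    using mult_smult_distrib[OF U_facts(1)[OF gh'(1)] pi_facts(3)[OF h]] by (simp add: smult_smult_mat)
qed

lemma \<theta>_one: "\<theta> \<one> = 1" using \<theta>_\<rho>[of \<one>] \<psi>\<rho>_one[OF rho_mem] one_mem by simp

lemma sig_K: "h \<in> K \<Longrightarrow> sig \<theta> h = \<pi> \<rho> h"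
  using sig_eq[of \<one> h] one_mem carr \<theta>_one left_mult_one_mat[OF pi_facts(3)] U_facts(2) by simp

lemma sig_C: "g \<in> C \<Longrightarrow> sig \<theta> g = \<theta> g \<cdot>\<^sub>m U \<rho> g"
  using sig_eq[of g \<one>] one_mem carr pi_facts(4) right_mult_one_mat[OF U_facts(1)] by simp

text \<open>\<open>UpiU\<close> moves the \<open>C\<close>-factor of y past the
  \<open>K\<close>-factor of x at the price of a conjugation, exactly as happens in the group
  itself.\<close>

lemma sig_rep: "rep (G\<lparr>carrier := H\<rparr>) d (sig \<theta>)"
  unfolding rep_subgroup_iff
proof (intro conjI ballI)
  show "sig \<theta> \<one> = 1\<^sub>m d" using sig_K[OF one_mem(3)] pi_facts(4) by simp
  fix x y assume x: "x \<in> H" and y: "y \<in> H"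
  obtain g h where gh: "g \<in> C" "h \<in> K" "x = g \<otimes> h" using HCK[OF x] by blast
  obtain g' h' where gh': "g' \<in> C" "h' \<in> K" "y = g' \<otimes> h'" using HCK[OF y] by blast
  note uc = U_facts(1)[OF gh(1)] U_facts(1)[OF gh'(1)] and pc = pi_facts(3)[OF gh(2)] pi_facts(3)[OF gh'(2)]
  show "sig \<theta> x \<in> carrier_mat d d" unfolding gh(3) sig_eq[OF gh(1,2)] using uc pc by simp
  let ?k = "inv g' \<otimes> h \<otimes> g'"
  have k: "?k \<in> K" by (rule CnormK[OF gh'(1) gh(2)])
  have c: "g \<in> carrier G" "h \<in> carrier G" "g' \<in> carrier G" "h' \<in> carrier G" using gh gh' carr by auto
  have xy: "x \<otimes> y = (g \<otimes> g') \<otimes> (?k \<otimes> h')" unfolding gh(3) gh'(3) using c inv_solve_left by (simp add: m_assoc[symmetric]) (simp add: m_assoc)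
  have "sig \<theta> x * sig \<theta> y = \<theta> g \<cdot>\<^sub>m (U \<rho> g * \<pi> \<rho> h) * (\<theta> g' \<cdot>\<^sub>m (U \<rho> g' * \<pi> \<rho> h'))"
    unfolding gh(3) gh'(3) sig_eq[OF gh(1,2)] sig_eq[OF gh'(1,2)] ..
  also have "\<dots> = (\<theta> g * \<theta> g') \<cdot>\<^sub>m (U \<rho> g * \<pi> \<rho> h * (U \<rho> g' * \<pi> \<rho> h'))"
    using mult_smult_assoc_mat[OF mult_carrier_mat[OF uc(1) pc(1)] smult_carrier_mat[OF mult_carrier_mat[OF uc(2) pc(2)]]]
      mult_smult_distrib[OF mult_carrier_mat[OF uc(1) pc(1)] mult_carrier_mat[OF uc(2) pc(2)]] by (simp add: smult_smult_mat)
  also have "U \<rho> g * \<pi> \<rho> h * (U \<rho> g' * \<pi> \<rho> h') = U \<rho> g * (\<pi> \<rho> h * U \<rho> g') * \<pi> \<rho> h'"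
    using uc pc by (simp add: assoc_mult_mat[of _ d d _ d _ d])
  also have "\<pi> \<rho> h * U \<rho> g' = U \<rho> g' * \<pi> \<rho> ?k" by (rule UpiU[OF gh'(1) gh(2)])
  also have "U \<rho> g * (U \<rho> g' * \<pi> \<rho> ?k) * \<pi> \<rho> h' = (U \<rho> g * U \<rho> g') * (\<pi> \<rho> ?k * \<pi> \<rho> h')"
    using uc pc pi_facts(3)[OF k] by (simp add: assoc_mult_mat[of _ d d _ d _ d])
  also have "(\<theta> g * \<theta> g') \<cdot>\<^sub>m \<dots> = sig \<theta> (x \<otimes> y)"
    unfolding xy sig_eq[OF mult_mem(2)[OF gh(1) gh'(1)] mult_mem(3)[OF k gh'(2)]] U_facts(3)[OF gh(1) gh'(1)]
      pi_facts(5)[OF k gh'(2)] \<theta>_mult[OF gh(1) gh'(1)] ..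
  finally show "sig \<theta> (x \<otimes> y) = sig \<theta> x * sig \<theta> y" by simp
qed

text \<open>The restriction to \<open>K\<close> is \<open>\<pi> \<rho>\<close>, which is irreducible
  already.\<close>

lemma sig_irr: "irr d H (sig \<theta>)"
proof (rule irr_mono[OF irr_cong[OF pi_facts(1)] KH])
  show "sig \<theta> x = \<pi> \<rho> x" if "x \<in> K" for x by (rule sig_K[OF that])
  show "sig \<theta> x \<in> carrier_mat d d" if "x \<in> H" for x using sig_rep that unfolding rep_subgroup_iff by blast
qed

lemma sig_contains: "contains_char d (sig \<theta>) (G\<lparr>carrier := L\<rparr>) \<psi>"
  unfolding contains_char_def
proof (intro bexI conjI ballI)
  show "unit_vec d 0 \<in> carrier_vec d" "unit_vec d 0 \<noteq> 0\<^sub>v d" using pi_facts(2) by auto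
  fix x assume "x \<in> carrier (G\<lparr>carrier := L\<rparr>)"
  hence x: "x \<in> L" by simp
  have xZ: "x \<in> Z" "x \<in> K" using x LZ ZK by auto
  have "sig \<theta> x = \<psi> x \<cdot>\<^sub>m 1\<^sub>m d" using sig_K[OF xZ(2)] pi_Z[OF xZ(1)] \<psi>\<rho>_L[OF rho_mem x] by simp
  thus "sig \<theta> x *\<^sub>v unit_vec d 0 = \<psi> x \<cdot>\<^sub>v unit_vec d 0" by (simp add: smult_mat_mult_vec[of "1\<^sub>m d" d d])
qed

end

text \<open>For an irreducible \<open>\<sigma>\<close> on which \<open>Z\<close> acts by \<open>\<psi>\<rho> \<rho>\<close>, the space of \<open>K\<close>-intertwiners from \<open>\<pi> \<rho>\<close> is
  non-zero by a trace computation, and evaluation at a \<open>U(C)\<close>-eigenvector embeds it as a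
  \<open>C\<close>-stable subspace of the space of \<open>\<sigma>\<close>.\<close>

lemma intertwiner_eigen:
  assumes \<sigma>: "irrep (G\<lparr>carrier := H\<rparr>) e \<sigma>" and \<sigma>Z: "\<And>z. z \<in> Z \<Longrightarrow> \<sigma> z = \<psi>\<rho> \<rho> z \<cdot>\<^sub>m 1\<^sub>m e"
  obtains T \<theta> where "T \<in> carrier_mat e d" "T \<noteq> 0\<^sub>m e d" "\<And>x. x \<in> K \<Longrightarrow> \<sigma> x * T = T * \<pi> \<rho> x"
    "\<And>g. g \<in> C \<Longrightarrow> \<sigma> g * T = \<theta> g \<cdot>\<^sub>m (T * U \<rho> g)"
proof -
  have \<sigma>i: "irr e H \<sigma>" and \<sigma>r: "rep (G\<lparr>carrier := H\<rparr>) e \<sigma>" using \<sigma> by (simp_all add: irrep_subgroup_iff)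
  note \<sigma>rr = \<sigma>r[unfolded rep_subgroup_iff]
  have \<sigma>c: "\<sigma> x \<in> carrier_mat e e" if "x \<in> H" for x using \<sigma>rr that by blast
  have \<sigma>m: "\<sigma> (x \<otimes> y) = \<sigma> x * \<sigma> y" if "x \<in> H" "y \<in> H" for x y using \<sigma>rr that by blast
  have epos: "0 < e" using \<sigma>i by (simp add: irr_def)
  have KHx: "x \<in> H" if "x \<in> K" for x using KH that by blast
  have CHx: "x \<in> H" if "x \<in> C" for x using CH that by blast
  define M where "M = {T \<in> carrier_mat e d. \<forall>x\<in>K. \<sigma> x * T = T * \<pi> \<rho> x}"
  have Mc: "T \<in> carrier_mat e d" and Mi: "x \<in> K \<Longrightarrow> \<sigma> x * T = T * \<pi> \<rho> x" if "T \<in> M" for T x using that by (auto simp: M_def)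
  \<comment> \<open>Off \<open>Z\<close> the trace of \<open>\<pi> \<rho>\<close> vanishes; on
    \<open>Z\<close> the scalars \<open>\<psi>\<rho> \<rho> x\<close> and
    \<open>\<psi>\<rho> \<rho> (inv x)\<close> cancel, so each term is e d.\<close>
  have "(\<Sum>x\<in>K. mtr (\<sigma> x) * mtr (\<pi> \<rho> (inv x))) = (\<Sum>x\<in>K. if x \<in> Z then of_nat e * of_nat d else 0)"
  proof (rule sum.cong[OF refl])
    fix x assume x: "x \<in> K"
    show "mtr (\<sigma> x) * mtr (\<pi> \<rho> (inv x)) = (if x \<in> Z then of_nat e * of_nat d else 0)"
    proof (cases "x \<in> Z")
      case True
      have "\<psi>\<rho> \<rho> x * \<psi>\<rho> \<rho> (inv x) = 1" by (rule \<psi>\<rho>_nz[OF rho_mem True])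
      thus ?thesis using True \<sigma>Z[OF True] pi_Z[OF inv_mem(4)[OF True]] mtr_smult[of "1\<^sub>m e" e] mtr_smult[of "1\<^sub>m d" d]
        by (simp add: mtr_one)
    next
      case False
      have "inv x \<notin> Z" using False inv_mem(4)[of "inv x"] x carr by auto
      thus ?thesis using pi_trace[OF inv_mem(3)[OF x]] False by simp
    qed
  qed
  also have "\<dots> = (\<Sum>x\<in>Z. of_nat e * of_nat d)" using finite_K ZK by (simp add: sum.If_cases Int_absorb1)
  finally have "(\<Sum>x\<in>K. mtr (\<sigma> x) * mtr (\<pi> \<rho> (inv x))) \<noteq> 0"
    using epos pi_facts(2) finite_K one_mem(4) by auto
  then obtain A where A: "A \<in> carrier_mat e d" "msum e d (\<lambda>x. \<sigma> x * A * \<pi> \<rho> (inv x)) K \<noteq> 0\<^sub>m e d"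
    by (rule nonzero_average[of K \<sigma> e "\<lambda>x. \<pi> \<rho> (inv x)" d, rotated 2]) (use \<sigma>c KHx pi_facts(3) inv_mem(3) in auto)
  define T0 where "T0 = msum e d (\<lambda>x. \<sigma> x * A * \<pi> \<rho> (inv x)) K"
  have T0c: "T0 \<in> carrier_mat e d" and T0nz: "T0 \<noteq> 0\<^sub>m e d" using A by (simp_all add: T0_def)
  have summand: "\<sigma> x * A * \<pi> \<rho> (inv x) \<in> carrier_mat e d" if "x \<in> K" for x
    using mult_carrier_mat[OF mult_carrier_mat[OF \<sigma>c[OF KHx[OF that]] A(1)] pi_facts(3)[OF inv_mem(3)[OF that]]] .
  have "\<sigma> u * T0 = T0 * \<pi> \<rho> u" if u: "u \<in> K" for u
  proof -
    have bij: "bij_betw (\<lambda>x. inv u \<otimes> x) K K"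
      by (rule bij_betw_byWitness[of _ "\<lambda>x. u \<otimes> x"]) (use u carr inv_mem mult_mem in \<open>auto simp: m_assoc[symmetric]\<close>)
    have "\<sigma> u * T0 = msum e d (\<lambda>x. \<sigma> u * (\<sigma> x * A * \<pi> \<rho> (inv x))) K"
      unfolding T0_def by (rule mult_msum[OF \<sigma>c[OF KHx[OF u]] summand])
    also have "\<dots> = msum e d (\<lambda>x. \<sigma> u * (\<sigma> (inv u \<otimes> x) * A * \<pi> \<rho> (inv (inv u \<otimes> x)))) K" by (rule msum_reindex[OF bij])
    also have "\<dots> = msum e d (\<lambda>x. \<sigma> x * A * \<pi> \<rho> (inv x) * \<pi> \<rho> u) K"
    proof (rule msum_cong)
      fix x assume x: "x \<in> K"
      have y: "inv u \<otimes> x \<in> K" and xi: "inv x \<in> K" using u x inv_mem mult_mem by auto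
      have e: "u \<otimes> (inv u \<otimes> x) = x" using u x carr by (simp add: m_assoc[symmetric])
      have e2: "inv (inv u \<otimes> x) = inv x \<otimes> u" using u x carr by (simp add: inv_mult_group)
      note cs = \<sigma>c[OF KHx[OF u]] \<sigma>c[OF KHx[OF y]] \<sigma>c[OF KHx[OF x]] A(1) pi_facts(3)[OF xi] pi_facts(3)[OF u]
      have "\<sigma> u * (\<sigma> (inv u \<otimes> x) * A * \<pi> \<rho> (inv (inv u \<otimes> x))) = \<sigma> u * (\<sigma> (inv u \<otimes> x) * A * (\<pi> \<rho> (inv x) * \<pi> \<rho> u))"
        unfolding e2 pi_facts(5)[OF xi u] ..
      also have "\<dots> = (\<sigma> u * \<sigma> (inv u \<otimes> x)) * A * (\<pi> \<rho> (inv x) * \<pi> \<rho> u)"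
        unfolding assoc_mult_mat[OF cs(1) mult_carrier_mat[OF cs(2,4)] mult_carrier_mat[OF cs(5,6)], symmetric]
          assoc_mult_mat[OF cs(1,2,4), symmetric] ..
      also have "\<sigma> u * \<sigma> (inv u \<otimes> x) = \<sigma> x" using \<sigma>m[OF KHx[OF u] KHx[OF y]] e by simp
      also have "\<sigma> x * A * (\<pi> \<rho> (inv x) * \<pi> \<rho> u) = \<sigma> x * A * \<pi> \<rho> (inv x) * \<pi> \<rho> u"
        by (rule assoc_mult_mat[OF mult_carrier_mat[OF cs(3,4)] cs(5,6), symmetric])
      finally show "\<sigma> u * (\<sigma> (inv u \<otimes> x) * A * \<pi> \<rho> (inv (inv u \<otimes> x))) = \<sigma> x * A * \<pi> \<rho> (inv x) * \<pi> \<rho> u" .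
    qed
    also have "\<dots> = T0 * \<pi> \<rho> u" unfolding T0_def by (rule msum_mult[OF pi_facts(3)[OF u] summand, symmetric])
    finally show ?thesis .
  qed
  hence T0M: "T0 \<in> M" using T0c by (simp add: M_def)
  \<comment> \<open>A common eigenvector of \<open>U\<close>, which exists because \<open>C\<close>
    is commutative; its eigenvalues \<mu> are divided out at the end.\<close>
  obtain u where u: "u \<in> carrier_vec d" "u \<noteq> 0\<^sub>v d" "\<And>g. g \<in> C \<Longrightarrow> \<exists>c. U \<rho> g *\<^sub>v u = c \<cdot>\<^sub>v u"
  proof (rule common_eigenvector[of "carrier_vec d" d C "U \<rho>"])
    show "VectorSpace.subspace class_ring (carrier_vec d) (module_vec TYPE(complex) d)" unfolding subspace_module_vec_iff by simp
    show "carrier_vec d \<noteq> {0\<^sub>v d :: complex vec}"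
      by (metis insertI1 pi_facts(2) singletonD unit_vec_carrier unit_vec_nonzero)
    show "U \<rho> x * U \<rho> y = U \<rho> y * U \<rho> x" if "x \<in> C" "y \<in> C" for x y
      using U_facts(3)[OF that] U_facts(3)[OF that(2,1)] Ccomm[OF that] by simp
    show "U \<rho> x *\<^sub>v w \<in> carrier_vec d" if "x \<in> C" "w \<in> carrier_vec d" for x w
      by (rule mult_mat_vec_carrier[OF U_facts(1)[OF that(1)] that(2)])
  qed (use U_facts(1) in blast)+
  then obtain \<mu> where \<mu>: "\<And>g. g \<in> C \<Longrightarrow> U \<rho> g *\<^sub>v u = \<mu> g \<cdot>\<^sub>v u" by metis
  have \<mu>nz: "\<mu> g \<noteq> 0" if g: "g \<in> C" for g
  proof
    assume z: "\<mu> g = 0"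
    have "u = U \<rho> (inv g) * U \<rho> g *\<^sub>v u" using U_inv(2)[OF g] u by simp
    also have "\<dots> = U \<rho> (inv g) *\<^sub>v (\<mu> g \<cdot>\<^sub>v u)"
      using assoc_mult_mat_vec[OF U_facts(1)[OF inv_mem(2)[OF g]] U_facts(1)[OF g] u(1)] \<mu>[OF g] by simp
    also have "\<dots> = 0\<^sub>v d" using z mult_mat_vec[OF U_facts(1)[OF inv_mem(2)[OF g]] u(1), of 0] U_facts(1)[OF inv_mem(2)[OF g]] u(1)
      by (auto intro!: eq_vecI)
    finally show False using u by simp
  qed
  \<comment> \<open>The kernel of an intertwiner is stable under the irreducible
    \<open>\<pi> \<rho>\<close>, so it is everything once it contains the nonzero
    \<open>u\<close>.\<close>
  have inj: "T = 0\<^sub>m e d" if T: "T \<in> M" and Tu: "T *\<^sub>v u = 0\<^sub>v e" for T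
  proof -
    let ?N = "{w \<in> carrier_vec d. T *\<^sub>v w = 0\<^sub>v e}"
    note Tc = Mc[OF T]
    have "?N = {0\<^sub>v d} \<or> ?N = carrier_vec d"
    proof (rule irrD[OF pi_facts(1)])
      show "0\<^sub>v d \<in> ?N" using Tc by (auto simp: mult_mat_vec_def intro!: eq_vecI)
      show "v + w \<in> ?N" if "v \<in> ?N" "w \<in> ?N" for v w using that mult_add_distrib_mat_vec[OF Tc, of v w] by simp
      show "c \<cdot>\<^sub>v v \<in> ?N" if "v \<in> ?N" for c v using that mult_mat_vec[OF Tc, of v c] by (auto intro!: eq_vecI)
      show "\<pi> \<rho> x *\<^sub>v w \<in> ?N" if x: "x \<in> K" and w: "w \<in> ?N" for x w
      proof -
        have wc: "w \<in> carrier_vec d" using w by simp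
        have "T *\<^sub>v (\<pi> \<rho> x *\<^sub>v w) = T * \<pi> \<rho> x *\<^sub>v w" by (rule assoc_mult_mat_vec[OF Tc pi_facts(3)[OF x] wc, symmetric])
        also have "\<dots> = \<sigma> x *\<^sub>v (T *\<^sub>v w)" unfolding Mi[OF T x, symmetric] by (rule assoc_mult_mat_vec[OF \<sigma>c[OF KHx[OF x]] Tc wc])
        also have "\<dots> = 0\<^sub>v e" using w \<sigma>c[OF KHx[OF x]] by (auto simp: mult_mat_vec_def intro!: eq_vecI)
        finally show ?thesis using pi_facts(3)[OF x] wc by auto
      qed
    qed auto
    moreover have "u \<in> ?N" using u Tu by simp
    ultimately have N: "?N = carrier_vec d" using u(2) by auto
    show ?thesis
    proof (rule mat_eq_vecI[OF Tc])
      fix w :: "complex vec" assume w: "w \<in> carrier_vec d"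
      hence "w \<in> ?N" using N by simp
      thus "T *\<^sub>v w = 0\<^sub>m e d *\<^sub>v w" using w by (auto simp: mult_mat_vec_def intro!: eq_vecI)
    qed simp
  qed
  \<comment> \<open>The action of g on intertwiners; \<open>U\<close> enters because conjugation by
    g alters \<open>\<pi> \<rho>\<close>. Under evaluation at \<open>u\<close> it becomes
    \<open>\<sigma> g\<close> up to the factor 1/\<mu>.\<close>
  define tw where "tw g T = \<sigma> g * T * U \<rho> (inv g)" for g T
  have twM: "tw g T \<in> M" and twu: "tw g T *\<^sub>v u = (1 / \<mu> g) \<cdot>\<^sub>v (\<sigma> g *\<^sub>v (T *\<^sub>v u))"
    if g: "g \<in> C" and T: "T \<in> M" for g T
  proof -
    have gi: "inv g \<in> C" by (rule inv_mem(2)[OF g])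
    note Tc = Mc[OF T] and sc = \<sigma>c[OF CHx[OF g]] and uc = U_facts(1)[OF gi]
    have sT: "\<sigma> g * T \<in> carrier_mat e d" by (rule mult_carrier_mat[OF sc Tc])
    have twc: "tw g T \<in> carrier_mat e d" unfolding tw_def by (rule mult_carrier_mat[OF sT uc])
    have "\<sigma> x * tw g T = tw g T * \<pi> \<rho> x" if x: "x \<in> K" for x
    proof -
      let ?y = "inv g \<otimes> x \<otimes> g"
      have y: "?y \<in> K" by (rule CnormK[OF g x])
      have gc: "g \<in> carrier G" "x \<in> carrier G" using g x carr by auto
      have xg: "x \<otimes> g = g \<otimes> ?y" using gc by (simp add: m_assoc[symmetric])
      have s: "\<sigma> x * \<sigma> g = \<sigma> g * \<sigma> ?y" using \<sigma>m[OF KHx[OF x] CHx[OF g]] \<sigma>m[OF CHx[OF g] KHx[OF y]] xg by simp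
      have y': "inv (inv g) \<otimes> ?y \<otimes> inv g = x" using gc by (simp add: m_assoc[symmetric]) (simp add: m_assoc)
      have pu: "\<pi> \<rho> ?y * U \<rho> (inv g) = U \<rho> (inv g) * \<pi> \<rho> x" using UpiU[OF gi y] y' by simp
      note xs = \<sigma>c[OF KHx[OF x]] and ys = \<sigma>c[OF KHx[OF y]] and yp = pi_facts(3)[OF y] and xp = pi_facts(3)[OF x]
      have "\<sigma> x * tw g T = \<sigma> x * \<sigma> g * T * U \<rho> (inv g)"
        unfolding tw_def assoc_mult_mat[OF xs sT uc, symmetric] assoc_mult_mat[OF xs sc Tc, symmetric] ..
      also have "\<dots> = \<sigma> g * (T * \<pi> \<rho> ?y) * U \<rho> (inv g)"
        unfolding s Mi[OF T y, symmetric] assoc_mult_mat[OF sc ys Tc] ..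
      also have "\<dots> = \<sigma> g * T * (\<pi> \<rho> ?y * U \<rho> (inv g))"
        unfolding assoc_mult_mat[OF sc Tc yp, symmetric] assoc_mult_mat[OF sT yp uc] ..
      also have "\<dots> = tw g T * \<pi> \<rho> x" unfolding pu tw_def assoc_mult_mat[OF sT uc xp] ..
      finally show ?thesis .
    qed
    thus "tw g T \<in> M" using twc by (simp add: M_def)
    have m: "U \<rho> (inv g) *\<^sub>v u = (1 / \<mu> g) \<cdot>\<^sub>v u"
    proof -
      have "u = U \<rho> (inv g) * U \<rho> g *\<^sub>v u" using U_inv(2)[OF g] u by simp
      also have "\<dots> = U \<rho> (inv g) *\<^sub>v (\<mu> g \<cdot>\<^sub>v u)"
        using assoc_mult_mat_vec[OF uc U_facts(1)[OF g] u(1)] \<mu>[OF g] by simp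
      also have "\<dots> = \<mu> g \<cdot>\<^sub>v (U \<rho> (inv g) *\<^sub>v u)" by (rule mult_mat_vec[OF uc u(1)])
      finally have "(1 / \<mu> g) \<cdot>\<^sub>v u = (1 / \<mu> g) \<cdot>\<^sub>v (\<mu> g \<cdot>\<^sub>v (U \<rho> (inv g) *\<^sub>v u))" by simp
      thus ?thesis using \<mu>nz[OF g] by (simp add: smult_smult_assoc)
    qed
    have "tw g T *\<^sub>v u = \<sigma> g * T *\<^sub>v ((1 / \<mu> g) \<cdot>\<^sub>v u)" unfolding tw_def m[symmetric] by (rule assoc_mult_mat_vec[OF sT uc u(1)])
    also have "\<dots> = (1 / \<mu> g) \<cdot>\<^sub>v (\<sigma> g * T *\<^sub>v u)" by (rule mult_mat_vec[OF sT u(1)])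
    also have "\<sigma> g * T *\<^sub>v u = \<sigma> g *\<^sub>v (T *\<^sub>v u)" by (rule assoc_mult_mat_vec[OF sc Tc u(1)])
    finally show "tw g T *\<^sub>v u = (1 / \<mu> g) \<cdot>\<^sub>v (\<sigma> g *\<^sub>v (T *\<^sub>v u))" .
  qed
  have Madd: "S + T \<in> M" if S: "S \<in> M" and T: "T \<in> M" for S T
  proof -
    have "\<sigma> x * (S + T) = (S + T) * \<pi> \<rho> x" if x: "x \<in> K" for x
      unfolding mult_add_distrib_mat[OF \<sigma>c[OF KHx[OF x]] Mc[OF S] Mc[OF T]] add_mult_distrib_mat[OF Mc[OF S] Mc[OF T] pi_facts(3)[OF x]]
        Mi[OF S x] Mi[OF T x] ..
    thus ?thesis using Mc[OF S] Mc[OF T] by (simp add: M_def)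
  qed
  have Msmult: "c \<cdot>\<^sub>m T \<in> M" if T: "T \<in> M" for c T
  proof -
    have "\<sigma> x * (c \<cdot>\<^sub>m T) = (c \<cdot>\<^sub>m T) * \<pi> \<rho> x" if x: "x \<in> K" for x
      unfolding mult_smult_distrib[OF \<sigma>c[OF KHx[OF x]] Mc[OF T]] mult_smult_assoc_mat[OF Mc[OF T] pi_facts(3)[OF x]] Mi[OF T x] ..
    thus ?thesis using Mc[OF T] by (simp add: M_def)
  qed
  let ?W = "(\<lambda>T. T *\<^sub>v u) ` M"
  have W0: "0\<^sub>v e \<in> ?W"
  proof -
    have "0 \<cdot>\<^sub>m T0 *\<^sub>v u = 0\<^sub>v e" using T0c u(1) by (auto simp: smult_mat_mult_vec[OF T0c u(1)] intro!: eq_vecI)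
    thus ?thesis using Msmult[OF T0M, of 0] by (metis imageI)
  qed
  have Wsub: "VectorSpace.subspace class_ring ?W (module_vec TYPE(complex) e)"
    unfolding subspace_module_vec_iff
  proof (intro conjI ballI allI)
    show "?W \<subseteq> carrier_vec e" using Mc u(1) by (auto simp del: mult_mat_vec_carrier intro!: mult_mat_vec_carrier)
    show "v + w \<in> ?W" if vw: "v \<in> ?W" "w \<in> ?W" for v w
    proof -
      obtain S T where ST: "S \<in> M" "T \<in> M" "v = S *\<^sub>v u" "w = T *\<^sub>v u" using vw by auto
      have "v + w = (S + T) *\<^sub>v u" unfolding ST using add_mult_distrib_mat_vec[OF Mc[OF ST(1)] Mc[OF ST(2)] u(1)] by simp
      thus ?thesis using Madd[OF ST(1,2)] by blast
    qed
    show "c \<cdot>\<^sub>v v \<in> ?W" if v: "v \<in> ?W" for c v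
    proof -
      obtain T where T: "T \<in> M" "v = T *\<^sub>v u" using v by auto
      have "c \<cdot>\<^sub>v v = (c \<cdot>\<^sub>m T) *\<^sub>v u" unfolding T using smult_mat_mult_vec[OF Mc[OF T(1)] u(1)] by simp
      thus ?thesis using Msmult[OF T(1)] by blast
    qed
  qed (rule W0)
  have "T0 *\<^sub>v u \<noteq> 0\<^sub>v e" using inj[OF T0M] T0nz by blast
  hence Wnz: "?W \<noteq> {0\<^sub>v e}" using T0M by auto
  have Wstab: "\<sigma> g *\<^sub>v w \<in> ?W" if g: "g \<in> C" and w: "w \<in> ?W" for g w
  proof -
    obtain T where T: "T \<in> M" "w = T *\<^sub>v u" using w by auto
    have "\<sigma> g *\<^sub>v w = \<mu> g \<cdot>\<^sub>v (tw g T *\<^sub>v u)" unfolding twu[OF g T(1)] T(2) using \<mu>nz[OF g] by (simp add: smult_smult_assoc)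
    also have "\<dots> = (\<mu> g \<cdot>\<^sub>m tw g T) *\<^sub>v u" using smult_mat_mult_vec[OF Mc[OF twM[OF g T(1)]] u(1)] by simp
    finally show ?thesis using Msmult[OF twM[OF g T(1)]] by blast
  qed
  obtain w where w: "w \<in> ?W" "w \<noteq> 0\<^sub>v e" "\<And>g. g \<in> C \<Longrightarrow> \<exists>c. \<sigma> g *\<^sub>v w = c \<cdot>\<^sub>v w"
  proof (rule common_eigenvector[OF Wsub Wnz, of C \<sigma>])
    show "\<sigma> x * \<sigma> y = \<sigma> y * \<sigma> x" if "x \<in> C" "y \<in> C" for x y
      using \<sigma>m[OF CHx[OF that(1)] CHx[OF that(2)]] \<sigma>m[OF CHx[OF that(2)] CHx[OF that(1)]] Ccomm[OF that] by simp
  qed (use \<sigma>c CHx Wstab in auto)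
  then obtain \<nu> where \<nu>: "\<And>g. g \<in> C \<Longrightarrow> \<sigma> g *\<^sub>v w = \<nu> g \<cdot>\<^sub>v w" by metis
  obtain T where T: "T \<in> M" "w = T *\<^sub>v u" using w(1) by auto
  note Tc = Mc[OF T(1)]
  \<comment> \<open>\<open>tw g T\<close> and the multiple of \<open>T\<close> by \<nu>/\<mu> are
    intertwiners with the same value at \<open>u\<close>, so \<open>inj\<close> identifies them. The
    character sought is \<nu>/\<mu>.\<close>
  have fin: "\<sigma> g * T = (\<nu> g / \<mu> g) \<cdot>\<^sub>m (T * U \<rho> g)" if g: "g \<in> C" for g
  proof -
    have gi: "inv g \<in> C" by (rule inv_mem(2)[OF g])
    let ?c = "\<nu> g / \<mu> g"
    have DM: "tw g T + (- ?c) \<cdot>\<^sub>m T \<in> M" by (rule Madd[OF twM[OF g T(1)] Msmult[OF T(1)]])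
    have "(tw g T + (- ?c) \<cdot>\<^sub>m T) *\<^sub>v u = tw g T *\<^sub>v u + (- ?c) \<cdot>\<^sub>v (T *\<^sub>v u)"
      using add_mult_distrib_mat_vec[OF Mc[OF twM[OF g T(1)]] Mc[OF Msmult[OF T(1)]] u(1), of "- ?c"]
        smult_mat_mult_vec[OF Tc u(1)] by simp
    also have "tw g T *\<^sub>v u = ?c \<cdot>\<^sub>v (T *\<^sub>v u)"
      unfolding twu[OF g T(1)] using \<nu>[OF g] T(2) by (simp add: smult_smult_assoc)
    also have "?c \<cdot>\<^sub>v (T *\<^sub>v u) + (- ?c) \<cdot>\<^sub>v (T *\<^sub>v u) = 0\<^sub>v e"
      using Tc u(1) by (auto intro!: eq_vecI)
    finally have z: "tw g T + (- ?c) \<cdot>\<^sub>m T = 0\<^sub>m e d" by (rule inj[OF DM])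
    have twT: "tw g T = ?c \<cdot>\<^sub>m T"
    proof (rule eq_matI)
      fix i j assume ij: "i < dim_row (?c \<cdot>\<^sub>m T)" "j < dim_col (?c \<cdot>\<^sub>m T)"
      have "(tw g T + (- ?c) \<cdot>\<^sub>m T) $$ (i,j) = 0" unfolding z using ij Tc by simp
      thus "tw g T $$ (i,j) = (?c \<cdot>\<^sub>m T) $$ (i,j)" using ij Tc Mc[OF twM[OF g T(1)]] by simp
    qed (use Tc Mc[OF twM[OF g T(1)]] in auto)
    have sT: "\<sigma> g * T \<in> carrier_mat e d" by (rule mult_carrier_mat[OF \<sigma>c[OF CHx[OF g]] Tc])
    have "\<sigma> g * T = \<sigma> g * T * (U \<rho> (inv g) * U \<rho> g)" unfolding U_inv(2)[OF g] by (rule right_mult_one_mat[OF sT, symmetric])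
    also have "\<dots> = tw g T * U \<rho> g" unfolding tw_def by (rule assoc_mult_mat[OF sT U_facts(1)[OF gi] U_facts(1)[OF g], symmetric])
    also have "\<dots> = ?c \<cdot>\<^sub>m (T * U \<rho> g)" unfolding twT by (rule mult_smult_assoc_mat[OF Tc U_facts(1)[OF g]])
    finally show ?thesis .
  qed
  have "T \<noteq> 0\<^sub>m e d"
  proof
    assume "T = 0\<^sub>m e d"
    hence "w = 0\<^sub>v e" unfolding T(2) using u(1) by (auto simp: mult_mat_vec_def intro!: eq_vecI)
    thus False using w(2) by simp
  qed
  thus ?thesis by (rule that[OF Tc _ Mi[OF T(1)] fin])
qed

end

lemma pi_obtain:
  assumes "\<rho> \<in> Rho"
  obtains d where "pidata \<rho> d"
  using pi_data[OF assms] assms unfolding pidata_def by blast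

lemma ThetasD:
  assumes "\<theta> \<in> Thetas"
  shows "\<And>x y. x \<in> C \<Longrightarrow> y \<in> C \<Longrightarrow> \<theta> (x \<otimes> y) = \<theta> x * \<theta> y" "\<And>x. x \<in> C \<inter> L \<Longrightarrow> \<theta> x = \<psi> x" "\<theta> \<in> extensional C"
  using assms by (auto simp: Thetas_def dual_def hom_def complex_units_def)

lemma rho_ext:
  assumes "\<theta> \<in> Thetas"
  shows "rho_ext \<theta> \<in> Rho" "\<And>g. g \<in> C \<inter> K \<Longrightarrow> \<theta> g = \<psi>\<rho> (rho_ext \<theta>) g"
proof -
  have "\<exists>!\<rho>. \<rho> \<in> Rho \<and> (\<forall>g\<in>C \<inter> K. \<theta> g = \<psi>\<rho> \<rho> g)" by (rule extension) (use ThetasD[OF assms] in auto)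
  from theI'[OF this] show "rho_ext \<theta> \<in> Rho" "\<And>g. g \<in> C \<inter> K \<Longrightarrow> \<theta> g = \<psi>\<rho> (rho_ext \<theta>) g"
    unfolding rho_ext_def by auto
qed

lemma rho_ext_eq:
  assumes \<theta>: "\<theta> \<in> Thetas" and "\<rho> \<in> Rho" "\<And>g. g \<in> C \<inter> K \<Longrightarrow> \<theta> g = \<psi>\<rho> \<rho> g"
  shows "rho_ext \<theta> = \<rho>"
proof -
  have "\<exists>!\<rho>. \<rho> \<in> Rho \<and> (\<forall>g\<in>C \<inter> K. \<theta> g = \<psi>\<rho> \<rho> g)" by (rule extension) (use ThetasD[OF \<theta>] in auto)
  from the1_equality[OF this] show ?thesis unfolding rho_ext_def using assms by blast
qed

lemma extends_rho_ext: "\<theta> \<in> Thetas \<Longrightarrow> extends \<theta> (rho_ext \<theta>)"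
  unfolding extends_def using ThetasD(1) rho_ext(2) by blast

text \<open>An isomorphism \<open>P\<close> compares two scalars on \<open>C \<inter> K\<close>, so
  the indices \<rho> agree; it then commutes with the irreducible representation of
  \<open>K\<close>, so it is a scalar itself, and comparison on \<open>C\<close> with the same
  invertible \<open>U\<close> gives equality.\<close>

lemma sig_injective:
  assumes 1: "\<theta>1 \<in> Thetas" and 2: "\<theta>2 \<in> Thetas"
    and eq: "iso_class (G\<lparr>carrier := H\<rparr>) (sig \<theta>1) = iso_class (G\<lparr>carrier := H\<rparr>) (sig \<theta>2)"
  shows "\<theta>1 = \<theta>2"
proof -
  let ?H = "G\<lparr>carrier := H\<rparr>"
  obtain d1 where d1: "pidata (rho_ext \<theta>1) d1" by (rule pi_obtain[OF rho_ext(1)[OF 1]])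
  obtain d2 where d2: "pidata (rho_ext \<theta>2) d2" by (rule pi_obtain[OF rho_ext(1)[OF 2]])
  note f1 = d1 extends_rho_ext[OF 1]
  note f2 = d2 extends_rho_ext[OF 2]
  have r1: "rep ?H d1 (sig \<theta>1)" and r2: "rep ?H d2 (sig \<theta>2)" by (rule sig_rep[OF f1]) (rule sig_rep[OF f2])
  have "sig \<theta>2 \<in> iso_class ?H (sig \<theta>1)" unfolding eq by (rule iso_class_refl[OF r2])
  then obtain e P where e: "rep ?H e (sig \<theta>1)" "rep ?H e (sig \<theta>2)" and P0: "P \<in> carrier_mat e e" "invertible_mat P"
    and int: "\<And>x. x \<in> H \<Longrightarrow> P * sig \<theta>1 x = sig \<theta>2 x * P" unfolding iso_class_def by auto
  have de: "d2 = d1" "e = d1" using rep_dim_unique[OF e(1) r1] rep_dim_unique[OF e(2) r2] by auto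
  have P: "P \<in> carrier_mat d1 d1" using P0 de by simp
  have d1pos: "0 < d1" by (rule pi_facts(2)[OF d1])
  obtain Q where Q: "Q \<in> carrier_mat d1 d1" "P * Q = 1\<^sub>m d1" by (rule invertible_mat_obtain[OF P0(2) P])
  have Pnz: "P \<noteq> 0\<^sub>m d1 d1"
  proof
    assume "P = 0\<^sub>m d1 d1"
    hence "(1\<^sub>m d1 :: complex mat) = 0\<^sub>m d1 d1" using Q by simp
    thus False using one_mat_nonzero[OF d1pos] by simp
  qed
  have eqCK: "\<theta>1 g = \<theta>2 g" if g: "g \<in> C \<inter> K" for g
  proof -
    have gZ: "g \<in> Z" "g \<in> K" "g \<in> H" using g CKZ KH by auto
    have s1: "sig \<theta>1 g = \<theta>1 g \<cdot>\<^sub>m 1\<^sub>m d1"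
      using sig_K[OF f1 gZ(2)] pi_Z[OF f1(1) gZ(1)] rho_ext(2)[OF 1 g] by simp
    have s2: "sig \<theta>2 g = \<theta>2 g \<cdot>\<^sub>m 1\<^sub>m d1"
      using sig_K[OF f2 gZ(2)] pi_Z[OF f2(1) gZ(1)] rho_ext(2)[OF 2 g] de by simp
    have "\<theta>1 g \<cdot>\<^sub>m P = \<theta>2 g \<cdot>\<^sub>m P" using int[OF gZ(3)] unfolding s1 s2 scalar_mat_mult[OF P] .
    thus ?thesis by (rule smult_mat_cancel[OF _ P Pnz])
  qed
  have \<rho>: "rho_ext \<theta>2 = rho_ext \<theta>1"
    by (rule rho_ext_eq[OF 2 rho_ext(1)[OF 1]]) (use eqCK rho_ext(2)[OF 1] in auto)
  obtain b where b: "P = b \<cdot>\<^sub>m 1\<^sub>m d1"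
  proof (rule schur_scalar[OF pi_facts(1)[OF f1(1)] P])
    show "\<pi> (rho_ext \<theta>1) x * P = P * \<pi> (rho_ext \<theta>1) x" if x: "x \<in> K" for x
      using int[of x] sig_K[OF f1 x] sig_K[OF f2 x] \<rho> x KH by auto
  qed auto
  have bnz: "b \<noteq> 0" using Pnz unfolding b by (auto intro!: eq_matI)
  have "\<theta>1 g = \<theta>2 g" if g: "g \<in> C" for g
  proof -
    let ?U = "U (rho_ext \<theta>1) g"
    have Uc: "?U \<in> carrier_mat d1 d1" by (rule U_facts(1)[OF f1(1) g])
    have Unz: "?U \<noteq> 0\<^sub>m d1 d1"
    proof
      assume z: "?U = 0\<^sub>m d1 d1"
      have "?U * U (rho_ext \<theta>1) (inv g) = 1\<^sub>m d1" by (rule U_inv(1)[OF f1(1) g])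
      hence "(1\<^sub>m d1 :: complex mat) = 0\<^sub>m d1 d1" unfolding z using U_facts(1)[OF f1(1) inv_mem(2)[OF g]] by simp
      thus False using one_mat_nonzero[OF d1pos] by simp
    qed
    have "P * (\<theta>1 g \<cdot>\<^sub>m ?U) = (\<theta>2 g \<cdot>\<^sub>m ?U) * P"
      using int[of g] sig_C[OF f1 g] sig_C[OF f2 g] \<rho> g CH by auto
    hence "(b * \<theta>1 g) \<cdot>\<^sub>m ?U = (b * \<theta>2 g) \<cdot>\<^sub>m ?U"
      unfolding b using scalar_mat_mult[of "\<theta>1 g \<cdot>\<^sub>m ?U" d1 d1 b] scalar_mat_mult[of "\<theta>2 g \<cdot>\<^sub>m ?U" d1 d1 b] Uc
      by (simp add: smult_smult_mat)
    hence "b * \<theta>1 g = b * \<theta>2 g" by (rule smult_mat_cancel[OF _ Uc Unz])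
    thus ?thesis using bnz by simp
  qed
  thus ?thesis using ThetasD(3)[OF 1] ThetasD(3)[OF 2] by (rule extensionalityI[rotated 2]) 
qed

lemma sig_surjective:
  assumes \<sigma>: "irrep (G\<lparr>carrier := H\<rparr>) e \<sigma>" and cc: "contains_char e \<sigma> (G\<lparr>carrier := L\<rparr>) \<psi>"
  obtains \<theta> where "\<theta> \<in> Thetas" "iso_class (G\<lparr>carrier := H\<rparr>) (sig \<theta>) = iso_class (G\<lparr>carrier := H\<rparr>) \<sigma>"
proof -
  let ?H = "G\<lparr>carrier := H\<rparr>"
  have \<sigma>i: "irr e H \<sigma>" and \<sigma>r: "rep ?H e \<sigma>" using \<sigma> by (simp_all add: irrep_subgroup_iff)
  note \<sigma>rr = \<sigma>r[unfolded rep_subgroup_iff]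
  have \<sigma>c: "\<sigma> x \<in> carrier_mat e e" if "x \<in> H" for x using \<sigma>rr that by blast
  have \<sigma>m: "\<sigma> (x \<otimes> y) = \<sigma> x * \<sigma> y" if "x \<in> H" "y \<in> H" for x y using \<sigma>rr that by blast
  have epos: "0 < e" using \<sigma>i by (simp add: irr_def)
  have CHx: "x \<in> H" if "x \<in> C" for x using CH that by blast
  have LH: "L \<subseteq> H" "Z \<subseteq> H" using LZ ZK KH by auto
  have \<sigma>L: "\<sigma> l = \<psi> l \<cdot>\<^sub>m 1\<^sub>m e" if "l \<in> L" for l
    by (rule isotypic_scalar[OF sub(1) \<sigma> LH(1) L_inv cc that])
  \<comment> \<open>The eigencharacter \<open>\<theta>0\<close> of this vector serves to find
    \<rho>. The final \<open>\<theta>\<close> comes from an intertwiner and need agree with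
    \<open>\<theta>0\<close> only on \<open>C \<inter> K\<close>.\<close>
  obtain w where w: "w \<in> carrier_vec e" "w \<noteq> 0\<^sub>v e" "\<And>g. g \<in> C \<Longrightarrow> \<exists>c. \<sigma> g *\<^sub>v w = c \<cdot>\<^sub>v w"
  proof (rule common_eigenvector[of "carrier_vec e" e C \<sigma>])
    show "VectorSpace.subspace class_ring (carrier_vec e) (module_vec TYPE(complex) e)" unfolding subspace_module_vec_iff by simp
    show "carrier_vec e \<noteq> {0\<^sub>v e :: complex vec}"
      by (metis insertI1 epos singletonD unit_vec_carrier unit_vec_nonzero)
    show "\<sigma> x * \<sigma> y = \<sigma> y * \<sigma> x" if "x \<in> C" "y \<in> C" for x y
      using \<sigma>m[OF CHx[OF that(1)] CHx[OF that(2)]] \<sigma>m[OF CHx[OF that(2)] CHx[OF that(1)]] Ccomm[OF that] by simp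
    show "\<sigma> x *\<^sub>v w \<in> carrier_vec e" if "x \<in> C" "w \<in> carrier_vec e" for x w
      by (rule mult_mat_vec_carrier[OF \<sigma>c[OF CHx[OF that(1)]] that(2)])
  qed (use \<sigma>c CHx in blast)+
  then obtain \<theta>0 where \<theta>0: "\<And>g. g \<in> C \<Longrightarrow> \<sigma> g *\<^sub>v w = \<theta>0 g \<cdot>\<^sub>v w" by metis
  have wcancel: "b = c" if "b \<cdot>\<^sub>v w = c \<cdot>\<^sub>v w" for b c
  proof -
    obtain i where i: "i < e" "w $ i \<noteq> 0" using w(1,2) by (metis carrier_vecD eq_vecI index_zero_vec(1,2))
    have "(b \<cdot>\<^sub>v w) $ i = (c \<cdot>\<^sub>v w) $ i" using that by simp
    thus ?thesis using i w(1) by simp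
  qed
  have \<sigma>Lw: "\<sigma> l *\<^sub>v w = \<psi> l \<cdot>\<^sub>v w" if "l \<in> L" for l
    unfolding \<sigma>L[OF that] using smult_mat_mult_vec[of "1\<^sub>m e" e e w "\<psi> l"] w(1) by simp
  have \<theta>0m: "\<theta>0 (x \<otimes> y) = \<theta>0 x * \<theta>0 y" if x: "x \<in> C" and y: "y \<in> C" for x y
  proof (rule wcancel)
    have "\<theta>0 (x \<otimes> y) \<cdot>\<^sub>v w = \<sigma> x * \<sigma> y *\<^sub>v w" using \<theta>0[OF mult_mem(2)[OF x y]] \<sigma>m[OF CHx[OF x] CHx[OF y]] by simp
    also have "\<dots> = \<sigma> x *\<^sub>v (\<theta>0 y \<cdot>\<^sub>v w)" using assoc_mult_mat_vec[OF \<sigma>c[OF CHx[OF x]] \<sigma>c[OF CHx[OF y]] w(1)] \<theta>0[OF y] by simp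
    also have "\<dots> = (\<theta>0 x * \<theta>0 y) \<cdot>\<^sub>v w" using mult_mat_vec[OF \<sigma>c[OF CHx[OF x]] w(1)] \<theta>0[OF x] by (simp add: smult_smult_assoc mult.commute)
    finally show "\<theta>0 (x \<otimes> y) \<cdot>\<^sub>v w = (\<theta>0 x * \<theta>0 y) \<cdot>\<^sub>v w" .
  qed
  have "\<exists>!\<rho>. \<rho> \<in> Rho \<and> (\<forall>g\<in>C \<inter> K. \<theta>0 g = \<psi>\<rho> \<rho> g)"
  proof (rule extension)
    show "\<theta>0 x = \<psi> x" if "x \<in> C \<inter> L" for x using wcancel \<theta>0 \<sigma>Lw that by (metis IntD1 IntD2)
  qed (use \<theta>0m in auto)
  then obtain \<rho> where \<rho>: "\<rho> \<in> Rho" and \<theta>\<rho>: "\<And>g. g \<in> C \<inter> K \<Longrightarrow> \<theta>0 g = \<psi>\<rho> \<rho> g" by blast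
  have "\<sigma> z *\<^sub>v w = \<psi>\<rho> \<rho> z \<cdot>\<^sub>v w" if z: "z \<in> Z" for z
  proof -
    obtain c l where cl: "c \<in> C \<inter> K" "l \<in> L" "z = c \<otimes> l" using ZCL[OF z] by blast
    have c: "c \<in> C" "c \<in> Z" using cl CKZ by auto
    have lH: "l \<in> H" using cl LH by blast
    have "\<sigma> z *\<^sub>v w = \<sigma> c *\<^sub>v (\<sigma> l *\<^sub>v w)" unfolding cl(3) \<sigma>m[OF CHx[OF c(1)] lH]
      by (rule assoc_mult_mat_vec[OF \<sigma>c[OF CHx[OF c(1)]] \<sigma>c[OF lH] w(1)])
    also have "\<dots> = \<psi> l \<cdot>\<^sub>v (\<theta>0 c \<cdot>\<^sub>v w)" unfolding \<sigma>Lw[OF cl(2)] mult_mat_vec[OF \<sigma>c[OF CHx[OF c(1)]] w(1)] \<theta>0[OF c(1)] ..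
    also have "\<dots> = \<psi>\<rho> \<rho> z \<cdot>\<^sub>v w" using \<theta>\<rho>[OF cl(1)] \<psi>\<rho>_L[OF \<rho> cl(2)] \<psi>\<rho>_mult[OF \<rho> c(2), of l] cl LZ
      by (auto simp: smult_smult_assoc mult.commute)
    finally show ?thesis .
  qed
  hence ccZ: "contains_char e \<sigma> (G\<lparr>carrier := Z\<rparr>) (\<psi>\<rho> \<rho>)" unfolding contains_char_def using w(1,2) by auto
  have \<sigma>Z: "\<sigma> z = \<psi>\<rho> \<rho> z \<cdot>\<^sub>m 1\<^sub>m e" if "z \<in> Z" for z
    by (rule isotypic_scalar[OF sub(1) \<sigma> LH(2) Z_inv_H[OF \<rho>] ccZ that])
  obtain d where d: "pidata \<rho> d" by (rule pi_obtain[OF \<rho>])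
  note f = d
  note pf = pi_facts[OF f]
  note uf = U_facts[OF f]
  obtain T \<theta>' where T: "T \<in> carrier_mat e d" "T \<noteq> 0\<^sub>m e d" "\<And>x. x \<in> K \<Longrightarrow> \<sigma> x * T = T * \<pi> \<rho> x"
    "\<And>g. g \<in> C \<Longrightarrow> \<sigma> g * T = \<theta>' g \<cdot>\<^sub>m (T * U \<rho> g)" by (rule intertwiner_eigen[OF f \<sigma> \<sigma>Z]) blast+
  define \<theta> where "\<theta> = restrict \<theta>' C"
  have T': "\<sigma> g * T = \<theta> g \<cdot>\<^sub>m (T * U \<rho> g)" if "g \<in> C" for g using T(4)[OF that] that by (simp add: \<theta>_def)
  have TU: "T * U \<rho> g \<in> carrier_mat e d" "T * U \<rho> g \<noteq> 0\<^sub>m e d" if g: "g \<in> C" for g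
  proof -
    have gi: "inv g \<in> C" by (rule inv_mem(2)[OF g])
    show "T * U \<rho> g \<in> carrier_mat e d" by (rule mult_carrier_mat[OF T(1) uf(1)[OF g]])
    show "T * U \<rho> g \<noteq> 0\<^sub>m e d"
    proof
      assume z: "T * U \<rho> g = 0\<^sub>m e d"
      have "T = T * (U \<rho> g * U \<rho> (inv g))" unfolding U_inv(1)[OF f g] by (rule right_mult_one_mat[OF T(1), symmetric])
      also have "\<dots> = T * U \<rho> g * U \<rho> (inv g)" by (rule assoc_mult_mat[OF T(1) uf(1)[OF g] uf(1)[OF gi], symmetric])
      also have "\<dots> = 0\<^sub>m e d" unfolding z by (rule left_mult_zero_mat[OF uf(1)[OF gi]])
      finally show False using T(2) by simp
    qed
  qed
  have \<theta>m: "\<theta> (x \<otimes> y) = \<theta> x * \<theta> y" if x: "x \<in> C" and y: "y \<in> C" for x y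
  proof (rule smult_mat_cancel[OF _ TU[OF mult_mem(2)[OF x y]]])
    have "\<theta> (x \<otimes> y) \<cdot>\<^sub>m (T * U \<rho> (x \<otimes> y)) = \<sigma> x * \<sigma> y * T" unfolding T'[OF mult_mem(2)[OF x y], symmetric] \<sigma>m[OF CHx[OF x] CHx[OF y]] ..
    also have "\<dots> = \<sigma> x * (\<theta> y \<cdot>\<^sub>m (T * U \<rho> y))" unfolding T'[OF y, symmetric]
      by (rule assoc_mult_mat[OF \<sigma>c[OF CHx[OF x]] \<sigma>c[OF CHx[OF y]] T(1)])
    also have "\<dots> = \<theta> y \<cdot>\<^sub>m (\<sigma> x * T * U \<rho> y)" unfolding mult_smult_distrib[OF \<sigma>c[OF CHx[OF x]] TU(1)[OF y]]
      assoc_mult_mat[OF \<sigma>c[OF CHx[OF x]] T(1) uf(1)[OF y]] ..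
    also have "\<dots> = \<theta> y \<cdot>\<^sub>m (\<theta> x \<cdot>\<^sub>m (T * U \<rho> (x \<otimes> y)))" unfolding T'[OF x] uf(3)[OF x y]
      mult_smult_assoc_mat[OF TU(1)[OF x] uf(1)[OF y]] assoc_mult_mat[OF T(1) uf(1)[OF x] uf(1)[OF y]] ..
    finally show "\<theta> (x \<otimes> y) \<cdot>\<^sub>m (T * U \<rho> (x \<otimes> y)) = (\<theta> x * \<theta> y) \<cdot>\<^sub>m (T * U \<rho> (x \<otimes> y))"
      by (simp add: smult_smult_mat mult.commute)
  qed
  have \<theta>K: "\<theta> g = \<psi>\<rho> \<rho> g" if g: "g \<in> C \<inter> K" for g
  proof (rule smult_mat_cancel[OF _ T(1,2)])
    have gZ: "g \<in> C" "g \<in> K" "g \<in> Z" using g CKZ by auto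
    have "\<theta> g \<cdot>\<^sub>m T = \<sigma> g * T" unfolding T'[OF gZ(1)] U_CK[OF f g] right_mult_one_mat[OF T(1)] ..
    also have "\<dots> = \<psi>\<rho> \<rho> g \<cdot>\<^sub>m T" unfolding T(3)[OF gZ(2)] pi_Z[OF f gZ(3)] by (rule scalar_mat_mult(2)[OF T(1)])
    finally show "\<theta> g \<cdot>\<^sub>m T = \<psi>\<rho> \<rho> g \<cdot>\<^sub>m T" .
  qed
  have \<theta>1: "\<theta> \<one> = 1" using \<theta>K[of \<one>] \<psi>\<rho>_one[OF \<rho>] one_mem by simp
  have \<theta>nz: "\<theta> x \<noteq> 0" if x: "x \<in> C" for x
    using \<theta>m[OF x inv_mem(2)[OF x]] \<theta>1 carr(2)[OF x] by auto
  have \<theta>T: "\<theta> \<in> Thetas"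
    unfolding Thetas_def dual_def hom_def complex_units_def
  proof (intro CollectI conjI ballI IntI)
    show "\<theta> g = \<psi> g" if "g \<in> C \<inter> L" for g
      using \<theta>K[of g] \<psi>\<rho>_L[OF \<rho>, of g] that LZ ZK by auto
  qed (use \<theta>m \<theta>nz in \<open>auto simp: \<theta>_def\<close>)
  have ext: "rho_ext \<theta> = \<rho>" by (rule rho_ext_eq[OF \<theta>T \<rho> \<theta>K])
  have "extends \<theta> \<rho>" unfolding extends_def using \<theta>m \<theta>K ext by blast
  note ff = f this
  have sr: "rep ?H d (sig \<theta>)" by (rule sig_rep[OF ff])
  have int: "\<sigma> x * T = T * sig \<theta> x" if x: "x \<in> H" for x
  proof -
    obtain g h where gh: "g \<in> C" "h \<in> K" "x = g \<otimes> h" using HCK[OF x] by blast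
    have hH: "h \<in> H" using gh KH by blast
    have "\<sigma> x * T = \<sigma> g * (T * \<pi> \<rho> h)" unfolding gh(3) \<sigma>m[OF CHx[OF gh(1)] hH] T(3)[OF gh(2), symmetric]
      by (rule assoc_mult_mat[OF \<sigma>c[OF CHx[OF gh(1)]] \<sigma>c[OF hH] T(1)])
    also have "\<dots> = \<sigma> g * T * \<pi> \<rho> h" by (rule assoc_mult_mat[OF \<sigma>c[OF CHx[OF gh(1)]] T(1) pf(3)[OF gh(2)], symmetric])
    also have "\<dots> = \<theta> g \<cdot>\<^sub>m (T * (U \<rho> g * \<pi> \<rho> h))" unfolding T'[OF gh(1)]
      mult_smult_assoc_mat[OF TU(1)[OF gh(1)] pf(3)[OF gh(2)]] assoc_mult_mat[OF T(1) uf(1)[OF gh(1)] pf(3)[OF gh(2)]] ..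
    also have "\<dots> = T * sig \<theta> x" unfolding gh(3) sig_eq[OF ff gh(1,2)]
      by (rule mult_smult_distrib[OF T(1) mult_carrier_mat[OF uf(1)[OF gh(1)] pf(3)[OF gh(2)]], symmetric])
    finally show ?thesis .
  qed
  have si: "irr d H (sig \<theta>)" by (rule sig_irr[OF ff])
  \<comment> \<open>\<open>T\<close> is a nonzero intertwiner between irreducible representations of
    \<open>H\<close>, so Schur's lemma makes it an isomorphism.\<close>
  have ed: "e = d" by (rule schur_zero_or_iso(1)[OF \<sigma>i si T(1) int T(2)])
  obtain Q where Q: "Q \<in> carrier_mat d d" "T * Q = 1\<^sub>m d" "Q * T = 1\<^sub>m d"
    using schur_zero_or_iso(2)[OF \<sigma>i si T(1) int T(2)] by blast
  have "iso_class ?H (sig \<theta>) = iso_class ?H \<sigma>"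
    by (rule iso_class_eqI[OF sr \<sigma>r[unfolded ed] T(1)[unfolded ed] Q]) (simp add: int)
  with \<theta>T that show ?thesis by blast
qed

theorem sig_bij:
  "bij_betw (\<lambda>\<theta>. iso_class (G\<lparr>carrier := H\<rparr>) (sig \<theta>)) Thetas
    (Irr_over (G\<lparr>carrier := H\<rparr>) (G\<lparr>carrier := L\<rparr>) \<psi>)"
  unfolding bij_betw_def
proof
  show "inj_on (\<lambda>\<theta>. iso_class (G\<lparr>carrier := H\<rparr>) (sig \<theta>)) Thetas"
    by (rule inj_onI) (rule sig_injective)
  show "(\<lambda>\<theta>. iso_class (G\<lparr>carrier := H\<rparr>) (sig \<theta>)) ` Thetas = Irr_over (G\<lparr>carrier := H\<rparr>) (G\<lparr>carrier := L\<rparr>) \<psi>"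
  proof (intro equalityI subsetI)
    fix X assume "X \<in> (\<lambda>\<theta>. iso_class (G\<lparr>carrier := H\<rparr>) (sig \<theta>)) ` Thetas"
    then obtain \<theta> where \<theta>: "\<theta> \<in> Thetas" "X = iso_class (G\<lparr>carrier := H\<rparr>) (sig \<theta>)" by blast
    obtain d where d: "pidata (rho_ext \<theta>) d" by (rule pi_obtain[OF rho_ext(1)[OF \<theta>(1)]])
    note f = d extends_rho_ext[OF \<theta>(1)]
    have "irrep (G\<lparr>carrier := H\<rparr>) d (sig \<theta>)" unfolding irrep_subgroup_iff using sig_rep[OF f] sig_irr[OF f] by blast
    moreover have "contains_char d (sig \<theta>) (G\<lparr>carrier := L\<rparr>) \<psi>" by (rule sig_contains[OF f])
    ultimately show "X \<in> Irr_over (G\<lparr>carrier := H\<rparr>) (G\<lparr>carrier := L\<rparr>) \<psi>" unfolding Irr_over_def \<theta>(2) by blast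
  next
    fix X assume "X \<in> Irr_over (G\<lparr>carrier := H\<rparr>) (G\<lparr>carrier := L\<rparr>) \<psi>"
    then obtain \<sigma> e where s: "X = iso_class (G\<lparr>carrier := H\<rparr>) \<sigma>" "irrep (G\<lparr>carrier := H\<rparr>) e \<sigma>"
      "contains_char e \<sigma> (G\<lparr>carrier := L\<rparr>) \<psi>" unfolding Irr_over_def by blast
    obtain \<theta> where "\<theta> \<in> Thetas" "iso_class (G\<lparr>carrier := H\<rparr>) (sig \<theta>) = iso_class (G\<lparr>carrier := H\<rparr>) \<sigma>"
      by (rule sig_surjective[OF s(2,3)])
    thus "X \<in> (\<lambda>\<theta>. iso_class (G\<lparr>carrier := H\<rparr>) (sig \<theta>)) ` Thetas" unfolding s(1) by (metis imageI)
  qed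
qed

end

section \<open>Square matrices as a ring\<close>

text \<open>A wrapper that makes matrices over the field an instance of \<open>ring_1\<close>, so
  that computations with integral lifts are ring arithmetic and not index manipulation.\<close>

typedef ('n, 'a) sqm = "UNIV :: ('n \<Rightarrow> 'n \<Rightarrow> 'a) set"
  morphisms ent Sqm ..

setup_lifting type_definition_sqm

lemmas ent_Sqm [simp] = Sqm_inverse[OF UNIV_I]
lemmas Sqm_ent [simp] = ent_inverse

lemma sqm_eqI: "(\<And>i j. ent A i j = ent B i j) \<Longrightarrow> A = B"
  by (metis ent_inject ext)

instantiation sqm :: (finite, comm_ring_1) ring_1
begin

lift_definition zero_sqm :: "('a, 'b) sqm" is "\<lambda>i j. 0" .
lift_definition one_sqm :: "('a, 'b) sqm" is "\<lambda>i j. if i = j then 1 else 0" .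
lift_definition plus_sqm :: "('a, 'b) sqm \<Rightarrow> ('a, 'b) sqm \<Rightarrow> ('a, 'b) sqm" is "\<lambda>A B i j. A i j + B i j" .
lift_definition minus_sqm :: "('a, 'b) sqm \<Rightarrow> ('a, 'b) sqm \<Rightarrow> ('a, 'b) sqm" is "\<lambda>A B i j. A i j - B i j" .
lift_definition uminus_sqm :: "('a, 'b) sqm \<Rightarrow> ('a, 'b) sqm" is "\<lambda>A i j. - A i j" .
lift_definition times_sqm :: "('a, 'b) sqm \<Rightarrow> ('a, 'b) sqm \<Rightarrow> ('a, 'b) sqm" is "\<lambda>A B i j. \<Sum>k\<in>UNIV. A i k * B k j" .

instance
proof
  fix A B C :: "('a, 'b) sqm"
  show "A * B * C = A * (B * C)"
  proof (rule sqm_eqI)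
    fix i j
    have "ent (A * B * C) i j = (\<Sum>l\<in>UNIV. \<Sum>k\<in>UNIV. ent A i k * ent B k l * ent C l j)"
      by (simp add: times_sqm.rep_eq sum_distrib_right)
    also have "\<dots> = (\<Sum>k\<in>UNIV. \<Sum>l\<in>UNIV. ent A i k * ent B k l * ent C l j)" by (rule sum.swap)
    also have "\<dots> = ent (A * (B * C)) i j" by (simp add: times_sqm.rep_eq sum_distrib_left mult.assoc)
    finally show "ent (A * B * C) i j = ent (A * (B * C)) i j" .
  qed
  show "1 * A = A"
  proof (rule sqm_eqI)
    fix i j
    have "ent (1 * A) i j = (\<Sum>k\<in>UNIV. if i = k then ent A k j else 0)"
      unfolding times_sqm.rep_eq one_sqm.rep_eq by (rule sum.cong) auto
    thus "ent (1 * A) i j = ent A i j" by simp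
  qed
  show "A * 1 = A"
  proof (rule sqm_eqI)
    fix i j
    have "ent (A * 1) i j = (\<Sum>k\<in>UNIV. if k = j then ent A i k else 0)"
      unfolding times_sqm.rep_eq one_sqm.rep_eq by (rule sum.cong) auto
    thus "ent (A * 1) i j = ent A i j" by simp
  qed
  show "(0 :: ('a, 'b) sqm) \<noteq> 1"
  proof
    assume "(0 :: ('a, 'b) sqm) = 1"
    hence "ent (0 :: ('a, 'b) sqm) undefined undefined = ent 1 undefined undefined" by simp
    thus False by (simp add: zero_sqm.rep_eq one_sqm.rep_eq)
  qed
qed (rule sqm_eqI, simp add: plus_sqm.rep_eq minus_sqm.rep_eq uminus_sqm.rep_eq zero_sqm.rep_eq times_sqm.rep_eq
      algebra_simps sum.distrib sum_distrib_left)+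

end

text \<open>Scalar multiplication is written as multiplication by the central matrix
  \<open>sc c\<close>, which keeps all terms within ring arithmetic.\<close>

lift_definition sc :: "'a \<Rightarrow> ('n::finite, 'a::comm_ring_1) sqm" is "\<lambda>c i j. if i = j then c else 0" .
lift_definition tr :: "('n::finite, 'a::comm_ring_1) sqm \<Rightarrow> 'a" is "\<lambda>A. \<Sum>i\<in>UNIV. A i i" .

lemmas sqm_simps = plus_sqm.rep_eq minus_sqm.rep_eq uminus_sqm.rep_eq zero_sqm.rep_eq one_sqm.rep_eq times_sqm.rep_eq sc.rep_eq tr.rep_eq

lemma ent_sc_mult: "ent (sc c * A) i j = c * ent A i j"
proof -
  have "ent (sc c * A) i j = (\<Sum>k\<in>UNIV. if i = k then c * ent A k j else 0)"
    unfolding times_sqm.rep_eq sc.rep_eq by (rule sum.cong) auto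
  thus ?thesis by simp
qed

lemma ent_mult_sc: "ent (A * sc c) i j = c * ent A i j"
proof -
  have "ent (A * sc c) i j = (\<Sum>k\<in>UNIV. if k = j then c * ent A i k else 0)"
    unfolding times_sqm.rep_eq sc.rep_eq by (rule sum.cong) (auto simp: mult.commute)
  thus ?thesis by simp
qed

lemma sc_commute: "A * sc c = sc c * A" by (rule sqm_eqI) (simp add: ent_sc_mult ent_mult_sc)

lemma sc_left_commute: "A * (sc c * B) = sc c * (A * B)"
  by (simp add: mult.assoc[symmetric] sc_commute)

lemma sc_mult: "sc (a * b) = sc a * sc b" by (rule sqm_eqI) (simp add: ent_sc_mult sc.rep_eq)
lemma sc_1 [simp]: "sc 1 = 1" by (rule sqm_eqI) (simp add: sqm_simps)
lemma sc_0 [simp]: "sc 0 = 0" by (rule sqm_eqI) (simp add: sqm_simps)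

lemma tr_add: "tr (A + B) = tr A + tr B" by (simp add: sqm_simps sum.distrib)
lemma tr_diff: "tr (A - B) = tr A - tr B" by (simp add: sqm_simps sum_subtractf)
lemma tr_0 [simp]: "tr 0 = 0" by (simp add: sqm_simps)
lemma tr_sc_mult: "tr (sc c * A) = c * tr A" by (simp add: tr.rep_eq ent_sc_mult sum_distrib_left)
lemma tr_mult_commute: "tr (A * B) = tr (B * A)"
proof -
  have "tr (A * B) = (\<Sum>i\<in>UNIV. \<Sum>k\<in>UNIV. ent A i k * ent B k i)" by (simp add: sqm_simps)
  also have "\<dots> = (\<Sum>k\<in>UNIV. \<Sum>i\<in>UNIV. ent A i k * ent B k i)" by (rule sum.swap)
  finally show ?thesis by (simp add: sqm_simps mult.commute)
qed

section \<open>The integer ring and its quotients\<close>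

locale local_field = nonarch_local_field v for v :: "'f::field \<Rightarrow> int" +
  fixes \<pi>F :: 'f
  assumes unif: "\<pi>F \<noteq> 0" "v \<pi>F = 1"
begin

lemma v_one: "v 1 = 0" using val_mult[of 1 1] by simp

lemma v_minus: "x \<noteq> 0 \<Longrightarrow> v (- x) = v x"
proof -
  assume x: "x \<noteq> 0"
  have "v (- 1) + v (- 1) = 0" using val_mult[of "- 1" "- 1"] v_one by simp
  thus ?thesis using val_mult[of "- 1" x] x by simp
qed

lemma v_pow: "v (\<pi>F ^ m) = int m"
  by (induction m) (simp_all add: v_one val_mult unif)

lemma ppow_0 [simp]: "0 \<in> ppow v m" by (simp add: ppow_def)

lemma ppow_add [simp]: "x \<in> ppow v m \<Longrightarrow> y \<in> ppow v m \<Longrightarrow> x + y \<in> ppow v m"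
  using val_add[of x y] by (cases "x = 0"; cases "y = 0"; cases "x + y = 0") (auto simp: ppow_def)

lemma ppow_minus [simp]: "x \<in> ppow v m \<Longrightarrow> - x \<in> ppow v m" by (cases "x = 0") (auto simp: ppow_def v_minus)

lemma ppow_diff [simp]: "x \<in> ppow v m \<Longrightarrow> y \<in> ppow v m \<Longrightarrow> x - y \<in> ppow v m"
  using ppow_add[of x m "- y"] by simp

lemma ppow_mult: "x \<in> ppow v m \<Longrightarrow> y \<in> ppow v k \<Longrightarrow> x * y \<in> ppow v (m + k)"
  by (cases "x = 0 \<or> y = 0") (auto simp: ppow_def val_mult)

lemma ppow_mono: "k \<le> m \<Longrightarrow> x \<in> ppow v m \<Longrightarrow> x \<in> ppow v k" by (auto simp: ppow_def)

lemma int_mult [simp]: "x \<in> ppow v 0 \<Longrightarrow> y \<in> ppow v 0 \<Longrightarrow> x * y \<in> ppow v 0" using ppow_mult[of x 0 y 0] by simp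

lemma ppow_mult_left: "x \<in> ppow v 0 \<Longrightarrow> y \<in> ppow v m \<Longrightarrow> x * y \<in> ppow v m" using ppow_mult[of x 0 y m] by simp
lemma ppow_mult_right: "x \<in> ppow v m \<Longrightarrow> y \<in> ppow v 0 \<Longrightarrow> x * y \<in> ppow v m" using ppow_mult[of x m y 0] by simp

lemma one_int [simp]: "1 \<in> ppow v 0" by (simp add: ppow_def v_one)

lemma int_sum [simp]: "(\<And>i. i \<in> I \<Longrightarrow> f i \<in> ppow v m) \<Longrightarrow> sum f I \<in> ppow v m"
  by (induction I rule: infinite_finite_induct) auto

lemma pow_mult_mem_iff: "\<pi>F ^ m * y \<in> ppow v (m + k) \<longleftrightarrow> y \<in> ppow v k"
  by (cases "y = 0") (auto simp: ppow_def val_mult v_pow unif)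

lemma pow_int [simp]: "\<pi>F ^ m \<in> ppow v m" "\<pi>F ^ m \<in> ppow v 0" by (auto simp: ppow_def v_pow)

lemma unif_int [simp]: "\<pi>F \<in> ppow v 0" using pow_int(2)[of 1] by simp

lemma ppow_iff: "x \<in> ppow v m \<longleftrightarrow> (\<exists>y\<in>ppow v 0. x = \<pi>F ^ m * y)"
proof
  assume x: "x \<in> ppow v m"
  have e: "x = \<pi>F ^ m * (x / \<pi>F ^ m)" using unif by simp
  have "x / \<pi>F ^ m \<in> ppow v 0" using pow_mult_mem_iff[of m "x / \<pi>F ^ m" 0] x e by simp
  with e show "\<exists>y\<in>ppow v 0. x = \<pi>F ^ m * y" by blast
qed (use pow_mult_mem_iff[of m _ 0] in auto)

lemma inter_ppow: "(\<And>m. x \<in> ppow v m) \<Longrightarrow> x = 0"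
proof (rule ccontr)
  assume a: "\<And>m. x \<in> ppow v m" and x: "x \<noteq> 0"
  have "int (nat (v x) + 1) \<le> v x" using a[of "nat (v x) + 1"] x by (simp add: ppow_def)
  thus False by linarith
qed

lemma int_ring_simps [simp]: "carrier (int_ring v) = ppow v 0" "mult (int_ring v) = (*)" "one (int_ring v) = 1"
  "zero (int_ring v) = 0" "add (int_ring v) = (+)"
  by (simp_all add: int_ring_def)

lemma cring_int: "cring (int_ring v)"
proof (rule cringI)
  show "abelian_group (int_ring v)"
  proof (rule abelian_groupI)
    show "\<exists>y\<in>carrier (int_ring v). y \<oplus>\<^bsub>int_ring v\<^esub> x = \<zero>\<^bsub>int_ring v\<^esub>" if "x \<in> carrier (int_ring v)" for x
      using that by (intro bexI[of _ "- x"]) auto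
  qed (auto simp: algebra_simps)
  show "comm_monoid (int_ring v)" by (rule comm_monoidI) (auto simp: algebra_simps)
qed (auto simp: algebra_simps)

sublocale OR: cring "int_ring v" by (rule cring_int)

lemma a_inv_int: "x \<in> ppow v 0 \<Longrightarrow> \<ominus>\<^bsub>int_ring v\<^esub> x = - x"
  by (rule OR.minus_equality) auto

lemma finsum_int: "(\<And>i. i \<in> I \<Longrightarrow> f i \<in> ppow v 0) \<Longrightarrow> finsum (int_ring v) f I = sum f I"
proof (induction I rule: infinite_finite_induct)
  case (insert x F)
  have "finsum (int_ring v) f (insert x F) = f x \<oplus>\<^bsub>int_ring v\<^esub> finsum (int_ring v) f F"
    by (rule OR.finsum_insert) (use insert in auto)
  thus ?case using insert by simp
qed simp_all

lemma ideal_ppow: "ideal (ppow v m) (int_ring v)"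
proof (rule idealI[OF OR.ring_axioms])
  have inv: "inv\<^bsub>add_monoid (int_ring v)\<^esub> x = - x" if "x \<in> ppow v 0" for x
    using a_inv_int[OF that] by (simp add: a_inv_def)
  show "subgroup (ppow v m) (add_monoid (int_ring v))"
    by (rule subgroup.intro) (use ppow_mono[of 0 m] inv in auto)
qed (auto intro: ppow_mult_left ppow_mult_right)

lemma cring_Omod: "cring (Omod v m)"
  unfolding Omod_def by (rule ideal.quotient_is_cring[OF ideal_ppow cring_int])

lemma omod_set: "omod v m x = (\<lambda>h. h + x) ` ppow v m"
  by (auto simp: omod_def a_r_coset_def r_coset_def)

lemma self_mem_omod: "x \<in> omod v m x" unfolding omod_set using ppow_0 by force

lemma mem_omod_iff: "y \<in> omod v m x \<longleftrightarrow> y - x \<in> ppow v m"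
  unfolding omod_set by (force simp: image_iff)

lemma omod_eq_iff: "omod v m x = omod v m y \<longleftrightarrow> x - y \<in> ppow v m"
proof
  assume "omod v m x = omod v m y"
  thus "x - y \<in> ppow v m" using self_mem_omod[of x m] mem_omod_iff by simp
next
  assume a: "x - y \<in> ppow v m"
  show "omod v m x = omod v m y"
  proof (rule Set.set_eqI)
    fix z
    show "z \<in> omod v m x \<longleftrightarrow> z \<in> omod v m y"
      unfolding mem_omod_iff using ppow_add[OF _ a, of "z - x"] ppow_diff[OF _ a, of "z - y"] by (auto simp: algebra_simps)
  qed
qed

lemma some_mem_omod: "(SOME a. a \<in> omod v m x) - x \<in> ppow v m"
proof -
  have "(SOME a. a \<in> omod v m x) \<in> omod v m x" by (rule someI[of "\<lambda>a. a \<in> omod v m x", OF self_mem_omod])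
  thus ?thesis by (simp add: mem_omod_iff)
qed

lemma omod_some: "k \<le> m \<Longrightarrow> omod v k (SOME a. a \<in> omod v m x) = omod v k x"
  unfolding omod_eq_iff by (rule ppow_mono[OF _ some_mem_omod])

lemma omod_hom: "omod v m \<in> Ring.ring_hom (int_ring v) (Omod v m)"
  using ideal.rcos_ring_hom[OF ideal_ppow[of m]] unfolding Omod_def omod_def[abs_def] .

lemma O_algebra_Omod: "O_algebra v (Omod v m) (omod v m)"
  unfolding O_algebra_def using cring_Omod omod_hom by simp

lemma carrier_Omod: "carrier (Omod v m) = omod v m ` ppow v 0"
  by (auto simp: Omod_def FactRing_def A_RCOSETS_def RCOSETS_def omod_def a_r_coset_def)

lemma omod_closed [simp]: "x \<in> ppow v 0 \<Longrightarrow> omod v m x \<in> carrier (Omod v m)"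
  by (simp add: carrier_Omod)

lemma omod_ops:
  "x \<in> ppow v 0 \<Longrightarrow> y \<in> ppow v 0 \<Longrightarrow> omod v m x \<oplus>\<^bsub>Omod v m\<^esub> omod v m y = omod v m (x + y)"
  "x \<in> ppow v 0 \<Longrightarrow> y \<in> ppow v 0 \<Longrightarrow> omod v m x \<otimes>\<^bsub>Omod v m\<^esub> omod v m y = omod v m (x * y)"
  "\<one>\<^bsub>Omod v m\<^esub> = omod v m 1" "\<zero>\<^bsub>Omod v m\<^esub> = omod v m 0"
proof -
  show "x \<in> ppow v 0 \<Longrightarrow> y \<in> ppow v 0 \<Longrightarrow> omod v m x \<oplus>\<^bsub>Omod v m\<^esub> omod v m y = omod v m (x + y)"
    using ring_hom_add[OF omod_hom, of x y m] by simp
  show "x \<in> ppow v 0 \<Longrightarrow> y \<in> ppow v 0 \<Longrightarrow> omod v m x \<otimes>\<^bsub>Omod v m\<^esub> omod v m y = omod v m (x * y)"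
    using ring_hom_mult[OF omod_hom, of x y m] by simp
  show "\<one>\<^bsub>Omod v m\<^esub> = omod v m 1" using ring_hom_one[OF omod_hom, of m] by simp
  show "\<zero>\<^bsub>Omod v m\<^esub> = omod v m 0"
    using ring_hom_zero[OF omod_hom OR.ring_axioms cring.axioms(1)[OF cring_Omod], of m] by simp
qed

lemma omod_minus: "x \<in> ppow v 0 \<Longrightarrow> y \<in> ppow v 0 \<Longrightarrow> omod v m x \<ominus>\<^bsub>Omod v m\<^esub> omod v m y = omod v m (x - y)"
proof -
  assume x: "x \<in> ppow v 0" and y: "y \<in> ppow v 0"
  interpret R: cring "Omod v m" by (rule cring_Omod)
  have "\<ominus>\<^bsub>Omod v m\<^esub> omod v m y = omod v m (- y)"
    by (rule R.minus_equality) (use y in \<open>auto simp: omod_ops\<close>)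
  thus ?thesis using x y by (simp add: a_minus_def omod_ops)
qed

lemma omod_finsum: "(\<And>i. i \<in> I \<Longrightarrow> f i \<in> ppow v 0) \<Longrightarrow> finsum (Omod v m) (\<lambda>i. omod v m (f i)) I = omod v m (sum f I)"
proof (induction I rule: infinite_finite_induct)
  case (insert x F)
  interpret R: cring "Omod v m" by (rule cring_Omod)
  have "finsum (Omod v m) (\<lambda>i. omod v m (f i)) (insert x F) = omod v m (f x) \<oplus>\<^bsub>Omod v m\<^esub> finsum (Omod v m) (\<lambda>i. omod v m (f i)) F"
    by (rule R.finsum_insert) (use insert in auto)
  thus ?case using insert by (simp add: omod_ops)
next
  case (infinite A)
  interpret R: cring "Omod v m" by (rule cring_Omod)
  show ?case using infinite by (simp add: R.finsum_infinite omod_ops)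
next
  case empty
  interpret R: cring "Omod v m" by (rule cring_Omod)
  show ?case by (simp add: omod_ops)
qed

text \<open>A class modulo \<pp>^(m+1) is determined by its residue digit and by a class modulo
  \<pp>^m; the map \<open>g\<close> reassembles it from the two.\<close>

lemma finite_Omod: "finite (carrier (Omod v m))"
proof (induction m)
  case 0
  have "omod v 0 ` ppow v 0 \<subseteq> {omod v 0 0}" using omod_eq_iff[of 0 _ 0] by auto
  thus ?case unfolding carrier_Omod by (meson finite.emptyI finite_insert finite_subset)
next
  case (Suc m)
  define g where "g = (\<lambda>(c, e). omod v (Suc m) ((SOME a. a \<in> c) + \<pi>F * (SOME a. a \<in> e)))"
  have "omod v (Suc m) x \<in> g ` (carrier (Omod v 1) \<times> carrier (Omod v m))" if x: "x \<in> ppow v 0" for x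
  proof -
    let ?a = "SOME a. a \<in> omod v 1 x"
    have a: "?a - x \<in> ppow v 1" by (rule some_mem_omod)
    have "x - ?a \<in> ppow v 1" using ppow_minus[OF a] by simp
    then obtain y where y: "y \<in> ppow v 0" "x - ?a = \<pi>F ^ 1 * y" using ppow_iff by blast
    let ?b = "SOME a. a \<in> omod v m y"
    have "?b - y \<in> ppow v m" by (rule some_mem_omod)
    hence "\<pi>F ^ 1 * (?b - y) \<in> ppow v (1 + m)" unfolding pow_mult_mem_iff .
    moreover have "?a + \<pi>F * ?b - x = \<pi>F ^ 1 * (?b - y)" using y(2) by (simp add: algebra_simps)
    ultimately have "g (omod v 1 x, omod v m y) = omod v (Suc m) x" by (simp add: g_def omod_eq_iff)
    thus ?thesis using x y by (metis SigmaI image_eqI omod_closed)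
  qed
  hence "carrier (Omod v (Suc m)) \<subseteq> g ` (carrier (Omod v 1) \<times> carrier (Omod v m))" unfolding carrier_Omod[of "Suc m"] by blast
  thus ?case using Suc finite_residue_field by (meson finite_SigmaI finite_imageI finite_subset)
qed

end

section \<open>Functoriality of points\<close>

lemma mmap_mmult:
  assumes "ring_hom_cring R S h" and A: "\<And>i j. A i j \<in> carrier R" and B: "\<And>i j. B i j \<in> carrier R"
  shows "mmap h (mmult R A B) = mmult S (mmap h A) (mmap h B)"
proof (intro ext)
  fix i j
  interpret ring_hom_cring R S h by (rule assms(1))
  have "h (\<Oplus>\<^bsub>R\<^esub>k\<in>UNIV. A i k \<otimes>\<^bsub>R\<^esub> B k j) = (\<Oplus>\<^bsub>S\<^esub>k\<in>UNIV. (h \<circ> (\<lambda>k. A i k \<otimes>\<^bsub>R\<^esub> B k j)) k)"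
    unfolding o_def by (subst hom_finsum) (auto simp: A B o_def)
  also have "\<dots> = (\<Oplus>\<^bsub>S\<^esub>k\<in>UNIV. h (A i k) \<otimes>\<^bsub>S\<^esub> h (B k j))" by (simp add: A B o_def)
  finally show "mmap h (mmult R A B) i j = mmult S (mmap h A) (mmap h B) i j" by (simp add: mmap_def mmult_def)
qed

lemma mmap_mone: "ring_hom_cring R S h \<Longrightarrow> mmap h (mone R) = mone S"
proof -
  assume "ring_hom_cring R S h"
  then interpret ring_hom_cring R S h .
  show ?thesis by (auto simp: mmap_def mone_def intro!: ext)
qed

lemma mmap_Units:
  assumes h: "ring_hom_cring R S h" and A: "A \<in> Units (mat_monoid R)"
  shows "mmap h A \<in> Units (mat_monoid S)"
proof -
  interpret ring_hom_cring R S h by (rule h)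
  from A obtain B where AB: "\<And>i j. A i j \<in> carrier R" "\<And>i j. B i j \<in> carrier R" "mmult R B A = mone R" "mmult R A B = mone R"
    by (auto simp: Units_def mat_monoid_def)
  have "mmult S (mmap h B) (mmap h A) = mone S" "mmult S (mmap h A) (mmap h B) = mone S"
    using mmap_mmult[OF h, of A B] mmap_mmult[OF h, of B A] AB(1,2) unfolding AB(3,4) mmap_mone[OF h] by simp_all
  moreover have "mmap h A i j \<in> carrier S" "mmap h B i j \<in> carrier S" for i j using AB by (simp_all add: mmap_def)
  ultimately show ?thesis by (auto simp: Units_def mat_monoid_def intro!: exI[of _ "mmap h B"])
qed

lemma poly_eval_hom:
  fixes A :: "('a::finite, 'r) sqmat"
  assumes h: "ring_hom_cring R S h" and A: "\<And>i j. A i j \<in> carrier R" and \<phi>: "\<And>m. \<phi> (Poly_Mapping.lookup p m) \<in> carrier R"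
  shows "h (poly_eval R \<phi> p A) = poly_eval S (h \<circ> \<phi>) p (mmap h A)"
proof -
  interpret ring_hom_cring R S h by (rule h)
  have pw: "h (x [^]\<^bsub>R\<^esub> (n::nat)) = h x [^]\<^bsub>S\<^esub> n" if "x \<in> carrier R" for x n
    using that by (induction n) auto
  have pc: "A i j [^]\<^bsub>R\<^esub> (n::nat) \<in> carrier R" for i j n by (rule R.nat_pow_closed[OF A])
  let ?t = "\<lambda>m :: 'a \<times> 'a \<Rightarrow>\<^sub>0 nat. \<Otimes>\<^bsub>R\<^esub>ij\<in>Poly_Mapping.keys m. A (fst ij) (snd ij) [^]\<^bsub>R\<^esub> Poly_Mapping.lookup m ij"
  have tc: "?t m \<in> carrier R" for m by (rule R.finprod_closed) (simp add: pc)
  have ht: "h (?t m) = (\<Otimes>\<^bsub>S\<^esub>ij\<in>Poly_Mapping.keys m. mmap h A (fst ij) (snd ij) [^]\<^bsub>S\<^esub> Poly_Mapping.lookup m ij)" for m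
    by (subst hom_finprod) (simp_all add: o_def pw[OF A] mmap_def pc)
  show ?thesis unfolding poly_eval_def
    by (subst hom_finsum) (auto simp: \<phi> tc o_def ht simp del: hom_finprod)
qed

lemma points_hom:
  assumes h: "ring_hom_cring R S h" and \<phi>: "\<And>p m. p \<in> E \<Longrightarrow> \<phi> (Poly_Mapping.lookup p m) \<in> carrier R"
    and A: "A \<in> points E R \<phi>"
  shows "mmap h A \<in> points E S (h \<circ> \<phi>)"
proof -
  interpret ring_hom_cring R S h by (rule h)
  have AU: "A \<in> Units (mat_monoid R)" and Ap: "\<And>p. p \<in> E \<Longrightarrow> poly_eval R \<phi> p A = \<zero>\<^bsub>R\<^esub>" using A by (auto simp: points_def)
  have Ac: "\<And>i j. A i j \<in> carrier R" using AU by (auto simp: Units_def mat_monoid_def)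
  have "poly_eval S (h \<circ> \<phi>) p (mmap h A) = \<zero>\<^bsub>S\<^esub>" if p: "p \<in> E" for p
    using poly_eval_hom[OF h, of A \<phi> p, OF Ac \<phi>[OF p]] Ap[OF p] by simp
  thus ?thesis using mmap_Units[OF h AU] by (auto simp: points_def)
qed

lemma cring_dual_numbers:
  assumes "cring R" shows "cring (dual_numbers R)"
proof -
  interpret cring R by (rule assms)
  have s: "carrier (dual_numbers R) = carrier R \<times> carrier R" "add (dual_numbers R) = (\<lambda>(a, b) (c, d). (a \<oplus>\<^bsub>R\<^esub> c, b \<oplus>\<^bsub>R\<^esub> d))"
    "zero (dual_numbers R) = (\<zero>\<^bsub>R\<^esub>, \<zero>\<^bsub>R\<^esub>)" "one (dual_numbers R) = (\<one>\<^bsub>R\<^esub>, \<zero>\<^bsub>R\<^esub>)"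
    "mult (dual_numbers R) = (\<lambda>(a, b) (c, d). (a \<otimes>\<^bsub>R\<^esub> c, a \<otimes>\<^bsub>R\<^esub> d \<oplus>\<^bsub>R\<^esub> b \<otimes>\<^bsub>R\<^esub> c))"
    by (simp_all add: dual_numbers_def)
  show ?thesis
  proof (rule cringI)
    show "abelian_group (dual_numbers R)"
    proof (rule abelian_groupI)
      show "\<exists>y\<in>carrier (dual_numbers R). y \<oplus>\<^bsub>dual_numbers R\<^esub> x = \<zero>\<^bsub>dual_numbers R\<^esub>" if "x \<in> carrier (dual_numbers R)" for x
        using that by (intro bexI[of _ "(\<ominus>\<^bsub>R\<^esub> fst x, \<ominus>\<^bsub>R\<^esub> snd x)"]) (auto simp: s l_neg)
    qed (auto simp: s a_ac)
    show "comm_monoid (dual_numbers R)"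
      by (rule comm_monoidI) (auto simp: s m_ac a_ac l_distr r_distr)
  qed (auto simp: s m_ac a_ac l_distr r_distr)
qed

lemma dual_numbers_hom:
  assumes h: "ring_hom_cring R S h"
  shows "ring_hom_cring (dual_numbers R) (dual_numbers S) (\<lambda>(a, b). (h a, h b))"
proof -
  interpret ring_hom_cring R S h by (rule h)
  show ?thesis
    by (intro ring_hom_cring.intro ring_hom_cring_axioms.intro cring_dual_numbers ring_hom_memI)
      (auto simp: dual_numbers_def R.is_cring S.is_cring)
qed

lemma dual_numbers_scale_hom:
  assumes R: "cring R" and c: "c \<in> carrier R"
  shows "ring_hom_cring (dual_numbers R) (dual_numbers R) (\<lambda>(a, b). (a, c \<otimes>\<^bsub>R\<^esub> b))"
proof -
  interpret cring R by (rule R)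
  show ?thesis
    by (intro ring_hom_cring.intro ring_hom_cring_axioms.intro cring_dual_numbers ring_hom_memI R)
      (auto simp: dual_numbers_def c r_distr m_ac)
qed

lemma lie_points_hom:
  assumes h: "ring_hom_cring R S h" and \<phi>: "\<And>p m. p \<in> E \<Longrightarrow> \<phi> (Poly_Mapping.lookup p m) \<in> carrier R"
    and X: "X \<in> lie_points E R \<phi>"
  shows "mmap h X \<in> lie_points E S (h \<circ> \<phi>)"
proof -
  interpret ring_hom_cring R S h by (rule h)
  have "mmap (\<lambda>(a, b). (h a, h b)) (\<lambda>i j. (mone R i j, X i j)) \<in> points E (dual_numbers S) ((\<lambda>(a, b). (h a, h b)) \<circ> (\<lambda>a. (\<phi> a, \<zero>\<^bsub>R\<^esub>)))"
    by (rule points_hom[OF dual_numbers_hom[OF h]]) (use X \<phi> in \<open>auto simp: lie_points_def dual_numbers_def\<close>)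
  moreover have "mmap (\<lambda>(a, b). (h a, h b)) (\<lambda>i j. (mone R i j, X i j)) = (\<lambda>i j. (mone S i j, mmap h X i j))"
    by (auto simp: mmap_def mone_def intro!: ext)
  moreover have "(\<lambda>(a, b). (h a, h b)) \<circ> (\<lambda>a. (\<phi> a, \<zero>\<^bsub>R\<^esub>)) = (\<lambda>a. ((h \<circ> \<phi>) a, \<zero>\<^bsub>S\<^esub>))" by auto
  ultimately show ?thesis using X by (auto simp: lie_points_def mmap_def)
qed

text \<open>The endomorphism of the dual numbers sending \<epsilon> to c \<epsilon> carries the
  point 1 + \<epsilon> X to 1 + \<epsilon> c X.\<close>

lemma lie_points_scale:
  assumes R: "cring R" and c: "c \<in> carrier R" and \<phi>: "\<And>p m. p \<in> E \<Longrightarrow> \<phi> (Poly_Mapping.lookup p m) \<in> carrier R"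
    and X: "X \<in> lie_points E R \<phi>"
  shows "msmult R c X \<in> lie_points E R \<phi>"
proof -
  interpret cring R by (rule R)
  have "mmap (\<lambda>(a, b). (a, c \<otimes>\<^bsub>R\<^esub> b)) (\<lambda>i j. (mone R i j, X i j)) \<in> points E (dual_numbers R) ((\<lambda>(a, b). (a, c \<otimes>\<^bsub>R\<^esub> b)) \<circ> (\<lambda>a. (\<phi> a, \<zero>\<^bsub>R\<^esub>)))"
    by (rule points_hom[OF dual_numbers_scale_hom[OF R c]]) (use X \<phi> in \<open>auto simp: lie_points_def dual_numbers_def\<close>)
  moreover have "mmap (\<lambda>(a, b). (a, c \<otimes>\<^bsub>R\<^esub> b)) (\<lambda>i j. (mone R i j, X i j)) = (\<lambda>i j. (mone R i j, msmult R c X i j))"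
    by (auto simp: mmap_def mone_def msmult_def intro!: ext)
  moreover have "(\<lambda>(a, b). (a, c \<otimes>\<^bsub>R\<^esub> b)) \<circ> (\<lambda>a. (\<phi> a, \<zero>\<^bsub>R\<^esub>)) = (\<lambda>a. (\<phi> a, \<zero>\<^bsub>R\<^esub>))" by (auto simp: c)
  ultimately show ?thesis using X c by (auto simp: lie_points_def msmult_def)
qed

section \<open>Reduction of integral matrices\<close>

context local_field
begin

text \<open>Elements of G(O_m) and of its Lie algebra are represented by integral matrices over the
  field, and equality over O_m becomes equality of \<open>red m\<close>; one lift thus serves at
  several levels at once.\<close>

definition intm :: "('n::finite, 'f) sqm \<Rightarrow> bool" where
  "intm A \<longleftrightarrow> (\<forall>i j. ent A i j \<in> ppow v 0)"

definition red :: "nat \<Rightarrow> ('n::finite, 'f) sqm \<Rightarrow> ('n, 'f set) sqmat" where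
  "red m A = mmap (omod v m) (ent A)"

definition lft :: "('n::finite, 'f set) sqmat \<Rightarrow> ('n, 'f) sqm" where
  "lft x = Sqm (mlift x)"

lemma intmD: "intm A \<Longrightarrow> ent A i j \<in> ppow v 0" by (simp add: intm_def)

lemma intm_arith [simp]:
  "intm A \<Longrightarrow> intm B \<Longrightarrow> intm (A + B)" "intm A \<Longrightarrow> intm B \<Longrightarrow> intm (A - B)" "intm A \<Longrightarrow> intm (- A)"
  "intm A \<Longrightarrow> intm B \<Longrightarrow> intm (A * B)" "intm 0" "intm 1" "c \<in> ppow v 0 \<Longrightarrow> intm (sc c)"
  by (auto simp: intm_def sqm_simps)

lemma tr_int [simp]: "intm A \<Longrightarrow> tr A \<in> ppow v 0" by (auto simp: intm_def sqm_simps)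

lemma red_eq_iff_ent: "red m A = red m B \<longleftrightarrow> (\<forall>i j. ent A i j - ent B i j \<in> ppow v m)"
  by (auto simp: red_def mmap_def fun_eq_iff omod_eq_iff)

lemma red_eq_iff: "red m A = red m B \<longleftrightarrow> (\<exists>C. intm C \<and> A = B + sc (\<pi>F ^ m) * C)"
proof
  assume "red m A = red m B"
  hence "\<forall>i j. \<exists>y\<in>ppow v 0. ent A i j - ent B i j = \<pi>F ^ m * y" unfolding red_eq_iff_ent ppow_iff[of _ m] by blast
  then obtain C where C: "\<And>i j. C i j \<in> ppow v 0" "\<And>i j. ent A i j - ent B i j = \<pi>F ^ m * C i j" by metis
  have "A = B + sc (\<pi>F ^ m) * Sqm C"
    by (rule sqm_eqI) (use C(2) in \<open>simp add: plus_sqm.rep_eq ent_sc_mult C(2)[symmetric]\<close>)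
  moreover have "intm (Sqm C)" using C(1) by (simp add: intm_def)
  ultimately show "\<exists>C. intm C \<and> A = B + sc (\<pi>F ^ m) * C" by blast
next
  assume "\<exists>C. intm C \<and> A = B + sc (\<pi>F ^ m) * C"
  thus "red m A = red m B" unfolding red_eq_iff_ent
    by (auto simp: plus_sqm.rep_eq ent_sc_mult intm_def ppow_iff[of _ m])
qed

lemma red_sc_add [simp]: "intm C \<Longrightarrow> red m (B + sc (\<pi>F ^ m) * C) = red m B"
  unfolding red_eq_iff by blast

lemma red_sc_diff [simp]: "intm C \<Longrightarrow> red m (B - sc (\<pi>F ^ m) * C) = red m B"
  using red_sc_add[of "- C" m B] by simp

lemma red_mono: "k \<le> m \<Longrightarrow> red m A = red m B \<Longrightarrow> red k A = red k B"
  unfolding red_eq_iff_ent using ppow_mono by blast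

lemma red_intm: "red m A = red m B \<Longrightarrow> intm A \<Longrightarrow> intm B"
proof -
  assume "red m A = red m B" "intm A"
  then obtain C where "intm C" "B = A + sc (\<pi>F ^ m) * C" using red_eq_iff[of m B A] by metis
  thus "intm B" using \<open>intm A\<close> by simp
qed

lemma red_add_cong: "red m A = red m A' \<Longrightarrow> red m B = red m B' \<Longrightarrow> red m (A + B) = red m (A' + B')"
  unfolding red_eq_iff_ent by (auto simp: plus_sqm.rep_eq add_diff_add)

lemma red_diff_cong: "red m A = red m A' \<Longrightarrow> red m B = red m B' \<Longrightarrow> red m (A - B) = red m (A' - B')"
proof -
  have e: "a - b - (a' - b') = (a - a') - (b - b')" for a b a' b' :: 'f by simp
  show "red m A = red m A' \<Longrightarrow> red m B = red m B' \<Longrightarrow> red m (A - B) = red m (A' - B')"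
    unfolding red_eq_iff_ent by (auto simp: minus_sqm.rep_eq e simp del: diff_diff_eq2)
qed

text \<open>With A = A' + \<open>\<pi>F ^ m\<close> C and B = B' + \<open>\<pi>F ^ m\<close> D the
  error terms are C B and A' D; this is why integrality is asked of \<open>A'\<close> and
  \<open>B\<close>.\<close>

lemma red_mult_cong:
  assumes "red m A = red m A'" "red m B = red m B'" "intm A'" "intm B"
  shows "red m (A * B) = red m (A' * B')"
proof -
  obtain C where C: "intm C" "A = A' + sc (\<pi>F ^ m) * C" using assms(1) red_eq_iff by blast
  obtain D where D: "intm D" "B = B' + sc (\<pi>F ^ m) * D" using assms(2) red_eq_iff by blast
  have "A * B = A' * B + sc (\<pi>F ^ m) * (C * B)" unfolding C(2) by (simp add: algebra_simps)
  also have "A' * B = A' * B' + sc (\<pi>F ^ m) * (A' * D)" unfolding D(2) by (simp add: algebra_simps sc_left_commute)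
  finally have "A * B = A' * B' + sc (\<pi>F ^ m) * (A' * D + C * B)" by (simp add: algebra_simps)
  moreover have "intm (A' * D + C * B)" using C(1) D(1) assms(3,4) by simp
  ultimately show ?thesis unfolding red_eq_iff by blast
qed

lemma red_sc_shift: "red (m + k) (sc (\<pi>F ^ m) * A) = red (m + k) (sc (\<pi>F ^ m) * B) \<longleftrightarrow> red k A = red k B"
  unfolding red_eq_iff_ent by (simp add: ent_sc_mult right_diff_distrib[symmetric] pow_mult_mem_iff)

lemma red_add_left_iff: "red m (A + B) = red m (A + C) \<longleftrightarrow> red m B = red m C"
  unfolding red_eq_iff_ent by (simp add: plus_sqm.rep_eq)

lemma red_closed: "intm A \<Longrightarrow> red m A i j \<in> carrier (Omod v m)" by (simp add: red_def mmap_def intmD)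

lemma carrier_mat_monoid: "x \<in> carrier (mat_monoid (Omod v m)) \<longleftrightarrow> (\<exists>A. intm A \<and> x = red m A)"
proof
  assume "x \<in> carrier (mat_monoid (Omod v m))"
  hence "\<forall>i j. \<exists>a\<in>ppow v 0. x i j = omod v m a" unfolding mat_monoid_def carrier_Omod by (auto simp: image_iff)
  then obtain A where A: "\<And>i j. A i j \<in> ppow v 0" "\<And>i j. x i j = omod v m (A i j)" by metis
  hence "intm (Sqm A)" "x = red m (Sqm A)" by (simp_all add: intm_def red_def mmap_def fun_eq_iff)
  thus "\<exists>A. intm A \<and> x = red m A" by blast
qed (auto simp: mat_monoid_def red_closed)

lemma red_ops:
  "intm A \<Longrightarrow> intm B \<Longrightarrow> mmult (Omod v m) (red m A) (red m B) = red m (A * B)"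
  "intm A \<Longrightarrow> intm B \<Longrightarrow> madd (Omod v m) (red m A) (red m B) = red m (A + B)"
  "intm A \<Longrightarrow> intm B \<Longrightarrow> mminus (Omod v m) (red m A) (red m B) = red m (A - B)"
  "mone (Omod v m) = red m 1" "mzero (Omod v m) = red m 0"
  "intm A \<Longrightarrow> c \<in> ppow v 0 \<Longrightarrow> msmult (Omod v m) (omod v m c) (red m A) = red m (sc c * A)"
  "intm A \<Longrightarrow> mtrace (Omod v m) (red m A) = omod v m (tr A)"
proof -
  show "mmult (Omod v m) (red m A) (red m B) = red m (A * B)" if "intm A" "intm B"
  proof (intro ext)
    fix i j
    have "mmult (Omod v m) (red m A) (red m B) i j = (\<Oplus>\<^bsub>Omod v m\<^esub>k\<in>UNIV. omod v m (ent A i k * ent B k j))"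
      using that by (simp add: mmult_def red_def mmap_def omod_ops intmD)
    also have "\<dots> = red m (A * B) i j" using that by (subst omod_finsum) (auto simp: intmD red_def mmap_def times_sqm.rep_eq)
    finally show "mmult (Omod v m) (red m A) (red m B) i j = red m (A * B) i j" .
  qed
  show "mtrace (Omod v m) (red m A) = omod v m (tr A)" if "intm A"
    unfolding mtrace_def red_def mmap_def tr.rep_eq by (rule omod_finsum) (rule intmD[OF that])
qed (simp_all add: fun_eq_iff madd_def mminus_def mone_def mzero_def msmult_def red_def mmap_def omod_ops omod_minus intmD
    plus_sqm.rep_eq minus_sqm.rep_eq one_sqm.rep_eq zero_sqm.rep_eq ent_sc_mult)

lemma bracket_red: "intm A \<Longrightarrow> intm B \<Longrightarrow> bracket (Omod v m) (red m A) (red m B) = red m (A * B - B * A)"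
  by (simp add: bracket_def red_ops)

lemma tform_red: "intm A \<Longrightarrow> intm B \<Longrightarrow> tform (Omod v m) (red m A) (red m B) = omod v m (tr (A * B))"
  by (simp add: tform_def red_ops)

lemma mmult_int: "intm A \<Longrightarrow> intm B \<Longrightarrow> mmult (int_ring v) (ent A) (ent B) = ent (A * B)"
  unfolding mmult_def times_sqm.rep_eq by (intro ext) (subst finsum_int, auto simp: intmD)

lemma tform_int: "intm A \<Longrightarrow> intm B \<Longrightarrow> tform (int_ring v) (ent A) (ent B) = tr (A * B)"
  unfolding tform_def mtrace_def using finsum_int[of UNIV "\<lambda>i. ent (A * B) i i"]
  by (simp add: mmult_int intmD tr.rep_eq)

lemma lft:
  assumes "x \<in> carrier (mat_monoid (Omod v m))"
  shows "intm (lft x)" "red m (lft x) = x"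
proof -
  obtain A where A: "intm A" "x = red m A" using assms carrier_mat_monoid by blast
  show "red m (lft x) = x" unfolding lft_def A(2) red_def mlift_def mmap_def ent_Sqm using omod_some[of m m] by simp
  thus "intm (lft x)" using red_intm[of m A "lft x"] A by simp
qed

lemma mred_red: "k \<le> m \<Longrightarrow> mred v k (red m A) = red k A"
  unfolding mred_def red_def mlift_def mmap_def by (simp add: omod_some)

lemma red_lft_red: "k \<le> m \<Longrightarrow> red k (lft (red m A)) = red k A"
  using mred_red[of k m A] by (simp add: mred_def red_def lft_def)

lemma one_plus_red: "mmap (omod v m) (one_plus c X) = red m (1 + sc c * Sqm X)"
  by (simp add: mmap_def red_def one_plus_def plus_sqm.rep_eq one_sqm.rep_eq ent_sc_mult)

lemma mat_monoid_simps: "mult (mat_monoid R) = mmult R" "one (mat_monoid R) = mone R"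
  by (simp_all add: mat_monoid_def)

lemma red_in_mats: "intm A \<Longrightarrow> red m A \<in> carrier (mat_monoid (Omod v m))"
  using carrier_mat_monoid by blast

lemma mats_cases:
  assumes "x \<in> carrier (mat_monoid (Omod v m))"
  obtains A where "intm A" "x = red m A"
  using assms carrier_mat_monoid by blast

lemma monoid_mats: "monoid (mat_monoid (Omod v m) :: ('n::finite, 'f set) sqmat monoid)"
proof (rule monoidI)
  fix x y z :: "('n, 'f set) sqmat"
  assume x: "x \<in> carrier (mat_monoid (Omod v m))"
  then obtain A where A: "intm A" "x = red m A" by (rule mats_cases)
  show "\<one>\<^bsub>mat_monoid (Omod v m)\<^esub> \<otimes>\<^bsub>mat_monoid (Omod v m)\<^esub> x = x" "x \<otimes>\<^bsub>mat_monoid (Omod v m)\<^esub> \<one>\<^bsub>mat_monoid (Omod v m)\<^esub> = x"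
    using A by (simp_all add: mat_monoid_simps red_ops)
  assume y: "y \<in> carrier (mat_monoid (Omod v m))"
  then obtain B where B: "intm B" "y = red m B" by (rule mats_cases)
  show "x \<otimes>\<^bsub>mat_monoid (Omod v m)\<^esub> y \<in> carrier (mat_monoid (Omod v m))"
    using A B by (simp add: mat_monoid_simps red_ops red_in_mats)
  assume z: "z \<in> carrier (mat_monoid (Omod v m))"
  then obtain C where C: "intm C" "z = red m C" by (rule mats_cases)
  show "x \<otimes>\<^bsub>mat_monoid (Omod v m)\<^esub> y \<otimes>\<^bsub>mat_monoid (Omod v m)\<^esub> z = x \<otimes>\<^bsub>mat_monoid (Omod v m)\<^esub> (y \<otimes>\<^bsub>mat_monoid (Omod v m)\<^esub> z)"
    using A B C by (simp add: mat_monoid_simps red_ops mult.assoc)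
qed (simp add: mat_monoid_simps red_ops red_in_mats)

lemma Units_red_iff:
  assumes A: "intm A"
  shows "red m A \<in> Units (mat_monoid (Omod v m)) \<longleftrightarrow> (\<exists>B. intm B \<and> red m (A * B) = red m 1 \<and> red m (B * A) = red m 1)"
proof
  assume "red m A \<in> Units (mat_monoid (Omod v m))"
  then obtain x where x: "x \<in> carrier (mat_monoid (Omod v m))" "mmult (Omod v m) x (red m A) = mone (Omod v m)" "mmult (Omod v m) (red m A) x = mone (Omod v m)"
    by (auto simp: Units_def mat_monoid_simps)
  then obtain B where B: "intm B" "x = red m B" unfolding carrier_mat_monoid by blast
  show "\<exists>B. intm B \<and> red m (A * B) = red m 1 \<and> red m (B * A) = red m 1"
    using x(2,3) B A by (auto simp: red_ops intro!: exI[of _ B])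
next
  assume "\<exists>B. intm B \<and> red m (A * B) = red m 1 \<and> red m (B * A) = red m 1"
  then obtain B where B: "intm B" "red m (A * B) = red m 1" "red m (B * A) = red m 1" by blast
  have "red m A \<in> carrier (mat_monoid (Omod v m))" "red m B \<in> carrier (mat_monoid (Omod v m))" using A B carrier_mat_monoid by blast+
  thus "red m A \<in> Units (mat_monoid (Omod v m))" using A B by (auto simp: Units_def mat_monoid_simps red_ops intro!: bexI[of _ "red m B"])
qed

lemma inv_red:
  assumes A: "intm A" "intm B" "red m (A * B) = red m 1" "red m (B * A) = red m 1"
  shows "inv\<^bsub>mat_monoid (Omod v m)\<^esub> (red m A) = red m B"
proof -
  interpret monoid "mat_monoid (Omod v m)" by (rule monoid_mats)
  have c: "red m A \<in> carrier (mat_monoid (Omod v m))" "red m B \<in> carrier (mat_monoid (Omod v m))" using A carrier_mat_monoid by blast+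
  show ?thesis by (rule inv_char) (use A c in \<open>simp_all add: mat_monoid_simps red_ops\<close>)
qed

lemma Ad_red:
  assumes "intm A" "intm B" "red m (A * B) = red m 1" "red m (B * A) = red m 1" "intm X"
  shows "Ad (Omod v m) (red m A) (red m X) = red m (A * X * B)"
  using assms by (simp add: Ad_def inv_red[OF assms(1-4)] red_ops)

lemma ring_hom_cring_omod: "ring_hom_cring (int_ring v) (Omod v m) (omod v m)"
  by (intro ring_hom_cring.intro ring_hom_cring_axioms.intro cring_int cring_Omod omod_hom)

text \<open>The projection from O_m to O_k on single entries, introduced so that functoriality of
  points and the lifting property can be applied to a ring homomorphism.\<close>

definition qred :: "nat \<Rightarrow> 'f set \<Rightarrow> 'f set" where "qred k c = omod v k (SOME a. a \<in> c)"

lemma qred_omod: "k \<le> m \<Longrightarrow> qred k (omod v m x) = omod v k x" by (simp add: qred_def omod_some)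

lemma mmap_qred: "mmap (qred k) x = mred v k x" by (simp add: mmap_def qred_def mred_def mlift_def)

lemma qred_hom: "k \<le> m \<Longrightarrow> ring_hom_cring (Omod v m) (Omod v k) (qred k)"
proof (intro ring_hom_cring.intro ring_hom_cring_axioms.intro cring_Omod ring_hom_memI)
  assume km: "k \<le> m"
  show "qred k x \<in> carrier (Omod v k)" if "x \<in> carrier (Omod v m)" for x
    using that km by (auto simp: carrier_Omod qred_omod)
  show "qred k (x \<otimes>\<^bsub>Omod v m\<^esub> y) = qred k x \<otimes>\<^bsub>Omod v k\<^esub> qred k y" if "x \<in> carrier (Omod v m)" "y \<in> carrier (Omod v m)" for x y
    using that km by (auto simp: carrier_Omod qred_omod omod_ops)
  show "qred k (x \<oplus>\<^bsub>Omod v m\<^esub> y) = qred k x \<oplus>\<^bsub>Omod v k\<^esub> qred k y" if "x \<in> carrier (Omod v m)" "y \<in> carrier (Omod v m)" for x y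
    using that km by (auto simp: carrier_Omod qred_omod omod_ops)
  show "qred k \<one>\<^bsub>Omod v m\<^esub> = \<one>\<^bsub>Omod v k\<^esub>" using km by (simp add: omod_ops qred_omod)
qed

lemma qred_comp: "k \<le> m \<Longrightarrow> qred k \<circ> omod v m = omod v k" by (auto simp: qred_omod)

end

section \<open>Points over the finite quotients\<close>

locale group_scheme = local_field v \<pi>F for v :: "'f::field \<Rightarrow> int" and \<pi>F +
  fixes E :: "('n::finite, 'f) mpoly set" and \<beta> :: "('n, 'f) sqmat"
  assumes closed_sub: "closed_subgroup_scheme v E" and smooth_G: "smooth_functor v (points E)"
    and condII: "cond_II v \<pi>F E" and condI: "cond_I v E" and \<beta>_lie: "\<beta> \<in> lie_int v E"
    and comm_C: "commutative_functor v (cent_points E \<beta>)" and smooth_C: "smooth_functor v (cent_points E \<beta>)"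
begin

abbreviation pw :: "nat \<Rightarrow> ('n, 'f) sqm" where "pw m \<equiv> sc (\<pi>F ^ m)"
abbreviation b :: "('n, 'f) sqm" where "b \<equiv> Sqm \<beta>"

definition PG :: "nat \<Rightarrow> ('n, 'f) sqm \<Rightarrow> bool" where
  "PG m A \<longleftrightarrow> intm A \<and> red m A \<in> points E (Omod v m) (omod v m)"

text \<open>Centralizing \<beta> is expressed by commutation modulo \<pp>^m, free of inverses;
  \<open>CG_iff\<close> gives the equivalence with membership in \<open>cent_points\<close>.\<close>

definition CG :: "nat \<Rightarrow> ('n, 'f) sqm \<Rightarrow> bool" where
  "CG m A \<longleftrightarrow> PG m A \<and> red m (A * b) = red m (b * A)"

definition Lie :: "nat \<Rightarrow> ('n, 'f) sqm \<Rightarrow> bool" where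
  "Lie m X \<longleftrightarrow> intm X \<and> red m X \<in> lie_points E (Omod v m) (omod v m)"

lemma intm_b [simp]: "intm b" using \<beta>_lie by (simp add: lie_points_def intm_def)

lemma coef: "p \<in> E \<Longrightarrow> Poly_Mapping.lookup p m \<in> ppow v 0"
  using closed_sub by (auto simp: closed_subgroup_scheme_def)

lemma intm_pw [simp]: "intm (pw m)" by (simp add: intm_arith(7))

lemma PG_intm: "PG m A \<Longrightarrow> intm A" by (simp add: PG_def)

lemma PG_cong: "red m A = red m B \<Longrightarrow> PG m A \<Longrightarrow> PG m B"
  using red_intm by (auto simp: PG_def)

lemma sub_points: "subgroup (points E (Omod v m) (omod v m)) (GLn (Omod v m))"
  using closed_sub O_algebra_Omod unfolding closed_subgroup_scheme_def by blast

lemma PG_mult: "PG m A \<Longrightarrow> PG m B \<Longrightarrow> PG m (A * B)"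
  using subgroup.m_closed[OF sub_points, of "red m A" m "red m B"] by (simp add: PG_def units_of_def mat_monoid_simps red_ops)

lemma PG_one: "PG m 1"
  using subgroup.one_closed[OF sub_points, of m] by (simp add: PG_def units_of_def mat_monoid_simps red_ops)

lemma PG_inv:
  assumes "PG m A"
  obtains B where "PG m B" "red m (A * B) = red m 1" "red m (B * A) = red m 1"
proof -
  have A: "intm A" "red m A \<in> points E (Omod v m) (omod v m)" using assms by (auto simp: PG_def)
  hence "red m A \<in> Units (mat_monoid (Omod v m))" by (auto simp: points_def)
  then obtain B where B: "intm B" "red m (A * B) = red m 1" "red m (B * A) = red m 1" using Units_red_iff[OF A(1)] by blast
  interpret M: monoid "mat_monoid (Omod v m) :: ('n, 'f set) sqmat monoid" by (rule monoid_mats)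
  have U: "red m A \<in> Units (mat_monoid (Omod v m))" using A by (auto simp: points_def)
  have "inv\<^bsub>GLn (Omod v m)\<^esub> (red m A) = red m B"
    using M.units_of_inv[OF U] inv_red[OF A(1) B] by simp
  hence "red m B \<in> points E (Omod v m) (omod v m)" using subgroup.m_inv_closed[OF sub_points A(2)] by simp
  with B that show ?thesis by (auto simp: PG_def)
qed

lemma PG_mono: "k \<le> m \<Longrightarrow> PG m A \<Longrightarrow> PG k A"
proof -
  assume km: "k \<le> m" and A: "PG m A"
  have "mmap (qred k) (red m A) \<in> points E (Omod v k) (qred k \<circ> omod v m)"
    by (rule points_hom[OF qred_hom[OF km]]) (use A coef in \<open>auto simp: PG_def\<close>)
  thus "PG k A" using A by (simp add: mmap_qred mred_red[OF km] qred_comp[OF km] PG_def)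
qed

lemma CG_iff: "CG m A \<longleftrightarrow> intm A \<and> red m A \<in> cent_points E \<beta> (Omod v m) (omod v m)"
proof -
  have e: "mmap (omod v m) \<beta> = red m b" by (simp add: red_def)
  have "Ad (Omod v m) (red m A) (red m b) = red m b \<longleftrightarrow> red m (A * b) = red m (b * A)" if A: "PG m A"
  proof -
    obtain B where B: "PG m B" "red m (A * B) = red m 1" "red m (B * A) = red m 1" by (rule PG_inv[OF A])
    note iA = PG_intm[OF A] and iB = PG_intm[OF B(1)]
    have Ad: "Ad (Omod v m) (red m A) (red m b) = red m (A * b * B)" by (rule Ad_red) (use iA iB B in auto)
    have 1: "red m (b * A * B) = red m b"
      using red_mult_cong[OF refl B(2), of b] iA iB by (simp add: mult.assoc)
    have 2: "red m (A * b * B * A) = red m (A * b)"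
      using red_mult_cong[OF refl B(3), of "A * b"] iA iB by (simp add: mult.assoc)
    show ?thesis
    proof
      assume "Ad (Omod v m) (red m A) (red m b) = red m b"
      hence "red m (A * b * B * A) = red m (b * A)" unfolding Ad by (rule red_mult_cong) (use iA in auto)
      thus "red m (A * b) = red m (b * A)" using 2 by simp
    next
      assume "red m (A * b) = red m (b * A)"
      hence "red m (A * b * B) = red m (b * A * B)" by (rule red_mult_cong) (use iA iB in auto)
      thus "Ad (Omod v m) (red m A) (red m b) = red m b" unfolding Ad using 1 by simp
    qed
  qed
  thus ?thesis unfolding CG_def cent_points_def e by (auto simp: PG_def)
qed

lemma CG_PG: "CG m A \<Longrightarrow> PG m A" by (simp add: CG_def)

lemma CG_cong: "red m A = red m B \<Longrightarrow> CG m A \<Longrightarrow> CG m B"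
  unfolding CG_iff using red_intm by auto

lemma CG_mono: "k \<le> m \<Longrightarrow> CG m A \<Longrightarrow> CG k A"
  unfolding CG_def using PG_mono red_mono by blast

lemma CG_comm: "CG m A \<Longrightarrow> CG m B \<Longrightarrow> red m (A * B) = red m (B * A)"
proof -
  assume A: "CG m A" and B: "CG m B"
  have "mmult (Omod v m) (red m A) (red m B) = mmult (Omod v m) (red m B) (red m A)"
    using comm_C O_algebra_Omod[of m] A B unfolding commutative_functor_def CG_iff by blast
  thus ?thesis using A B by (simp add: red_ops CG_def PG_def)
qed

lemma CG_mult: "CG m A \<Longrightarrow> CG m B \<Longrightarrow> CG m (A * B)"
proof -
  assume A: "CG m A" and B: "CG m B"
  note i = PG_intm[OF CG_PG[OF A]] PG_intm[OF CG_PG[OF B]]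
  have "red m (A * (B * b)) = red m (A * (b * B))" by (rule red_mult_cong) (use A B i in \<open>auto simp: CG_def\<close>)
  moreover have "red m (A * b * B) = red m (b * A * B)" by (rule red_mult_cong) (use A B i in \<open>auto simp: CG_def\<close>)
  ultimately have "red m (A * B * b) = red m (b * (A * B))" by (simp add: mult.assoc)
  thus ?thesis using A B PG_mult by (simp add: CG_def)
qed

lemma CG_one: "CG m 1" by (simp add: CG_def PG_one)

lemma CG_inv:
  assumes "CG m A" "PG m B" "red m (A * B) = red m 1" "red m (B * A) = red m 1"
  shows "CG m B"
proof -
  note i = PG_intm[OF CG_PG[OF assms(1)]] PG_intm[OF assms(2)]
  have "red m (B * b) = red m (B * b * (A * B))"
    using red_mult_cong[OF refl assms(3), of "B * b"] i by simp
  also have "\<dots> = red m (B * (b * A) * B)" by (simp add: mult.assoc)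
  also have "\<dots> = red m (B * (A * b) * B)"
    by (rule red_mult_cong[OF red_mult_cong[OF refl] refl]) (use assms(1) i in \<open>auto simp: CG_def\<close>)
  also have "\<dots> = red m (B * A * (b * B))" by (simp add: mult.assoc)
  also have "\<dots> = red m (b * B)" using red_mult_cong[OF assms(4) refl, of "b * B"] i by simp
  finally show ?thesis using assms(2) by (simp add: CG_def)
qed

text \<open>The kernel of O_(m+1) \<rightarrow> O_m consists of the classes of \<pp>^m, and 2m \<ge>
  m + 1 for m > 0: it has square zero, so smoothness lifts points along this map.\<close>

lemma qred_kernel:
  assumes "x \<in> a_kernel (Omod v (Suc m)) (Omod v m) (qred m)" "y \<in> a_kernel (Omod v (Suc m)) (Omod v m) (qred m)" "0 < m"
  shows "x \<otimes>\<^bsub>Omod v (Suc m)\<^esub> y = \<zero>\<^bsub>Omod v (Suc m)\<^esub>"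
proof -
  have k: "\<exists>a. a \<in> ppow v 0 \<and> a \<in> ppow v m \<and> x = omod v (Suc m) a" if "x \<in> a_kernel (Omod v (Suc m)) (Omod v m) (qred m)" for x
  proof -
    have "x \<in> carrier (Omod v (Suc m))" "qred m x = omod v m 0" using that by (auto simp: a_kernel_def kernel_def omod_ops)
    then obtain a where a: "a \<in> ppow v 0" "x = omod v (Suc m) a" unfolding carrier_Omod by auto
    moreover have "omod v m a = omod v m 0" using \<open>qred m x = _\<close> a by (simp add: qred_omod)
    ultimately show ?thesis by (auto simp: omod_eq_iff)
  qed
  obtain a c where ac: "a \<in> ppow v 0" "a \<in> ppow v m" "x = omod v (Suc m) a" "c \<in> ppow v 0" "c \<in> ppow v m" "y = omod v (Suc m) c"
    using k[OF assms(1)] k[OF assms(2)] by blast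
  have "a * c \<in> ppow v (m + m)" using ac ppow_mult by blast
  hence "a * c \<in> ppow v (Suc m)" by (rule ppow_mono[rotated]) (use assms(3) in simp)
  thus ?thesis using ac by (simp add: omod_ops omod_eq_iff)
qed

lemma smooth_step:
  assumes "smooth_functor v X" "0 < m" "A \<in> X (Omod v m) (omod v m)"
  obtains B where "B \<in> X (Omod v (Suc m)) (omod v (Suc m))" "mred v m B = A"
proof -
  have q: "qred m \<in> Ring.ring_hom (Omod v (Suc m)) (Omod v m)" using qred_hom[of m "Suc m"] by (simp add: ring_hom_cring.homh)
  have im: "qred m ` carrier (Omod v (Suc m)) = carrier (Omod v m)"
    unfolding carrier_Omod image_image by (rule image_cong) (auto simp: qred_omod)
  have comp: "qred m \<circ> omod v (Suc m) = omod v m" by (rule qred_comp) simp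
  have "\<exists>B\<in>X (Omod v (Suc m)) (omod v (Suc m)). mmap (qred m) B = A"
    using assms(1)[unfolded smooth_functor_def, rule_format, of "Omod v (Suc m)" "omod v (Suc m)" "Omod v m" "qred m" A]
      O_algebra_Omod[of "Suc m"] cring_Omod[of m] q im qred_kernel[of _ m] assms(2,3) comp by simp
  thus ?thesis using that by (auto simp: mmap_qred)
qed

lemma PG_lift1: "0 < m \<Longrightarrow> PG m A \<Longrightarrow> \<exists>B. PG (Suc m) B \<and> red m B = red m A"
proof -
  assume m: "0 < m" and A: "PG m A"
  obtain x where x: "x \<in> points E (Omod v (Suc m)) (omod v (Suc m))" "mred v m x = red m A"
    by (rule smooth_step[OF smooth_G m]) (use A in \<open>auto simp: PG_def\<close>)
  have xc: "x \<in> carrier (mat_monoid (Omod v (Suc m)))" using x by (auto simp: points_def Units_def)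
  have "PG (Suc m) (lft x)" using lft[OF xc] x by (simp add: PG_def)
  moreover have "red m (lft x) = red m A" using mred_red[of m "Suc m" "lft x"] lft[OF xc] x by simp
  ultimately show ?thesis by blast
qed

lemma CG_lift1: "0 < m \<Longrightarrow> CG m A \<Longrightarrow> \<exists>B. CG (Suc m) B \<and> red m B = red m A"
proof -
  assume m: "0 < m" and A: "CG m A"
  obtain x where x: "x \<in> cent_points E \<beta> (Omod v (Suc m)) (omod v (Suc m))" "mred v m x = red m A"
    by (rule smooth_step[OF smooth_C m]) (use A in \<open>auto simp: CG_iff\<close>)
  have xc: "x \<in> carrier (mat_monoid (Omod v (Suc m)))" using x by (auto simp: points_def cent_points_def Units_def)
  have "CG (Suc m) (lft x)" using lft[OF xc] x by (simp add: CG_iff)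
  moreover have "red m (lft x) = red m A" using mred_red[of m "Suc m" "lft x"] lft[OF xc] x by simp
  ultimately show ?thesis by blast
qed

lemma PG_lift:
  assumes "0 < m" "m \<le> r" "PG m A"
  shows "\<exists>B. PG r B \<and> red m B = red m A"
  using assms(2)
proof (induction r rule: dec_induct)
  case (step r)
  then obtain B where B: "PG r B" "red m B = red m A" by blast
  have r: "0 < r" using step assms(1) by simp
  obtain C where C: "PG (Suc r) C" "red r C = red r B" using PG_lift1[OF r B(1)] by blast
  have "red m C = red m B" by (rule red_mono[OF _ C(2)]) (use step in simp)
  thus ?case using B C by auto
qed (use assms in auto)

lemma CG_lift:
  assumes "0 < m" "m \<le> r" "CG m A"
  shows "\<exists>B. CG r B \<and> red m B = red m A"
  using assms(2)
proof (induction r rule: dec_induct)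
  case (step r)
  then obtain B where B: "CG r B" "red m B = red m A" by blast
  have r: "0 < r" using step assms(1) by simp
  obtain C where C: "CG (Suc r) C" "red r C = red r B" using CG_lift1[OF r B(1)] by blast
  have "red m C = red m B" by (rule red_mono[OF _ C(2)]) (use step in simp)
  thus ?case using B C by auto
qed (use assms in auto)

section \<open>The Lie algebra\<close>

lemma Lie_intm: "Lie m X \<Longrightarrow> intm X" by (simp add: Lie_def)

lemma Lie_cong: "red m X = red m Y \<Longrightarrow> Lie m X \<Longrightarrow> Lie m Y"
  using red_intm by (auto simp: Lie_def)

lemma one_pw_cong: "red k X = red k Y \<Longrightarrow> red (l + k) (1 + pw l * X) = red (l + k) (1 + pw l * Y)"
  by (simp add: red_add_left_iff red_sc_shift)

text \<open>Condition II in terms of lifts. The exponent \<open>l\<close> may be any integer \<ge>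
  \<open>k\<close>; varying it lets group operations at different levels yield the closure
  properties of the Lie algebra.\<close>

lemma Lie_iff:
  assumes "0 < k" "k \<le> l"
  shows "Lie k X \<longleftrightarrow> intm X \<and> PG (l + k) (1 + pw l * X)"
proof -
  let ?h = "\<lambda>X. mmap (omod v (l + k)) (one_plus (\<pi>F ^ l) (mlift X))"
  have iso: "?h \<in> iso (lie_group v E k) (K_group v E l (l + k))" using condII assms unfolding cond_II_def by blast
  have h: "?h (red k X) = red (l + k) (1 + pw l * X)" for X :: "('n, 'f) sqm"
  proof -
    have "?h (red k X) = red (l + k) (1 + pw l * lft (red k X))" by (simp add: one_plus_red lft_def)
    also have "\<dots> = red (l + k) (1 + pw l * X)" by (rule one_pw_cong) (rule red_lft_red, simp)
    finally show ?thesis .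
  qed
  show ?thesis
  proof
    assume X: "Lie k X"
    have "red k X \<in> carrier (lie_group v E k)" using X by (simp add: Lie_def lie_group_def)
    hence "?h (red k X) \<in> carrier (K_group v E l (l + k))" using iso unfolding iso_def hom_def by auto
    hence "red (l + k) (1 + pw l * X) \<in> carrier (K_group v E l (l + k))" unfolding h .
    thus "intm X \<and> PG (l + k) (1 + pw l * X)" using Lie_intm[OF X] by (simp add: PG_def K_group_def G_group_def)
  next
    assume X: "intm X \<and> PG (l + k) (1 + pw l * X)"
    have "mred v l (red (l + k) (1 + pw l * X)) = mone (Omod v l)" using X by (simp add: mred_red red_ops)
    hence "red (l + k) (1 + pw l * X) \<in> carrier (K_group v E l (l + k))" using X by (simp add: PG_def K_group_def G_group_def)
    hence "red (l + k) (1 + pw l * X) \<in> ?h ` carrier (lie_group v E k)" using iso unfolding iso_def bij_betw_def by simp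
    then obtain y where y: "y \<in> lie_points E (Omod v k) (omod v k)" "red (l + k) (1 + pw l * X) = ?h y" by (auto simp: lie_group_def)
    have yc: "y \<in> carrier (mat_monoid (Omod v k))" using y by (auto simp: lie_points_def mat_monoid_def)
    have "red (l + k) (1 + pw l * X) = red (l + k) (1 + pw l * lft y)"
      unfolding y(2) h[of "lft y", symmetric] lft(2)[OF yc] ..
    hence "red k X = red k (lft y)" unfolding red_add_left_iff red_sc_shift .
    thus "Lie k X" using y lft[OF yc] X by (simp add: Lie_def)
  qed
qed

lemma one_pw_mult: "(1 + pw l * X) * (1 + pw l * Y) = 1 + pw l * (X + Y + pw l * (X * Y))"
  by (simp add: algebra_simps sc_left_commute[of X])

text \<open>The product of \<open>1 + pw k * X\<close> and \<open>1 + pw k * Y\<close> has the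
  parameter \<open>X + Y + pw k * (X * Y)\<close>, whose last term vanishes modulo \<pp>^k.\<close>

lemma Lie_add: "0 < k \<Longrightarrow> Lie k X \<Longrightarrow> Lie k Y \<Longrightarrow> Lie k (X + Y)"
proof -
  assume k: "0 < k" and X: "Lie k X" and Y: "Lie k Y"
  have "PG (k + k) ((1 + pw k * X) * (1 + pw k * Y))" using PG_mult X Y Lie_iff[OF k order_refl] by blast
  hence "Lie k (X + Y + pw k * (X * Y))" unfolding one_pw_mult using Lie_iff[OF k order_refl] Lie_intm[OF X] Lie_intm[OF Y] by simp
  thus ?thesis by (rule Lie_cong[rotated]) (use Lie_intm[OF X] Lie_intm[OF Y] in simp)
qed

lemma Lie_0: "0 < k \<Longrightarrow> Lie k 0" unfolding Lie_iff[of k k, OF _ order_refl] by (simp add: PG_one)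

text \<open>Modulo \<pp>^(2k) the inverse of \<open>1 + pw k * X\<close> is
  \<open>1 + pw k * (- X)\<close>, since the product of the two differs from 1 by a multiple of
  \<open>pw (k + k)\<close>.\<close>

lemma Lie_uminus: "0 < k \<Longrightarrow> Lie k X \<Longrightarrow> Lie k (- X)"
proof -
  assume k: "0 < k" and X: "Lie k X"
  note i = Lie_intm[OF X]
  have "PG (k + k) (1 + pw k * X)" using X Lie_iff[OF k order_refl] by blast
  then obtain B where B: "PG (k + k) B" "red (k + k) ((1 + pw k * X) * B) = red (k + k) 1" "red (k + k) (B * (1 + pw k * X)) = red (k + k) 1"
    by (rule PG_inv)
  have "red (k + k) B = red (k + k) (B * (1 + pw k * X) * (1 + pw k * (- X)))"
  proof -
    have "B * (1 + pw k * X) * (1 + pw k * (- X)) = B + pw (k + k) * (- (B * (X * X)))"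
    proof -
      have "(1 + pw k * X) * (1 + pw k * (- X)) = 1 - pw (k + k) * (X * X)"
        by (simp add: algebra_simps sc_left_commute[of X] power_add sc_mult)
      hence "B * ((1 + pw k * X) * (1 + pw k * (- X))) = B - B * (pw (k + k) * (X * X))" by (simp add: algebra_simps)
      thus ?thesis by (simp add: sc_left_commute[of B] mult.assoc)
    qed
    thus ?thesis using i PG_intm[OF B(1)] by simp
  qed
  also have "\<dots> = red (k + k) (1 + pw k * (- X))"
    using red_mult_cong[OF B(3) refl, of "1 + pw k * (- X)"] i by simp
  finally have "PG (k + k) (1 + pw k * (- X))" using B(1) PG_cong by blast
  thus ?thesis using Lie_iff[OF k order_refl] i by simp
qed

lemma Lie_diff: "0 < k \<Longrightarrow> Lie k X \<Longrightarrow> Lie k Y \<Longrightarrow> Lie k (X - Y)"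
  using Lie_add[of k X "- Y"] Lie_uminus[of k Y] by simp

lemma Lie_mono: "k \<le> m \<Longrightarrow> Lie m X \<Longrightarrow> Lie k X"
proof -
  assume km: "k \<le> m" and X: "Lie m X"
  have "mmap (qred k) (red m X) \<in> lie_points E (Omod v k) (qred k \<circ> omod v m)"
    by (rule lie_points_hom[OF qred_hom[OF km]]) (use X coef in \<open>auto simp: Lie_def\<close>)
  thus "Lie k X" using X by (simp add: mmap_qred mred_red[OF km] qred_comp[OF km] Lie_def)
qed

lemma Lie_scale: "c \<in> ppow v 0 \<Longrightarrow> Lie k X \<Longrightarrow> Lie k (sc c * X)"
proof -
  assume c: "c \<in> ppow v 0" and X: "Lie k X"
  have "msmult (Omod v k) (omod v k c) (red k X) \<in> lie_points E (Omod v k) (omod v k)"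
    by (rule lie_points_scale[OF cring_Omod]) (use X c coef in \<open>auto simp: Lie_def\<close>)
  thus ?thesis using X c by (simp add: red_ops Lie_def)
qed

text \<open>The group commutator of \<open>1 + pw 1 * X'\<close> and \<open>1 + pw 1 * Y'\<close> is
  \<open>1 + pw 2 * ?D\<close> modulo \<pp>^3, and \<open>Lie_iff\<close> with exponent 2 reads off
  the bracket. The matrices X' and Y' agree with X and Y modulo \<pp> and are adjusted by smoothness
  so that both factors lie in G(O_3).\<close>

lemma Lie_bracket: "Lie 1 X \<Longrightarrow> Lie 1 Y \<Longrightarrow> Lie 1 (X * Y - Y * X)"
proof -
  assume X: "Lie 1 X" and Y: "Lie 1 Y"
  have lift: "\<exists>X'. intm X' \<and> red 1 X' = red 1 X \<and> PG 3 (1 + pw 1 * X')" if X: "Lie 1 X" for X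
  proof -
    have "PG 2 (1 + pw 1 * X)" using X Lie_iff[of 1 1 X] by (simp add: numeral_2_eq_2)
    then obtain A where A: "PG 3 A" "red 2 A = red 2 (1 + pw 1 * X)" using PG_lift[of 2 3] by auto
    then obtain C where C: "intm C" "A = 1 + pw 1 * X + pw 2 * C" using red_eq_iff by blast
    have "A = 1 + pw 1 * (X + pw 1 * C)" unfolding C(2) by (simp add: algebra_simps numeral_2_eq_2 sc_mult)
    moreover have "intm (X + pw 1 * C)" using C(1) Lie_intm[OF X] by simp
    ultimately show ?thesis using A(1) red_sc_add[OF C(1), of 1 X] by blast
  qed
  obtain X' where X': "intm X'" "red 1 X' = red 1 X" "PG 3 (1 + pw 1 * X')" using lift[OF X] by blast
  obtain Y' where Y': "intm Y'" "red 1 Y' = red 1 Y" "PG 3 (1 + pw 1 * Y')" using lift[OF Y] by blast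
  let ?A = "1 + pw 1 * X'" and ?B = "1 + pw 1 * Y'"
  let ?D = "X' * Y' - Y' * X'"
  have iD: "intm ?D" using X' Y' by simp
  have BA: "PG 3 (?B * ?A)" and AB: "PG 3 (?A * ?B)" using X'(3) Y'(3) PG_mult by blast+
  obtain B where B: "PG 3 B" "red 3 (?B * ?A * B) = red 3 1" "red 3 (B * (?B * ?A)) = red 3 1" by (rule PG_inv[OF BA])
  have p2: "pw 1 * pw 1 = pw 2" by (simp add: sc_mult[symmetric] power2_eq_square)
  have p3: "pw 2 * pw 1 = pw 3" by (simp add: sc_mult[symmetric] power_Suc2[symmetric] numeral_3_eq_3 numeral_2_eq_2 del: power_Suc)
  have AB': "?A * ?B = ?B * ?A + pw 2 * ?D"
    unfolding p2[symmetric] by (simp add: algebra_simps sc_left_commute[of X'] sc_left_commute[of Y'])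
  have B1: "red 1 B = red 1 1"
  proof -
    have "red 1 (?B * ?A) = red 1 1" unfolding one_pw_mult by (rule red_sc_add) (use X'(1) Y'(1) in simp)
    hence "red 1 (?B * ?A * B) = red 1 (1 * B)" by (rule red_mult_cong) (use PG_intm[OF B(1)] in auto)
    moreover have "red 1 (?B * ?A * B) = red 1 1" by (rule red_mono[OF _ B(2)]) simp
    ultimately show ?thesis by simp
  qed
  then obtain B' where B': "intm B'" "B = 1 + pw 1 * B'" using red_eq_iff by blast
  have "red 3 (?A * ?B * B) = red 3 (1 + pw 2 * ?D)"
  proof -
    have "?A * ?B * B = ?B * ?A * B + pw 2 * ?D + pw 3 * (?D * B')"
    proof -
      have "?A * ?B * B = ?B * ?A * B + pw 2 * (?D * B)" unfolding AB' by (simp add: distrib_right mult.assoc)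
      also have "?D * B = ?D + pw 1 * (?D * B')" unfolding B'(2) by (simp add: distrib_left sc_left_commute[of ?D])
      finally show ?thesis unfolding p3[symmetric] by (simp only: distrib_left mult.assoc add.assoc)
    qed
    hence "red 3 (?A * ?B * B) = red 3 (?B * ?A * B + pw 2 * ?D)" using iD B' by simp
    also have "\<dots> = red 3 (1 + pw 2 * ?D)" by (rule red_add_cong[OF B(2) refl])
    finally show ?thesis .
  qed
  hence "PG 3 (1 + pw 2 * ?D)" using PG_cong[OF _ PG_mult[OF AB B(1)]] by blast
  hence "Lie 1 ?D" using Lie_iff[of 1 2 ?D] iD by (simp add: numeral_3_eq_3 numeral_2_eq_2)
  moreover have "red 1 ?D = red 1 (X * Y - Y * X)"
    by (intro red_diff_cong red_mult_cong X'(2) Y'(2)) (use X' Y' Lie_intm[OF X] Lie_intm[OF Y] in auto)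
  ultimately show ?thesis using Lie_cong by blast
qed

text \<open>Smoothness of G lifts \<open>1 + pw (Suc m) * X\<close> from level 2m+1 to level 2m+2.
  The correction is divisible by \<open>\<pi>F\<close> to the power 2m+1, so it changes X by a
  multiple of \<open>\<pi>F ^ m\<close>, and \<open>Lie_iff\<close> with exponent m+1 applies at
  both levels.\<close>

lemma Lie_lift1: "0 < m \<Longrightarrow> Lie m X \<Longrightarrow> \<exists>Y. Lie (Suc m) Y \<and> red m Y = red m X"
proof -
  assume m: "0 < m" and X: "Lie m X"
  have "PG (Suc m + m) (1 + pw (Suc m) * X)" using Lie_iff[OF m, of "Suc m" X] X by simp
  then obtain A where A: "PG (Suc m + Suc m) A" "red (Suc m + m) A = red (Suc m + m) (1 + pw (Suc m) * X)"
    using PG_lift[of "Suc m + m" "Suc m + Suc m"] m by auto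
  then obtain C where C: "intm C" "A = 1 + pw (Suc m) * X + pw (Suc m + m) * C" using red_eq_iff by blast
  have e: "A = 1 + pw (Suc m) * (X + pw m * C)" unfolding C(2) power_add sc_mult by (simp add: algebra_simps)
  have i: "intm (X + pw m * C)" using C Lie_intm[OF X] by simp
  have "Lie (Suc m) (X + pw m * C)" using Lie_iff[of "Suc m" "Suc m" "X + pw m * C"] A(1) e i by simp
  moreover have "red m (X + pw m * C) = red m X" using C by simp
  ultimately show ?thesis by blast
qed

text \<open>The defining polynomials at the point 1 + \<epsilon> X over O reduce to zero modulo
  every power of \<pp>, so they vanish because these powers intersect in 0.\<close>

lemma lie_int_lim:
  assumes X: "intm X" and L: "\<And>m. 0 < m \<Longrightarrow> Lie m X"
  shows "ent X \<in> lie_int v E"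
proof -
  let ?D = "dual_numbers (int_ring v)"
  let ?A = "\<lambda>i j. (mone (int_ring v) i j, ent X i j)" and ?B = "\<lambda>i j. (mone (int_ring v) i j, - ent X i j)"
  interpret D: cring ?D by (rule cring_dual_numbers[OF cring_int])
  have Ds: "carrier ?D = ppow v 0 \<times> ppow v 0" "add ?D = (\<lambda>(a, b) (c, d). (a + c, b + d))" "zero ?D = (0, 0)" "one ?D = (1, 0)"
    "mult ?D = (\<lambda>(a, b) (c, d). (a * c, a * d + b * c))"
    by (simp_all add: dual_numbers_def)
  have fs: "finsum ?D f I = (sum (\<lambda>i. fst (f i)) I, sum (\<lambda>i. snd (f i)) I)"
    if "finite I" "\<And>i. i \<in> I \<Longrightarrow> f i \<in> carrier ?D" for f and I :: "'n set"
    using that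
  proof (induction I rule: finite_induct)
    case (insert x F)
    have "finsum ?D f (insert x F) = f x \<oplus>\<^bsub>?D\<^esub> finsum ?D f F" by (rule D.finsum_insert) (use insert in auto)
    thus ?case using insert by (simp add: Ds split: prod.splits)
  qed (simp add: Ds)
  \<comment> \<open>The inverse of 1 + \<epsilon> P is 1 - \<epsilon> P.\<close>
  have unit: "mmult ?D (\<lambda>i j. (mone (int_ring v) i j, P i j)) (\<lambda>i j. (mone (int_ring v) i j, - P i j)) = mone ?D"
    if P: "\<And>i j. P i j \<in> ppow v 0" for P :: "'n \<Rightarrow> 'n \<Rightarrow> 'f"
  proof (intro ext)
    fix i j
    have "mmult ?D (\<lambda>i j. (mone (int_ring v) i j, P i j)) (\<lambda>i j. (mone (int_ring v) i j, - P i j)) i j =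
      ((\<Sum>k\<in>UNIV. mone (int_ring v) i k * mone (int_ring v) k j), (\<Sum>k\<in>UNIV. mone (int_ring v) i k * (- P k j) + P i k * mone (int_ring v) k j))"
      unfolding mmult_def by (rule trans[OF fs]) (auto simp: Ds mone_def P intro!: sum.cong)
    also have "(\<Sum>k\<in>UNIV. mone (int_ring v) i k * mone (int_ring v) k j) = (\<Sum>k\<in>UNIV. if k = i then (if i = j then 1 else 0) else (0::'f))"
      by (rule sum.cong) (auto simp: mone_def)
    also have "(\<Sum>k\<in>UNIV. mone (int_ring v) i k * (- P k j) + P i k * mone (int_ring v) k j) =
       (\<Sum>k\<in>UNIV. if k = i then - P i j else 0) + (\<Sum>k\<in>UNIV. if k = j then P i j else 0)"
      unfolding sum.distrib[symmetric] by (rule sum.cong) (auto simp: mone_def)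
    finally show "mmult ?D (\<lambda>i j. (mone (int_ring v) i j, P i j)) (\<lambda>i j. (mone (int_ring v) i j, - P i j)) i j = mone ?D i j"
      by (simp add: mone_def Ds)
  qed
  have ac: "\<And>i j. ?A i j \<in> carrier ?D" "\<And>i j. ?B i j \<in> carrier ?D" using intmD[OF X] by (auto simp: Ds mone_def)
  have "mmult ?D ?A ?B = mone ?D" using unit[of "ent X"] intmD[OF X] by simp
  moreover have "mmult ?D ?B ?A = mone ?D" using unit[of "\<lambda>i j. - ent X i j"] intmD[OF X] by simp
  ultimately have U: "?A \<in> Units (mat_monoid ?D)" using ac unfolding Units_def mat_monoid_def by (auto intro!: exI[of _ ?B])
  have "poly_eval ?D (\<lambda>a. (id a, \<zero>\<^bsub>int_ring v\<^esub>)) p ?A = \<zero>\<^bsub>?D\<^esub>" if p: "p \<in> E" for p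
  proof -
    let ?z = "poly_eval ?D (\<lambda>a. (id a, \<zero>\<^bsub>int_ring v\<^esub>)) p ?A"
    have "omod v m (fst ?z) = omod v m 0 \<and> omod v m (snd ?z) = omod v m 0" if m: "0 < m" for m
    proof -
      let ?h = "\<lambda>(a, b). (omod v m a, omod v m b)"
      have hA: "mmap ?h ?A = (\<lambda>i j. (mone (Omod v m) i j, red m X i j))"
        by (auto simp: mmap_def mone_def red_def omod_ops intro!: ext)
      have "?h ?z = poly_eval (dual_numbers (Omod v m)) (?h \<circ> (\<lambda>a. (id a, \<zero>\<^bsub>int_ring v\<^esub>))) p (mmap ?h ?A)"
        by (rule poly_eval_hom[OF dual_numbers_hom[OF ring_hom_cring_omod] ac(1)]) (use coef[OF p] in \<open>simp add: Ds\<close>)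
      also have "?h \<circ> (\<lambda>a. (id a, \<zero>\<^bsub>int_ring v\<^esub>)) = (\<lambda>a. (omod v m a, \<zero>\<^bsub>Omod v m\<^esub>))" by (auto simp: omod_ops)
      also have "poly_eval (dual_numbers (Omod v m)) \<dots> p (mmap ?h ?A) = \<zero>\<^bsub>dual_numbers (Omod v m)\<^esub>"
        using L[OF m] p unfolding hA Lie_def lie_points_def points_def by auto
      finally show ?thesis by (simp add: dual_numbers_def omod_ops split: prod.splits)
    qed
    hence z: "fst ?z \<in> ppow v m \<and> snd ?z \<in> ppow v m" if "0 < m" for m using that by (simp add: omod_eq_iff)
    have "fst ?z \<in> ppow v m \<and> snd ?z \<in> ppow v m" for m using z[of "Suc m"] ppow_mono[of m "Suc m"] by auto
    hence "fst ?z = 0" "snd ?z = 0" using inter_ppow by blast+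
    thus ?thesis by (simp add: Ds prod_eq_iff)
  qed
  thus ?thesis using U X by (auto simp: lie_points_def points_def intm_def)
qed

text \<open>Iterated lifting gives a sequence that no longer changes modulo \<pp>^(k+i) after step
  i; completeness provides its limit, to which \<open>lie_int_lim\<close> applies.\<close>

lemma lie_int_lift:
  assumes k: "0 < k" and X: "Lie k X"
  obtains Y where "ent Y \<in> lie_int v E" "intm Y" "red k Y = red k X"
proof -
  define nx where "nx m X = (SOME Y. Lie (Suc m) Y \<and> red m Y = red m X)" for m X
  have nx: "Lie (Suc m) (nx m X) \<and> red m (nx m X) = red m X" if "0 < m" "Lie m X" for m X
    unfolding nx_def by (rule someI_ex[OF Lie_lift1[OF that]])
  define s where "s = rec_nat X (\<lambda>i Y. nx (k + i) Y)"
  have s0: "s 0 = X" and sS: "\<And>i. s (Suc i) = nx (k + i) (s i)" by (simp_all add: s_def)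
  have sL: "Lie (k + i) (s i)" for i
  proof (induction i)
    case (Suc i) thus ?case using nx[of "k + i" "s i"] k by (simp add: sS)
  qed (simp add: s0 X)
  have step: "red (k + i) (s (Suc i)) = red (k + i) (s i)" for i using nx[of "k + i" "s i"] k sL[of i] by (simp add: sS)
  have cau: "red (k + i) (s j) = red (k + i) (s i)" if "i \<le> j" for i j
    using that
  proof (induction j rule: dec_induct)
    case (step j)
    have "red (k + i) (s (Suc j)) = red (k + i) (s j)" by (rule red_mono[OF _ \<open>\<And>i. red (k + i) (s (Suc i)) = red (k + i) (s i)\<close>]) (use step in simp)
    thus ?case using step by simp
  qed simp
  have ex: "\<exists>x. \<forall>m. \<exists>N. \<forall>q\<ge>N. ent (s q) i j - x \<in> ppow v m" for i j
  proof (rule complete)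
    fix m
    show "\<exists>N. \<forall>p\<ge>N. \<forall>q\<ge>N. ent (s p) i j - ent (s q) i j \<in> ppow v m"
    proof (intro exI[of _ m] allI impI)
      fix p q assume pq: "m \<le> p" "m \<le> q"
      have "red (k + m) (s p) = red (k + m) (s q)" using cau[OF pq(1)] cau[OF pq(2)] by simp
      hence "ent (s p) i j - ent (s q) i j \<in> ppow v (k + m)" by (simp add: red_eq_iff_ent)
      thus "ent (s p) i j - ent (s q) i j \<in> ppow v m" by (rule ppow_mono[rotated]) simp
    qed
  qed
  then obtain Y where Y: "\<And>i j m. \<exists>N. \<forall>q\<ge>N. ent (s q) i j - Y i j \<in> ppow v m" by metis
  have r: "red (k + m) (Sqm Y) = red (k + m) (s m)" for m
    unfolding red_eq_iff_ent
  proof (intro allI)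
    fix i j
    obtain N where N: "\<And>q. N \<le> q \<Longrightarrow> ent (s q) i j - Y i j \<in> ppow v (k + m)" using Y[of i j "k + m"] by blast
    let ?q = "max N m"
    have "ent (s ?q) i j - ent (s m) i j \<in> ppow v (k + m)" using cau[of m ?q] by (simp add: red_eq_iff_ent)
    hence "(ent (s ?q) i j - ent (s m) i j) - (ent (s ?q) i j - Y i j) \<in> ppow v (k + m)" by (rule ppow_diff) (use N[of ?q] in simp)
    thus "ent (Sqm Y) i j - ent (s m) i j \<in> ppow v (k + m)" by simp
  qed
  have LY: "Lie (k + m) (Sqm Y)" for m using Lie_cong[OF r[symmetric] sL] .
  have i: "intm (Sqm Y)" using Lie_intm[OF LY] .
  have "ent (Sqm Y) \<in> lie_int v E"
    by (rule lie_int_lim[OF i]) (rule Lie_mono[OF _ LY], rule le_add2)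
  moreover have "red k (Sqm Y) = red k X" using r[of 0] s0 by simp
  ultimately show ?thesis using that i by blast
qed

lemma Lie_b: "Lie 1 b"
proof -
  have "mmap (omod v 1) \<beta> \<in> lie_points E (Omod v 1) (omod v 1 \<circ> id)"
    by (rule lie_points_hom[OF ring_hom_cring_omod]) (use \<beta>_lie coef in auto)
  thus ?thesis by (simp add: Lie_def red_def)
qed

lemma nondeg:
  assumes X: "Lie 1 X" and z: "\<And>Y. Lie 1 Y \<Longrightarrow> tr (X * Y) \<in> ppow v 1"
  shows "red 1 X = red 1 0"
proof -
  have "tform (Omod v 1) (red 1 X) y = \<zero>\<^bsub>Omod v 1\<^esub>" if y: "y \<in> carrier (lie_group v E 1)" for y
  proof -
    have yc: "y \<in> carrier (mat_monoid (Omod v 1))" using y by (auto simp: lie_group_def lie_points_def mat_monoid_def)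
    have "Lie 1 (lft y)" using y lft[OF yc] by (simp add: Lie_def lie_group_def)
    hence "tr (X * lft y) \<in> ppow v 1" by (rule z)
    moreover have "tform (Omod v 1) (red 1 X) y = omod v 1 (tr (X * lft y))"
      using tform_red[of X "lft y" 1] lft[OF yc] Lie_intm[OF X] by simp
    ultimately show ?thesis by (simp add: omod_ops omod_eq_iff)
  qed
  moreover have "red 1 X \<in> carrier (lie_group v E 1)" using X by (simp add: Lie_def lie_group_def)
  ultimately show ?thesis using condI unfolding cond_I_def red_ops(5) by blast
qed

end

section \<open>Subgroups at a finite level\<close>

context group_scheme
begin

lemma G_simps: "carrier (G_group v E m) = points E (Omod v m) (omod v m)" "mult (G_group v E m) = mmult (Omod v m)"
  "one (G_group v E m) = red m 1"
  by (simp_all add: G_group_def units_of_def mat_monoid_simps red_ops)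

lemma group_G: "group (G_group v E m)"
proof -
  interpret M: monoid "mat_monoid (Omod v m) :: ('n, 'f set) sqmat monoid" by (rule monoid_mats)
  show ?thesis unfolding G_group_def by (rule subgroup.subgroup_is_group[OF sub_points M.units_group])
qed

lemma mem_G: "intm A \<Longrightarrow> red m A \<in> carrier (G_group v E m) \<longleftrightarrow> PG m A"
  by (simp add: G_simps PG_def)

lemma G_cases:
  assumes "x \<in> carrier (G_group v E m)"
  obtains A where "PG m A" "x = red m A"
proof -
  have xc: "x \<in> carrier (mat_monoid (Omod v m))" using assms by (auto simp: G_simps points_def Units_def)
  have "PG m (lft x)" using lft[OF xc] assms by (simp add: PG_def G_simps)
  thus ?thesis using that lft[OF xc] by simp
qed

lemma G_mult: "intm A \<Longrightarrow> intm B \<Longrightarrow> red m A \<otimes>\<^bsub>G_group v E m\<^esub> red m B = red m (A * B)"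
  by (simp add: G_simps red_ops)

lemma G_inv: "PG m A \<Longrightarrow> PG m B \<Longrightarrow> red m (B * A) = red m 1 \<Longrightarrow> inv\<^bsub>G_group v E m\<^esub> (red m A) = red m B"
proof -
  assume A: "PG m A" and B: "PG m B" and BA: "red m (B * A) = red m 1"
  interpret G: group "G_group v E m" by (rule group_G)
  show ?thesis by (rule G.inv_equality) (use A B BA PG_intm in \<open>auto simp: G_mult mem_G G_simps(3)\<close>)
qed

lemma G_inv_cases:
  assumes "PG m A"
  obtains B where "PG m B" "red m (A * B) = red m 1" "red m (B * A) = red m 1" "inv\<^bsub>G_group v E m\<^esub> (red m A) = red m B"
proof (rule PG_inv[OF assms])
  fix B assume B: "PG m B" "red m (A * B) = red m 1" "red m (B * A) = red m 1"
  from that[OF B G_inv[OF assms B(1,3)]] show thesis .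
qed

lemma finite_mats: "finite {x :: ('n, 'f set) sqmat. \<forall>i j. x i j \<in> carrier (Omod v m)}"
proof -
  have "finite (PiE (UNIV :: 'n set) (\<lambda>_. PiE (UNIV :: 'n set) (\<lambda>_. carrier (Omod v m))))"
    by (intro finite_PiE finite_Omod) auto
  moreover have "{x :: ('n, 'f set) sqmat. \<forall>i j. x i j \<in> carrier (Omod v m)} = PiE UNIV (\<lambda>_. PiE UNIV (\<lambda>_. carrier (Omod v m)))"
    by (auto simp: PiE_def Pi_def)
  ultimately show ?thesis by simp
qed

lemma finite_G: "finite (carrier (G_group v E m))"
  by (rule finite_subset[OF _ finite_mats]) (auto simp: G_simps points_def Units_def mat_monoid_def)

text \<open>Subgroups of G(O_m) are given by predicates on lifts. A lift has an inverse only modulo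
  \<pp>^m, so closure is asked for every \<open>B\<close> that inverts \<open>A\<close> in this
  sense.\<close>

lemma subgroup_red:
  assumes PG: "\<And>A. P A \<Longrightarrow> PG m A" and one: "P 1" and mult: "\<And>A B. P A \<Longrightarrow> P B \<Longrightarrow> P (A * B)"
    and inv: "\<And>A B. P A \<Longrightarrow> PG m B \<Longrightarrow> red m (A * B) = red m 1 \<Longrightarrow> red m (B * A) = red m 1 \<Longrightarrow> P B"
  shows "subgroup (red m ` Collect P) (G_group v E m)"
proof -
  interpret G: group "G_group v E m" by (rule group_G)
  show ?thesis
  proof (rule G.subgroupI)
    show "red m ` Collect P \<subseteq> carrier (G_group v E m)" using mem_G[OF PG_intm[OF PG]] PG by auto
    show "red m ` Collect P \<noteq> {}" using one by auto
    show "inv\<^bsub>G_group v E m\<^esub> x \<in> red m ` Collect P" if x: "x \<in> red m ` Collect P" for x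
    proof -
      obtain A where A: "P A" "x = red m A" using x by auto
      obtain B where B: "PG m B" "red m (A * B) = red m 1" "red m (B * A) = red m 1" "inv\<^bsub>G_group v E m\<^esub> (red m A) = red m B"
        by (rule G_inv_cases[OF PG[OF A(1)]])
      show ?thesis unfolding A(2) B(4) using inv[OF A(1) B(1-3)] by blast
    qed
    show "x \<otimes>\<^bsub>G_group v E m\<^esub> y \<in> red m ` Collect P" if xy: "x \<in> red m ` Collect P" "y \<in> red m ` Collect P" for x y
    proof -
      obtain A B where AB: "P A" "x = red m A" "P B" "y = red m B" using xy by auto
      have "x \<otimes>\<^bsub>G_group v E m\<^esub> y = red m (A * B)" unfolding AB(2,4) by (rule G_mult) (use PG PG_intm AB in auto)
      thus ?thesis using mult[OF AB(1,3)] by blast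
    qed
  qed
qed

lemma inv_unique: "PG m B \<Longrightarrow> PG m B' \<Longrightarrow> PG m A \<Longrightarrow> red m (B * A) = red m 1 \<Longrightarrow> red m (A * B') = red m 1 \<Longrightarrow> red m B = red m B'"
proof -
  assume B: "PG m B" and B': "PG m B'" and A: "PG m A" and 1: "red m (B * A) = red m 1" and 2: "red m (A * B') = red m 1"
  note i = PG_intm[OF A] PG_intm[OF B] PG_intm[OF B']
  have "red m (B * (A * B')) = red m (B * 1)" by (rule red_mult_cong) (use 2 i in auto)
  moreover have "red m (B * A * B') = red m (1 * B')" by (rule red_mult_cong) (use 1 i in auto)
  ultimately show ?thesis by (simp add: mult.assoc)
qed

lemma conj_red:
  assumes "red m B = red m B'" "red m A = red m A'" "red m X = red m X'" "intm B'" "intm X" "intm X'" "intm A"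
  shows "red m (B * X * A) = red m (B' * X' * A')"
  by (rule red_mult_cong[OF red_mult_cong]) (use assms in auto)

text \<open>Conjugating \<open>1 + pw 1 * X\<close> by a lift of A to level 2 gives
  \<open>1 + pw 1 * (B2 * X * A2)\<close>, which stays in G(O_2); modulo \<pp> the inverse
  \<open>B2\<close> of the lift agrees with \<open>B\<close> by uniqueness of inverses.\<close>

lemma Lie_Ad:
  assumes A: "PG 1 A" and B: "PG 1 B" and BA: "red 1 (B * A) = red 1 1" and X: "Lie 1 X"
  shows "Lie 1 (B * X * A)"
proof -
  obtain A2 where A2: "PG 2 A2" "red 1 A2 = red 1 A" using PG_lift[of 1 2 A] A by auto
  obtain B2 where B2: "PG 2 B2" "red 2 (A2 * B2) = red 2 1" "red 2 (B2 * A2) = red 2 1" by (rule PG_inv[OF A2(1)])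
  note i = PG_intm[OF A2(1)] PG_intm[OF B2(1)] PG_intm[OF A] PG_intm[OF B] Lie_intm[OF X]
  have "red 1 (A2 * B2) = red 1 (A * B2)" by (rule red_mult_cong) (use A2 i in auto)
  moreover have "red 1 (A2 * B2) = red 1 1" by (rule red_mono[OF _ B2(2)]) simp
  ultimately have AB2: "red 1 (A * B2) = red 1 1" by simp
  have "PG 1 B2" by (rule PG_mono[OF _ B2(1)]) simp
  hence B12: "red 1 B = red 1 B2" by (rule inv_unique[OF B _ A BA AB2])
  have "PG 2 (1 + pw 1 * X)" using Lie_iff[of 1 1 X] X by (simp add: numeral_2_eq_2)
  hence "PG 2 (B2 * (1 + pw 1 * X) * A2)" using PG_mult A2(1) B2(1) by blast
  moreover have "red 2 (B2 * (1 + pw 1 * X) * A2) = red 2 (1 + pw 1 * (B2 * X * A2))"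
  proof -
    have "B2 * (1 + pw 1 * X) * A2 = B2 * A2 + pw 1 * (B2 * X * A2)"
      by (simp add: algebra_simps sc_left_commute[of B2])
    thus ?thesis using red_add_cong[OF B2(3) refl] by simp
  qed
  ultimately have "PG 2 (1 + pw 1 * (B2 * X * A2))" using PG_cong by blast
  hence "Lie 1 (B2 * X * A2)" using Lie_iff[of 1 1 "B2 * X * A2"] i by (simp add: numeral_2_eq_2)
  moreover have "red 1 (B2 * X * A2) = red 1 (B * X * A)" by (rule conj_red) (use B12 A2 i in auto)
  ultimately show ?thesis using Lie_cong by blast
qed

definition LC :: "('n, 'f) sqm \<Rightarrow> bool" where
  "LC X \<longleftrightarrow> Lie 1 X \<and> red 1 (X * b) = red 1 (b * X)"

lemma pw_commute_iff: "red (m + k) ((1 + pw m * X) * b) = red (m + k) (b * (1 + pw m * X)) \<longleftrightarrow> red k (X * b) = red k (b * X)"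
  by (simp add: distrib_left distrib_right sc_left_commute[of b] mult.assoc red_add_left_iff red_sc_shift)

text \<open>Commutativity of G_\<beta> passes to its Lie algebra: \<open>1 + pw 1 * Y\<close> is a
  point of G_\<beta> over O_2, so it commutes with a lift of A, and comparing the coefficients of
  \<open>\<pi>F\<close> gives Y A = A Y modulo \<pp>. Over the residue field G_\<beta> is therefore
  contained in the group on which the cocycle is defined.\<close>

lemma CG_fixes_LC:
  assumes A: "CG 1 A" and B: "PG 1 B" and BA: "red 1 (B * A) = red 1 1" and Y: "LC Y"
  shows "red 1 (B * Y * A) = red 1 Y"
proof -
  have LY: "Lie 1 Y" using Y by (simp add: LC_def)
  obtain A2 where A2: "CG 2 A2" "red 1 A2 = red 1 A" using CG_lift[of 1 2 A] A by auto
  note i = PG_intm[OF CG_PG[OF A2(1)]] PG_intm[OF CG_PG[OF A]] PG_intm[OF B] Lie_intm[OF LY]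
  have e: "(2::nat) = 1 + 1" by simp
  have "PG 2 (1 + pw 1 * Y)" using Lie_iff[of 1 1 Y] LY by (simp add: numeral_2_eq_2)
  moreover have "red 2 ((1 + pw 1 * Y) * b) = red 2 (b * (1 + pw 1 * Y))" unfolding e pw_commute_iff using Y by (simp add: LC_def)
  ultimately have "CG 2 (1 + pw 1 * Y)" by (simp add: CG_def)
  from CG_comm[OF this A2(1)] have "red (1 + 1) (A2 + pw 1 * (Y * A2)) = red (1 + 1) (A2 + pw 1 * (A2 * Y))"
    unfolding e by (simp add: distrib_left distrib_right sc_left_commute[of A2] mult.assoc del: One_nat_def)
  hence 1: "red 1 (Y * A2) = red 1 (A2 * Y)" unfolding red_add_left_iff red_sc_shift .
  have "red 1 (Y * A2) = red 1 (Y * A)" by (rule red_mult_cong) (use A2 i in auto)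
  moreover have "red 1 (A2 * Y) = red 1 (A * Y)" by (rule red_mult_cong) (use A2 i in auto)
  ultimately have "red 1 (Y * A) = red 1 (A * Y)" using 1 by simp
  hence "red 1 (B * (Y * A)) = red 1 (B * (A * Y))" by (rule red_mult_cong[OF refl]) (use i in auto)
  moreover have "red 1 (B * A * Y) = red 1 (1 * Y)" by (rule red_mult_cong) (use BA i in auto)
  ultimately show ?thesis by (simp add: mult.assoc)
qed

end

section \<open>The additive character\<close>

locale level = group_scheme v \<pi>F E \<beta> for v :: "'f::field \<Rightarrow> int" and \<pi>F and E :: "('n::finite, 'f) mpoly set" and \<beta> +
  fixes \<tau> :: "'f \<Rightarrow> complex" and r :: nat
  assumes \<tau>_char: "cont_unitary_char v \<tau>" and \<tau>_cond: "{x. \<forall>y\<in>ppow v 0. \<tau> (x * y) = 1} = ppow v 0"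
    and odd_char: "odd_residue_char v" and r2: "2 \<le> r"
begin

text \<open>With \<open>k\<close> in the role of l', the group K_(l-1)(O_r) is \<open>KK\<close>
  when \<open>r\<close> is odd, and \<open>KK\<close> equals \<open>LL\<close> when \<open>r\<close>
  is even.\<close>

abbreviation l :: nat where "l \<equiv> lup r"
abbreviation k :: nat where "k \<equiv> ldn r"
abbreviation GG where "GG \<equiv> G_group v E r"
abbreviation HH where "HH \<equiv> carrier (stab_group v E r \<beta>)"
abbreviation CC where "CC \<equiv> carrier (cent_group v E \<beta> r)"
abbreviation KK where "KK \<equiv> carrier (K_group v E k r)"
abbreviation LL where "LL \<equiv> carrier (K_group v E l r)"
abbreviation ZZ where "ZZ \<equiv> carrier (Z_group v \<pi>F E r \<beta>)"
abbreviation RR where "RR \<equiv> dual (lie_cent_res v E \<beta>)"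
abbreviation \<psi> where "\<psi> \<equiv> psi v \<pi>F \<tau> E r \<beta>"
abbreviation \<psi>\<rho> where "\<psi>\<rho> \<equiv> psi_rho v \<pi>F \<tau> r \<beta>"

lemma lk: "l + k = r" "0 < k" "k \<le> l" "0 < l" "k \<le> r" "l \<le> r" using r2 by (auto simp: lup_def ldn_def)

lemma \<tau>_add: "\<tau> (x + y) = \<tau> x * \<tau> y" using \<tau>_char by (simp add: cont_unitary_char_def)
lemma \<tau>_nz [simp]: "\<tau> x \<noteq> 0"
proof -
  have "cmod (\<tau> x) = 1" using \<tau>_char by (simp add: cont_unitary_char_def)
  thus ?thesis by auto
qed
lemma \<tau>_0 [simp]: "\<tau> 0 = 1" using \<tau>_add[of 0 0] by simp
lemma \<tau>_uminus: "\<tau> (- x) = inverse (\<tau> x)" using \<tau>_add[of x "- x"] by (simp add: field_simps)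
lemma \<tau>_diff: "\<tau> (x - y) = \<tau> x * inverse (\<tau> y)" using \<tau>_add[of x "- y"] by (simp add: \<tau>_uminus)

lemma \<tau>_int: "x \<in> ppow v 0 \<Longrightarrow> \<tau> x = 1"
proof -
  assume "x \<in> ppow v 0"
  hence "\<forall>y\<in>ppow v 0. \<tau> (x * y) = 1" using \<tau>_cond by blast
  thus ?thesis using one_int by (metis mult_1_right)
qed

lemma \<tau>_eqI: "x - y \<in> ppow v 0 \<Longrightarrow> \<tau> x = \<tau> y"
  using \<tau>_int[of "x - y"] \<tau>_diff[of x y] by (simp add: field_simps)

lemma \<tau>_detect: "(\<And>y. y \<in> ppow v 0 \<Longrightarrow> \<tau> (x * y) = 1) \<Longrightarrow> x \<in> ppow v 0"
  using \<tau>_cond by blast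

text \<open>Some odd integer 2j + 1 lies in \<pp>; if 2 did as well, so would 1.\<close>

lemma two_unit: "(2::'f) \<noteq> 0" "inverse 2 \<in> ppow v 0" "2 \<in> ppow v 0"
proof -
  show i2: "2 \<in> ppow v 0" using ppow_add[OF one_int one_int] by simp
  obtain p :: nat where p: "odd p" "omod v 1 (of_nat p) = omod v 1 0" using odd_char by (auto simp: odd_residue_char_def omod_ops)
  hence pp: "of_nat p \<in> ppow v 1" by (simp add: omod_eq_iff)
  obtain j where j: "p = 2 * j + 1" using p(1) by (rule oddE)
  have ji: "(of_nat j :: 'f) \<in> ppow v 0" by (induction j) auto
  have "2 \<notin> ppow v 1"
  proof
    assume "2 \<in> ppow v 1"
    hence "2 * of_nat j \<in> ppow v 1" by (rule ppow_mult_right[OF _ ji])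
    hence "of_nat p - 2 * of_nat j \<in> ppow v 1" using pp by simp
    hence "1 \<in> ppow v 1" by (simp add: j)
    thus False by (simp add: ppow_def v_one)
  qed
  thus n0: "(2::'f) \<noteq> 0" using ppow_0 by metis
  have v2: "v 2 = 0" using \<open>2 \<notin> ppow v 1\<close> i2 n0 by (auto simp: ppow_def)
  have "v (2 * inverse 2) = v 2 + v (inverse 2)" by (rule val_mult) (use n0 in auto)
  hence "v (inverse 2) = 0" using v2 n0 v_one by simp
  thus "inverse 2 \<in> ppow v 0" by (simp add: ppow_def)
qed

lemma inv_pow_cancel: "inverse (\<pi>F ^ m) * (\<pi>F ^ m * x) = x" using unif by simp

lemma \<tau>_tr_cong:
  fixes X Y A :: "('n, 'f) sqm"
  assumes "red m X = red m Y" "intm A"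
  shows "\<tau> (inverse (\<pi>F ^ m) * tr (X * A)) = \<tau> (inverse (\<pi>F ^ m) * tr (Y * A))"
proof (rule \<tau>_eqI)
  obtain C where C: "intm C" "X = Y + pw m * C" using assms(1) red_eq_iff by blast
  have "tr (X * A) = tr (Y * A) + \<pi>F ^ m * tr (C * A)" unfolding C(2) by (simp add: distrib_right mult.assoc tr_add tr_sc_mult)
  hence "inverse (\<pi>F ^ m) * tr (X * A) - inverse (\<pi>F ^ m) * tr (Y * A) = tr (C * A)"
    using unif by (simp add: distrib_left inv_pow_cancel mult.assoc[symmetric])
  thus "inverse (\<pi>F ^ m) * tr (X * A) - inverse (\<pi>F ^ m) * tr (Y * A) \<in> ppow v 0" using C(1) assms(2) by simp
qed

text \<open>The class of an element of \<open>K\<^sub>l(O\<^sub>r)\<close> determines \<open>X\<close> only modulo \<open>\<pp>\<^sup>k\<close>; the choice in \<^const>\<open>psi\<close> exists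
  because \<open>\<gg>(O) \<rightarrow> \<gg>(O\<^sub>k)\<close> is onto.\<close>

lemma psi_eq:
  assumes X: "intm X" and P: "PG r (1 + pw l * X)"
  shows "\<psi> (red r (1 + pw l * X)) = \<tau> (inverse (\<pi>F ^ k) * tr (X * b))"
proof -
  let ?Q = "\<lambda>Y. Y \<in> lie_int v E \<and> red r (1 + pw l * X) = mmap (omod v r) (one_plus (\<pi>F ^ l) Y)"
  define Y where "Y = (SOME Y. ?Q Y)"
  have "Lie k X" using Lie_iff[OF lk(2,3)] X P lk(1) by simp
  then obtain Y0 where Y0: "ent Y0 \<in> lie_int v E" "intm Y0" "red k Y0 = red k X" by (rule lie_int_lift[OF lk(2)])
  have "?Q (ent Y0)" using Y0 one_pw_cong[OF Y0(3), of l] lk(1) by (simp add: one_plus_red)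
  hence "?Q Y" unfolding Y_def by (rule someI[of ?Q])
  hence Yl: "Y \<in> lie_int v E" and "red (l + k) (1 + pw l * X) = red (l + k) (1 + pw l * Sqm Y)" by (simp_all add: one_plus_red lk(1))
  hence e: "red k (Sqm Y) = red k X" unfolding red_add_left_iff red_sc_shift by simp
  have iY: "intm (Sqm Y)" using red_intm[OF e[symmetric] X] .
  have "\<psi> (red r (1 + pw l * X)) = \<tau> (inverse (\<pi>F ^ k) * tform (int_ring v) Y \<beta>)"
    unfolding psi_def Let_def Y_def ..
  also have "tform (int_ring v) Y \<beta> = tr (Sqm Y * b)" using tform_int[OF iY intm_b] by simp
  finally show ?thesis using \<tau>_tr_cong[OF e intm_b] by simp
qed

text \<open>The part of \<open>psi_rho\<close> that does not involve \<rho>, taken as a function of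
  the parameter of an arbitrary element of K and not only of Z. On K it is not multiplicative;
  \<open>\<chi>0_mult\<close> gives the defect.\<close>

definition \<chi>0 :: "('n, 'f) sqm \<Rightarrow> complex" where
  "\<chi>0 X = \<tau> (inverse (\<pi>F ^ l) * tr (X * b) - inverse (2 * \<pi>F) * tr (X * X * b))"

lemma half_pi: "inverse (2 * \<pi>F) = inverse 2 * inverse \<pi>F" by simp

lemma half_pi_int: "x \<in> ppow v 1 \<Longrightarrow> inverse (2 * \<pi>F) * x \<in> ppow v 0"
proof -
  assume "x \<in> ppow v 1"
  then obtain y where y: "y \<in> ppow v 0" "x = \<pi>F ^ 1 * y" using ppow_iff by blast
  have "inverse (2 * \<pi>F) * x = inverse 2 * (inverse \<pi>F * \<pi>F) * y" unfolding y(2) half_pi by (simp add: mult.assoc del: divide_inverse)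
  hence e: "inverse (2 * \<pi>F) * x = inverse 2 * y" using unif by simp
  show "inverse (2 * \<pi>F) * x \<in> ppow v 0" unfolding e by (rule int_mult[OF two_unit(2) y(1)])
qed

lemma tr_cong:
  fixes X Y :: "('n, 'f) sqm"
  assumes "red m X = red m Y"
  shows "tr X - tr Y \<in> ppow v m"
proof -
  note \<open>red m X = red m Y\<close>
  then obtain C where C: "intm C" "X = Y + pw m * C" using red_eq_iff by blast
  show ?thesis unfolding C(2) ppow_iff[of _ m] by (rule bexI[of _ "tr C"]) (use C in \<open>auto simp: tr_add tr_sc_mult\<close>)
qed

text \<open>The linear term has denominator \<open>\<pi>F ^ l\<close> and the quadratic one only
  \<open>\<pi>F\<close>. The class modulo \<pp>^l is also all that \<open>1 + pw k * X\<close>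
  modulo \<pp>^r determines, as k + l = r.\<close>

lemma \<chi>0_cong:
  assumes "red l X = red l Y" "intm X" "intm Y"
  shows "\<chi>0 X = \<chi>0 Y"
proof -
  have "red 1 X = red 1 Y" by (rule red_mono[OF _ assms(1)]) (use lk in simp)
  hence "red 1 (X * X * b) = red 1 (Y * Y * b)" by (intro red_mult_cong) (use assms in auto)
  hence "inverse (2 * \<pi>F) * (tr (X * X * b) - tr (Y * Y * b)) \<in> ppow v 0" by (intro half_pi_int tr_cong)
  hence "\<tau> (inverse (2 * \<pi>F) * tr (X * X * b)) = \<tau> (inverse (2 * \<pi>F) * tr (Y * Y * b))"
    by (intro \<tau>_eqI) (simp add: right_diff_distrib)
  thus ?thesis unfolding \<chi>0_def \<tau>_diff using \<tau>_tr_cong[OF assms(1) intm_b] by simp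
qed

lemma psi_rho_eq:
  assumes X: "intm X" and odd: "odd r"
  shows "\<psi>\<rho> \<rho> (red r (1 + pw k * X)) = \<chi>0 X * \<rho> (red 1 X)"
proof -
  have lk1: "l = Suc k" using odd by (auto simp: lup_def ldn_def elim!: oddE)
  let ?Q = "\<lambda>Y. (\<forall>i j. Y i j \<in> carrier (int_ring v)) \<and> red r (1 + pw k * X) = mmap (omod v r) (one_plus (\<pi>F ^ (l - 1)) Y)"
  define Y where "Y = (SOME Y. ?Q Y)"
  have "?Q (ent X)" using X by (simp add: one_plus_red intmD lk1)
  hence "?Q Y" unfolding Y_def by (rule someI[of ?Q])
  hence iY: "intm (Sqm Y)" and "red (k + l) (1 + pw k * X) = red (k + l) (1 + pw k * Sqm Y)"
    using lk(1) by (simp_all add: one_plus_red intm_def lk1)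
  hence e: "red l X = red l (Sqm Y)" unfolding red_add_left_iff red_sc_shift by simp
  have e1: "red 1 X = red 1 (Sqm Y)" by (rule red_mono[OF _ e]) (use lk in simp)
  have YY: "mmult (int_ring v) Y Y = ent (Sqm Y * Sqm Y)" using mmult_int[OF iY iY] by simp
  have "\<psi>\<rho> \<rho> (red r (1 + pw k * X)) =
    \<tau> (inverse (\<pi>F ^ l) * tform (int_ring v) Y \<beta> - inverse (2 * \<pi>F) * tform (int_ring v) (mmult (int_ring v) Y Y) \<beta>) * \<rho> (mmap (omod v 1) Y)"
    unfolding psi_rho_def Let_def Y_def ..
  also have "mmap (omod v 1) Y = red 1 (Sqm Y)" by (simp add: red_def)
  also have "tform (int_ring v) Y \<beta> = tr (Sqm Y * b)" using tform_int[OF iY intm_b] by simp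
  also have "tform (int_ring v) (mmult (int_ring v) Y Y) \<beta> = tr (Sqm Y * Sqm Y * b)" unfolding YY using tform_int[of "Sqm Y * Sqm Y" b] iY by simp
  finally show ?thesis unfolding e1 \<chi>0_cong[OF e X iY] by (simp add: \<chi>0_def)
qed

text \<open>Because l = k + 1, the term \<open>pw k * (X * Y)\<close> adds the trace of XYb divided
  by \<open>\<pi>F\<close> to the linear part, while the cross terms of the square of X + Y subtract
  half the trace of (XY + YX)b divided by \<open>\<pi>F\<close>. What remains is half of the
  commutator term.\<close>

lemma \<chi>0_mult:
  assumes X: "intm X" and Y: "intm Y" and odd: "odd r"
  shows "\<chi>0 (X + Y + pw k * (X * Y)) = \<chi>0 X * \<chi>0 Y * \<tau> (inverse (2 * \<pi>F) * tr ((X * Y - Y * X) * b))"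
proof -
  have lk1: "l = Suc k" using odd by (auto simp: lup_def ldn_def elim!: oddE)
  let ?S = "X + Y + pw k * (X * Y)"
  have r1: "red 1 ?S = red 1 (X + Y)" by (rule red_mono[of 1 k]) (use lk X Y in auto)
  have "red 1 (?S * ?S * b) = red 1 ((X + Y) * (X + Y) * b)" by (intro red_mult_cong r1 refl) (use X Y in auto)
  hence "inverse (2 * \<pi>F) * (tr (?S * ?S * b) - tr ((X + Y) * (X + Y) * b)) \<in> ppow v 0" by (intro half_pi_int tr_cong)
  hence 1: "\<tau> (inverse (2 * \<pi>F) * tr (?S * ?S * b)) = \<tau> (inverse (2 * \<pi>F) * tr ((X + Y) * (X + Y) * b))"
    by (intro \<tau>_eqI) (simp add: right_diff_distrib)
  have pp: "inverse (\<pi>F ^ l) * \<pi>F ^ k = inverse \<pi>F" unfolding lk1 using unif by (simp add: field_simps)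
  have 2: "inverse (\<pi>F ^ l) * tr (?S * b) = inverse (\<pi>F ^ l) * tr (X * b) + inverse (\<pi>F ^ l) * tr (Y * b) + inverse \<pi>F * tr (X * Y * b)"
    by (simp add: distrib_right distrib_left tr_add tr_sc_mult mult.assoc pp[symmetric])
  have h: "inverse \<pi>F = inverse (2 * \<pi>F) + inverse (2 * \<pi>F)" using two_unit(1) unif by (simp add: field_simps)
  have 3: "inverse (\<pi>F ^ l) * tr (?S * b) - inverse (2 * \<pi>F) * tr ((X + Y) * (X + Y) * b) =
      (inverse (\<pi>F ^ l) * tr (X * b) - inverse (2 * \<pi>F) * tr (X * X * b)) + (inverse (\<pi>F ^ l) * tr (Y * b) - inverse (2 * \<pi>F) * tr (Y * Y * b))
      + inverse (2 * \<pi>F) * tr ((X * Y - Y * X) * b)"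
    unfolding 2 h by (simp add: algebra_simps tr_add tr_diff)
  have "\<chi>0 ?S = \<tau> (inverse (\<pi>F ^ l) * tr (?S * b) - inverse (2 * \<pi>F) * tr ((X + Y) * (X + Y) * b))"
    unfolding \<chi>0_def \<tau>_diff 1 ..
  also have "\<dots> = \<chi>0 X * \<chi>0 Y * \<tau> (inverse (2 * \<pi>F) * tr ((X * Y - Y * X) * b))" unfolding 3 \<tau>_add \<chi>0_def ..
  finally show ?thesis .
qed

text \<open>Cyclicity of the trace collects A b B, which is b modulo \<pp>^l, and A B, which is 1
  modulo \<pp>^l.\<close>

lemma \<chi>0_conj:
  assumes A: "intm A" and B: "intm B" and X: "intm X" and AB: "red l (A * B) = red l 1" and Ab: "red l (A * b) = red l (b * A)"
  shows "\<chi>0 (B * X * A) = \<chi>0 X"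
proof -
  have AbB: "red l (A * b * B) = red l b"
  proof -
    have "red l (A * b * B) = red l (b * A * B)" by (rule red_mult_cong) (use A B Ab in auto)
    also have "\<dots> = red l (b * (A * B))" by (simp add: mult.assoc)
    also have "\<dots> = red l (b * 1)" by (rule red_mult_cong) (use A B AB in auto)
    finally show ?thesis by simp
  qed
  have 1: "\<tau> (inverse (\<pi>F ^ l) * tr (B * X * A * b)) = \<tau> (inverse (\<pi>F ^ l) * tr (X * b))"
  proof -
    have "tr (B * X * A * b) = tr ((A * b * B) * X)" using tr_mult_commute[of "B * X" "A * b"] by (simp add: mult.assoc)
    thus ?thesis using \<tau>_tr_cong[OF AbB X] tr_mult_commute[of b X] by simp
  qed
  have m: "red 1 P = red 1 Q" if "red l P = red l Q" for P Q by (rule red_mono[OF _ that]) (use lk in simp)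
  have "inverse (2 * \<pi>F) * (tr (B * X * A * (B * X * A) * b) - tr (X * X * b)) \<in> ppow v 0"
  proof (rule half_pi_int)
    have e1: "red 1 (X * (A * B) * X) = red 1 (X * 1 * X)" by (intro red_mult_cong refl m[OF AB]) (use A B X in auto)
    have "tr (B * X * A * (B * X * A) * b) = tr ((X * (A * B) * X) * (A * b * B))"
      using tr_mult_commute[of B "X * A * (B * X * A) * b"] by (simp add: mult.assoc)
    moreover have "red 1 ((X * (A * B) * X) * (A * b * B)) = red 1 (X * 1 * X * b)" by (rule red_mult_cong[OF e1 m[OF AbB]]) (use A B X in auto)
    ultimately show "tr (B * X * A * (B * X * A) * b) - tr (X * X * b) \<in> ppow v 1" using tr_cong[of 1 "(X * (A * B) * X) * (A * b * B)" "X * X * b"] by simp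
  qed
  hence "\<tau> (inverse (2 * \<pi>F) * tr (B * X * A * (B * X * A) * b)) = \<tau> (inverse (2 * \<pi>F) * tr (X * X * b))"
    by (intro \<tau>_eqI) (simp add: right_diff_distrib)
  thus ?thesis unfolding \<chi>0_def \<tau>_diff 1 by simp
qed

lemma \<chi>0_nz [simp]: "\<chi>0 X \<noteq> 0" by (simp add: \<chi>0_def)

lemma \<chi>0_0 [simp]: "\<chi>0 0 = 1" by (simp add: \<chi>0_def)

section \<open>The stabilizer and its subgroups\<close>

lemma mem_K: "intm A \<Longrightarrow> m \<le> r \<Longrightarrow> red r A \<in> carrier (K_group v E m r) \<longleftrightarrow> PG r A \<and> red m A = red m 1"
  by (simp add: K_group_def mem_G mred_red red_ops)

lemma mem_C: "intm A \<Longrightarrow> red r A \<in> CC \<longleftrightarrow> CG r A"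
  by (simp add: cent_group_def CG_iff)

lemma mem_H: "intm A \<Longrightarrow> red r A \<in> HH \<longleftrightarrow> PG r A \<and> CG k A"
proof -
  assume i: "intm A"
  have e: "mmap (omod v k) \<beta> = red k b" by (simp add: red_def)
  have "PG r A \<Longrightarrow> PG k A" by (rule PG_mono[OF lk(5)])
  thus ?thesis using i CG_iff[of k A]
    by (auto simp: stab_group_def mem_G mred_red[OF lk(5)] cent_points_def e PG_def)
qed

lemma K_eq: "m \<le> r \<Longrightarrow> carrier (K_group v E m r) = red r ` {A. PG r A \<and> red m A = red m 1}"
proof -
  assume m: "m \<le> r"
  have "x \<in> red r ` {A. PG r A \<and> red m A = red m 1}" if x: "x \<in> carrier (K_group v E m r)" for x
  proof -
    have "x \<in> carrier GG" using x by (simp add: K_group_def)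
    then obtain A where "PG r A" "x = red r A" by (rule G_cases)
    thus ?thesis using x mem_K[OF PG_intm m] by blast
  qed
  thus ?thesis using mem_K[OF PG_intm m] by auto
qed

lemma C_eq: "CC = red r ` {A. CG r A}"
proof -
  have "x \<in> red r ` {A. CG r A}" if x: "x \<in> CC" for x
  proof -
    have "x \<in> carrier GG" using x by (simp add: cent_group_def cent_points_def G_simps)
    then obtain A where "PG r A" "x = red r A" by (rule G_cases)
    thus ?thesis using x mem_C[OF PG_intm] by blast
  qed
  thus ?thesis using mem_C[OF PG_intm[OF CG_PG]] by auto
qed

lemma H_eq: "HH = red r ` {A. PG r A \<and> CG k A}"
proof -
  have "x \<in> red r ` {A. PG r A \<and> CG k A}" if x: "x \<in> HH" for x
  proof -
    have "x \<in> carrier GG" using x by (simp add: stab_group_def)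
    then obtain A where "PG r A" "x = red r A" by (rule G_cases)
    thus ?thesis using x mem_H[OF PG_intm] by blast
  qed
  thus ?thesis using mem_H[OF PG_intm] by auto
qed

lemma K_form:
  assumes "x \<in> carrier (K_group v E m r)" "m \<le> r"
  obtains X where "intm X" "x = red r (1 + pw m * X)" "PG r (1 + pw m * X)"
proof -
  obtain A where A: "PG r A" "red m A = red m 1" "x = red r A" using assms K_eq by auto
  obtain X where "intm X" "A = 1 + pw m * X" using A(2) red_eq_iff by blast
  thus ?thesis using that A by blast
qed

lemma sub_K: "m \<le> r \<Longrightarrow> subgroup (carrier (K_group v E m r)) GG"
proof -
  assume m: "m \<le> r"
  show ?thesis unfolding K_eq[OF m]
  proof (rule subgroup_red)
    show "PG r (A * B) \<and> red m (A * B) = red m 1" if "PG r A \<and> red m A = red m 1" "PG r B \<and> red m B = red m 1" for A B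
      using that red_mult_cong[of m A 1 B 1] PG_mult PG_intm by auto
    show "PG r B \<and> red m B = red m 1" if "PG r A \<and> red m A = red m 1" "PG r B" "red r (A * B) = red r 1" for A B
      using that red_mult_cong[of m A 1 B B] red_mono[OF m that(3)] PG_intm by auto
  qed (auto simp: PG_one)
qed

lemma sub_C: "subgroup CC GG"
  unfolding C_eq by (rule subgroup_red) (auto simp: CG_one CG_PG CG_mult intro: CG_inv)

lemma sub_H: "subgroup HH GG"
  unfolding H_eq
proof (rule subgroup_red)
  show "PG r B \<and> CG k B" if "PG r A \<and> CG k A" "PG r B" "red r (A * B) = red r 1" "red r (B * A) = red r 1" for A B
    using that CG_inv[of k A B] PG_mono[OF lk(5)] red_mono[OF lk(5)] by blast
qed (auto simp: PG_one CG_one PG_mult CG_mult)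

text \<open>Modulo \<pp>^k an element of the stabilizer is a point of G_\<beta>; smoothness lifts
  that point to O_r, and the quotient of the two is 1 modulo \<pp>^k.\<close>

lemma H_decomp:
  assumes "h \<in> HH"
  shows "\<exists>c\<in>CC. \<exists>x\<in>KK. h = c \<otimes>\<^bsub>GG\<^esub> x"
proof -
  obtain A where A: "PG r A" "CG k A" "h = red r A" using assms H_eq by auto
  obtain C where C: "CG r C" "red k C = red k A" using CG_lift[OF lk(2,5) A(2)] by blast
  obtain B where B: "PG r B" "red r (C * B) = red r 1" "red r (B * C) = red r 1" by (rule PG_inv[OF CG_PG[OF C(1)]])
  note i = PG_intm[OF A(1)] PG_intm[OF CG_PG[OF C(1)]] PG_intm[OF B(1)]
  have "red k (B * A) = red k (B * C)" by (rule red_mult_cong) (use C i in auto)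
  hence "red k (B * A) = red k 1" using red_mono[OF lk(5) B(3)] by simp
  hence BA: "red r (B * A) \<in> KK" using mem_K[of "B * A" k] lk(5) i PG_mult[OF B(1) A(1)] by simp
  have "red r C \<otimes>\<^bsub>GG\<^esub> red r (B * A) = red r (C * B * A)" using G_mult[of C "B * A"] i by (simp add: mult.assoc)
  also have "\<dots> = red r (1 * A)" by (rule red_mult_cong) (use B i in auto)
  finally have "h = red r C \<otimes>\<^bsub>GG\<^esub> red r (B * A)" using A(3) by simp
  moreover have "red r C \<in> CC" using C mem_C[OF i(2)] by simp
  ultimately show ?thesis using BA by blast
qed

lemma conj_form:
  assumes "PG r A" "PG r B" "red r (B * A) = red r 1" "intm X"
  shows "red r (B * (1 + pw m * X) * A) = red r (1 + pw m * (B * X * A))"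
proof -
  have "B * (1 + pw m * X) * A = B * A + pw m * (B * X * A)" by (simp add: algebra_simps sc_left_commute[of B])
  thus ?thesis using red_add_cong[OF assms(3) refl] by simp
qed

lemma L_inv:
  assumes h: "h \<in> HH" and x: "x \<in> LL"
  shows "inv\<^bsub>GG\<^esub> h \<otimes>\<^bsub>GG\<^esub> x \<otimes>\<^bsub>GG\<^esub> h \<in> LL"
    and "\<psi> (inv\<^bsub>GG\<^esub> h \<otimes>\<^bsub>GG\<^esub> x \<otimes>\<^bsub>GG\<^esub> h) = \<psi> x"
proof -
  obtain A where A: "PG r A" "CG k A" "h = red r A" using h H_eq by auto
  obtain X where X: "intm X" "x = red r (1 + pw l * X)" "PG r (1 + pw l * X)" by (rule K_form[OF x lk(6)])
  obtain B where B: "PG r B" "red r (A * B) = red r 1" "red r (B * A) = red r 1" "inv\<^bsub>GG\<^esub> (red r A) = red r B"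
    by (rule G_inv_cases[OF A(1)])
  note i = PG_intm[OF A(1)] PG_intm[OF B(1)] X(1)
  have e: "inv\<^bsub>GG\<^esub> h \<otimes>\<^bsub>GG\<^esub> x \<otimes>\<^bsub>GG\<^esub> h = red r (1 + pw l * (B * X * A))"
    unfolding A(3) B(4) X(2) using i by (simp add: G_mult conj_form[OF A(1) B(1,3) X(1)])
  have P: "PG r (1 + pw l * (B * X * A))"
    using PG_cong[OF conj_form[OF A(1) B(1,3) X(1)]] PG_mult[OF PG_mult[OF B(1) X(3)] A(1)] by blast
  show "inv\<^bsub>GG\<^esub> h \<otimes>\<^bsub>GG\<^esub> x \<otimes>\<^bsub>GG\<^esub> h \<in> LL"
    unfolding e using mem_K[OF PG_intm[OF P] lk(6)] P i by simp
  have AbB: "red k (A * b * B) = red k b"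
  proof -
    have "red k (A * b * B) = red k (b * A * B)" by (rule red_mult_cong) (use A i in \<open>auto simp: CG_def\<close>)
    also have "\<dots> = red k (b * (A * B))" by (simp add: mult.assoc)
    also have "\<dots> = red k (b * 1)" by (rule red_mult_cong) (use i red_mono[OF lk(5) B(2)] in auto)
    finally show ?thesis by simp
  qed
  have "tr (B * X * A * b) = tr ((A * b * B) * X)" using tr_mult_commute[of "B * X" "A * b"] by (simp add: mult.assoc)
  hence "\<tau> (inverse (\<pi>F ^ k) * tr (B * X * A * b)) = \<tau> (inverse (\<pi>F ^ k) * tr (X * b))"
    using \<tau>_tr_cong[OF AbB X(1)] tr_mult_commute[of b X] by simp
  thus "\<psi> (inv\<^bsub>GG\<^esub> h \<otimes>\<^bsub>GG\<^esub> x \<otimes>\<^bsub>GG\<^esub> h) = \<psi> x"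
    unfolding e unfolding X(2) using psi_eq[OF X(1,3)] psi_eq[OF _ P] i by simp
qed

lemma psi_mult:
  assumes "x \<in> LL" "y \<in> LL"
  shows "\<psi> (x \<otimes>\<^bsub>GG\<^esub> y) = \<psi> x * \<psi> y"
proof -
  obtain X where X: "intm X" "x = red r (1 + pw l * X)" "PG r (1 + pw l * X)" by (rule K_form[OF assms(1) lk(6)])
  obtain Y where Y: "intm Y" "y = red r (1 + pw l * Y)" "PG r (1 + pw l * Y)" by (rule K_form[OF assms(2) lk(6)])
  let ?S = "X + Y + pw l * (X * Y)"
  have i: "intm ?S" using X Y by simp
  have e: "x \<otimes>\<^bsub>GG\<^esub> y = red r (1 + pw l * ?S)" unfolding X(2) Y(2) one_pw_mult[symmetric] by (rule G_mult) (use X Y in auto)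
  have P: "PG r (1 + pw l * ?S)" unfolding one_pw_mult[symmetric] by (rule PG_mult[OF X(3) Y(3)])
  have "red k ?S = red k (X + Y)" by (rule red_mono[OF lk(3)]) (use X Y in simp)
  hence "\<tau> (inverse (\<pi>F ^ k) * tr (?S * b)) = \<tau> (inverse (\<pi>F ^ k) * tr ((X + Y) * b))" by (rule \<tau>_tr_cong) simp
  thus ?thesis unfolding e psi_eq[OF i P] unfolding X(2) Y(2) psi_eq[OF X(1,3)] psi_eq[OF Y(1,3)]
    by (simp add: distrib_right distrib_left tr_add \<tau>_add)
qed

lemma psi_one: "\<psi> (red r 1) = 1"
  using psi_eq[of 0] by (simp add: PG_one)

end

section \<open>The symplectic space\<close>

context level
begin

abbreviation LG :: "('n, 'f set) sqmat monoid" where "LG \<equiv> lie_group v E 1"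
abbreviation ZL :: "('n, 'f set) sqmat set" where "ZL \<equiv> carrier (lie_cent_res v E \<beta>)"
abbreviation V :: "('n, 'f set) sqmat set monoid" where "V \<equiv> Vspace v E \<beta>"
abbreviation cl :: "('n, 'f) sqm \<Rightarrow> ('n, 'f set) sqmat set" where "cl X \<equiv> Vclass v E \<beta> (red 1 X)"

text \<open>A lift of the symplectic form that is exactly bilinear and alternating; for X and Y in
  the Lie algebra its value modulo \<pp> depends only on their classes in V.\<close>

definition fm :: "('n, 'f) sqm \<Rightarrow> ('n, 'f) sqm \<Rightarrow> 'f" where "fm X Y = tr ((X * Y - Y * X) * b)"

definition ev :: "('n, 'f set) sqmat set \<Rightarrow> ('n, 'f set) sqmat set \<Rightarrow> complex" where
  "ev u w = hat_tau \<pi>F \<tau> (sympl_form v \<beta> u w)"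

text \<open>Half of \<open>ev\<close> in the exponent, used as the Heisenberg multiplier; the
  cocycle c_{\<beta>,\<rho>} is by definition a value of it.\<close>

definition av :: "('n, 'f set) sqmat set \<Rightarrow> ('n, 'f set) sqmat set \<Rightarrow> complex" where
  "av u w = hat_tau \<pi>F \<tau> (omod v 1 (inverse 2) \<otimes>\<^bsub>Omod v 1\<^esub> sympl_form v \<beta> u w)"

lemma LG_simps: "monoid.mult (lie_group v E m) = madd (Omod v m)" "one (lie_group v E m) = red m 0" "carrier (lie_group v E m) = lie_points E (Omod v m) (omod v m)"
  by (simp_all add: lie_group_def red_ops)

lemma mem_LG: "intm X \<Longrightarrow> red 1 X \<in> carrier LG \<longleftrightarrow> Lie 1 X" by (simp add: LG_simps Lie_def)

lemma LG_cases:
  assumes "x \<in> carrier LG"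
  obtains X where "Lie 1 X" "x = red 1 X"
proof -
  have xc: "x \<in> carrier (mat_monoid (Omod v 1))" using assms by (auto simp: LG_simps lie_points_def mat_monoid_def)
  have "Lie 1 (lft x)" using lft[OF xc] assms by (simp add: Lie_def LG_simps)
  thus ?thesis using that lft[OF xc] by simp
qed

lemma LG_mult: "intm X \<Longrightarrow> intm Y \<Longrightarrow> red 1 X \<otimes>\<^bsub>LG\<^esub> red 1 Y = red 1 (X + Y)" by (simp add: LG_simps red_ops)

lemma comm_group_LG: "comm_group LG"
proof (rule comm_groupI)
  fix x y z assume x: "x \<in> carrier LG"
  obtain X where X: "Lie 1 X" "x = red 1 X" by (rule LG_cases[OF x])
  note iX = Lie_intm[OF X(1)]
  show "\<one>\<^bsub>LG\<^esub> \<otimes>\<^bsub>LG\<^esub> x = x" unfolding LG_simps(2) X(2) using LG_mult[of 0 X] iX by simp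
  have "red 1 (- X) \<otimes>\<^bsub>LG\<^esub> x = \<one>\<^bsub>LG\<^esub>" unfolding LG_simps(2) X(2) using LG_mult[of "- X" X] iX by simp
  moreover have "red 1 (- X) \<in> carrier LG" using mem_LG Lie_uminus[of 1 X] X iX by simp
  ultimately show "\<exists>y\<in>carrier LG. y \<otimes>\<^bsub>LG\<^esub> x = \<one>\<^bsub>LG\<^esub>" by blast
  assume y: "y \<in> carrier LG"
  obtain Y where Y: "Lie 1 Y" "y = red 1 Y" by (rule LG_cases[OF y])
  note iY = Lie_intm[OF Y(1)]
  show "x \<otimes>\<^bsub>LG\<^esub> y \<in> carrier LG" unfolding X(2) Y(2) LG_mult[OF iX iY] using mem_LG Lie_add[of 1 X Y] X Y iX iY by simp
  show "x \<otimes>\<^bsub>LG\<^esub> y = y \<otimes>\<^bsub>LG\<^esub> x" unfolding X(2) Y(2) LG_mult[OF iX iY] LG_mult[OF iY iX] by (simp add: add.commute)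
  assume z: "z \<in> carrier LG"
  obtain Z where Z: "Lie 1 Z" "z = red 1 Z" by (rule LG_cases[OF z])
  note iZ = Lie_intm[OF Z(1)]
  show "x \<otimes>\<^bsub>LG\<^esub> y \<otimes>\<^bsub>LG\<^esub> z = x \<otimes>\<^bsub>LG\<^esub> (y \<otimes>\<^bsub>LG\<^esub> z)"
    unfolding X(2) Y(2) Z(2) using LG_mult[OF iX iY] LG_mult[OF iY iZ] LG_mult[of "X + Y" Z] LG_mult[of X "Y + Z"] iX iY iZ by (simp add: add.assoc)
next
  show "\<one>\<^bsub>LG\<^esub> \<in> carrier LG" unfolding LG_simps(2) using mem_LG[of 0] Lie_0[of 1] by simp
qed

lemma mem_ZL: "intm X \<Longrightarrow> red 1 X \<in> ZL \<longleftrightarrow> LC X"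
proof -
  assume i: "intm X"
  have "mmap (omod v 1) \<beta> = red 1 b" by (simp add: red_def)
  hence "red 1 X \<in> ZL \<longleftrightarrow> Lie 1 X \<and> red 1 (X * b - b * X) = red 1 0"
    using i by (simp add: lie_cent_res_def lie_cent_points_def bracket_red red_ops Lie_def)
  also have "red 1 (X * b - b * X) = red 1 0 \<longleftrightarrow> red 1 (X * b) = red 1 (b * X)"
    by (simp add: red_eq_iff_ent minus_sqm.rep_eq zero_sqm.rep_eq)
  finally show ?thesis by (simp add: LC_def)
qed

lemma ZL_cases:
  assumes "x \<in> ZL"
  obtains X where "LC X" "x = red 1 X"
proof -
  have "x \<in> carrier LG" using assms by (simp add: lie_cent_res_def lie_cent_points_def LG_simps)
  then obtain X where X: "Lie 1 X" "x = red 1 X" by (rule LG_cases)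
  have "LC X" using assms mem_ZL[OF Lie_intm[OF X(1)]] X(2) by simp
  thus ?thesis using that X(2) by blast
qed

lemma LC_Lie: "LC X \<Longrightarrow> Lie 1 X" by (simp add: LC_def)

lemma LC_cong: "red 1 X = red 1 Y \<Longrightarrow> LC X \<Longrightarrow> LC Y"
proof -
  assume e: "red 1 X = red 1 Y" and X: "LC X"
  have iX: "intm X" by (rule Lie_intm[OF LC_Lie[OF X]])
  have iY: "intm Y" using red_intm[OF e iX] .
  show "LC Y" using X e mem_ZL[OF iX] mem_ZL[OF iY] by simp
qed

lemma LC_diff: "LC X \<Longrightarrow> LC Y \<Longrightarrow> LC (X - Y)"
  unfolding LC_def using Lie_diff[of 1 X Y] red_diff_cong[of 1 "X * b" "b * X" "Y * b" "b * Y"]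
  by (auto simp: left_diff_distrib right_diff_distrib)

lemma LC_0: "LC 0" using Lie_0[of 1] by (simp add: LC_def)

lemma LC_uminus: "LC X \<Longrightarrow> LC (- X)" using LC_diff[OF LC_0, of X] by simp
lemma LC_add: "LC X \<Longrightarrow> LC Y \<Longrightarrow> LC (X + Y)" using LC_diff[of X "- Y"] LC_uminus[of Y] by simp

lemma ZL_subgroup: "subgroup ZL LG"
proof -
  interpret LG: comm_group LG by (rule comm_group_LG)
  show ?thesis
  proof (rule LG.subgroupI)
    show "ZL \<subseteq> carrier LG" by (auto simp: lie_cent_res_def lie_cent_points_def LG_simps)
    show "ZL \<noteq> {}" using mem_ZL[of 0] LC_0 by auto
    fix x assume "x \<in> ZL"
    then obtain X where X: "LC X" "x = red 1 X" by (rule ZL_cases)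
    note iX = Lie_intm[OF LC_Lie[OF X(1)]]
    have "inv\<^bsub>LG\<^esub> x = red 1 (- X)"
    proof (rule LG.inv_equality)
      show "red 1 (- X) \<otimes>\<^bsub>LG\<^esub> x = \<one>\<^bsub>LG\<^esub>" unfolding LG_simps(2) X(2) using LG_mult[of "- X" X] iX by simp
    qed (use X mem_LG LC_Lie LC_uminus iX in auto)
    thus "inv\<^bsub>LG\<^esub> x \<in> ZL" using mem_ZL[of "- X"] LC_uminus X iX by simp
    fix y assume "y \<in> ZL"
    then obtain Y where Y: "LC Y" "y = red 1 Y" by (rule ZL_cases)
    note iY = Lie_intm[OF LC_Lie[OF Y(1)]]
    show "x \<otimes>\<^bsub>LG\<^esub> y \<in> ZL" unfolding X(2) Y(2) LG_mult[OF iX iY] using mem_ZL[of "X + Y"] LC_add[OF X(1) Y(1)] iX iY by simp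
  qed
qed

lemma cl_eq_image: "intm X \<Longrightarrow> cl X = {red 1 (H + X) | H. LC H}"
proof -
  assume i: "intm X"
  have "cl X = (\<Union>h\<in>ZL. {h \<otimes>\<^bsub>LG\<^esub> red 1 X})" by (simp add: Vclass_def r_coset_def)
  also have "\<dots> = {red 1 (H + X) | H. LC H}"
  proof (intro equalityI subsetI)
    fix x assume "x \<in> (\<Union>h\<in>ZL. {h \<otimes>\<^bsub>LG\<^esub> red 1 X})"
    then obtain h where h: "h \<in> ZL" "x = h \<otimes>\<^bsub>LG\<^esub> red 1 X" by blast
    obtain H where H: "LC H" "h = red 1 H" by (rule ZL_cases[OF h(1)])
    have "x = red 1 (H + X)" unfolding h(2) H(2) by (rule LG_mult[OF Lie_intm[OF LC_Lie[OF H(1)]] i])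
    thus "x \<in> {red 1 (H + X) | H. LC H}" using H by blast
  next
    fix x assume "x \<in> {red 1 (H + X) | H. LC H}"
    then obtain H where H: "LC H" "x = red 1 (H + X)" by blast
    have "x = red 1 H \<otimes>\<^bsub>LG\<^esub> red 1 X" unfolding H(2) by (rule LG_mult[OF Lie_intm[OF LC_Lie[OF H(1)]] i, symmetric])
    moreover have "red 1 H \<in> ZL" using mem_ZL[OF Lie_intm[OF LC_Lie[OF H(1)]]] H by simp
    ultimately show "x \<in> (\<Union>h\<in>ZL. {h \<otimes>\<^bsub>LG\<^esub> red 1 X})" by blast
  qed
  finally show ?thesis .
qed

lemma mem_cl: "intm X \<Longrightarrow> intm Y \<Longrightarrow> red 1 Y \<in> cl X \<longleftrightarrow> LC (Y - X)"
proof
  assume i: "intm X" "intm Y" and "red 1 Y \<in> cl X"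
  then obtain H where H: "LC H" "red 1 Y = red 1 (H + X)" using cl_eq_image by blast
  have "red 1 (Y - X) = red 1 (H + X - X)" by (rule red_diff_cong[OF H(2) refl])
  thus "LC (Y - X)" using H(1) LC_cong[of H "Y - X"] by simp
next
  assume i: "intm X" "intm Y" and "LC (Y - X)"
  thus "red 1 Y \<in> cl X" unfolding cl_eq_image[OF i(1)] by (auto intro!: exI[of _ "Y - X"])
qed

lemma cl_eq_iff: "intm X \<Longrightarrow> intm Y \<Longrightarrow> cl X = cl Y \<longleftrightarrow> LC (X - Y)"
proof
  assume i: "intm X" "intm Y" and "cl X = cl Y"
  thus "LC (X - Y)" using mem_cl[of Y X] mem_cl[of X X] LC_0 by simp
next
  assume i: "intm X" "intm Y" and L: "LC (X - Y)"
  have "H + X \<in> {H + Y | H. LC H}" if "LC H" for H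
    using LC_add[OF that L] by (auto intro!: exI[of _ "H + (X - Y)"])
  moreover have "H + Y \<in> {H + X | H. LC H}" if "LC H" for H
    using LC_diff[OF that L] by (auto intro!: exI[of _ "H - (X - Y)"])
  ultimately have "{H + X | H. LC H} = {H + Y | H. LC H}" by blast
  moreover have "{red 1 (H + Z) | H. LC H} = red 1 ` {H + Z | H. LC H}" for Z by blast
  ultimately show "cl X = cl Y" unfolding cl_eq_image[OF i(1)] cl_eq_image[OF i(2)] by simp
qed

lemma carrier_V: "carrier V = cl ` {X. Lie 1 X}"
proof -
  have "carrier V = (\<lambda>x. ZL #>\<^bsub>LG\<^esub> x) ` carrier LG" by (auto simp: Vspace_def FactGroup_def RCOSETS_def)
  also have "\<dots> = cl ` {X. Lie 1 X}"
  proof (intro equalityI subsetI)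
    fix u assume "u \<in> (\<lambda>x. ZL #>\<^bsub>LG\<^esub> x) ` carrier LG"
    then obtain x where x: "x \<in> carrier LG" "u = ZL #>\<^bsub>LG\<^esub> x" by blast
    obtain X where "Lie 1 X" "x = red 1 X" by (rule LG_cases[OF x(1)])
    thus "u \<in> cl ` {X. Lie 1 X}" using x by (auto simp: Vclass_def)
  next
    fix u assume "u \<in> cl ` {X. Lie 1 X}"
    then obtain X where "Lie 1 X" "u = cl X" by blast
    thus "u \<in> (\<lambda>x. ZL #>\<^bsub>LG\<^esub> x) ` carrier LG" using mem_LG[OF Lie_intm] by (auto simp: Vclass_def)
  qed
  finally show ?thesis .
qed

lemma V_cases:
  assumes "u \<in> carrier V"
  obtains X where "Lie 1 X" "u = cl X"
  using assms unfolding carrier_V by blast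

lemma cl_V [simp]: "Lie 1 X \<Longrightarrow> cl X \<in> carrier V" by (auto simp: carrier_V)

lemma comm_group_V: "comm_group V"
proof -
  interpret LG: comm_group LG by (rule comm_group_LG)
  show ?thesis unfolding Vspace_def by (rule LG.abelian_FactGroup[OF ZL_subgroup])
qed

lemma cl_mult: "Lie 1 X \<Longrightarrow> Lie 1 Y \<Longrightarrow> cl X \<otimes>\<^bsub>V\<^esub> cl Y = cl (X + Y)"
proof -
  assume X: "Lie 1 X" and Y: "Lie 1 Y"
  interpret LG: comm_group LG by (rule comm_group_LG)
  have n: "ZL \<lhd> LG" by (rule LG.subgroup_imp_normal[OF ZL_subgroup])
  have "cl X \<otimes>\<^bsub>V\<^esub> cl Y = ZL #>\<^bsub>LG\<^esub> (red 1 X \<otimes>\<^bsub>LG\<^esub> red 1 Y)"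
    unfolding Vspace_def FactGroup_def Vclass_def
    using normal.rcos_sum[OF n, of "red 1 X" "red 1 Y"] X Y mem_LG[OF Lie_intm] by simp
  thus ?thesis using LG_mult[OF Lie_intm[OF X] Lie_intm[OF Y]] by (simp add: Vclass_def)
qed

lemma V_one: "one V = cl 0"
proof -
  interpret V: comm_group V by (rule comm_group_V)
  have L0: "Lie 1 0" using Lie_0[of 1] by simp
  have "cl 0 \<otimes>\<^bsub>V\<^esub> cl 0 = cl 0" using cl_mult[OF L0 L0] by simp
  thus ?thesis using V.r_cancel_one[of "cl 0" "cl 0"] cl_V[OF L0] by simp
qed

lemma finite_V: "finite (carrier V)"
proof -
  have "finite (carrier LG)" by (rule finite_subset[OF _ finite_mats[of 1]]) (auto simp: LG_simps lie_points_def)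
  moreover have "carrier V = (\<lambda>x. ZL #>\<^bsub>LG\<^esub> x) ` carrier LG" by (auto simp: Vspace_def FactGroup_def RCOSETS_def)
  ultimately show ?thesis by simp
qed

lemma some_cl:
  assumes X: "Lie 1 X"
  obtains Y where "Lie 1 Y" "LC (Y - X)" "(SOME x. x \<in> cl X) = red 1 Y"
proof -
  note iX = Lie_intm[OF X]
  have "red 1 X \<in> cl X" using mem_cl[OF iX iX] LC_0 by simp
  hence "(SOME x. x \<in> cl X) \<in> cl X" by (rule someI[of "\<lambda>x. x \<in> cl X"])
  then obtain H where H: "LC H" "(SOME x. x \<in> cl X) = red 1 (H + X)" using cl_eq_image[OF iX] by blast
  have "Lie 1 (H + X)" using Lie_add[OF _ LC_Lie[OF H(1)] X] by simp
  thus ?thesis using that[of "H + X"] H by simp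
qed

section \<open>The symplectic form computed on lifts\<close>

lemma fm_int: "intm X \<Longrightarrow> intm Y \<Longrightarrow> fm X Y \<in> ppow v 0" by (simp add: fm_def)

lemma fm_add_left: "fm (X + Y) Z = fm X Z + fm Y Z" by (simp add: fm_def algebra_simps tr_add tr_diff)
lemma fm_add_right: "fm X (Y + Z) = fm X Y + fm X Z" by (simp add: fm_def algebra_simps tr_add tr_diff)
lemma fm_diff_left: "fm (X - Y) Z = fm X Z - fm Y Z" by (simp add: fm_def algebra_simps tr_add tr_diff)
lemma fm_diff_right: "fm X (Y - Z) = fm X Y - fm X Z" by (simp add: fm_def algebra_simps tr_add tr_diff)
lemma fm_scale_right: "fm X (sc c * Y) = c * fm X Y"
  by (simp add: fm_def left_diff_distrib right_diff_distrib mult.assoc sc_left_commute[of X] tr_diff tr_sc_mult)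
lemma fm_alt: "fm X X = 0" by (simp add: fm_def)
lemma fm_skew: "fm X Y = - fm Y X" by (simp add: fm_def left_diff_distrib tr_diff)
text \<open>By cyclicity of the trace. In this shape the radical is visible: it consists of the X
  whose bracket with b is orthogonal to the Lie algebra modulo \<pp>.\<close>

lemma fm_bracket: "fm X Y = tr ((b * X - X * b) * Y)"
proof -
  have "tr (X * Y * b) = tr (b * X * Y)" using tr_mult_commute[of "X * Y" b] by (simp add: mult.assoc)
  moreover have "tr (Y * X * b) = tr (X * b * Y)" using tr_mult_commute[of Y "X * b"] by (simp add: mult.assoc)
  ultimately show ?thesis by (simp add: fm_def left_diff_distrib tr_diff)
qed

lemma fm_LC: "LC X \<Longrightarrow> intm Y \<Longrightarrow> fm X Y \<in> ppow v 1"
proof -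
  assume X: "LC X" and Y: "intm Y"
  note iX = Lie_intm[OF LC_Lie[OF X]]
  have "red 1 (b * X) = red 1 (X * b)" using X by (simp add: LC_def)
  hence "red 1 (b * X - X * b) = red 1 (X * b - X * b)" by (rule red_diff_cong) (rule refl)
  hence "red 1 (b * X - X * b) = red 1 0" by simp
  hence "red 1 ((b * X - X * b) * Y) = red 1 (0 * Y)" by (rule red_mult_cong) (use Y in auto)
  thus ?thesis unfolding fm_bracket using tr_cong[of 1 "(b * X - X * b) * Y" 0] by simp
qed

lemma fm_LC_right: "LC Y \<Longrightarrow> intm X \<Longrightarrow> fm X Y \<in> ppow v 1"
  using fm_LC[of Y X] fm_skew[of X Y] by simp

lemma hat_tau_omod: "x \<in> ppow v 0 \<Longrightarrow> hat_tau \<pi>F \<tau> (omod v 1 x) = \<tau> (inverse \<pi>F * x)"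
proof -
  assume x: "x \<in> ppow v 0"
  have "(SOME a. a \<in> omod v 1 x) - x \<in> ppow v 1" by (rule some_mem_omod)
  then obtain y where y: "y \<in> ppow v 0" "(SOME a. a \<in> omod v 1 x) - x = \<pi>F ^ 1 * y" using ppow_iff by blast
  have "inverse \<pi>F * (SOME a. a \<in> omod v 1 x) - inverse \<pi>F * x = inverse \<pi>F * (\<pi>F ^ 1 * y)"
    unfolding y(2)[symmetric] by (rule right_diff_distrib[symmetric])
  also have "\<dots> = y" using unif by (simp add: mult.assoc[symmetric])
  finally show ?thesis unfolding hat_tau_def by (intro \<tau>_eqI) (use y in simp)
qed

lemma sympl_eq: "Lie 1 X \<Longrightarrow> Lie 1 Y \<Longrightarrow> sympl_form v \<beta> (cl X) (cl Y) = omod v 1 (fm X Y)"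
proof -
  assume X: "Lie 1 X" and Y: "Lie 1 Y"
  obtain X' where X': "Lie 1 X'" "LC (X' - X)" "(SOME x. x \<in> cl X) = red 1 X'" by (rule some_cl[OF X])
  obtain Y' where Y': "Lie 1 Y'" "LC (Y' - Y)" "(SOME x. x \<in> cl Y) = red 1 Y'" by (rule some_cl[OF Y])
  note i = Lie_intm[OF X] Lie_intm[OF Y] Lie_intm[OF X'(1)] Lie_intm[OF Y'(1)]
  have e: "mmap (omod v 1) \<beta> = red 1 b" by (simp add: red_def)
  have "sympl_form v \<beta> (cl X) (cl Y) = omod v 1 (fm X' Y')"
    unfolding sympl_form_def X'(3) Y'(3) e fm_def using i by (simp add: bracket_red tform_red)
  also have "\<dots> = omod v 1 (fm X Y)"
  proof -
    have "fm X' Y' - fm X Y = fm (X' - X) Y' + fm X (Y' - Y)" by (simp add: fm_diff_left fm_diff_right)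
    thus ?thesis unfolding omod_eq_iff using fm_LC[OF X'(2) i(4)] fm_LC_right[OF Y'(2) i(1)] by simp
  qed
  finally show ?thesis .
qed

lemma ev_eq: "Lie 1 X \<Longrightarrow> Lie 1 Y \<Longrightarrow> ev (cl X) (cl Y) = \<tau> (inverse \<pi>F * fm X Y)"
  unfolding ev_def by (simp only: sympl_eq hat_tau_omod fm_int Lie_intm)

lemma av_eq: "Lie 1 X \<Longrightarrow> Lie 1 Y \<Longrightarrow> av (cl X) (cl Y) = \<tau> (inverse \<pi>F * (inverse 2 * fm X Y))"
proof -
  assume X: "Lie 1 X" and Y: "Lie 1 Y"
  have "av (cl X) (cl Y) = hat_tau \<pi>F \<tau> (omod v 1 (inverse 2) \<otimes>\<^bsub>Omod v 1\<^esub> omod v 1 (fm X Y))"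
    unfolding av_def sympl_eq[OF X Y] ..
  also have "\<dots> = hat_tau \<pi>F \<tau> (omod v 1 (inverse 2 * fm X Y))"
    using omod_ops(2)[OF two_unit(2) fm_int[OF Lie_intm[OF X] Lie_intm[OF Y]], of 1] by (rule arg_cong)
  also have "\<dots> = \<tau> (inverse \<pi>F * (inverse 2 * fm X Y))"
    by (rule hat_tau_omod[OF int_mult[OF two_unit(2) fm_int[OF Lie_intm[OF X] Lie_intm[OF Y]]]])
  finally show ?thesis .
qed

lemma av_square: "Lie 1 X \<Longrightarrow> Lie 1 Y \<Longrightarrow> av (cl X) (cl Y) ^ 2 = ev (cl X) (cl Y)"
proof -
  assume X: "Lie 1 X" and Y: "Lie 1 Y"
  have h: "fm X Y = inverse 2 * fm X Y + inverse 2 * fm X Y" using two_unit(1) by (simp add: field_simps)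
  have "ev (cl X) (cl Y) = \<tau> (inverse \<pi>F * (inverse 2 * fm X Y + inverse 2 * fm X Y))" unfolding ev_eq[OF X Y] h[symmetric] ..
  thus ?thesis unfolding distrib_left[of "inverse \<pi>F"] \<tau>_add av_eq[OF X Y] power2_eq_square by simp
qed

text \<open>Scaling Y by all elements of O turns triviality of \<tau> into divisibility of
  \<open>fm X Y\<close> by \<open>\<pi>F\<close>, by the normalisation of \<tau>. The bracket of b
  with X lies in the Lie algebra, so nondegeneracy of the trace form applies to it.\<close>

lemma ev_nondeg:
  assumes X: "Lie 1 X" and z: "\<And>Y. Lie 1 Y \<Longrightarrow> ev (cl X) (cl Y) = 1"
  shows "LC X"
proof -
  have D: "Lie 1 (b * X - X * b)" by (rule Lie_bracket[OF Lie_b X])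
  have "tr ((b * X - X * b) * Y) \<in> ppow v 1" if Y: "Lie 1 Y" for Y
  proof -
    have "inverse \<pi>F * fm X Y \<in> ppow v 0"
    proof (rule \<tau>_detect)
      fix c assume c: "c \<in> ppow v 0"
      have "\<tau> (inverse \<pi>F * fm X (sc c * Y)) = 1" using z[OF Lie_scale[OF c Y]] ev_eq[OF X Lie_scale[OF c Y]] by simp
      thus "\<tau> (inverse \<pi>F * fm X Y * c) = 1" by (simp add: fm_scale_right ac_simps)
    qed
    moreover have "fm X Y = \<pi>F ^ 1 * (inverse \<pi>F * fm X Y)" using unif by simp
    ultimately have "fm X Y \<in> ppow v 1" using ppow_iff by blast
    thus ?thesis by (simp add: fm_bracket)
  qed
  from nondeg[OF D this] have "red 1 (b * X - X * b) = red 1 0" .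
  hence "red 1 (X * b) = red 1 (b * X)" by (simp add: red_eq_iff_ent minus_sqm.rep_eq zero_sqm.rep_eq) (metis minus_diff_eq ppow_minus)
  thus ?thesis using X by (simp add: LC_def)
qed

sublocale HV: heisenberg V av
proof (intro heisenberg.intro heisenberg_axioms.intro comm_group_V finite_V)
  fix x assume x: "x \<in> carrier V"
  obtain X where X: "Lie 1 X" "x = cl X" by (rule V_cases[OF x])
  show "av x x = 1" unfolding X(2) av_eq[OF X(1) X(1)] by (simp add: fm_alt)
  show "x = \<one>\<^bsub>V\<^esub>" if n: "\<And>y. y \<in> carrier V \<Longrightarrow> av x y ^ 2 = 1"
  proof -
    have "LC X"
    proof (rule ev_nondeg[OF X(1)])
      show "ev (cl X) (cl Y) = 1" if "Lie 1 Y" for Y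
        using n[OF cl_V[OF that]] av_square[OF X(1) that] X(2) by simp
    qed
    thus ?thesis unfolding V_one X(2) using cl_eq_iff[of X 0] Lie_intm[OF X(1)] by simp
  qed
  fix y z assume y: "y \<in> carrier V" and z: "z \<in> carrier V"
  obtain Y where Y: "Lie 1 Y" "y = cl Y" by (rule V_cases[OF y])
  obtain Z where Z: "Lie 1 Z" "z = cl Z" by (rule V_cases[OF z])
  have XY: "Lie 1 (X + Y)" and YZ: "Lie 1 (Y + Z)" using Lie_add[of 1] X Y Z by auto
  show "av (x \<otimes>\<^bsub>V\<^esub> y) z = av x z * av y z"
    unfolding X(2) Y(2) Z(2) cl_mult[OF X(1) Y(1)] av_eq[OF XY Z(1)] av_eq[OF X(1) Z(1)] av_eq[OF Y(1) Z(1)] fm_add_left distrib_left \<tau>_add ..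
  show "av x (y \<otimes>\<^bsub>V\<^esub> z) = av x y * av x z"
    unfolding X(2) Y(2) Z(2) cl_mult[OF Y(1) Z(1)] av_eq[OF X(1) YZ] av_eq[OF X(1) Z(1)] av_eq[OF X(1) Y(1)] fm_add_right distrib_left \<tau>_add ..
qed

lemma ev_av: "x \<in> carrier V \<Longrightarrow> y \<in> carrier V \<Longrightarrow> ev x y = av x y * av x y"
proof -
  assume x: "x \<in> carrier V" and y: "y \<in> carrier V"
  obtain X where X: "Lie 1 X" "x = cl X" by (rule V_cases[OF x])
  obtain Y where Y: "Lie 1 Y" "y = cl Y" by (rule V_cases[OF y])
  show ?thesis unfolding X(2) Y(2) av_square[OF X(1) Y(1), symmetric] power2_eq_square ..
qed

lemma ev_inj:
  assumes x: "x \<in> carrier V" and y: "y \<in> carrier V" and e: "\<And>u. u \<in> carrier V \<Longrightarrow> ev u x = ev u y"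
  shows "x = y"
proof -
  have "x \<otimes>\<^bsub>V\<^esub> inv\<^bsub>V\<^esub> y = \<one>\<^bsub>V\<^esub>"
  proof (rule HV.a_nondeg)
    fix u assume u: "u \<in> carrier V"
    have p: "av a c * av a c * (av c a * av c a) = 1" if "a \<in> carrier V" "c \<in> carrier V" for a c
      using HV.a_skew[OF that] by (metis mult.assoc mult.commute mult_1)
    have "av u x * av u x = av u y * av u y" using e[OF u] ev_av u x y by simp
    hence xu: "av x u * av x u = av y u * av y u" using p[OF u x] p[OF u y] by (metis mult.commute mult_cancel_left mult_zero_left zero_neq_one)
    have "av (x \<otimes>\<^bsub>V\<^esub> inv\<^bsub>V\<^esub> y) u = av x u * av u y" using x y u by (simp add: HV.a_mult_left HV.a_inv_left)
    hence "av (x \<otimes>\<^bsub>V\<^esub> inv\<^bsub>V\<^esub> y) u ^ 2 = av x u * av x u * (av u y * av u y)" by (simp add: power2_eq_square ac_simps)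
    also have "\<dots> = 1" unfolding xu using p[OF y u] by simp
    finally show "av (x \<otimes>\<^bsub>V\<^esub> inv\<^bsub>V\<^esub> y) u ^ 2 = 1" .
  qed (use x y in simp)
  thus ?thesis using x y by (metis HV.inv_closed HV.inv_equality HV.inv_inv)
qed

text \<open>The character comes from \<open>av\<close> by \<open>character_from_pairing\<close>;
  halving the vector turns \<open>av\<close> into \<open>ev\<close>.\<close>

lemma character_ev:
  assumes \<chi>: "\<And>x y. x \<in> carrier V \<Longrightarrow> y \<in> carrier V \<Longrightarrow> \<chi> (x \<otimes>\<^bsub>V\<^esub> y) = \<chi> x * \<chi> y" and nz: "\<chi> \<one>\<^bsub>V\<^esub> \<noteq> (0 :: complex)"
  obtains w where "w \<in> carrier V" "\<And>u. u \<in> carrier V \<Longrightarrow> \<chi> u = ev u w"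
proof -
  obtain w where w: "w \<in> carrier V" "\<And>u. u \<in> carrier V \<Longrightarrow> \<chi> u = av u w" by (rule HV.character_from_pairing[OF \<chi> nz]) blast+
  obtain Y where Y: "Lie 1 Y" "w = cl Y" by (rule V_cases[OF w(1)])
  have hY: "Lie 1 (sc (inverse 2) * Y)" by (rule Lie_scale[OF two_unit(2) Y(1)])
  have "\<chi> u = ev u (cl (sc (inverse 2) * Y))" if u: "u \<in> carrier V" for u
  proof -
    obtain X where X: "Lie 1 X" "u = cl X" by (rule V_cases[OF u])
    have "\<chi> u = av u w" by (rule w(2)[OF u])
    also have "\<dots> = ev u (cl (sc (inverse 2) * Y))" unfolding X(2) Y(2) av_eq[OF X(1) Y(1)] ev_eq[OF X(1) hY] fm_scale_right ..
    finally show ?thesis .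
  qed
  thus ?thesis using that[OF cl_V[OF hY]] by blast
qed

section \<open>The action of the centralizer\<close>

abbreviation Gam :: "('n, 'f set) sqmat monoid" where "Gam \<equiv> cent_group v E \<beta> 1"

lemma Gam_simps: "carrier (cent_group v E \<beta> m) = cent_points E \<beta> (Omod v m) (omod v m)" "monoid.mult (cent_group v E \<beta> m) = monoid.mult (G_group v E m)" "one (cent_group v E \<beta> m) = red m 1"
  by (simp_all add: cent_group_def G_simps)

lemma Gam_cases:
  assumes "g \<in> carrier Gam"
  obtains A B where "CG 1 A" "g = red 1 A" "CG 1 B" "red 1 (A * B) = red 1 1" "red 1 (B * A) = red 1 1"
    "inv\<^bsub>G_group v E 1\<^esub> g = red 1 B"
proof -
  have "g \<in> carrier (G_group v E 1)" using assms by (simp add: Gam_simps cent_points_def G_simps)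
  then obtain A where A: "PG 1 A" "g = red 1 A" by (rule G_cases)
  have CA: "CG 1 A" using assms A CG_iff[of 1 A] PG_intm[OF A(1)] by (simp add: Gam_simps)
  obtain B where B: "PG 1 B" "red 1 (A * B) = red 1 1" "red 1 (B * A) = red 1 1" "inv\<^bsub>G_group v E 1\<^esub> (red 1 A) = red 1 B"
    by (rule G_inv_cases[OF A(1)])
  show ?thesis using that[OF CA A(2) CG_inv[OF CA B(1-3)] B(2,3)] B(4) A(2) by simp
qed

lemma mem_Gam: "CG 1 A \<Longrightarrow> red 1 A \<in> carrier Gam" by (simp add: Gam_simps CG_iff)

lemma Gam_mult: "intm A \<Longrightarrow> intm B \<Longrightarrow> red 1 A \<otimes>\<^bsub>Gam\<^esub> red 1 B = red 1 (A * B)" using G_mult[of A B 1] by (simp add: Gam_simps)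

lemma CG_intm: "CG m A \<Longrightarrow> intm A" by (rule PG_intm[OF CG_PG])

lemma Gam_subgroup: "subgroup (carrier Gam) (G_group v E 1)"
proof -
  have "x \<in> red 1 ` {A. CG 1 A}" if "x \<in> carrier Gam" for x
  proof -
    show ?thesis by (rule Gam_cases[OF that]) blast
  qed
  hence "carrier Gam = red 1 ` {A. CG 1 A}" using mem_Gam by blast
  moreover have "subgroup (red 1 ` Collect (CG 1)) (G_group v E 1)"
    by (rule subgroup_red) (auto simp: CG_one CG_PG CG_mult intro: CG_inv)
  ultimately show ?thesis by (simp add: Collect_conv_if)
qed

lemma group_Gam: "group Gam"
proof -
  have "Gam = (G_group v E 1)\<lparr>carrier := carrier Gam\<rparr>" by (simp add: cent_group_def)
  thus ?thesis using subgroup.subgroup_is_group[OF Gam_subgroup group_G] by simp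
qed

abbreviation act where "act \<equiv> Vact v E \<beta>"

text \<open>\<open>Vact\<close> picks some representative of the class. Another one differs by an
  element of the centralizer, which A fixes by \<open>CG_fixes_LC\<close>, so the class of the
  result is the same.\<close>

lemma act_eq:
  assumes X: "Lie 1 X" and A: "CG 1 A" and B: "CG 1 B" and AB: "red 1 (A * B) = red 1 1" and BA: "red 1 (B * A) = red 1 1"
  shows "act (cl X) (red 1 A) = cl (B * X * A)"
proof -
  obtain Y where Y: "Lie 1 Y" "LC (Y - X)" "(SOME x. x \<in> cl X) = red 1 Y" by (rule some_cl[OF X])
  note i = CG_intm[OF A] CG_intm[OF B] Lie_intm[OF X] Lie_intm[OF Y(1)]
  have inv: "inv\<^bsub>G_group v E 1\<^esub> (red 1 A) = red 1 B" by (rule G_inv[OF CG_PG[OF A] CG_PG[OF B] BA])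
  have "act (cl X) (red 1 A) = cl (B * Y * A)"
    unfolding Vact_def Y(3) inv Ad_red[OF i(2,1) BA AB i(4)] ..
  also have "\<dots> = cl (B * X * A)"
  proof -
    have "red 1 (B * (Y - X) * A) = red 1 (Y - X)" by (rule CG_fixes_LC[OF A CG_PG[OF B] BA Y(2)])
    hence "LC (B * (Y - X) * A)" using LC_cong[OF _ Y(2)] by metis
    thus ?thesis using cl_eq_iff[of "B * Y * A" "B * X * A"] i by (simp add: left_diff_distrib right_diff_distrib)
  qed
  finally show ?thesis .
qed

lemma act_closed: "u \<in> carrier V \<Longrightarrow> g \<in> carrier Gam \<Longrightarrow> act u g \<in> carrier V"
proof -
  assume u: "u \<in> carrier V" and g: "g \<in> carrier Gam"
  obtain X where X: "Lie 1 X" "u = cl X" by (rule V_cases[OF u])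
  obtain A B where A: "CG 1 A" "g = red 1 A" "CG 1 B" "red 1 (A * B) = red 1 1" "red 1 (B * A) = red 1 1" by (rule Gam_cases[OF g])
  show ?thesis unfolding X(2) A(2) act_eq[OF X(1) A(1,3-5)] by (rule cl_V[OF Lie_Ad[OF CG_PG[OF A(1)] CG_PG[OF A(3)] A(5) X(1)]])
qed

lemma act_mult: "u \<in> carrier V \<Longrightarrow> w \<in> carrier V \<Longrightarrow> g \<in> carrier Gam \<Longrightarrow> act (u \<otimes>\<^bsub>V\<^esub> w) g = act u g \<otimes>\<^bsub>V\<^esub> act w g"
proof -
  assume u: "u \<in> carrier V" and w: "w \<in> carrier V" and g: "g \<in> carrier Gam"
  obtain X where X: "Lie 1 X" "u = cl X" by (rule V_cases[OF u])
  obtain Y where Y: "Lie 1 Y" "w = cl Y" by (rule V_cases[OF w])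
  obtain A B where A: "CG 1 A" "g = red 1 A" "CG 1 B" "red 1 (A * B) = red 1 1" "red 1 (B * A) = red 1 1" by (rule Gam_cases[OF g])
  have XY: "Lie 1 (X + Y)" using Lie_add[of 1] X Y by simp
  note L = Lie_Ad[OF CG_PG[OF A(1)] CG_PG[OF A(3)] A(5)]
  show ?thesis unfolding X(2) Y(2) A(2) cl_mult[OF X(1) Y(1)] act_eq[OF X(1) A(1,3-5)] act_eq[OF Y(1) A(1,3-5)] act_eq[OF XY A(1,3-5)]
      cl_mult[OF L[OF X(1)] L[OF Y(1)]] by (simp add: distrib_left distrib_right)
qed

text \<open>A b B is b modulo \<pp>, so conjugation leaves both traces in \<open>fm\<close>
  unchanged modulo \<pp>; halving is harmless since 2 is a unit.\<close>

lemma act_av: "u \<in> carrier V \<Longrightarrow> w \<in> carrier V \<Longrightarrow> g \<in> carrier Gam \<Longrightarrow> av (act u g) (act w g) = av u w"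
proof -
  assume u: "u \<in> carrier V" and w: "w \<in> carrier V" and g: "g \<in> carrier Gam"
  obtain X where X: "Lie 1 X" "u = cl X" by (rule V_cases[OF u])
  obtain Y where Y: "Lie 1 Y" "w = cl Y" by (rule V_cases[OF w])
  obtain A B where A: "CG 1 A" "g = red 1 A" "CG 1 B" "red 1 (A * B) = red 1 1" "red 1 (B * A) = red 1 1" by (rule Gam_cases[OF g])
  note L = Lie_Ad[OF CG_PG[OF A(1)] CG_PG[OF A(3)] A(5)]
  note i = CG_intm[OF A(1)] CG_intm[OF A(3)] Lie_intm[OF X(1)] Lie_intm[OF Y(1)]
  have AbB: "red 1 (A * b * B) = red 1 b"
  proof -
    have "red 1 (A * b * B) = red 1 (b * A * B)" by (rule red_mult_cong) (use A i in \<open>auto simp: CG_def\<close>)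
    also have "\<dots> = red 1 (b * (A * B))" by (simp add: mult.assoc)
    also have "\<dots> = red 1 (b * 1)" by (rule red_mult_cong) (use i A in auto)
    finally show ?thesis by simp
  qed
  have part: "tr (B * P * A * (B * Q * A) * b) - tr (P * Q * b) \<in> ppow v 1" if P: "intm P" and Q: "intm Q" for P Q
  proof -
    have e1: "red 1 (P * (A * B) * Q) = red 1 (P * 1 * Q)" by (rule red_mult_cong[OF red_mult_cong[OF refl A(4)] refl]) (use i P Q in auto)
    have "tr (B * P * A * (B * Q * A) * b) = tr ((P * (A * B) * Q) * (A * b * B))"
      using tr_mult_commute[of B "P * A * (B * Q * A) * b"] by (simp add: mult.assoc)
    moreover have "red 1 ((P * (A * B) * Q) * (A * b * B)) = red 1 (P * 1 * Q * b)" by (rule red_mult_cong[OF e1 AbB]) (use i P Q in auto)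
    ultimately show ?thesis using tr_cong[of 1 "(P * (A * B) * Q) * (A * b * B)" "P * Q * b"] by simp
  qed
  have "fm (B * X * A) (B * Y * A) - fm X Y = (tr (B * X * A * (B * Y * A) * b) - tr (X * Y * b)) - (tr (B * Y * A * (B * X * A) * b) - tr (Y * X * b))"
    by (simp add: fm_def left_diff_distrib tr_diff)
  hence d: "fm (B * X * A) (B * Y * A) - fm X Y \<in> ppow v 1" using part[OF i(3,4)] part[OF i(4,3)] by simp
  have "\<tau> (inverse \<pi>F * (inverse 2 * fm (B * X * A) (B * Y * A))) = \<tau> (inverse \<pi>F * (inverse 2 * fm X Y))"
  proof (rule \<tau>_eqI)
    have "inverse \<pi>F * (inverse 2 * fm (B * X * A) (B * Y * A)) - inverse \<pi>F * (inverse 2 * fm X Y) =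
        inverse (2 * \<pi>F) * (fm (B * X * A) (B * Y * A) - fm X Y)" unfolding half_pi by (simp only: right_diff_distrib ac_simps)
    thus "inverse \<pi>F * (inverse 2 * fm (B * X * A) (B * Y * A)) - inverse \<pi>F * (inverse 2 * fm X Y) \<in> ppow v 0"
      using half_pi_int[OF d] by (simp only:)
  qed
  thus ?thesis unfolding X(2) Y(2) A(2) act_eq[OF X(1) A(1,3-5)] act_eq[OF Y(1) A(1,3-5)] av_eq[OF X(1) Y(1)] av_eq[OF L[OF X(1)] L[OF Y(1)]] .
qed

lemma act_act: "u \<in> carrier V \<Longrightarrow> g \<in> carrier Gam \<Longrightarrow> h \<in> carrier Gam \<Longrightarrow> act u (g \<otimes>\<^bsub>Gam\<^esub> h) = act (act u g) h"
proof -
  assume u: "u \<in> carrier V" and g: "g \<in> carrier Gam" and h: "h \<in> carrier Gam"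
  obtain X where X: "Lie 1 X" "u = cl X" by (rule V_cases[OF u])
  obtain A B where A: "CG 1 A" "g = red 1 A" "CG 1 B" "red 1 (A * B) = red 1 1" "red 1 (B * A) = red 1 1" by (rule Gam_cases[OF g])
  obtain A' B' where A': "CG 1 A'" "h = red 1 A'" "CG 1 B'" "red 1 (A' * B') = red 1 1" "red 1 (B' * A') = red 1 1" by (rule Gam_cases[OF h])
  note i = CG_intm[OF A(1)] CG_intm[OF A(3)] CG_intm[OF A'(1)] CG_intm[OF A'(3)]
  have 1: "red 1 (A * A' * (B' * B)) = red 1 1"
  proof -
    have "red 1 (A * (A' * B') * B) = red 1 (A * 1 * B)" by (rule red_mult_cong[OF red_mult_cong[OF refl A'(4)] refl]) (use i in auto)
    thus ?thesis using A(4) by (simp add: mult.assoc)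
  qed
  have 2: "red 1 (B' * B * (A * A')) = red 1 1"
  proof -
    have "red 1 (B' * (B * A) * A') = red 1 (B' * 1 * A')" by (rule red_mult_cong[OF red_mult_cong[OF refl A(5)] refl]) (use i in auto)
    thus ?thesis using A'(5) by (simp add: mult.assoc)
  qed
  show ?thesis unfolding X(2) A(2) A'(2) Gam_mult[OF i(1,3)] act_eq[OF X(1) CG_mult[OF A(1) A'(1)] CG_mult[OF A'(3) A(3)] 1 2]
      act_eq[OF X(1) A(1,3-5)] act_eq[OF Lie_Ad[OF CG_PG[OF A(1)] CG_PG[OF A(3)] A(5) X(1)] A'(1,3-5)] by (simp add: mult.assoc)
qed

lemma act_one: "u \<in> carrier V \<Longrightarrow> act u \<one>\<^bsub>Gam\<^esub> = u"
proof -
  assume u: "u \<in> carrier V"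
  obtain X where X: "Lie 1 X" "u = cl X" by (rule V_cases[OF u])
  show ?thesis unfolding X(2) Gam_simps(3) using act_eq[OF X(1) CG_one CG_one] by simp
qed

end

declare One_nat_def [simp del]

section \<open>Existence of the intertwining representation\<close>

lemma smult_mult_smult:
  fixes A B :: "complex mat"
  assumes "A \<in> carrier_mat n m" "B \<in> carrier_mat m p"
  shows "(a \<cdot>\<^sub>m A) * (c \<cdot>\<^sub>m B) = (a * c) \<cdot>\<^sub>m (A * B)"
  using assms mult_smult_assoc_mat[of A n m "c \<cdot>\<^sub>m B" p a] mult_smult_distrib[of A n m B p c] by (simp add: smult_smult_mat)

context level
begin

lemma dual_ZL:
  assumes "\<rho> \<in> RR"
  shows "LC X \<Longrightarrow> LC Y \<Longrightarrow> \<rho> (red 1 (X + Y)) = \<rho> (red 1 X) * \<rho> (red 1 Y)" "LC X \<Longrightarrow> \<rho> (red 1 X) \<noteq> 0" "\<rho> (red 1 0) = 1"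
proof -
  have m: "monoid.mult (lie_cent_res v E \<beta>) = monoid.mult LG" by (simp add: lie_cent_res_def)
  have i: "LC X \<Longrightarrow> intm X" for X by (rule Lie_intm[OF LC_Lie])
  show nz: "\<rho> (red 1 X) \<noteq> 0" if "LC X" for X
    using assms mem_ZL[OF i[OF that]] that by (auto simp: dual_def hom_def complex_units_def)
  show add: "\<rho> (red 1 (X + Y)) = \<rho> (red 1 X) * \<rho> (red 1 Y)" if "LC X" "LC Y" for X Y
  proof -
    have "\<rho> (red 1 X \<otimes>\<^bsub>LG\<^esub> red 1 Y) = \<rho> (red 1 X) * \<rho> (red 1 Y)"
      using assms mem_ZL[OF i[OF that(1)]] mem_ZL[OF i[OF that(2)]] that m by (auto simp: dual_def hom_def complex_units_def)
    thus ?thesis unfolding LG_mult[OF i[OF that(1)] i[OF that(2)]] .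
  qed
  show "\<rho> (red 1 0) = 1" using add[OF LC_0 LC_0] nz[OF LC_0] by simp
qed

lemma odd_lk: "odd r \<Longrightarrow> l = Suc k" by (auto simp: lup_def ldn_def elim!: oddE)

lemma K_Lie: "odd r \<Longrightarrow> intm X \<Longrightarrow> PG r (1 + pw k * X) \<Longrightarrow> Lie 1 X"
proof -
  assume o: "odd r" and X: "intm X" "PG r (1 + pw k * X)"
  have "PG (k + 1) (1 + pw k * X)" by (rule PG_mono[OF _ X(2)]) (use lk odd_lk[OF o] in auto)
  thus ?thesis using Lie_iff[of 1 k X] X(1) lk by simp
qed

text \<open>Only the residue of the parameter can be prescribed: \<open>1 + pw k * X\<close> lies in
  G at level k + 1 by \<open>Lie_iff\<close>, and lifting it to level r changes X by a multiple of
  \<open>\<pi>F\<close>.\<close>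

lemma Lie_K:
  assumes "odd r" "Lie 1 X"
  obtains Y where "intm Y" "red 1 Y = red 1 X" "PG r (1 + pw k * Y)"
proof -
  have "PG (k + 1) (1 + pw k * X)" using Lie_iff[of 1 k X] assms(2) lk by simp
  then obtain A where A: "PG r A" "red (k + 1) A = red (k + 1) (1 + pw k * X)" using PG_lift[of "k + 1" r] lk odd_lk[OF assms(1)] by auto
  have "red k A = red k (1 + pw k * X)" by (rule red_mono[OF _ A(2)]) simp
  hence "red k A = red k 1" using Lie_intm[OF assms(2)] by simp
  then obtain Y where Y: "intm Y" "A = 1 + pw k * Y" using red_eq_iff[of k A 1] by auto
  have "red 1 Y = red 1 X" using A(2) unfolding Y(2) by (simp only: red_add_left_iff red_sc_shift)
  thus ?thesis using that Y A(1) by simp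
qed

lemma \<tau>_half_fm: "Lie 1 X \<Longrightarrow> Lie 1 Y \<Longrightarrow> \<tau> (inverse (2 * \<pi>F) * tr ((X * Y - Y * X) * b)) = av (cl X) (cl Y)"
  unfolding av_eq fm_def[symmetric] half_pi by (simp only: ac_simps)

end

section \<open>The elements v_g, the cocycle, and the corrected Weil representation\<close>

locale odd_level = level v \<pi>F E \<beta> \<tau> r for v :: "'f::field \<Rightarrow> int" and \<pi>F and E :: "('n::finite, 'f) mpoly set" and \<beta> \<tau> r +
  fixes s \<rho>
  assumes odd_r: "odd r" and sec: "linear_section v E \<beta> s" and \<rho>: "\<rho> \<in> RR"
    and trivial_class: "trivial_H2_class (cent_group v E \<beta> 1) (cocycle v \<pi>F \<tau> E \<beta> s \<rho>)"
begin

lemmas \<rho>_add = dual_ZL(1)[OF \<rho>] and \<rho>_nz = dual_ZL(2)[OF \<rho>] and \<rho>_0 = dual_ZL(3)[OF \<rho>]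

definition S :: "('n, 'f set) sqmat set \<Rightarrow> ('n, 'f) sqm" where "S u = lft (s u)"

lemma S:
  assumes "u \<in> carrier V"
  shows "intm (S u)" "red 1 (S u) = s u" "Lie 1 (S u)" "cl (S u) = u"
proof -
  have s: "s u \<in> carrier LG" "Vclass v E \<beta> (s u) = u" using sec assms by (auto simp: linear_section_def)
  have xc: "s u \<in> carrier (mat_monoid (Omod v 1))" using s(1) by (auto simp: LG_simps lie_points_def mat_monoid_def)
  show i: "intm (S u)" "red 1 (S u) = s u" unfolding S_def using lft[OF xc] by auto
  show "Lie 1 (S u)" using mem_LG[OF i(1)] i(2) s(1) by simp
  show "cl (S u) = u" unfolding i(2) by (rule s(2))
qed

lemma S_mult: "u \<in> carrier V \<Longrightarrow> w \<in> carrier V \<Longrightarrow> red 1 (S (u \<otimes>\<^bsub>V\<^esub> w)) = red 1 (S u + S w)"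
proof -
  assume u: "u \<in> carrier V" and w: "w \<in> carrier V"
  have "s (u \<otimes>\<^bsub>V\<^esub> w) = madd (Omod v 1) (s u) (s w)" using sec u w by (simp add: linear_section_def)
  thus ?thesis unfolding S(2)[OF HV.m_closed[OF u w]] S(2)[OF u, symmetric] S(2)[OF w, symmetric] red_ops(2)[OF S(1)[OF u] S(1)[OF w]] .
qed

lemma S_one: "red 1 (S \<one>\<^bsub>V\<^esub>) = red 1 0"
proof -
  have "red 1 (S \<one>\<^bsub>V\<^esub> + 0) = red 1 (S \<one>\<^bsub>V\<^esub> + S \<one>\<^bsub>V\<^esub>)" using S_mult[OF HV.one_closed HV.one_closed] by simp
  thus ?thesis unfolding red_add_left_iff by simp
qed

definition ga where "ga u g = gam v E \<beta> s u g"
definition ve where "ve g = v_elem v \<pi>F \<tau> E \<beta> s \<rho> g"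

lemma ga_eq:
  assumes u: "u \<in> carrier V" and A: "CG 1 A" "CG 1 B" "red 1 (A * B) = red 1 1" "red 1 (B * A) = red 1 1"
  shows "ga u (red 1 A) = red 1 (B * S u * A - S (act u (red 1 A)))" "LC (B * S u * A - S (act u (red 1 A)))"
proof -
  note i = CG_intm[OF A(1)] CG_intm[OF A(2)] S(1)[OF u]
  have a: "act u (red 1 A) \<in> carrier V" by (rule act_closed[OF u mem_Gam[OF A(1)]])
  have inv: "inv\<^bsub>G_group v E 1\<^esub> (red 1 A) = red 1 B" by (rule G_inv[OF CG_PG[OF A(1)] CG_PG[OF A(2)] A(4)])
  have iB: "intm (B * S u * A)" using i by simp
  show "ga u (red 1 A) = red 1 (B * S u * A - S (act u (red 1 A)))"
    unfolding ga_def gam_def inv S(2)[OF u, symmetric] Ad_red[OF i(2,1) A(4,3) i(3)] S(2)[OF a, symmetric] red_ops(3)[OF iB S(1)[OF a]] ..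
  have "cl (B * S u * A) = cl (S (act u (red 1 A)))"
    unfolding S(4)[OF a] act_eq[OF S(3)[OF u] A, symmetric] S(4)[OF u] ..
  thus "LC (B * S u * A - S (act u (red 1 A)))" using cl_eq_iff[OF iB S(1)[OF a]] by simp
qed

lemma ga_mult:
  assumes u: "u \<in> carrier V" and w: "w \<in> carrier V" and g: "g \<in> carrier Gam"
  shows "\<rho> (ga (u \<otimes>\<^bsub>V\<^esub> w) g) = \<rho> (ga u g) * \<rho> (ga w g)"
proof -
  obtain A B where A: "CG 1 A" "g = red 1 A" "CG 1 B" "red 1 (A * B) = red 1 1" "red 1 (B * A) = red 1 1" by (rule Gam_cases[OF g])
  have uw: "u \<otimes>\<^bsub>V\<^esub> w \<in> carrier V" using u w by simp
  note a = act_closed[OF u g] act_closed[OF w g]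
  note i = CG_intm[OF A(1)] CG_intm[OF A(3)] S(1)[OF u] S(1)[OF w] S(1)[OF uw]
  note G = ga_eq[OF _ A(1,3-5), folded A(2)]
  have "red 1 (B * S (u \<otimes>\<^bsub>V\<^esub> w) * A - S (act (u \<otimes>\<^bsub>V\<^esub> w) g)) = red 1 (B * (S u + S w) * A - (S (act u g) + S (act w g)))"
  proof (rule red_diff_cong)
    show "red 1 (B * S (u \<otimes>\<^bsub>V\<^esub> w) * A) = red 1 (B * (S u + S w) * A)"
      by (rule conj_red[OF refl refl S_mult[OF u w]]) (use i in auto)
    show "red 1 (S (act (u \<otimes>\<^bsub>V\<^esub> w) g)) = red 1 (S (act u g) + S (act w g))" unfolding act_mult[OF u w g] by (rule S_mult[OF a])
  qed
  also have "B * (S u + S w) * A - (S (act u g) + S (act w g)) = (B * S u * A - S (act u g)) + (B * S w * A - S (act w g))"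
    by (simp add: distrib_left distrib_right)
  finally show ?thesis unfolding G(1)[OF uw] G(1)[OF u] G(1)[OF w] using \<rho>_add[OF G(2)[OF u] G(2)[OF w]] by simp
qed

text \<open>By \<open>ga_mult\<close>, u \<mapsto> \<rho>(\<gamma>(u, g)) is a character of V, hence
  of the form \<open>ev u w\<close>; the element w is unique by \<open>ev_inj\<close>, which
  resolves the description in \<open>v_elem\<close>.\<close>

lemma ve:
  assumes g: "g \<in> carrier Gam"
  shows "ve g \<in> carrier V" "\<And>u. u \<in> carrier V \<Longrightarrow> \<rho> (ga u g) = ev u (ve g)"
proof -
  obtain A B where A: "CG 1 A" "g = red 1 A" "CG 1 B" "red 1 (A * B) = red 1 1" "red 1 (B * A) = red 1 1" by (rule Gam_cases[OF g])
  have nz: "\<rho> (ga \<one>\<^bsub>V\<^esub> g) \<noteq> 0" unfolding A(2) ga_eq(1)[OF HV.one_closed A(1,3-5)] by (rule \<rho>_nz[OF ga_eq(2)[OF HV.one_closed A(1,3-5)]])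
  obtain w where w: "w \<in> carrier V" "\<And>u. u \<in> carrier V \<Longrightarrow> \<rho> (ga u g) = ev u w"
    by (rule character_ev[of "\<lambda>u. \<rho> (ga u g)"]) (use ga_mult[OF _ _ g] nz in blast)+
  have "\<exists>!w. w \<in> carrier V \<and> (\<forall>u\<in>carrier V. \<rho> (gam v E \<beta> s u g) = hat_tau \<pi>F \<tau> (sympl_form v \<beta> u w))"
  proof (rule ex1I[of _ w])
    show "w \<in> carrier V \<and> (\<forall>u\<in>carrier V. \<rho> (gam v E \<beta> s u g) = hat_tau \<pi>F \<tau> (sympl_form v \<beta> u w))"
      using w by (simp add: ga_def ev_def)
    fix w' assume w': "w' \<in> carrier V \<and> (\<forall>u\<in>carrier V. \<rho> (gam v E \<beta> s u g) = hat_tau \<pi>F \<tau> (sympl_form v \<beta> u w'))"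
    show "w' = w"
    proof (rule ev_inj)
      fix u assume u: "u \<in> carrier V"
      have "ev u w' = \<rho> (ga u g)" unfolding ev_def ga_def using w' u by simp
      thus "ev u w' = ev u w" using w(2)[OF u] by simp
    qed (use w w' in auto)
  qed
  from theI'[OF this] have "ve g \<in> carrier V \<and> (\<forall>u\<in>carrier V. \<rho> (gam v E \<beta> s u g) = hat_tau \<pi>F \<tau> (sympl_form v \<beta> u (ve g)))"
    unfolding ve_def v_elem_def .
  thus "ve g \<in> carrier V" "\<And>u. u \<in> carrier V \<Longrightarrow> \<rho> (ga u g) = ev u (ve g)" unfolding ga_def ev_def by auto
qed

text \<open>Additively \<gamma>(u, gh) = Ad(h)^-1 \<gamma>(u, g) + \<gamma>(u \<sigma>_g, h), and
  Ad(h) acts trivially on the centralizer, in which \<gamma> takes its values.\<close>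

lemma ga_comp:
  assumes u: "u \<in> carrier V" and g: "g \<in> carrier Gam" and h: "h \<in> carrier Gam"
  shows "\<rho> (ga u (g \<otimes>\<^bsub>Gam\<^esub> h)) = \<rho> (ga u g) * \<rho> (ga (act u g) h)"
proof -
  obtain A B where A: "CG 1 A" "g = red 1 A" "CG 1 B" "red 1 (A * B) = red 1 1" "red 1 (B * A) = red 1 1" by (rule Gam_cases[OF g])
  obtain A' B' where A': "CG 1 A'" "h = red 1 A'" "CG 1 B'" "red 1 (A' * B') = red 1 1" "red 1 (B' * A') = red 1 1" by (rule Gam_cases[OF h])
  note i = CG_intm[OF A(1)] CG_intm[OF A(3)] CG_intm[OF A'(1)] CG_intm[OF A'(3)] S(1)[OF u]
  have 1: "red 1 (A * A' * (B' * B)) = red 1 1"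
  proof -
    have "red 1 (A * (A' * B') * B) = red 1 (A * 1 * B)" by (rule red_mult_cong[OF red_mult_cong[OF refl A'(4)] refl]) (use i in auto)
    thus ?thesis using A(4) by (simp add: mult.assoc)
  qed
  have 2: "red 1 (B' * B * (A * A')) = red 1 1"
  proof -
    have "red 1 (B' * (B * A) * A') = red 1 (B' * 1 * A')" by (rule red_mult_cong[OF red_mult_cong[OF refl A(5)] refl]) (use i in auto)
    thus ?thesis using A'(5) by (simp add: mult.assoc)
  qed
  have gh: "g \<otimes>\<^bsub>Gam\<^esub> h = red 1 (A * A')" unfolding A(2) A'(2) by (rule Gam_mult[OF i(1,3)])
  note a = act_closed[OF u g]
  note Gg = ga_eq[OF u A(1,3-5), folded A(2)] and Gh = ga_eq[OF a A'(1,3-5), folded A'(2)]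
  note Ggh = ga_eq[OF u CG_mult[OF A(1) A'(1)] CG_mult[OF A'(3) A(3)] 1 2, folded gh]
  define P Q where "P = B * S u * A - S (act u g)" and "Q = B' * S (act u g) * A' - S (act (act u g) h)"
  have P: "LC P" and Q: "LC Q" using Gg(2) Gh(2) by (simp_all add: P_def Q_def)
  have e: "red 1 (B' * P * A') = red 1 P" by (rule CG_fixes_LC[OF A'(1) CG_PG[OF A'(3)] A'(5) P])
  have P': "LC (B' * P * A')" using LC_cong[OF e[symmetric] P] .
  have "B' * B * S u * (A * A') - S (act u (g \<otimes>\<^bsub>Gam\<^esub> h)) = B' * P * A' + Q"
    unfolding act_act[OF u g h] P_def Q_def by (simp add: left_diff_distrib right_diff_distrib mult.assoc)
  hence "\<rho> (ga u (g \<otimes>\<^bsub>Gam\<^esub> h)) = \<rho> (red 1 (B' * P * A' + Q))" using Ggh(1) by simp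
  also have "\<dots> = \<rho> (red 1 P) * \<rho> (red 1 Q)" unfolding \<rho>_add[OF P' Q] e ..
  finally show ?thesis unfolding Gg(1) Gh(1) P_def Q_def .
qed

text \<open>This is \<open>ga_comp\<close> read through the pairing, whose invariance moves
  \<sigma>_g from the first argument to its inverse on the second. So g \<mapsto> v_g is a 1-cocycle
  with values in V.\<close>

lemma ve_mult:
  assumes g: "g \<in> carrier Gam" and h: "h \<in> carrier Gam"
  shows "ve (g \<otimes>\<^bsub>Gam\<^esub> h) = ve g \<otimes>\<^bsub>V\<^esub> act (ve h) (inv\<^bsub>Gam\<^esub> g)"
proof -
  interpret Gm: group Gam by (rule group_Gam)
  note gi = Gm.inv_closed[OF g]
  note a = act_closed[OF ve(1)[OF h] gi]
  show ?thesis
  proof (rule ev_inj)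
    fix u assume u: "u \<in> carrier V"
    note au = act_closed[OF u g]
    have ae: "ev (act x g) (act y g) = ev x y" if "x \<in> carrier V" "y \<in> carrier V" for x y
      using that act_av[OF that g] ev_av act_closed[OF _ g] by simp
    have bk: "act (act (ve h) (inv\<^bsub>Gam\<^esub> g)) g = ve h"
      using act_act[OF ve(1)[OF h] gi g] act_one[OF ve(1)[OF h]] g by simp
    have "ev u (ve (g \<otimes>\<^bsub>Gam\<^esub> h)) = ev u (ve g) * ev (act u g) (ve h)"
      using ga_comp[OF u g h] ve(2)[OF Gm.m_closed[OF g h] u] ve(2)[OF g u] ve(2)[OF h au] by simp
    also have "ev (act u g) (ve h) = ev u (act (ve h) (inv\<^bsub>Gam\<^esub> g))" using ae[OF u a] bk by simp
    also have "ev u (ve g) * \<dots> = ev u (ve g \<otimes>\<^bsub>V\<^esub> act (ve h) (inv\<^bsub>Gam\<^esub> g))"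
      using ev_av HV.a_mult_right[OF u ve(1)[OF g] a] u ve(1)[OF g] a by simp
    finally show "ev u (ve (g \<otimes>\<^bsub>Gam\<^esub> h)) = ev u (ve g \<otimes>\<^bsub>V\<^esub> act (ve h) (inv\<^bsub>Gam\<^esub> g))" .
  qed (use ve(1)[OF Gm.m_closed[OF g h]] ve(1)[OF g] a in auto)
qed

text \<open>In v_gh = v_g + v_h \<sigma>_g^-1 the first summand pairs trivially with v_g. What is
  left is the multiplier that arises from the product of W(v_g) and W(v_h \<sigma>_g^-1).\<close>

lemma cocycle_eq:
  assumes g: "g \<in> carrier Gam" and h: "h \<in> carrier Gam"
  shows "cocycle v \<pi>F \<tau> E \<beta> s \<rho> g h = av (ve g) (act (ve h) (inv\<^bsub>Gam\<^esub> g))"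
proof -
  interpret Gm: group Gam by (rule group_Gam)
  note a = act_closed[OF ve(1)[OF h] Gm.inv_closed[OF g]]
  have "cocycle v \<pi>F \<tau> E \<beta> s \<rho> g h = av (ve g) (ve (g \<otimes>\<^bsub>Gam\<^esub> h))" by (simp only: cocycle_def av_def ve_def)
  also have "\<dots> = av (ve g) (act (ve h) (inv\<^bsub>Gam\<^esub> g))"
    unfolding ve_mult[OF g h] HV.a_mult_right[OF ve(1)[OF g] ve(1)[OF g] a] HV.a_alt[OF ve(1)[OF g]] by simp
  finally show ?thesis .
qed

lemma ve_one: "ve \<one>\<^bsub>Gam\<^esub> = \<one>\<^bsub>V\<^esub>"
proof -
  interpret Gm: group Gam by (rule group_Gam)
  have "ve \<one>\<^bsub>Gam\<^esub> \<otimes>\<^bsub>V\<^esub> \<one>\<^bsub>V\<^esub> = ve \<one>\<^bsub>Gam\<^esub> \<otimes>\<^bsub>V\<^esub> ve \<one>\<^bsub>Gam\<^esub>"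
    using ve_mult[OF Gm.one_closed Gm.one_closed] ve(1)[OF Gm.one_closed] act_one by simp
  thus ?thesis using ve(1)[OF Gm.one_closed]  HV.l_cancel_one[of "ve \<one>\<^bsub>Gam\<^esub>" "ve \<one>\<^bsub>Gam\<^esub>"] by simp
qed

text \<open>Moving \<open>W u\<close> past W(v_g) costs the square of \<open>av u (ve g)\<close>,
  that is \<open>ev u (ve g)\<close> = \<rho>(\<gamma>(u, g)): the factor by which conjugation by g
  fails to respect the section. The function \<open>f\<close> whose coboundary is the cocycle is
  divided out of W(v_g) \<omega>(g).\<close>

lemma weil_extension:
  obtains d W U where "heisenberg_rep V av d W" "rep Gam d U"
    "\<And>u g. u \<in> carrier V \<Longrightarrow> g \<in> carrier Gam \<Longrightarrow> W u * U g = ev u (ve g) \<cdot>\<^sub>m (U g * W (act u g))"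
proof -
  interpret Gm: group Gam by (rule group_Gam)
  obtain d W where W: "HV.proj d W" "irr d (carrier V) W" by (rule HV.heisenberg_rep_exists)
  interpret HR: heisenberg_rep V av d W by (intro heisenberg_rep.intro heisenberg_rep_axioms.intro HV.heisenberg_axioms W)
  obtain \<omega> where \<omega>: "rep Gam d \<omega>" "\<And>x g. x \<in> carrier V \<Longrightarrow> g \<in> carrier Gam \<Longrightarrow> W x * \<omega> g = \<omega> g * W (act x g)"
    by (rule HR.weil_representation[of Gam act, OF group_Gam act_closed act_mult act_av act_act act_one]) blast+
  have \<omega>c: "g \<in> carrier Gam \<Longrightarrow> \<omega> g \<in> carrier_mat d d" for g using \<omega>(1) by (simp add: rep_def)
  have \<omega>m: "g \<in> carrier Gam \<Longrightarrow> h \<in> carrier Gam \<Longrightarrow> \<omega> (g \<otimes>\<^bsub>Gam\<^esub> h) = \<omega> g * \<omega> h" for g h using \<omega>(1) by (simp add: rep_def)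
  have \<omega>1: "\<omega> \<one>\<^bsub>Gam\<^esub> = 1\<^sub>m d" using \<omega>(1) by (simp add: rep_def)
  obtain f where f: "\<And>g. g \<in> carrier Gam \<Longrightarrow> f g \<noteq> 0"
    "\<And>g h. g \<in> carrier Gam \<Longrightarrow> h \<in> carrier Gam \<Longrightarrow> cocycle v \<pi>F \<tau> E \<beta> s \<rho> g h = f h * inverse (f (g \<otimes>\<^bsub>Gam\<^esub> h)) * f g"
    using trivial_class unfolding trivial_H2_class_def by blast
  define U0 where "U0 g = W (ve g) * \<omega> g" for g
  define U where "U g = inverse (f g) \<cdot>\<^sub>m U0 g" for g
  have U0c: "U0 g \<in> carrier_mat d d" if "g \<in> carrier Gam" for g unfolding U0_def using HR.W_carrier[OF ve(1)[OF that]] \<omega>c[OF that] by simp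
  have U0m: "U0 g * U0 h = (f h * inverse (f (g \<otimes>\<^bsub>Gam\<^esub> h)) * f g) \<cdot>\<^sub>m U0 (g \<otimes>\<^bsub>Gam\<^esub> h)" if g: "g \<in> carrier Gam" and h: "h \<in> carrier Gam" for g h
  proof -
    note gi = Gm.inv_closed[OF g]
    let ?x = "act (ve h) (inv\<^bsub>Gam\<^esub> g)"
    have x: "?x \<in> carrier V" by (rule act_closed[OF ve(1)[OF h] gi])
    have bk: "act ?x g = ve h" using act_act[OF ve(1)[OF h] gi g] act_one[OF ve(1)[OF h]] g by simp
    note c = HR.W_carrier[OF ve(1)[OF g]] HR.W_carrier[OF ve(1)[OF h]] HR.W_carrier[OF x] \<omega>c[OF g] \<omega>c[OF h]
    have "U0 g * U0 h = W (ve g) * (\<omega> g * (W (ve h) * \<omega> h))" unfolding U0_def using c by (simp add: assoc_mult_mat[of _ d d _ d _ d])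
    also have "\<omega> g * (W (ve h) * \<omega> h) = \<omega> g * W (ve h) * \<omega> h" using c by (simp add: assoc_mult_mat[of _ d d _ d _ d])
    also have "\<omega> g * W (ve h) = W ?x * \<omega> g" using \<omega>(2)[OF x g] bk by simp
    also have "W (ve g) * (W ?x * \<omega> g * \<omega> h) = W (ve g) * W ?x * (\<omega> g * \<omega> h)" using c by (simp add: assoc_mult_mat[of _ d d _ d _ d])
    also have "\<dots> = (av (ve g) ?x \<cdot>\<^sub>m W (ve g \<otimes>\<^bsub>V\<^esub> ?x)) * \<omega> (g \<otimes>\<^bsub>Gam\<^esub> h)" unfolding HR.W_mult[OF ve(1)[OF g] x] \<omega>m[OF g h] ..
    also have "\<dots> = av (ve g) ?x \<cdot>\<^sub>m U0 (g \<otimes>\<^bsub>Gam\<^esub> h)"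
      unfolding ve_mult[OF g h, symmetric] U0_def
      by (rule mult_smult_assoc_mat[OF HR.W_carrier[OF ve(1)[OF Gm.m_closed[OF g h]]] \<omega>c[OF Gm.m_closed[OF g h]]])
    finally show ?thesis unfolding cocycle_eq[OF g h, symmetric] f(2)[OF g h] .
  qed
  have "rep Gam d U" unfolding rep_def
  proof (intro conjI ballI)
    show "U g \<in> carrier_mat d d" if "g \<in> carrier Gam" for g unfolding U_def using U0c[OF that] by simp
    \<comment> \<open>The cocycle is 1 at the pair of identities because \<open>av\<close> is
      alternating, which normalises \<open>f\<close>.\<close>
    have "f \<one>\<^bsub>Gam\<^esub> = 1"
    proof -
      have "cocycle v \<pi>F \<tau> E \<beta> s \<rho> \<one>\<^bsub>Gam\<^esub> \<one>\<^bsub>Gam\<^esub> = 1"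
        unfolding cocycle_eq[OF Gm.one_closed Gm.one_closed] Gm.inv_one act_one[OF ve(1)[OF Gm.one_closed]] by (rule HV.a_alt[OF ve(1)[OF Gm.one_closed]])
      moreover have "cocycle v \<pi>F \<tau> E \<beta> s \<rho> \<one>\<^bsub>Gam\<^esub> \<one>\<^bsub>Gam\<^esub> = f \<one>\<^bsub>Gam\<^esub> * inverse (f \<one>\<^bsub>Gam\<^esub>) * f \<one>\<^bsub>Gam\<^esub>"
        using f(2)[OF Gm.one_closed Gm.one_closed] by (simp only: Gm.l_one[OF Gm.one_closed])
      ultimately show ?thesis using f(1)[OF Gm.one_closed] by simp
    qed
    thus "U \<one>\<^bsub>Gam\<^esub> = 1\<^sub>m d" unfolding U_def U0_def ve_one \<omega>1 HR.W_one by simp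
    fix g h assume g: "g \<in> carrier Gam" and h: "h \<in> carrier Gam"
    have "U g * U h = (inverse (f g) * inverse (f h)) \<cdot>\<^sub>m (U0 g * U0 h)" unfolding U_def by (rule smult_mult_smult[OF U0c[OF g] U0c[OF h]])
    also have "\<dots> = (inverse (f g) * inverse (f h) * (f h * inverse (f (g \<otimes>\<^bsub>Gam\<^esub> h)) * f g)) \<cdot>\<^sub>m U0 (g \<otimes>\<^bsub>Gam\<^esub> h)"
      unfolding U0m[OF g h] smult_smult_mat ..
    also have "inverse (f g) * inverse (f h) * (f h * inverse (f (g \<otimes>\<^bsub>Gam\<^esub> h)) * f g) = inverse (f (g \<otimes>\<^bsub>Gam\<^esub> h))"
      using f(1)[OF g] f(1)[OF h] by (simp add: field_simps)
    finally show "U (g \<otimes>\<^bsub>Gam\<^esub> h) = U g * U h" unfolding U_def by simp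
  qed
  moreover have "W u * U g = ev u (ve g) \<cdot>\<^sub>m (U g * W (act u g))" if u: "u \<in> carrier V" and g: "g \<in> carrier Gam" for u g
  proof -
    note vg = ve(1)[OF g] and a = act_closed[OF u g]
    note c = HR.W_carrier[OF vg] HR.W_carrier[OF u] HR.W_carrier[OF a] \<omega>c[OF g]
    have "W u * U0 g = W u * W (ve g) * \<omega> g" unfolding U0_def using c by (simp add: assoc_mult_mat[of _ d d _ d _ d])
    also have "W u * W (ve g) = (av u (ve g) * av u (ve g)) \<cdot>\<^sub>m (W (ve g) * W u)"
      unfolding HR.W_mult[OF u vg] HR.W_mult[OF vg u] smult_smult_mat HV.m_comm[OF u vg] using HV.a_skew[OF u vg] by (simp add: mult.assoc)
    also have "\<dots> * \<omega> g = (av u (ve g) * av u (ve g)) \<cdot>\<^sub>m (W (ve g) * W u * \<omega> g)" using c by (intro mult_smult_assoc_mat[of _ d d _ d]) auto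
    also have "W (ve g) * W u * \<omega> g = W (ve g) * (W u * \<omega> g)" using c by (simp add: assoc_mult_mat[of _ d d _ d _ d])
    also have "\<dots> = U0 g * W (act u g)" unfolding \<omega>(2)[OF u g] U0_def using c by (simp add: assoc_mult_mat[of _ d d _ d _ d])
    finally have e: "W u * U0 g = ev u (ve g) \<cdot>\<^sub>m (U0 g * W (act u g))" unfolding ev_av[OF u vg] .
    have "W u * U g = inverse (f g) \<cdot>\<^sub>m (W u * U0 g)" unfolding U_def by (rule mult_smult_distrib[OF c(2) U0c[OF g]])
    also have "\<dots> = ev u (ve g) \<cdot>\<^sub>m (inverse (f g) \<cdot>\<^sub>m (U0 g * W (act u g)))" unfolding e smult_smult_mat by (simp add: mult.commute)
    also have "inverse (f g) \<cdot>\<^sub>m (U0 g * W (act u g)) = U g * W (act u g)" unfolding U_def by (rule mult_smult_assoc_mat[OF U0c[OF g] c(3), symmetric])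
    finally show ?thesis .
  qed
  ultimately show ?thesis using that[of d W U] HR.heisenberg_rep_axioms by blast
qed

end

section \<open>Parameters of the elements of K and Z for odd level\<close>

context level
begin

lemma red_l: "odd r \<Longrightarrow> red r (1 + pw k * X) = red r (1 + pw k * Y) \<longleftrightarrow> red l X = red l Y"
proof -
  have "k + l = r" using lk(1) by simp
  from red_sc_shift[of k l X Y, unfolded this] show ?thesis unfolding red_add_left_iff .
qed

lemma mem_Z:
  assumes o: "odd r" and X: "intm X"
  shows "red r (1 + pw k * X) \<in> ZZ \<longleftrightarrow> PG r (1 + pw k * X) \<and> LC X"
proof -
  have lk1: "l - 1 = k" "r = k + l" using odd_lk[OF o] lk by simp_all
  have i: "intm (1 + pw k * X)" using X by simp
  have K: "red r (1 + pw k * X) \<in> KK \<longleftrightarrow> PG r (1 + pw k * X)" using mem_K[OF i lk(5)] X by simp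
  have L: "mmap (omod v 1) Y = red 1 (Sqm Y)" "mmap (omod v r) (one_plus (\<pi>F ^ k) Y) = red r (1 + pw k * Sqm Y)" for Y
    by (simp_all add: red_def one_plus_red)
  have I: "(\<forall>i j. Y i j \<in> carrier (int_ring v)) \<longleftrightarrow> intm (Sqm Y)" for Y :: "('n, 'f) sqmat"
    by (simp add: intm_def int_ring_simps)
  have Zs: "ZZ = {A \<in> carrier (K_group v E (l - 1) r).
    \<exists>X. (\<forall>i j. X i j \<in> carrier (int_ring v)) \<and> A = mmap (omod v r) (one_plus (\<pi>F ^ (l - 1)) X) \<and> mmap (omod v 1) X \<in> ZL}"
    by (simp add: Z_group_def)
  have Zc: "x \<in> ZZ \<longleftrightarrow> x \<in> KK \<and>
      (\<exists>Y. intm (Sqm Y) \<and> x = red r (1 + pw k * Sqm Y) \<and> red 1 (Sqm Y) \<in> ZL)" for x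
    unfolding Zs lk1(1) I L mem_Collect_eq ..
  show ?thesis
  proof
    assume z: "red r (1 + pw k * X) \<in> ZZ"
    note z = z[unfolded Zc]
    obtain Y where Y: "intm (Sqm Y) \<and> red r (1 + pw k * X) = red r (1 + pw k * Sqm Y) \<and> red 1 (Sqm Y) \<in> ZL"
      by (rule exE[OF conjunct2[OF z]])
    note zK = conjunct1[OF z] and Y = conjunct1[OF Y] conjunct1[OF conjunct2[OF Y]] conjunct2[OF conjunct2[OF Y]]
    have "red l X = red l (Sqm Y)" using Y(2) red_l[OF o] by (simp only:)
    hence "red 1 X = red 1 (Sqm Y)" by (rule red_mono[rotated]) (use lk in simp)
    hence "LC X" using Y(3) mem_ZL[OF X] by (simp only:)
    thus "PG r (1 + pw k * X) \<and> LC X" using K zK by (simp only:)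
  next
    assume "PG r (1 + pw k * X) \<and> LC X"
    thus "red r (1 + pw k * X) \<in> ZZ"
      unfolding Zc using K mem_ZL[OF X] X by (intro conjI exI[of _ "ent X"]) (simp_all only: Sqm_ent)
  qed
qed

lemma Z_sub_K: "odd r \<Longrightarrow> ZZ \<subseteq> KK"
  unfolding Z_group_def using odd_lk by simp

lemma Z_form:
  assumes o: "odd r" and x: "x \<in> ZZ"
  obtains X where "intm X" "x = red r (1 + pw k * X)" "PG r (1 + pw k * X)" "LC X"
proof -
  have "x \<in> KK" using Z_sub_K[OF o] x by blast
  then obtain X where X: "intm X" "x = red r (1 + pw k * X)" "PG r (1 + pw k * X)" by (rule K_form) (use lk in simp)
  have "LC X" using x mem_Z[OF o X(1)] X(2) by simp
  thus ?thesis using that X by blast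
qed

lemma K_mult: "odd r \<Longrightarrow> intm X \<Longrightarrow> intm Y \<Longrightarrow>
  red r (1 + pw k * X) \<otimes>\<^bsub>GG\<^esub> red r (1 + pw k * Y) = red r (1 + pw k * (X + Y + pw k * (X * Y)))"
  unfolding one_pw_mult[symmetric] by (rule G_mult) auto

end

section \<open>The explicit model of \<pi>_{\<beta>,\<rho>} and of its extension to C\<close>

context odd_level
begin

text \<open>The section splits the residue of X into that of \<open>S (cl X)\<close> and a part in
  the centralizer. The latter acts through \<rho>, the class through the Heisenberg operator, and
  \<open>\<chi>0\<close> supplies the quadratic exponential.\<close>

definition Pm where "Pm W X = (\<chi>0 X * \<rho> (red 1 (X - S (cl X)))) \<cdot>\<^sub>m W (cl X)"

definition pim where "pim W x = Pm W (SOME X. intm X \<and> x = red r (1 + pw k * X))"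

lemma LC_S: "Lie 1 X \<Longrightarrow> LC (X - S (cl X))"
proof -
  assume X: "Lie 1 X"
  have c: "cl X \<in> carrier V" by (rule cl_V[OF X])
  have "cl X = cl (S (cl X))" by (simp only: S(4)[OF c])
  thus ?thesis using cl_eq_iff[OF Lie_intm[OF X] S(1)[OF c]] by blast
qed

text \<open>The chosen parameter is determined modulo \<pp>^l, and every factor of \<open>Pm\<close>
  depends on that class only.\<close>

lemma pim_eq: "intm X \<Longrightarrow> pim W (red r (1 + pw k * X)) = Pm W X"
proof -
  assume X: "intm X"
  define Y where "Y = (SOME Y. intm Y \<and> red r (1 + pw k * X) = red r (1 + pw k * Y))"
  have Y: "intm Y \<and> red r (1 + pw k * X) = red r (1 + pw k * Y)"
    unfolding Y_def by (rule someI[of "\<lambda>Y. intm Y \<and> red r (1 + pw k * X) = red r (1 + pw k * Y)" X]) (use X in simp)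
  have l: "red l X = red l Y" using Y red_l[OF odd_r] by blast
  have 1: "red 1 X = red 1 Y" by (rule red_mono[OF _ l]) (use lk in simp)
  have "red 1 (Y - S (cl Y)) = red 1 (X - S (cl X))" by (rule red_diff_cong) (simp_all only: 1)
  moreover have "\<chi>0 Y = \<chi>0 X" using \<chi>0_cong[OF l] X Y by simp
  ultimately have "Pm W Y = Pm W X" unfolding Pm_def using 1 by simp
  thus ?thesis unfolding pim_def Y_def .
qed

theorem pi_U_data_exists: "\<exists>\<pi> U. pi_U_data v \<pi>F \<tau> E r \<beta> \<rho> \<pi> U"
proof -
  interpret Gr: group "GG" by (rule group_G)
  interpret Gm: group Gam by (rule group_Gam)
  obtain d W U where HR: "heisenberg_rep V av d W" and U: "rep Gam d U"
    and WU: "\<And>u g. u \<in> carrier V \<Longrightarrow> g \<in> carrier Gam \<Longrightarrow> W u * U g = ev u (ve g) \<cdot>\<^sub>m (U g * W (act u g))"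
    by (rule weil_extension) blast
  interpret HR: heisenberg_rep V av d W by (rule HR)
  have Uc: "g \<in> carrier Gam \<Longrightarrow> U g \<in> carrier_mat d d" for g using U by (simp add: rep_def)
  have Um: "g \<in> carrier Gam \<Longrightarrow> h \<in> carrier Gam \<Longrightarrow> U (g \<otimes>\<^bsub>Gam\<^esub> h) = U g * U h" for g h using U by (simp add: rep_def)
  have U1: "U (red 1 1) = 1\<^sub>m d" using U by (simp add: rep_def Gam_simps)
  \<comment> \<open>C acts through its reduction modulo \<pp>, which makes \<open>U'\<close> trivial
    on the intersection of C and K.\<close>
  define U' where "U' g = U (mred v 1 g)" for g
  have Pc: "Pm W X \<in> carrier_mat d d" if "Lie 1 X" for X unfolding Pm_def using HR.W_carrier[OF cl_V[OF that]] by simp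
  have K: "\<exists>X. intm X \<and> x = red r (1 + pw k * X) \<and> PG r (1 + pw k * X) \<and> Lie 1 X" if x: "x \<in> KK" for x
  proof -
    obtain X where X: "intm X" "x = red r (1 + pw k * X)" "PG r (1 + pw k * X)" by (rule K_form[OF x lk(5)])
    thus ?thesis using K_Lie[OF odd_r] by blast
  qed
  have PZ: "Pm W X = (\<chi>0 X * \<rho> (red 1 X)) \<cdot>\<^sub>m 1\<^sub>m d" if X: "LC X" for X
  proof -
    have "cl X = cl 0" using cl_eq_iff[of X 0] Lie_intm[OF LC_Lie[OF X]] X by simp
    hence c: "cl X = \<one>\<^bsub>V\<^esub>" by (simp only: V_one)
    have "red 1 (X - S \<one>\<^bsub>V\<^esub>) = red 1 (X - 0)" by (rule red_diff_cong[OF refl S_one])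
    thus ?thesis unfolding Pm_def c by simp
  qed
  \<comment> \<open>The defect of \<open>\<chi>0\<close> found in \<open>\<chi>0_mult\<close> is
    exactly the multiplier \<open>av\<close> of W, so a linear representation results.\<close>
  have Pmult: "Pm W (X + Y + pw k * (X * Y)) = Pm W X * Pm W Y" if X: "Lie 1 X" and Y: "Lie 1 Y" for X Y
  proof -
    note i = Lie_intm[OF X] Lie_intm[OF Y]
    note c = cl_V[OF X] cl_V[OF Y]
    let ?Q = "X + Y + pw k * (X * Y)"
    have k1: "red 1 ?Q = red 1 (X + Y)"
      by (rule red_mono[of 1 k]) (use lk i in auto)
    have XY: "Lie 1 (X + Y)" by (rule Lie_add[OF _ X Y]) simp
    have cQ: "cl ?Q = cl X \<otimes>\<^bsub>V\<^esub> cl Y" unfolding cl_mult[OF X Y] k1 ..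
    have "red 1 (?Q - S (cl ?Q)) = red 1 (X + Y - (S (cl X) + S (cl Y)))" unfolding cQ by (rule red_diff_cong[OF k1 S_mult[OF c]])
    also have "X + Y - (S (cl X) + S (cl Y)) = (X - S (cl X)) + (Y - S (cl Y))" by simp
    finally have r: "\<rho> (red 1 (?Q - S (cl ?Q))) = \<rho> (red 1 (X - S (cl X))) * \<rho> (red 1 (Y - S (cl Y)))"
      using \<rho>_add[OF LC_S[OF X] LC_S[OF Y]] by simp
    have "Pm W X * Pm W Y = (\<chi>0 X * \<rho> (red 1 (X - S (cl X))) * (\<chi>0 Y * \<rho> (red 1 (Y - S (cl Y))))) \<cdot>\<^sub>m (W (cl X) * W (cl Y))"
      unfolding Pm_def by (rule smult_mult_smult[OF HR.W_carrier[OF c(1)] HR.W_carrier[OF c(2)]])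
    also have "\<dots> = (\<chi>0 X * \<rho> (red 1 (X - S (cl X))) * (\<chi>0 Y * \<rho> (red 1 (Y - S (cl Y)))) * av (cl X) (cl Y)) \<cdot>\<^sub>m W (cl ?Q)"
      unfolding HR.W_mult[OF c] smult_smult_mat cQ ..
    also have "\<dots> = Pm W ?Q" unfolding Pm_def r \<chi>0_mult[OF i odd_r] \<tau>_half_fm[OF X Y] by (simp only: ac_simps)
    finally show ?thesis ..
  qed
  have repK: "rep (GG\<lparr>carrier := KK\<rparr>) d (pim W)"
    unfolding rep_subgroup_iff
  proof (intro conjI ballI)
    fix x assume x: "x \<in> KK"
    obtain X where X: "intm X" "x = red r (1 + pw k * X)" "PG r (1 + pw k * X)" "Lie 1 X" using K[OF x] by blast
    show "pim W x \<in> carrier_mat d d" unfolding X(2) pim_eq[OF X(1)] by (rule Pc[OF X(4)])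
    fix y assume y: "y \<in> KK"
    obtain Y where Y: "intm Y" "y = red r (1 + pw k * Y)" "PG r (1 + pw k * Y)" "Lie 1 Y" using K[OF y] by blast
    have iQ: "intm (X + Y + pw k * (X * Y))" using X Y by simp
    show "pim W (x \<otimes>\<^bsub>GG\<^esub> y) = pim W x * pim W y"
      unfolding X(2) Y(2) K_mult[OF odd_r X(1) Y(1)] pim_eq[OF X(1)] pim_eq[OF Y(1)] pim_eq[OF iQ] by (rule Pmult[OF X(4) Y(4)])
  next
    have "pim W (red r (1 + pw k * 0)) = Pm W 0" by (rule pim_eq) simp
    thus "pim W \<one>\<^bsub>GG\<^esub> = 1\<^sub>m d" using PZ[OF LC_0] \<rho>_0 by (simp add: G_simps)
  qed
  \<comment> \<open>Up to nonzero scalars the operators of K are all the \<open>W u\<close>, since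
    by \<open>Lie_K\<close> every class of V contains the residue of the parameter of an element of
    K.\<close>
  have irrK: "irr d KK (pim W)"
    unfolding irr_def
  proof (intro conjI allI impI ballI)
    show "0 < d" by (rule HR.d_pos)
    show "pim W x \<in> carrier_mat d d" if "x \<in> KK" for x using repK that by (simp add: rep_subgroup_iff)
    fix T assume T: "VectorSpace.subspace class_ring T (module_vec TYPE(complex) d) \<and> (\<forall>x\<in>KK. \<forall>w\<in>T. pim W x *\<^sub>v w \<in> T)"
    have Ts: "T \<subseteq> carrier_vec d" "0\<^sub>v d \<in> T" "\<And>v w. v \<in> T \<Longrightarrow> w \<in> T \<Longrightarrow> v + w \<in> T" "\<And>c v. v \<in> T \<Longrightarrow> c \<cdot>\<^sub>v v \<in> T"
      using T unfolding subspace_module_vec_iff by auto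
    have "W u *\<^sub>v w \<in> T" if u: "u \<in> carrier V" and w: "w \<in> T" for u w
    proof -
      obtain X0 where X0: "Lie 1 X0" "u = cl X0" by (rule V_cases[OF u])
      obtain X where X: "intm X" "red 1 X = red 1 X0" "PG r (1 + pw k * X)" by (rule Lie_K[OF odd_r X0(1)])
      have LX: "Lie 1 X" by (rule K_Lie[OF odd_r X(1,3)])
      have uX: "u = cl X" unfolding X0(2) X(2) ..
      define c where "c = \<chi>0 X * \<rho> (red 1 (X - S (cl X)))"
      have c0: "c \<noteq> 0" unfolding c_def using \<rho>_nz[OF LC_S[OF LX]] by simp
      have wc: "w \<in> carrier_vec d" using Ts(1) w by blast
      have xK: "red r (1 + pw k * X) \<in> KK" using mem_K[of "1 + pw k * X" k] X lk by simp
      have "pim W (red r (1 + pw k * X)) *\<^sub>v w \<in> T" using T xK w by blast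
      hence "c \<cdot>\<^sub>v (W u *\<^sub>v w) \<in> T"
        unfolding pim_eq[OF X(1)] Pm_def uX[symmetric] c_def[folded uX, symmetric] smult_mat_mult_vec[OF HR.W_carrier[OF u] wc] .
      hence "inverse c \<cdot>\<^sub>v (c \<cdot>\<^sub>v (W u *\<^sub>v w)) \<in> T" by (rule Ts(4))
      thus ?thesis using c0 by (simp add: smult_smult_assoc)
    qed
    thus "T = {0\<^sub>v d} \<or> T = carrier_vec d" using irrD[OF HR.W_irr Ts] by blast
  qed
  have chi: "contains_char d (pim W) (Z_group v \<pi>F E r \<beta>) (\<psi>\<rho> \<rho>)"
    unfolding contains_char_def
  proof (intro bexI[of _ "unit_vec d 0"] conjI ballI)
    show "unit_vec d 0 \<noteq> (0\<^sub>v d :: complex vec)" using HR.d_pos by (metis index_unit_vec(1) index_zero_vec(1) zero_neq_one)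
    fix x assume x: "x \<in> ZZ"
    obtain X where X: "intm X" "x = red r (1 + pw k * X)" "PG r (1 + pw k * X)" "LC X" by (rule Z_form[OF odd_r x])
    have u: "unit_vec d 0 \<in> carrier_vec d" by simp
    show "pim W x *\<^sub>v unit_vec d 0 = \<psi>\<rho> \<rho> x \<cdot>\<^sub>v unit_vec d 0"
      unfolding X(2) pim_eq[OF X(1)] PZ[OF X(4)] psi_rho_eq[OF X(1) odd_r] smult_mat_mult_vec[OF one_carrier_mat u] by simp
  qed simp
  have C: "\<exists>A B. CG r A \<and> CG r B \<and> g = red r A \<and> inv\<^bsub>GG\<^esub> g = red r B \<and> red r (B * A) = red r 1 \<and> red r (A * B) = red r 1"
    if g: "g \<in> CC" for g
  proof -
    obtain A where A: "CG r A" "g = red r A" using g unfolding C_eq by blast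
    obtain B where B: "PG r B" "red r (A * B) = red r 1" "red r (B * A) = red r 1" "inv\<^bsub>GG\<^esub> (red r A) = red r B" by (rule G_inv_cases[OF CG_PG[OF A(1)]])
    thus ?thesis using A CG_inv[OF A(1) B(1-3)] by auto
  qed
  have r1: "1 \<le> r" using r2 by simp
  have CU: "U' (red r A) = U (red 1 A)" for A unfolding U'_def mred_red[OF r1] ..
  have repC: "rep (cent_group v E \<beta> r) d U'"
    unfolding cent_group_def rep_subgroup_iff
  proof (intro conjI ballI)
    fix x assume "x \<in> cent_points E \<beta> (Omod v r) (omod v r)"
    hence "x \<in> CC" by (simp add: Gam_simps)
    then obtain A where A: "CG r A" "x = red r A" unfolding C_eq by blast
    have A1: "CG 1 A" by (rule CG_mono[OF r1 A(1)])
    show "U' x \<in> carrier_mat d d" unfolding A(2) CU by (rule Uc[OF mem_Gam[OF A1]])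
    fix y assume "y \<in> cent_points E \<beta> (Omod v r) (omod v r)"
    hence "y \<in> CC" by (simp add: Gam_simps)
    then obtain B where B: "CG r B" "y = red r B" unfolding C_eq by blast
    have B1: "CG 1 B" by (rule CG_mono[OF r1 B(1)])
    show "U' (x \<otimes>\<^bsub>GG\<^esub> y) = U' x * U' y"
      unfolding A(2) B(2) G_mult[OF CG_intm[OF A(1)] CG_intm[OF B(1)]] CU Um[OF mem_Gam[OF A1] mem_Gam[OF B1], symmetric] Gam_mult[OF CG_intm[OF A(1)] CG_intm[OF B(1)]] ..
  next
    show "U' \<one>\<^bsub>GG\<^esub> = 1\<^sub>m d" unfolding G_simps CU by (rule U1)
  qed
  \<comment> \<open>Conjugation moves the class by \<sigma>_g and preserves both
    \<open>\<chi>0\<close> and the part in the centralizer; the section contributes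
    \<rho>(\<gamma>(u, g)), which is the scalar in the commutation rule of W and U.\<close>
  have conj: "pim W (inv\<^bsub>GG\<^esub> g \<otimes>\<^bsub>GG\<^esub> x \<otimes>\<^bsub>GG\<^esub> g) = U' (inv\<^bsub>GG\<^esub> g) * pim W x * U' g"
    if g: "g \<in> CC" and x: "x \<in> KK" for g x
  proof -
    obtain A B where A: "CG r A" "g = red r A" and B: "CG r B" "inv\<^bsub>GG\<^esub> g = red r B" and AB: "red r (B * A) = red r 1" "red r (A * B) = red r 1"
      using C[OF g] by blast
    obtain X where X: "intm X" "x = red r (1 + pw k * X)" "PG r (1 + pw k * X)" "Lie 1 X" using K[OF x] by blast
    have A1: "CG 1 A" and B1: "CG 1 B" using CG_mono[OF r1] A B by auto
    have AB1: "red 1 (A * B) = red 1 1" "red 1 (B * A) = red 1 1" using red_mono[OF r1] AB by auto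
    have ABl: "red l (A * B) = red l 1" using red_mono[OF lk(6)] AB by auto
    have Abl: "red l (A * b) = red l (b * A)" using CG_mono[OF lk(6) A(1)] by (simp add: CG_def)
    note i = CG_intm[OF A(1)] CG_intm[OF B(1)]
    define u where "u = cl X"
    define a where "a = red 1 A"
    have u: "u \<in> carrier V" unfolding u_def by (rule cl_V[OF X(4)])
    have a: "a \<in> carrier Gam" unfolding a_def by (rule mem_Gam[OF A1])
    note au = act_closed[OF u a]
    have cX: "cl (B * X * A) = act u a" unfolding u_def a_def by (rule act_eq[OF X(4) A1 B1 AB1, symmetric])
    have x': "inv\<^bsub>GG\<^esub> g \<otimes>\<^bsub>GG\<^esub> x \<otimes>\<^bsub>GG\<^esub> g = red r (1 + pw k * (B * X * A))"
    proof -
      have "red r B \<otimes>\<^bsub>GG\<^esub> red r (1 + pw k * X) \<otimes>\<^bsub>GG\<^esub> red r A = red r (B * (1 + pw k * X) * A)"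
        using G_mult i X(1) by simp
      thus ?thesis unfolding B(2) unfolding A(2) X(2) conj_form[OF CG_PG[OF A(1)] CG_PG[OF B(1)] AB(1) X(1)] .
    qed
    note G = ga_eq[OF u A1 B1 AB1, folded a_def]
    have L1: "LC (X - S u)" unfolding u_def by (rule LC_S[OF X(4)])
    have e: "red 1 (B * (X - S u) * A) = red 1 (X - S u)" by (rule CG_fixes_LC[OF A1 CG_PG[OF B1] AB1(2) L1])
    have d: "B * X * A - S (act u a) = B * (X - S u) * A + (B * S u * A - S (act u a))" by (simp add: left_diff_distrib right_diff_distrib)
    have "\<rho> (red 1 (B * X * A - S (act u a))) = \<rho> (red 1 (B * (X - S u) * A)) * \<rho> (red 1 (B * S u * A - S (act u a)))"
      unfolding d by (rule \<rho>_add[OF LC_cong[OF e[symmetric] L1] G(2)])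
    hence r: "\<rho> (red 1 (B * X * A - S (act u a))) = \<rho> (red 1 (X - S u)) * ev u (ve a)" unfolding e G(1)[symmetric] ve(2)[OF a u] .
    have iB: "intm (B * X * A)" using i X(1) by simp
    have Pl: "pim W (red r (1 + pw k * (B * X * A))) = (\<chi>0 X * \<rho> (red 1 (X - S u)) * ev u (ve a)) \<cdot>\<^sub>m W (act u a)"
      unfolding pim_eq[OF iB] Pm_def cX r \<chi>0_conj[OF i X(1) ABl Abl] by (simp only: mult.assoc)
    have Pr: "pim W x = (\<chi>0 X * \<rho> (red 1 (X - S u))) \<cdot>\<^sub>m W u" unfolding X(2) pim_eq[OF X(1)] Pm_def u_def ..
    define c where "c = \<chi>0 X * \<rho> (red 1 (X - S u))"
    have bG: "red 1 B \<in> carrier Gam" by (rule mem_Gam[OF B1])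
    have UU: "U (red 1 B) * U a = 1\<^sub>m d" unfolding a_def Um[OF bG mem_Gam[OF A1], symmetric] Gam_mult[OF i(2,1)] AB1(2) by (rule U1)
    note cc = Uc[OF a] Uc[OF bG] HR.W_carrier[OF u] HR.W_carrier[OF au]
    have "U' (inv\<^bsub>GG\<^esub> g) * pim W x * U' g = U (red 1 B) * (c \<cdot>\<^sub>m W u) * U a"
      unfolding B(2) Pr c_def[symmetric] unfolding A(2) CU a_def ..
    also have "\<dots> = c \<cdot>\<^sub>m (U (red 1 B) * W u * U a)"
      unfolding mult_smult_distrib[OF cc(2,3)] by (rule mult_smult_assoc_mat[of _ d d _ d]) (use cc in simp_all)
    also have "U (red 1 B) * W u * U a = U (red 1 B) * (W u * U a)" by (rule assoc_mult_mat[OF cc(2,3,1)])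
    also have "\<dots> = ev u (ve a) \<cdot>\<^sub>m (U (red 1 B) * (U a * W (act u a)))"
      unfolding WU[OF u a] by (rule mult_smult_distrib[of _ d d _ d]) (use cc in simp_all)
    also have "U (red 1 B) * (U a * W (act u a)) = U (red 1 B) * U a * W (act u a)" by (rule assoc_mult_mat[OF cc(2,1,4), symmetric])
    also have "\<dots> = W (act u a)" unfolding UU by (rule left_mult_one_mat[OF cc(4)])
    finally show ?thesis unfolding x' Pl c_def smult_smult_mat ..
  qed
  have triv: "U' g = 1\<^sub>m d" if g: "g \<in> CC \<inter> KK" for g
  proof -
    obtain A where A: "PG r A" "red k A = red k 1" "g = red r A" using IntD2[OF g] unfolding K_eq[OF lk(5)] by blast
    have "red 1 A = red 1 1" by (rule red_mono[OF _ A(2)]) (use lk in simp)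
    thus ?thesis unfolding A(3) CU using U1 by simp
  qed
  have lk1: "l - 1 = k" using odd_lk[OF odd_r] by simp
  have eK: "GG\<lparr>carrier := KK\<rparr> = K_group v E k r" by (simp add: K_group_def)
  have "irrep (K_group v E k r) d (pim W)" unfolding irrep_iff using repK irrK unfolding eK by blast
  hence "pi_U_data v \<pi>F \<tau> E r \<beta> \<rho> (pim W) U'"
    unfolding pi_U_data_def lk1 using chi repC conj triv by blast
  thus ?thesis by blast
qed

end

section \<open>The Clifford correspondence for the stabilizer\<close>

context level
begin

lemma pw_add: "pw (m + n) * M = pw m * (pw n * M)" by (simp add: power_add sc_mult mult.assoc)

lemma L_eq: "LL = red r ` {A. PG r A \<and> red l A = red l 1}" by (rule K_eq[OF lk(6)])

text \<open>Since l = k + 1, the residue of X commutes with b exactly when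
  \<open>1 + pw k * X\<close> commutes with b modulo \<pp>^l. Z is thus cut out of K by centralizing
  at level l, where the lifting property of G_\<beta> is available.\<close>

lemma Z_eq:
  assumes o: "odd r"
  shows "ZZ = red r ` {A. PG r A \<and> red k A = red k 1 \<and> CG l A}"
proof -
  have l: "l = k + 1" using odd_lk[OF o] by simp
  have key: "CG l (1 + pw k * X) \<longleftrightarrow> LC X" if "intm X" "PG r (1 + pw k * X)" for X
    using pw_commute_iff[of k 1 X] K_Lie[OF o that] PG_mono[OF lk(6) that(2)] unfolding CG_def LC_def l by simp
  show ?thesis
  proof (intro equalityI subsetI)
    fix x assume "x \<in> ZZ"
    then obtain X where X: "intm X" "x = red r (1 + pw k * X)" "PG r (1 + pw k * X)" "LC X" by (rule Z_form[OF o])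
    have "red k (1 + pw k * X) = red k 1" using X(1) by simp
    thus "x \<in> red r ` {A. PG r A \<and> red k A = red k 1 \<and> CG l A}" using X key[OF X(1,3)] by blast
  next
    fix x assume "x \<in> red r ` {A. PG r A \<and> red k A = red k 1 \<and> CG l A}"
    then obtain A where A: "PG r A" "red k A = red k 1" "CG l A" "x = red r A" by blast
    obtain X where X: "intm X" "A = 1 + pw k * X" using A(2) red_eq_iff[of k A 1] by blast
    have "LC X" using key[OF X(1)] A X(2) by blast
    thus "x \<in> ZZ" unfolding A(4) X(2) using mem_Z[OF o X(1)] A(1) X(2) by blast
  qed
qed

lemma red_inv_one: "intm A \<Longrightarrow> intm B \<Longrightarrow> red m A = red m 1 \<Longrightarrow> red m (A * B) = red m 1 \<Longrightarrow> red m B = red m 1"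
  using red_mult_cong[of m A 1 B B] by simp

lemma red_mult_one: "intm A \<Longrightarrow> intm B \<Longrightarrow> red m A = red m 1 \<Longrightarrow> red m B = red m 1 \<Longrightarrow> red m (A * B) = red m 1"
  using red_mult_cong[of m A 1 B 1] by simp

lemma sub_Z:
  assumes o: "odd r"
  shows "subgroup ZZ GG"
  unfolding Z_eq[OF o]
proof (rule subgroup_red)
  show "PG r (A * B) \<and> red k (A * B) = red k 1 \<and> CG l (A * B)"
    if "PG r A \<and> red k A = red k 1 \<and> CG l A" "PG r B \<and> red k B = red k 1 \<and> CG l B" for A B
    using that PG_mult CG_mult red_mult_one PG_intm by blast
  show "PG r B \<and> red k B = red k 1 \<and> CG l B"
    if A: "PG r A \<and> red k A = red k 1 \<and> CG l A" and B: "PG r B" "red r (A * B) = red r 1" "red r (B * A) = red r 1" for A B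
    using A B(1) CG_inv[of l A B, OF _ PG_mono[OF lk(6) B(1)] red_mono[OF lk(6) B(2)] red_mono[OF lk(6) B(3)]]
      red_inv_one[OF PG_intm PG_intm _ red_mono[OF lk(5) B(2)]] by blast
qed (auto simp: PG_one CG_one)

lemma C_sub_H: "CC \<subseteq> HH"
  unfolding C_eq H_eq using CG_PG CG_mono[OF lk(5)] by blast

lemma K_sub_H: "KK \<subseteq> HH"
  unfolding K_eq[OF lk(5)] H_eq using CG_cong[OF sym CG_one] by blast

lemma L_sub_Z: "odd r \<Longrightarrow> LL \<subseteq> ZZ"
proof
  fix x assume o: "odd r" and "x \<in> LL"
  then obtain A where A: "PG r A" "red l A = red l 1" "x = red r A" unfolding L_eq by blast
  have "CG l A" by (rule CG_cong[OF A(2)[symmetric] CG_one])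
  thus "x \<in> ZZ" unfolding Z_eq[OF o] using A red_mono[OF lk(3) A(2)] by blast
qed

lemma L_sub_K: "LL \<subseteq> KK"
  unfolding K_eq[OF lk(5)] L_eq using red_mono[OF lk(3)] by blast

lemma CK_sub_Z: "odd r \<Longrightarrow> CC \<inter> KK \<subseteq> ZZ"
proof
  fix x assume o: "odd r" and x: "x \<in> CC \<inter> KK"
  obtain A where A: "PG r A" "red k A = red k 1" "x = red r A" using IntD2[OF x] unfolding K_eq[OF lk(5)] by blast
  have "CG l A" using mem_C[OF PG_intm[OF A(1)]] IntD1[OF x] A(3) CG_mono[OF lk(6)] by blast
  thus "x \<in> ZZ" unfolding Z_eq[OF o] using A by blast
qed

text \<open>The argument of \<open>H_decomp\<close> one level higher: an element of Z is a point of
  G_\<beta> modulo \<pp>^l, and the lift of that point to O_r stays in K.\<close>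

lemma Z_decomp:
  assumes o: "odd r" and z: "z \<in> ZZ"
  shows "\<exists>c\<in>CC \<inter> KK. \<exists>x\<in>LL. z = c \<otimes>\<^bsub>GG\<^esub> x"
proof -
  obtain A where A: "PG r A" "red k A = red k 1" "CG l A" "z = red r A" using z unfolding Z_eq[OF o] by blast
  obtain B where B: "CG r B" "red l B = red l A" using CG_lift[OF lk(4,6) A(3)] by blast
  obtain B' where B': "PG r B'" "red r (B * B') = red r 1" "red r (B' * B) = red r 1" by (rule PG_inv[OF CG_PG[OF B(1)]])
  note i = PG_intm[OF A(1)] CG_intm[OF B(1)] PG_intm[OF B'(1)]
  have kB: "red k B = red k 1" using red_mono[OF lk(3) B(2)] A(2) by simp
  have "red l (B' * A) = red l (B' * B)" by (rule red_mult_cong[OF refl B(2)[symmetric]]) (use i in auto)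
  hence lB: "red l (B' * A) = red l 1" using red_mono[OF lk(6) B'(3)] by simp
  have "red r (B * B' * A) = red r (1 * A)" by (rule red_mult_cong[OF B'(2) refl]) (use i in auto)
  hence e: "red r A = red r (B * (B' * A))" by (simp add: mult.assoc)
  have "z = red r B \<otimes>\<^bsub>GG\<^esub> red r (B' * A)" unfolding A(4) e using G_mult i by simp
  moreover have "red r B \<in> CC" "red r B \<in> KK" "red r (B' * A) \<in> LL"
    unfolding C_eq K_eq[OF lk(5)] L_eq using B CG_PG kB lB PG_mult[OF B'(1) A(1)] by blast+
  ultimately show ?thesis by blast
qed

lemma C_comm: "x \<in> CC \<Longrightarrow> y \<in> CC \<Longrightarrow>
  x \<otimes>\<^bsub>GG\<^esub> y = y \<otimes>\<^bsub>GG\<^esub> x"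
proof -
  assume x: "x \<in> CC" and y: "y \<in> CC"
  obtain A where A: "CG r A" "x = red r A" using x unfolding C_eq by blast
  obtain B where B: "CG r B" "y = red r B" using y unfolding C_eq by blast
  note i = CG_intm[OF A(1)] CG_intm[OF B(1)]
  show ?thesis unfolding A(2) B(2) G_mult[OF i] G_mult[OF i(2,1)] by (rule CG_comm[OF A(1) B(1)])
qed

lemma H_conj:
  assumes h: "h \<in> HH"
  shows "\<exists>A B. PG r A \<and> CG k A \<and> h = red r A \<and> PG r B \<and> inv\<^bsub>GG\<^esub> h = red r B \<and> red r (A * B) = red r 1 \<and> red r (B * A) = red r 1 \<and>
    (\<forall>X. intm X \<longrightarrow> inv\<^bsub>GG\<^esub> h \<otimes>\<^bsub>GG\<^esub> red r (1 + pw k * X) \<otimes>\<^bsub>GG\<^esub> h = red r (1 + pw k * (B * X * A)))"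
proof -
  obtain A where A: "PG r A" "CG k A" "h = red r A" using h unfolding H_eq by blast
  obtain B where B: "PG r B" "red r (A * B) = red r 1" "red r (B * A) = red r 1" "inv\<^bsub>GG\<^esub> (red r A) = red r B" by (rule G_inv_cases[OF A(1)])
  note i = PG_intm[OF A(1)] PG_intm[OF B(1)]
  have "inv\<^bsub>GG\<^esub> h \<otimes>\<^bsub>GG\<^esub> red r (1 + pw k * X) \<otimes>\<^bsub>GG\<^esub> h = red r (1 + pw k * (B * X * A))" if X: "intm X" for X
  proof -
    have "red r B \<otimes>\<^bsub>GG\<^esub> red r (1 + pw k * X) \<otimes>\<^bsub>GG\<^esub> red r A = red r (B * (1 + pw k * X) * A)"
      using G_mult i X by simp
    thus ?thesis unfolding A(3) B(4) conj_form[OF A(1) B(1) B(3) X] .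
  qed
  moreover have "inv\<^bsub>GG\<^esub> h = red r B" unfolding A(3) by (rule B(4))
  ultimately show ?thesis using A B(1-3) by blast
qed

lemma K_normal:
  assumes h: "h \<in> HH" and x: "x \<in> KK"
  shows "inv\<^bsub>GG\<^esub> h \<otimes>\<^bsub>GG\<^esub> x \<otimes>\<^bsub>GG\<^esub> h \<in> KK"
proof -
  interpret Gr: group "GG" by (rule group_G)
  obtain A B where A: "PG r A" "h = red r A" "PG r B" "inv\<^bsub>GG\<^esub> h = red r B"
    and c: "\<And>X. intm X \<Longrightarrow> inv\<^bsub>GG\<^esub> h \<otimes>\<^bsub>GG\<^esub> red r (1 + pw k * X) \<otimes>\<^bsub>GG\<^esub> h = red r (1 + pw k * (B * X * A))"
    using H_conj[OF h] by blast
  obtain X where X: "intm X" "x = red r (1 + pw k * X)" "PG r (1 + pw k * X)" by (rule K_form[OF x lk(5)])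
  note i = PG_intm[OF A(1)] PG_intm[OF A(3)]
  have i': "intm (1 + pw k * (B * X * A))" "intm (B * X * A)" using i X(1) by auto
  have "h \<in> carrier GG" "x \<in> carrier GG" using h x by (simp_all add: stab_group_def K_group_def)
  hence "inv\<^bsub>GG\<^esub> h \<otimes>\<^bsub>GG\<^esub> x \<otimes>\<^bsub>GG\<^esub> h \<in> carrier GG" by simp
  hence "PG r (1 + pw k * (B * X * A))" unfolding X(2) c[OF X(1)] using mem_G[OF i'(1)] by blast
  thus ?thesis unfolding X(2) c[OF X(1)] using mem_K[OF i'(1) lk(5)] i'(2) by simp
qed

lemma \<tau>_fm_LC: "LC X \<Longrightarrow> intm Y \<Longrightarrow> \<tau> (inverse (2 * \<pi>F) * fm X Y) = 1" "LC Y \<Longrightarrow> intm X \<Longrightarrow> \<tau> (inverse (2 * \<pi>F) * fm X Y) = 1"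
  using \<tau>_int[OF half_pi_int] fm_LC fm_LC_right by blast+

text \<open>For h in C the exponent is invariant by \<open>\<chi>0_conj\<close>. For h in K the
  equation h z' = z h is compared through \<open>\<chi>0_mult\<close>, whose commutator factors are
  trivial because the parameters of z and z' commute with b modulo \<pp>.\<close>

lemma Z_invariant:
  assumes o: "odd r" and h: "h \<in> CC \<union> KK" and z: "z \<in> ZZ"
  shows "inv\<^bsub>GG\<^esub> h \<otimes>\<^bsub>GG\<^esub> z \<otimes>\<^bsub>GG\<^esub> h \<in> ZZ \<and>
    \<psi>\<rho> \<rho> (inv\<^bsub>GG\<^esub> h \<otimes>\<^bsub>GG\<^esub> z \<otimes>\<^bsub>GG\<^esub> h) = \<psi>\<rho> \<rho> z"
proof -
  interpret Gr: group "GG" by (rule group_G)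
  have hH: "h \<in> HH" using h C_sub_H K_sub_H by blast
  obtain A B where A: "PG r A" "CG k A" "h = red r A" "PG r B" "inv\<^bsub>GG\<^esub> h = red r B" "red r (A * B) = red r 1" "red r (B * A) = red r 1"
    and c: "\<And>X. intm X \<Longrightarrow> inv\<^bsub>GG\<^esub> h \<otimes>\<^bsub>GG\<^esub> red r (1 + pw k * X) \<otimes>\<^bsub>GG\<^esub> h = red r (1 + pw k * (B * X * A))"
    using H_conj[OF hH] by blast
  obtain X where X: "intm X" "z = red r (1 + pw k * X)" "PG r (1 + pw k * X)" "LC X" by (rule Z_form[OF o z])
  note i = PG_intm[OF A(1)] PG_intm[OF A(4)]
  have r1: "1 \<le> r" "1 \<le> k" using lk by auto
  let ?X = "B * X * A"
  have iX: "intm ?X" using i X(1) by simp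
  have e1: "red 1 ?X = red 1 X" by (rule CG_fixes_LC[OF CG_mono[OF r1(2) A(2)] PG_mono[OF r1(1) A(4)] red_mono[OF r1(1) A(7)] X(4)])
  have LX: "LC ?X" by (rule LC_cong[OF e1[symmetric] X(4)])
  have "red r (1 + pw k * ?X) \<in> KK" unfolding c[OF X(1), symmetric] X(2)[symmetric]
    by (rule K_normal[OF hH]) (use z Z_sub_K[OF o] in blast)
  hence "PG r (1 + pw k * ?X)" using mem_K[of "1 + pw k * ?X" k] iX lk by simp
  hence Z: "red r (1 + pw k * ?X) \<in> ZZ" using mem_Z[OF o iX] LX by blast
  have "\<chi>0 ?X = \<chi>0 X"
  proof (cases "h \<in> CC")
    case True
    hence "CG l A" using mem_C[OF i(1)] A(3) CG_mono[OF lk(6)] by blast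
    thus ?thesis using \<chi>0_conj[OF i X(1) red_mono[OF lk(6) A(6)]] by (simp add: CG_def)
  next
    case False
    hence hK: "h \<in> KK" using h by blast
    obtain Y where Y: "intm Y" "h = red r (1 + pw k * Y)" "PG r (1 + pw k * Y)" by (rule K_form[OF hK lk(5)])
    have hG: "h \<in> carrier GG" "z \<in> carrier GG" using hH z Z_sub_K[OF o] by (auto simp: stab_group_def K_group_def)
    have "h \<otimes>\<^bsub>GG\<^esub> red r (1 + pw k * ?X) = z \<otimes>\<^bsub>GG\<^esub> h"
      unfolding c[OF X(1), symmetric] X(2)[symmetric] using hG by (simp add: Gr.m_assoc[symmetric])
    hence "red l (Y + ?X + pw k * (Y * ?X)) = red l (X + Y + pw k * (X * Y))"
      unfolding X(2) Y(2) K_mult[OF o X(1) Y(1)] K_mult[OF o Y(1) iX] red_l[OF o] .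
    hence "\<chi>0 (Y + ?X + pw k * (Y * ?X)) = \<chi>0 (X + Y + pw k * (X * Y))" by (rule \<chi>0_cong) (use X(1) Y(1) iX in auto)
    thus ?thesis unfolding \<chi>0_mult[OF X(1) Y(1) o] \<chi>0_mult[OF Y(1) iX o] fm_def[symmetric] \<tau>_fm_LC(1)[OF X(4) Y(1)] \<tau>_fm_LC(2)[OF LX Y(1)] by simp
  qed
  hence "\<psi>\<rho> \<rho> (red r (1 + pw k * ?X)) = \<psi>\<rho> \<rho> (red r (1 + pw k * X))"
    unfolding psi_rho_eq[OF iX o] psi_rho_eq[OF X(1) o] e1 by simp
  thus ?thesis using Z unfolding X(2) c[OF X(1)] by blast
qed

lemma psi_rho_mult:
  assumes o: "odd r" and \<rho>: "\<rho> \<in> RR" and x: "x \<in> ZZ" and y: "y \<in> ZZ"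
  shows "\<psi>\<rho> \<rho> (x \<otimes>\<^bsub>GG\<^esub> y) = \<psi>\<rho> \<rho> x * \<psi>\<rho> \<rho> y"
proof -
  obtain X where X: "intm X" "x = red r (1 + pw k * X)" "PG r (1 + pw k * X)" "LC X" by (rule Z_form[OF o x])
  obtain Y where Y: "intm Y" "y = red r (1 + pw k * Y)" "PG r (1 + pw k * Y)" "LC Y" by (rule Z_form[OF o y])
  let ?Q = "X + Y + pw k * (X * Y)"
  have iQ: "intm ?Q" using X Y by simp
  have "red 1 ?Q = red 1 (X + Y)" by (rule red_mono[of 1 k]) (use lk X Y in auto)
  hence r: "\<rho> (red 1 ?Q) = \<rho> (red 1 X) * \<rho> (red 1 Y)" using dual_ZL(1)[OF \<rho> X(4) Y(4)] by simp
  show ?thesis unfolding X(2) Y(2) K_mult[OF o X(1) Y(1)] psi_rho_eq[OF iQ o] psi_rho_eq[OF X(1) o] psi_rho_eq[OF Y(1) o] r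
    \<chi>0_mult[OF X(1) Y(1) o] fm_def[symmetric] \<tau>_fm_LC(1)[OF X(4) Y(1)] by (simp add: ac_simps)
qed

lemma psi_rho_one:
  assumes o: "odd r" and \<rho>: "\<rho> \<in> RR"
  shows "\<psi>\<rho> \<rho> \<one>\<^bsub>GG\<^esub> = 1"
  using psi_rho_eq[of 0 \<rho>] o dual_ZL(3)[OF \<rho>] by (simp add: G_simps)

lemma \<chi>0_pw:
  assumes o: "odd r" and Y: "intm Y" and m: "0 < m"
  shows "\<chi>0 (pw m * Y) = \<tau> (inverse (\<pi>F ^ l) * (\<pi>F ^ m * tr (Y * b)))"
proof -
  have t1: "tr (pw m * Y * b) = \<pi>F ^ m * tr (Y * b)" by (simp add: mult.assoc tr_sc_mult)
  have "pw m * Y * (pw m * Y) * b = pw m * (pw m * (Y * Y * b))" by (simp add: mult.assoc sc_left_commute[of Y])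
  hence t2: "tr (pw m * Y * (pw m * Y) * b) = \<pi>F ^ m * (\<pi>F ^ m * tr (Y * Y * b))" by (simp add: tr_sc_mult)
  have "tr (Y * Y * b) \<in> ppow v 0" using Y by simp
  hence t: "\<pi>F ^ m * tr (Y * Y * b) \<in> ppow v 0" by (intro int_mult pow_int)
  have "\<pi>F ^ m * (\<pi>F ^ m * tr (Y * Y * b)) \<in> ppow v m" unfolding ppow_iff[of _ m] using t by blast
  hence "\<pi>F ^ m * (\<pi>F ^ m * tr (Y * Y * b)) \<in> ppow v 1" by (rule ppow_mono[rotated]) (use m in simp)
  hence "inverse (2 * \<pi>F) * tr (pw m * Y * (pw m * Y) * b) \<in> ppow v 0" unfolding t2 by (rule half_pi_int)
  hence "\<tau> (inverse (2 * \<pi>F) * tr (pw m * Y * (pw m * Y) * b)) = 1" by (rule \<tau>_int)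
  thus ?thesis unfolding \<chi>0_def \<tau>_diff t1 by simp
qed

text \<open>As an element of K, an element of L has a parameter divisible by \<open>\<pi>F\<close>:
  neither \<rho> nor the quadratic term sees it, and one power of \<open>\<pi>F\<close> cancels in
  the linear term.\<close>

lemma psi_rho_L:
  assumes o: "odd r" and \<rho>: "\<rho> \<in> RR" and x: "x \<in> LL"
  shows "\<psi>\<rho> \<rho> x = \<psi> x"
proof -
  obtain Y where Y: "intm Y" "x = red r (1 + pw l * Y)" "PG r (1 + pw l * Y)" by (rule K_form[OF x lk(6)])
  have l: "l = k + 1" using odd_lk[OF o] by simp
  have e: "pw l * Y = pw k * (pw 1 * Y)" unfolding l by (rule pw_add)
  have iY: "intm (pw 1 * Y)" using Y(1) by (intro intm_arith(4) intm_pw)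
  have "red 1 (0 + pw 1 * Y) = red 1 0" by (rule red_sc_add[OF Y(1)])
  hence r: "\<rho> (red 1 (pw 1 * Y)) = 1" using dual_ZL(3)[OF \<rho>] by simp
  have "inverse (\<pi>F ^ l) * (\<pi>F ^ 1 * tr (Y * b)) = inverse (\<pi>F ^ k) * tr (Y * b)"
    unfolding l using unif by (simp add: field_simps power_add)
  hence "\<chi>0 (pw 1 * Y) = \<tau> (inverse (\<pi>F ^ k) * tr (Y * b))" using \<chi>0_pw[OF o Y(1), of 1] by (simp only: zero_less_one)
  thus ?thesis unfolding Y(2) psi_eq[OF Y(1,3)] unfolding e psi_rho_eq[OF iY o] r by simp
qed

text \<open>The commutator of y and x is \<open>1 + pw (2 * k) * D\<close> with 2k = r - 1 and D the
  bracket of Y and X. On it \<open>psi_rho\<close> is \<tau> of \<open>fm Y X\<close> divided by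
  \<open>\<pi>F\<close>, and nondegeneracy of the pairing provides a Y for which this is not
  1.\<close>

lemma psi_rho_noncentral:
  assumes o: "odd r" and \<rho>: "\<rho> \<in> RR" and x: "x \<in> KK" and xZ: "x \<notin> ZZ"
  defines "cm \<equiv> \<lambda>y. y \<otimes>\<^bsub>GG\<^esub> x \<otimes>\<^bsub>GG\<^esub> inv\<^bsub>GG\<^esub> y \<otimes>\<^bsub>GG\<^esub> inv\<^bsub>GG\<^esub> x"
  shows "\<exists>y\<in>KK. cm y \<in> ZZ \<and> \<psi>\<rho> \<rho> (cm y) \<noteq> 1"
proof -
  interpret Gr: group "GG" by (rule group_G)
  have l: "l = k + 1" using odd_lk[OF o] by simp
  obtain X where X: "intm X" "x = red r (1 + pw k * X)" "PG r (1 + pw k * X)" by (rule K_form[OF x lk(5)])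
  have LX: "Lie 1 X" by (rule K_Lie[OF o X(1,3)])
  have "\<not> LC X" using xZ mem_Z[OF o X(1)] X by blast
  then obtain Y0 where Y0: "Lie 1 Y0" "ev (cl X) (cl Y0) \<noteq> 1" using ev_nondeg[OF LX] by blast
  obtain Y where Y: "intm Y" "red 1 Y = red 1 Y0" "PG r (1 + pw k * Y)" by (rule Lie_K[OF o Y0(1)])
  have LY: "Lie 1 Y" by (rule K_Lie[OF o Y(1,3)])
  have ne: "\<tau> (inverse \<pi>F * fm X Y) \<noteq> 1" using Y0(2) ev_eq[OF LX LY] unfolding Y(2)[symmetric] by simp
  define y where "y = red r (1 + pw k * Y)"
  have yK: "y \<in> KK" unfolding y_def using mem_K[of "1 + pw k * Y" k] Y lk by simp
  define D where "D = Y * X - X * Y"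
  have iD: "intm D" unfolding D_def using X(1) Y(1) by simp
  define P where "P = pw k * D"
  have iP: "intm P" unfolding P_def using iD by simp
  have yG: "y \<in> carrier GG" "x \<in> carrier GG" using yK x by (auto simp: K_group_def)
  have yx: "y \<otimes>\<^bsub>GG\<^esub> x = red r (1 + pw k * P) \<otimes>\<^bsub>GG\<^esub> (x \<otimes>\<^bsub>GG\<^esub> y)"
  proof -
    let ?Q = "X + Y + pw k * (X * Y)"
    have iQ: "intm ?Q" using X(1) Y(1) by simp
    have "P + ?Q + pw k * (P * ?Q) = Y + X + pw k * (Y * X) + pw k * (P * ?Q)" unfolding P_def D_def by (simp add: right_diff_distrib)
    moreover have "red l (Y + X + pw k * (Y * X) + pw k * (P * ?Q)) = red l (Y + X + pw k * (Y * X))"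
    proof -
      \<comment> \<open>The remaining error is divisible by \<open>\<pi>F\<close> to the power 2k,
        and 2k \<ge> l because l = k + 1 and k \<ge> 1.\<close>
      have "pw k * (P * ?Q) = pw (k + k) * (D * ?Q)" unfolding P_def by (simp only: pw_add mult.assoc)
      moreover have "red (k + k) (Y + X + pw k * (Y * X) + pw (k + k) * (D * ?Q)) = red (k + k) (Y + X + pw k * (Y * X))"
        by (rule red_sc_add) (use iD iQ in simp)
      hence "red l (Y + X + pw k * (Y * X) + pw (k + k) * (D * ?Q)) = red l (Y + X + pw k * (Y * X))"
        by (rule red_mono[rotated]) (use l lk in simp)
      ultimately show ?thesis by simp
    qed
    ultimately have "red l (Y + X + pw k * (Y * X)) = red l (P + ?Q + pw k * (P * ?Q))" by (simp only:)
    thus ?thesis unfolding y_def X(2) K_mult[OF o Y(1) X(1)] K_mult[OF o X(1) Y(1)] K_mult[OF o iP iQ] red_l[OF o] .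
  qed
  have PGr: "red r (1 + pw k * P) \<in> carrier GG"
  proof -
    have "Lie 1 D" unfolding D_def by (rule Lie_bracket[OF LY LX])
    hence "PG (2 * k + 1) (1 + pw (2 * k) * D)" using Lie_iff[of 1 "2 * k" D] lk by simp
    moreover have "2 * k + 1 = r" using l lk by simp
    moreover have "pw (2 * k) * D = pw k * P" unfolding P_def mult_2 by (rule pw_add)
    ultimately have "PG r (1 + pw k * P)" by simp
    thus ?thesis using mem_G iP by simp
  qed
  have cm: "cm y = red r (1 + pw k * P)"
  proof -
    have "cm y = (y \<otimes>\<^bsub>GG\<^esub> x) \<otimes>\<^bsub>GG\<^esub> inv\<^bsub>GG\<^esub> (x \<otimes>\<^bsub>GG\<^esub> y)"
      unfolding cm_def using yG by (simp add: Gr.inv_mult_group Gr.m_assoc)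
    also have "\<dots> = red r (1 + pw k * P)" unfolding yx using yG PGr by (simp add: Gr.m_assoc)
    finally show ?thesis .
  qed
  have "red k (0 + P) = red k 0" unfolding P_def by (rule red_sc_add[OF iD])
  hence P0: "red 1 P = red 1 0" using red_mono[of 1 k P 0] lk by simp
  have LP: "LC P" by (rule LC_cong[OF P0[symmetric] LC_0])
  have "cm y \<in> ZZ" unfolding cm using mem_Z[OF o iP] PGr mem_G iP LP by simp
  moreover have "\<psi>\<rho> \<rho> (cm y) \<noteq> 1"
  proof -
    have "\<psi>\<rho> \<rho> (cm y) = \<chi>0 P" unfolding cm psi_rho_eq[OF iP o] P0 using dual_ZL(3)[OF \<rho>] by simp
    also have "\<dots> = \<tau> (inverse (\<pi>F ^ l) * (\<pi>F ^ k * tr (D * b)))" unfolding P_def by (rule \<chi>0_pw[OF o iD lk(2)])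
    also have "inverse (\<pi>F ^ l) * (\<pi>F ^ k * tr (D * b)) = inverse \<pi>F * fm Y X" unfolding l fm_def D_def using unif by (simp add: field_simps power_add)
    also have "\<tau> \<dots> = inverse (\<tau> (inverse \<pi>F * fm X Y))" unfolding fm_skew[of Y X] by (simp add: \<tau>_uminus)
    finally show ?thesis using ne by simp
  qed
  ultimately show ?thesis using yK by blast
qed

end

section \<open>Characters of the intersection of C and K, and the parameter \<rho>\<close>

context level
begin

abbreviation CK where "CK \<equiv> CC \<inter> KK"
abbreviation CL where "CL \<equiv> CC \<inter> LL"

text \<open>A base point: dividing by \<open>psi_rho\<close> at the trivial character turns a
  character of \<open>CK\<close> that equals \<open>\<psi>\<close> on \<open>CL\<close> into one
  that is trivial on \<open>CL\<close>.\<close>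

definition trv :: "('n, 'f set) sqmat \<Rightarrow> complex" where "trv = restrict (\<lambda>_. 1) ZL"

lemma trv: "trv \<in> RR"
proof -
  have "x \<otimes>\<^bsub>LG\<^esub> y \<in> ZL" if "x \<in> ZL" "y \<in> ZL" for x y using subgroup.m_closed[OF ZL_subgroup that] .
  moreover have "monoid.mult (lie_cent_res v E \<beta>) = monoid.mult LG" by (simp add: lie_cent_res_def)
  ultimately show ?thesis by (auto simp: dual_def hom_def complex_units_def trv_def)
qed

text \<open>For odd \<open>r\<close> this is the isomorphism of \<open>CK\<close> modulo
  \<open>CL\<close> with the Lie algebra of G_\<beta> over the residue field, in relational
  form.\<close>

definition residue :: "('n, 'f set) sqmat \<Rightarrow> ('n, 'f set) sqmat \<Rightarrow> bool" where
  "residue c z \<longleftrightarrow> c \<in> CK \<and> (\<exists>X. intm X \<and> c = red r (1 + pw k * X) \<and> z = red 1 X)"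

text \<open>An element of K with the given residue commutes with b modulo \<pp>^l; smoothness of
  G_\<beta> replaces it by a point of G_\<beta> over O_r that is the same modulo \<pp>^l and so has
  the same residue.\<close>

lemma residue_exists:
  assumes o: "odd r" and z: "z \<in> ZL"
  shows "\<exists>c. residue c z"
proof -
  obtain X where X: "LC X" "z = red 1 X" by (rule ZL_cases[OF z])
  obtain Y where Y: "intm Y" "red 1 Y = red 1 X" "PG r (1 + pw k * Y)" by (rule Lie_K[OF o LC_Lie[OF X(1)]])
  have l: "l = k + 1" using odd_lk[OF o] by simp
  have LY: "LC Y" by (rule LC_cong[OF Y(2)[symmetric] X(1)])
  have C: "CG l (1 + pw k * Y)"
    using pw_commute_iff[of k 1 Y] LY PG_mono[OF lk(6) Y(3)] unfolding CG_def LC_def l by blast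
  obtain B where B: "CG r B" "red l B = red l (1 + pw k * Y)" using CG_lift[OF lk(4,6) C] by blast
  have kB: "red k B = red k 1" using red_mono[OF lk(3) B(2)] Y(1) by simp
  obtain W where W: "intm W" "B = 1 + pw k * W" using kB red_eq_iff[of k B 1] by blast
  have "red 1 W = red 1 Y" using B(2) unfolding W(2) l red_add_left_iff red_sc_shift .
  moreover have "red r B \<in> CK" unfolding C_eq K_eq[OF lk(5)] using B(1) CG_PG kB by blast
  ultimately have "residue (red r B) z" unfolding residue_def using W X(2) Y(2) by auto
  thus ?thesis by blast
qed

lemma residue_mem:
  assumes o: "odd r" and c: "c \<in> CK"
  obtains X where "intm X" "LC X" "c = red r (1 + pw k * X)" "residue c (red 1 X)"
proof -
  have "c \<in> ZZ" using CK_sub_Z[OF o] c by blast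
  then obtain X where X: "intm X" "c = red r (1 + pw k * X)" "PG r (1 + pw k * X)" "LC X" by (rule Z_form[OF o])
  have "residue c (red 1 X)" unfolding residue_def using X(1,2) c by blast
  thus ?thesis using that X by blast
qed

lemma sub_CK: "subgroup CK GG"
  by (rule group.subgroups_Inter_pair[OF group_G sub_C sub_K[OF lk(5)]])

lemma residue_mult:
  assumes o: "odd r" and c: "residue c z" "residue c' z'"
  shows "residue (c \<otimes>\<^bsub>GG\<^esub> c') (z \<otimes>\<^bsub>LG\<^esub> z')"
proof -
  obtain X where X: "intm X" "c = red r (1 + pw k * X)" "z = red 1 X" using c(1) unfolding residue_def by blast
  obtain Y where Y: "intm Y" "c' = red r (1 + pw k * Y)" "z' = red 1 Y" using c(2) unfolding residue_def by blast
  let ?Q = "X + Y + pw k * (X * Y)"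
  have iQ: "intm ?Q" using X(1) Y(1) by simp
  have "red 1 ?Q = red 1 (X + Y)" by (rule red_mono[of 1 k]) (use lk X(1) Y(1) in auto)
  hence q: "z \<otimes>\<^bsub>LG\<^esub> z' = red 1 ?Q" unfolding X(3) Y(3) LG_mult[OF X(1) Y(1)] by simp
  have "c \<otimes>\<^bsub>GG\<^esub> c' = red r (1 + pw k * ?Q)" unfolding X(2) Y(2) by (rule K_mult[OF o X(1) Y(1)])
  moreover have "c \<otimes>\<^bsub>GG\<^esub> c' \<in> CK" using subgroup.m_closed[OF sub_CK] c unfolding residue_def by blast
  ultimately show ?thesis unfolding residue_def q using iQ by blast
qed

lemma residue_unique:
  assumes o: "odd r" and c: "residue c z" "residue c' z"
  obtains d where "d \<in> CL" "c = c' \<otimes>\<^bsub>GG\<^esub> d"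
proof -
  interpret Gr: group "GG" by (rule group_G)
  have l: "l = k + 1" using odd_lk[OF o] by simp
  obtain X where X: "intm X" "c = red r (1 + pw k * X)" "z = red 1 X" and cC: "c \<in> CK" using c(1) unfolding residue_def by blast
  obtain Y where Y: "intm Y" "c' = red r (1 + pw k * Y)" "z = red 1 Y" and c'C: "c' \<in> CK" using c(2) unfolding residue_def by blast
  let ?A = "1 + pw k * X" and ?B = "1 + pw k * Y"
  have i: "intm ?A" "intm ?B" using X(1) Y(1) by auto
  have A: "PG r ?A" and B: "PG r ?B" using mem_K[OF i(1) lk(5)] mem_K[OF i(2) lk(5)] cC c'C X(2) Y(2) by auto
  have e: "red l ?A = red l ?B" unfolding l red_add_left_iff red_sc_shift using X(3) Y(3) by simp
  obtain B' where B': "PG r B'" "red r (?B * B') = red r 1" "red r (B' * ?B) = red r 1" "inv\<^bsub>GG\<^esub> (red r ?B) = red r B'" by (rule G_inv_cases[OF B])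
  define d where "d = inv\<^bsub>GG\<^esub> c' \<otimes>\<^bsub>GG\<^esub> c"
  have dCK: "d \<in> CK" unfolding d_def by (rule subgroup.m_closed[OF sub_CK subgroup.m_inv_closed[OF sub_CK c'C] cC])
  have dd: "d = red r (B' * ?A)" unfolding d_def X(2) Y(2) B'(4) by (rule G_mult[OF PG_intm[OF B'(1)] i(1)])
  have "red l (B' * ?A) = red l (B' * ?B)" by (rule red_mult_cong[OF refl e]) (use i PG_intm[OF B'(1)] in auto)
  hence "red l (B' * ?A) = red l 1" using red_mono[OF lk(6) B'(3)] by simp
  hence "d \<in> LL" unfolding dd L_eq using PG_mult[OF B'(1) A] by blast
  hence "d \<in> CL" using dCK by blast
  moreover have "c = c' \<otimes>\<^bsub>GG\<^esub> d"
    unfolding d_def using cC c'C subgroup.mem_carrier[OF sub_CK] by (simp add: Gr.m_assoc[symmetric])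
  ultimately show ?thesis using that by blast
qed

text \<open>The quotient of \<open>\<theta>\<close> by the base point descends along
  \<open>residue\<close> to a character of the Lie algebra of the centralizer. Since every element
  there is a residue, the character is unique.\<close>

lemma rho_extension:
  assumes o: "odd r" and \<theta>m: "\<And>x y. x \<in> CK \<Longrightarrow> y \<in> CK \<Longrightarrow> \<theta> (x \<otimes>\<^bsub>GG\<^esub> y) = \<theta> x * \<theta> y"
    and \<theta>L: "\<And>x. x \<in> CL \<Longrightarrow> \<theta> x = \<psi> x"
  shows "\<exists>!\<rho>. \<rho> \<in> RR \<and> (\<forall>g\<in>CK. \<theta> g = \<psi>\<rho> \<rho> g)"
proof -
  interpret Gr: group "GG" by (rule group_G)
  define \<phi> where "\<phi> g = \<theta> g / \<psi>\<rho> trv g" for g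
  have CKZ: "x \<in> ZZ" if "x \<in> CK" for x using CK_sub_Z[OF o] that by blast
  have trv1: "\<psi>\<rho> trv (red r (1 + pw k * X)) = \<chi>0 X" if "LC X" for X
  proof -
    have i: "intm X" by (rule Lie_intm[OF LC_Lie[OF that]])
    have "red 1 X \<in> ZL" using mem_ZL[OF i] that by blast
    thus ?thesis unfolding psi_rho_eq[OF i o] by (simp add: trv_def)
  qed
  have \<phi>m: "\<phi> (x \<otimes>\<^bsub>GG\<^esub> y) = \<phi> x * \<phi> y" if "x \<in> CK" "y \<in> CK" for x y
    unfolding \<phi>_def \<theta>m[OF that] psi_rho_mult[OF o trv CKZ[OF that(1)] CKZ[OF that(2)]] by simp
  have one: "\<one>\<^bsub>GG\<^esub> \<in> CL" using subgroup.one_closed[OF sub_C] subgroup.one_closed[OF sub_K[OF lk(6)]] by blast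
  have CLK: "x \<in> CK" if "x \<in> CL" for x using that L_sub_K by blast
  have pnz: "\<psi>\<rho> trv x \<noteq> 0" if x: "x \<in> CK" for x
  proof -
    obtain X where X: "LC X" "x = red r (1 + pw k * X)" by (rule residue_mem[OF o x])
    show ?thesis unfolding X(2) trv1[OF X(1)] by simp
  qed
  have \<phi>L: "\<phi> x = 1" if "x \<in> CL" for x
  proof -
    have "\<psi>\<rho> trv x = \<theta> x" unfolding \<theta>L[OF that] by (rule psi_rho_L[OF o trv IntD2[OF that]])
    thus ?thesis using pnz[OF CLK[OF that]] by (simp add: \<phi>_def)
  qed
  have \<phi>nz: "\<phi> x \<noteq> 0" if x: "x \<in> CK" for x
  proof -
    have "\<phi> x * \<phi> (inv\<^bsub>GG\<^esub> x) = 1"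
      using \<phi>m[OF x subgroup.m_inv_closed[OF sub_CK x]] \<phi>L[OF one] subgroup.mem_carrier[OF sub_CK x] by simp
    thus ?thesis by auto
  qed
  have \<phi>u: "\<phi> c = \<phi> c'" if c: "residue c z" "residue c' z" for c c' z
  proof -
    obtain d where d: "d \<in> CL" "c = c' \<otimes>\<^bsub>GG\<^esub> d" by (rule residue_unique[OF o c])
    have "c' \<in> CK" using c(2) by (simp add: residue_def)
    thus ?thesis unfolding d(2) using \<phi>m[OF _ CLK[OF d(1)]] \<phi>L[OF d(1)] by simp
  qed
  define \<rho> where "\<rho> = restrict (\<lambda>z. \<phi> (SOME c. residue c z)) ZL"
  have \<rho>: "\<rho> z = \<phi> c" if "residue c z" "z \<in> ZL" for c z
    unfolding \<rho>_def using \<phi>u[OF someI[of "\<lambda>c. residue c z", OF that(1)] that(1)] that(2) by simp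
  have ZLm: "x \<otimes>\<^bsub>LG\<^esub> y \<in> ZL" if "x \<in> ZL" "y \<in> ZL" for x y by (rule subgroup.m_closed[OF ZL_subgroup that])
  have rd: "\<rho> \<in> RR"
  proof -
    have 1: "\<rho> z \<noteq> 0" if z: "z \<in> ZL" for z
    proof -
      obtain c where c: "residue c z" using residue_exists[OF o z] by blast
      thus ?thesis unfolding \<rho>[OF c z] using \<phi>nz by (simp add: residue_def)
    qed
    have 2: "\<rho> (z \<otimes>\<^bsub>LG\<^esub> z') = \<rho> z * \<rho> z'" if z: "z \<in> ZL" and z': "z' \<in> ZL" for z z'
    proof -
      obtain c where c: "residue c z" using residue_exists[OF o z] by blast
      obtain c' where c': "residue c' z'" using residue_exists[OF o z'] by blast
      show ?thesis unfolding \<rho>[OF c z] \<rho>[OF c' z'] \<rho>[OF residue_mult[OF o c c'] ZLm[OF z z']]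
        by (rule \<phi>m) (use c c' in \<open>simp_all add: residue_def\<close>)
    qed
    have 3: "\<rho> \<in> extensional ZL" by (simp add: \<rho>_def)
    have "monoid.mult (lie_cent_res v E \<beta>) = monoid.mult LG" by (simp add: lie_cent_res_def)
    thus ?thesis unfolding dual_def hom_def complex_units_def using 1 2 3 by auto
  qed
  show ?thesis
  proof (rule ex1I[of _ \<rho>])
    show "\<rho> \<in> RR \<and> (\<forall>g\<in>CK. \<theta> g = \<psi>\<rho> \<rho> g)"
    proof (intro conjI ballI rd)
      fix g assume g: "g \<in> CK"
      obtain X where X: "intm X" "LC X" "g = red r (1 + pw k * X)" "residue g (red 1 X)" by (rule residue_mem[OF o g])
      have z: "red 1 X \<in> ZL" using mem_ZL[OF X(1)] X(2) by blast
      have "\<psi>\<rho> \<rho> g = \<chi>0 X * \<phi> g" unfolding X(3) psi_rho_eq[OF X(1) o] \<rho>[OF X(4) z, unfolded X(3)] ..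
      thus "\<theta> g = \<psi>\<rho> \<rho> g" unfolding \<phi>_def using trv1[OF X(2), folded X(3)] by simp
    qed
    fix \<rho>' assume r': "\<rho>' \<in> RR \<and> (\<forall>g\<in>CK. \<theta> g = \<psi>\<rho> \<rho>' g)"
    show "\<rho>' = \<rho>"
    proof (rule extensionalityI[of _ ZL])
      show "\<rho>' \<in> extensional ZL" "\<rho> \<in> extensional ZL" using r' rd by (auto simp: dual_def)
      fix z assume z: "z \<in> ZL"
      obtain c where c: "residue c z" using residue_exists[OF o z] by blast
      obtain X where X: "intm X" "c = red r (1 + pw k * X)" "z = red 1 X" and cK: "c \<in> CK" using c unfolding residue_def by blast
      have LX: "LC X" using mem_ZL[OF X(1)] z X(3) by blast
      have "\<theta> c = \<chi>0 X * \<rho>' z" using r' cK psi_rho_eq[OF X(1) o, folded X(2,3)] by simp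
      thus "\<rho>' z = \<rho> z" unfolding \<rho>[OF c z] \<phi>_def using trv1[OF LX, folded X(2)] by simp
    qed
  qed
qed

section \<open>The correspondence for the two parities of the level\<close>

theorem sigma_bij_odd:
  assumes o: "odd r" and data: "\<And>\<rho>. \<rho> \<in> RR \<Longrightarrow> pi_U_data v \<pi>F \<tau> E r \<beta> \<rho> (\<pi> \<rho>) (U \<rho>)"
  shows "bij_betw (\<lambda>\<theta>. iso_class (stab_group v E r \<beta>) (sigma v \<pi>F \<tau> E r \<beta> \<pi> U \<theta>))
    (Theta v \<pi>F \<tau> E r \<beta>) (Irr_over (stab_group v E r \<beta>) (K_group v E l r) (\<psi>))"
proof -
  have lk1: "l - 1 = k" using odd_lk[OF o] by simp
  have rec: "GG\<lparr>carrier := carrier (K_group v E m r)\<rparr> = K_group v E m r"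
    "GG\<lparr>carrier := CC\<rparr> = cent_group v E \<beta> r"
    "GG\<lparr>carrier := HH\<rparr> = stab_group v E r \<beta>"
    "GG\<lparr>carrier := ZZ\<rparr> = Z_group v \<pi>F E r \<beta>" for m
    by (simp_all add: K_group_def cent_group_def stab_group_def Z_group_def)
  interpret cl: clifford "GG" "HH" "CC" "KK"
    "ZZ" "LL" "dual (lie_cent_res v E \<beta>)" "\<psi>" "\<psi>\<rho>" \<pi> U
  proof (intro clifford.intro clifford_axioms.intro group_G sub_H sub_C sub_K sub_Z[OF o] C_sub_H K_sub_H Z_sub_K[OF o] L_sub_Z[OF o] CK_sub_Z[OF o] lk)
    show "finite HH" by (rule finite_subset[OF subgroup.subset[OF sub_H] finite_G])
    show "inv\<^bsub>GG\<^esub> g \<otimes>\<^bsub>GG\<^esub> x \<otimes>\<^bsub>GG\<^esub> g \<in> KK"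
      if "g \<in> CC" "x \<in> KK" for g x
      by (rule K_normal[OF subsetD[OF C_sub_H that(1)] that(2)])
    show "\<exists>d. irrep (GG\<lparr>carrier := KK\<rparr>) d (\<pi> \<rho>) \<and>
      contains_char d (\<pi> \<rho>) (GG\<lparr>carrier := ZZ\<rparr>) (\<psi>\<rho> \<rho>) \<and>
      rep (GG\<lparr>carrier := CC\<rparr>) d (U \<rho>) \<and>
      (\<forall>g\<in>CC. \<forall>x\<in>KK.
        \<pi> \<rho> (inv\<^bsub>GG\<^esub> g \<otimes>\<^bsub>GG\<^esub> x \<otimes>\<^bsub>GG\<^esub> g) = U \<rho> (inv\<^bsub>GG\<^esub> g) * \<pi> \<rho> x * U \<rho> g) \<and>
      (\<forall>g\<in>CK. U \<rho> g = 1\<^sub>m d)" if "\<rho> \<in> RR" for \<rho>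
      using data[OF that] unfolding pi_U_data_def lk1 rec .
    show "\<exists>c\<in>CC. \<exists>x\<in>KK. h = c \<otimes>\<^bsub>GG\<^esub> x" if "h \<in> HH" for h
      by (rule H_decomp[OF that])
    show "\<exists>c\<in>CK. \<exists>x\<in>LL. z = c \<otimes>\<^bsub>GG\<^esub> x" if "z \<in> ZZ" for z
      by (rule Z_decomp[OF o that])
    show "x \<otimes>\<^bsub>GG\<^esub> y = y \<otimes>\<^bsub>GG\<^esub> x" if "x \<in> CC" "y \<in> CC" for x y
      by (rule C_comm[OF that])
    show "inv\<^bsub>GG\<^esub> h \<otimes>\<^bsub>GG\<^esub> x \<otimes>\<^bsub>GG\<^esub> h \<in> LL \<and> \<psi> (inv\<^bsub>GG\<^esub> h \<otimes>\<^bsub>GG\<^esub> x \<otimes>\<^bsub>GG\<^esub> h) = \<psi> x"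
      if "h \<in> HH" "x \<in> LL" for h x
      by (rule conjI[OF L_inv[OF that]])
    fix \<rho> assume \<rho>: "\<rho> \<in> RR"
    show "\<psi>\<rho> \<rho> \<one>\<^bsub>GG\<^esub> = 1" by (rule psi_rho_one[OF o \<rho>])
    show "\<psi>\<rho> \<rho> x = \<psi> x" if "x \<in> LL" for x
      by (rule psi_rho_L[OF o \<rho> that])
    show "\<psi>\<rho> \<rho> (x \<otimes>\<^bsub>GG\<^esub> y) = \<psi>\<rho> \<rho> x * \<psi>\<rho> \<rho> y"
      if "x \<in> ZZ" "y \<in> ZZ" for x y
      by (rule psi_rho_mult[OF o \<rho> that])
    show "inv\<^bsub>GG\<^esub> h \<otimes>\<^bsub>GG\<^esub> z \<otimes>\<^bsub>GG\<^esub> h \<in> ZZ \<and> \<psi>\<rho> \<rho> (inv\<^bsub>GG\<^esub> h \<otimes>\<^bsub>GG\<^esub> z \<otimes>\<^bsub>GG\<^esub> h) = \<psi>\<rho> \<rho> z"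
      if "h \<in> CC \<union> KK" "z \<in> ZZ" for h z
      by (rule Z_invariant[OF o that])
    show "\<exists>y\<in>KK. y \<otimes>\<^bsub>GG\<^esub> x \<otimes>\<^bsub>GG\<^esub> inv\<^bsub>GG\<^esub> y \<otimes>\<^bsub>GG\<^esub> inv\<^bsub>GG\<^esub> x \<in> ZZ \<and>
        \<psi>\<rho> \<rho> (y \<otimes>\<^bsub>GG\<^esub> x \<otimes>\<^bsub>GG\<^esub> inv\<^bsub>GG\<^esub> y \<otimes>\<^bsub>GG\<^esub> inv\<^bsub>GG\<^esub> x) \<noteq> 1"
      if "x \<in> KK" "x \<notin> ZZ" for x
      by (rule psi_rho_noncentral[OF o \<rho> that])
  next
    show "\<exists>!\<rho>. \<rho> \<in> RR \<and> (\<forall>g\<in>CK. \<theta> g = \<psi>\<rho> \<rho> g)"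
      if "\<And>x y. x \<in> CK \<Longrightarrow> y \<in> CK \<Longrightarrow> \<theta> (x \<otimes>\<^bsub>GG\<^esub> y) = \<theta> x * \<theta> y" "\<And>x. x \<in> CL \<Longrightarrow> \<theta> x = \<psi> x" for \<theta>
      by (rule rho_extension[OF o that])
  qed
  have T: "cl.Thetas = Theta v \<pi>F \<tau> E r \<beta>" unfolding cl.Thetas_def Theta_def rec ..
  have "cl.rho_ext \<theta> = rho_of v \<pi>F \<tau> E r \<beta> \<theta>" for \<theta> unfolding cl.rho_ext_def rho_of_def lk1 ..
  hence S: "cl.sig \<theta> = sigma v \<pi>F \<tau> E r \<beta> \<pi> U \<theta>" for \<theta>
    unfolding cl.sig_def sigma_def using o by (intro ext) simp
  show ?thesis using cl.sig_bij unfolding T S rec .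
qed

text \<open>Here k = l, so \<open>clifford\<close> is instantiated with K, Z and L all equal and a
  one-element index set; \<open>noncentral\<close> then holds vacuously, and
  \<open>extension\<close> reduces to the condition that \<open>\<theta>\<close> equals
  \<open>\<psi>\<close> on the intersection of C and K.\<close>

theorem sigma_bij_even:
  assumes e: "even r"
  shows "bij_betw (\<lambda>\<theta>. iso_class (stab_group v E r \<beta>) (sigma v \<pi>F \<tau> E r \<beta> \<pi> U \<theta>))
    (Theta v \<pi>F \<tau> E r \<beta>) (Irr_over (stab_group v E r \<beta>) (K_group v E l r) (\<psi>))"
proof -
  interpret Gr: group "GG" by (rule group_G)
  have kl: "k = l" using e by (auto simp: lup_def ldn_def elim!: evenE)
  let ?K = "LL"
  have rec: "GG\<lparr>carrier := carrier (K_group v E m r)\<rparr> = K_group v E m r"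
    "GG\<lparr>carrier := CC\<rparr> = cent_group v E \<beta> r"
    "GG\<lparr>carrier := HH\<rparr> = stab_group v E r \<beta>" for m
    by (simp_all add: K_group_def cent_group_def stab_group_def)
  have KH: "?K \<subseteq> HH" using K_sub_H unfolding kl .
  have Lc: "inv\<^bsub>GG\<^esub> h \<otimes>\<^bsub>GG\<^esub> x \<otimes>\<^bsub>GG\<^esub> h \<in> ?K \<and>
    \<psi> (inv\<^bsub>GG\<^esub> h \<otimes>\<^bsub>GG\<^esub> x \<otimes>\<^bsub>GG\<^esub> h) = \<psi> x"
    if "h \<in> HH" "x \<in> ?K" for h x using L_inv[OF that] by blast
  have one: "\<one>\<^bsub>GG\<^esub> \<in> CC \<inter> ?K" using subgroup.one_closed[OF sub_C] subgroup.one_closed[OF sub_K[OF lk(6)]] by blast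
  have psi1: "\<psi> \<one>\<^bsub>GG\<^esub> = 1" using psi_one by (simp add: G_simps)
  define \<pi>0 where "\<pi>0 = (\<lambda>(_::unit) x. \<psi> x \<cdot>\<^sub>m 1\<^sub>m 1 :: complex mat)"
  define U0 where "U0 = (\<lambda>(_::unit) (_::('n, 'f set) sqmat). 1\<^sub>m 1 :: complex mat)"
  have irr1: "W = {0\<^sub>v 1} \<or> W = carrier_vec 1"
    if Wc: "W \<subseteq> carrier_vec 1" and W0: "0\<^sub>v 1 \<in> W" and Ws: "\<And>c v. v \<in> W \<Longrightarrow> c \<cdot>\<^sub>v v \<in> W" for W :: "complex vec set"
  proof (cases "W = {0\<^sub>v 1}")
    case False
    then obtain w where w: "w \<in> W" "w \<noteq> 0\<^sub>v 1" using W0 by blast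
    have wc: "w \<in> carrier_vec 1" using w Wc by blast
    have w0: "w $ 0 \<noteq> 0"
    proof
      assume "w $ 0 = 0"
      hence "w = 0\<^sub>v 1" by (intro eq_vecI) (use wc in auto)
      thus False using w by simp
    qed
    have "x \<in> W" if x: "x \<in> carrier_vec 1" for x
    proof -
      have "x = (x $ 0 / w $ 0) \<cdot>\<^sub>v w" by (rule eq_vecI) (use x wc w0 in auto)
      thus ?thesis using Ws[OF w(1), of "x $ 0 / w $ 0"] by simp
    qed
    thus ?thesis using Wc by blast
  qed simp
  have repK: "rep (GG\<lparr>carrier := ?K\<rparr>) 1 (\<pi>0 u)" for u
    unfolding rep_subgroup_iff \<pi>0_def
  proof (intro conjI ballI)
    fix x y assume x: "x \<in> ?K" and y: "y \<in> ?K"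
    show "\<psi> (x \<otimes>\<^bsub>GG\<^esub> y) \<cdot>\<^sub>m 1\<^sub>m 1 = \<psi> x \<cdot>\<^sub>m 1\<^sub>m 1 * (\<psi> y \<cdot>\<^sub>m (1\<^sub>m 1 :: complex mat))"
      unfolding psi_mult[OF x y] smult_mult_smult[OF one_carrier_mat one_carrier_mat] by simp
  qed (simp_all add: psi1)
  have irrK: "irrep (GG\<lparr>carrier := ?K\<rparr>) 1 (\<pi>0 u)" for u
    unfolding irrep_iff irr_def
  proof (intro conjI allI impI repK ballI)
    show "\<pi>0 u x \<in> carrier_mat 1 1" for x by (simp add: \<pi>0_def)
    show "W = {0\<^sub>v 1} \<or> W = carrier_vec 1" if "VectorSpace.subspace class_ring W (module_vec TYPE(complex) 1) \<and>
        (\<forall>x\<in>carrier (GG\<lparr>carrier := ?K\<rparr>). \<forall>w\<in>W. \<pi>0 u x *\<^sub>v w \<in> W)" for W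
      using that irr1[of W] unfolding subspace_module_vec_iff by blast
  qed simp
  interpret cl: clifford "GG" "HH" "CC" ?K ?K ?K
    "{()}" "\<psi>" "\<lambda>_. \<psi>" \<pi>0 U0
  proof (intro clifford.intro clifford_axioms.intro group_G sub_H sub_C sub_K C_sub_H KH lk)
    show "finite HH" by (rule finite_subset[OF subgroup.subset[OF sub_H] finite_G])
    show "\<exists>c\<in>CC \<inter> ?K. \<exists>x\<in>?K. z = c \<otimes>\<^bsub>GG\<^esub> x" if "z \<in> ?K" for z
      using one that subgroup.mem_carrier[OF sub_K[OF lk(6)] that] by (metis Gr.l_one)
    show "inv\<^bsub>GG\<^esub> g \<otimes>\<^bsub>GG\<^esub> x \<otimes>\<^bsub>GG\<^esub> g \<in> ?K" if "g \<in> CC" "x \<in> ?K" for g x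
      using Lc C_sub_H that by blast
    show "inv\<^bsub>GG\<^esub> h \<otimes>\<^bsub>GG\<^esub> x \<otimes>\<^bsub>GG\<^esub> h \<in> ?K \<and>
      \<psi> (inv\<^bsub>GG\<^esub> h \<otimes>\<^bsub>GG\<^esub> x \<otimes>\<^bsub>GG\<^esub> h) = \<psi> x"
      if "h \<in> CC \<union> ?K" "x \<in> ?K" for h x using Lc C_sub_H KH that by blast
    show "\<exists>!u. u \<in> {()} \<and> (\<forall>g\<in>CC \<inter> ?K. \<theta> g = \<psi> g)"
      if "\<And>x. x \<in> CC \<inter> ?K \<Longrightarrow> \<theta> x = \<psi> x" for \<theta> by (rule ex1I[of _ "()"]) (use that in auto)
    show "\<exists>d. irrep (GG\<lparr>carrier := ?K\<rparr>) d (\<pi>0 u) \<and>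
      contains_char d (\<pi>0 u) (GG\<lparr>carrier := ?K\<rparr>) (\<psi>) \<and>
      rep (GG\<lparr>carrier := CC\<rparr>) d (U0 u) \<and>
      (\<forall>g\<in>CC. \<forall>x\<in>?K.
        \<pi>0 u (inv\<^bsub>GG\<^esub> g \<otimes>\<^bsub>GG\<^esub> x \<otimes>\<^bsub>GG\<^esub> g) = U0 u (inv\<^bsub>GG\<^esub> g) * \<pi>0 u x * U0 u g) \<and>
      (\<forall>g\<in>CC \<inter> ?K. U0 u g = 1\<^sub>m d)" for u
    proof (intro exI[of _ 1] conjI irrK ballI)
      show "contains_char 1 (\<pi>0 u) (GG\<lparr>carrier := ?K\<rparr>) (\<psi>)"
        unfolding contains_char_def
      proof (intro bexI[of _ "unit_vec 1 0"] conjI ballI)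
        show "unit_vec 1 0 \<noteq> (0\<^sub>v 1 :: complex vec)" 
        proof
          assume "unit_vec 1 0 = (0\<^sub>v 1 :: complex vec)"
          hence "unit_vec 1 0 $ 0 = (0\<^sub>v 1 :: complex vec) $ 0" by (rule arg_cong)
          thus False by simp
        qed
        show "\<pi>0 u x *\<^sub>v unit_vec 1 0 = \<psi> x \<cdot>\<^sub>v unit_vec 1 0" for x
          unfolding \<pi>0_def smult_mat_mult_vec[OF one_carrier_mat unit_vec_carrier] one_mult_mat_vec[OF unit_vec_carrier] ..
      qed simp
      show "rep (GG\<lparr>carrier := CC\<rparr>) 1 (U0 u)" unfolding rep_subgroup_iff U0_def by simp
      fix g x assume "g \<in> CC" "x \<in> ?K"
      thus "\<pi>0 u (inv\<^bsub>GG\<^esub> g \<otimes>\<^bsub>GG\<^esub> x \<otimes>\<^bsub>GG\<^esub> g) = U0 u (inv\<^bsub>GG\<^esub> g) * \<pi>0 u x * U0 u g"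
        using Lc[of g x] C_sub_H unfolding \<pi>0_def U0_def by (simp add: subset_iff)
    qed (simp add: U0_def)
  qed (use H_decomp[unfolded kl] C_comm Lc psi_mult psi1 in blast)+
  have T: "cl.Thetas = Theta v \<pi>F \<tau> E r \<beta>" unfolding cl.Thetas_def Theta_def rec ..
  have S: "cl.sig \<theta> = sigma v \<pi>F \<tau> E r \<beta> \<pi> U \<theta>" for \<theta>
    unfolding cl.sig_def sigma_def unfolding \<pi>0_def U0_def kl using e by (intro ext) (simp add: smult_smult_mat)
  show ?thesis using cl.sig_bij unfolding T S rec .
qed

end

theorem theorem2p4p1:
  fixes v :: "'f::field \<Rightarrow> int" and \<pi>F :: 'f and \<tau> :: "'f \<Rightarrow> complex"
    and E :: "('n::finite, 'f) mpoly set" and \<beta> :: "('n, 'f) sqmat" and r :: nat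
    and s :: "('n, 'f set) sqmat set \<Rightarrow> ('n, 'f set) sqmat"
  assumes "nonarch_local_field v" and "odd_residue_char v"
    and "\<pi>F \<noteq> 0" and "v \<pi>F = 1"
    and "cont_unitary_char v \<tau>" and "{x. \<forall>y\<in>ppow v 0. \<tau> (x * y) = 1} = ppow v 0"
    and "closed_subgroup_scheme v E" and "smooth_functor v (points E)"
    and "noncommutative_fibre (points E) (class_ring :: 'f ring) id"
    and "noncommutative_fibre (points E) (Omod v 1) (omod v 1)"
    and "cond_I v E" and "cond_II v \<pi>F E" and "cond_III v \<pi>F E"
    and "2 \<le> r" and "\<beta> \<in> lie_int v E"
    and cond1: "commutative_functor v (cent_points E \<beta>)" "smooth_functor v (cent_points E \<beta>)"
    and section_choice: "linear_section v E \<beta> s"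
    and cond2: "\<And>\<rho>. \<rho> \<in> dual (lie_cent_res v E \<beta>) \<Longrightarrow>
      trivial_H2_class (cent_group v E \<beta> 1) (cocycle v \<pi>F \<tau> E \<beta> s \<rho>)"
  shows "(odd r \<longrightarrow> (\<forall>\<rho>\<in>dual (lie_cent_res v E \<beta>). \<exists>\<pi> U. pi_U_data v \<pi>F \<tau> E r \<beta> \<rho> \<pi> U)) \<and>
    (\<forall>\<pi> U. (odd r \<longrightarrow> (\<forall>\<rho>\<in>dual (lie_cent_res v E \<beta>). pi_U_data v \<pi>F \<tau> E r \<beta> \<rho> (\<pi> \<rho>) (U \<rho>))) \<longrightarrow>
      bij_betw (\<lambda>\<theta>. iso_class (stab_group v E r \<beta>) (sigma v \<pi>F \<tau> E r \<beta> \<pi> U \<theta>))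
        (Theta v \<pi>F \<tau> E r \<beta>)
        (Irr_over (stab_group v E r \<beta>) (K_group v E (lup r) r) (psi v \<pi>F \<tau> E r \<beta>)))"
proof -
  interpret lv: level v \<pi>F E \<beta> \<tau> r
    by (intro level.intro group_scheme.intro local_field.intro group_scheme_axioms.intro level_axioms.intro local_field_axioms.intro assms)
  show ?thesis
  proof (intro conjI impI ballI allI)
    fix \<rho> assume o: "odd r" and \<rho>: "\<rho> \<in> dual (lie_cent_res v E \<beta>)"
    interpret od: odd_level v \<pi>F E \<beta> \<tau> r s \<rho>
      by (intro odd_level.intro odd_level_axioms.intro lv.level_axioms o section_choice \<rho> cond2[OF \<rho>])
    show "\<exists>\<pi> U. pi_U_data v \<pi>F \<tau> E r \<beta> \<rho> \<pi> U" by (rule od.pi_U_data_exists)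
  next
    fix \<pi> U assume d: "odd r \<longrightarrow> (\<forall>\<rho>\<in>dual (lie_cent_res v E \<beta>). pi_U_data v \<pi>F \<tau> E r \<beta> \<rho> (\<pi> \<rho>) (U \<rho>))"
    show "bij_betw (\<lambda>\<theta>. iso_class (stab_group v E r \<beta>) (sigma v \<pi>F \<tau> E r \<beta> \<pi> U \<theta>))
        (Theta v \<pi>F \<tau> E r \<beta>) (Irr_over (stab_group v E r \<beta>) (K_group v E (lup r) r) (psi v \<pi>F \<tau> E r \<beta>))"
      by (cases "odd r") (use lv.sigma_bij_odd[of \<pi> U] lv.sigma_bij_even[of \<pi> U] d in blast)+
  qed
qed

end
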